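(* Let $g\in C_n$, let $\underline R$ and $\underline S$ be $C_n$-Green functors, let $(\underline P,\gamma)\colon\underline R\to\underline S$ be a left dualizable 1-cell in the bicategory of $C_n$-twists $\mathbf{Bimod}/\mathbf{Green}^{C_n}$, and let $f\colon\underline P\Rightarrow\underline P$ be a 2-cell. Then the following identity of morphisms of $C_n$-Mackey functors $\underline S\to\underline{\mathrm{HH}}^g_0(\underline R)$ holds: $$\operatorname{tr}^g(f)\circ q^{(g)}=\operatorname{tr}^g_{\mathrm{HS},\gamma}\circ f_*\circ\varrho ,$$ where $q^{(g)}\colon\underline S\to\underline{\mathrm{HH}}_0^g(\underline S)$ is the quotient map, $\varrho\colon\underline S\to\underline{\mathrm{End}}_{\underline R}(\underline P)$ is the adjunct of the right $\underline S$-action, and $f_*\colon\underline{\mathrm{End}}_{\underline R}(\underline P)\to\underline{\mathrm{End}}_{\underline R}(\underline P)$ is post-composition with $f$. Equivalently, for every finite $C_n$-set $X$ and every $s\in\underline S(X)$, $$(\operatorname{tr}^g(f))_X(q^{(g)}_X(s))=(\operatorname{tr}^g_{\mathrm{HS},\gamma})_X(f\circ\varrho_{X,s})=(\operatorname{tr}^g_{\mathrm{HS},\gamma})_X(\varrho_{X,s}\circ f_X).$$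
   Context: **Mackey and Green functors.** A $C_n$-Mackey functor is an additive functor from the Burnside category $\mathcal B_{C_n}$ (finite $C_n$-sets and group-completed spans) to $\mathbf{Ab}$. $\mathbf{Mack}_{C_n}$ is closed symmetric monoidal under the box product $\square$, with internal Hom $\underline{\mathrm{Hom}}$; $\underline A_X=\mathcal B_{C_n}(X,-)$. Green functors are monoids; relative box product $\square_{\underline R}$ (coequalizer) and $\underline{\mathrm{Hom}}_{\underline R}$ (equalizer) are as usual, $\underline{\mathrm{End}}_{\underline R}(\underline P)=\underline{\mathrm{Hom}}_{\underline R}(\underline P,\underline P)$. Put $\underline P_X=\underline P\square\underline A_X$; by Yoneda, $\underline{\mathrm{Hom}}_{\underline R}(\underline P,\underline Q)(X)\cong{}_{\underline R}\mathbf{Mod}(\underline P_X,\underline Q)$. Finitely generated projective means a direct summand of some $\underline R\square\underline A_X$. **Twisting.** Since $C_n$ is abelian, the orbit automorphisms $xH\mapsto gxH$ of $C_n/H$ induce Green functor automorphisms $\alpha_g$ of each $\underline R$. In the bicategory with 0-cells the $C_n$-Green functors, 1-cells $\underline R\to\underline S$ the $(\underline R,\underline S)$-bimodules, composition $\underline M\odot\underline N=\underline M\square_{\underline S}\underline N$ and unit $U_{\underline R}=\underline R$, put $\Theta_{\underline R}(g)=\underline R^g$ ($\underline R$ with right action twisted by $\alpha_g$), with canonical isomorphisms $\underline R^g\odot\underline R^h\cong\underline R^{gh}$, $\underline R\cong\underline R^e$. Put ${}^g\underline M=\Theta_{\underline R}(g^{-1})\odot\underline M$, identified with $\underline M$ with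 left action precomposed with $\alpha_g$, and $\underline M^g=\underline M\odot\Theta_{\underline S}(g)$. **Bicategory of $C_n$-twists $\mathbf{Bimod}/\mathbf{Green}^{C_n}$.** 1-cells are bimodules $\underline M$ with bimodule isomorphisms $\tau_g\colon\Theta_{\underline R}(g)\odot\underline M\to\underline M\odot\Theta_{\underline S}(g)$ ($g\in C_n$), $\tau_e$ canonical and $\tau_{gh}=(\tau_g\odot\mathrm{id})(\mathrm{id}\odot\tau_h)$ under $\Theta(gh)\cong\Theta(g)\odot\Theta(h)$; 2-cells are bimodule maps commuting with the $\tau_g$; composites carry $(\mathrm{id}\odot\sigma_g)(\tau_g\odot\mathrm{id})$, units the canonical constraints. The data $\tau$ are equivalent to the bi-twist isomorphisms $\gamma_g\colon\underline M\cong\Theta(g^{-1})\odot\Theta(g)\odot\underline M\xrightarrow{\mathrm{id}\odot\tau_g}{}^g\underline M^g$. Transport map: $g_{\underline M}=(\tau_{g^{-1}})^{-1}\colon\underline M^{g^{-1}}\to{}^g\underline M$. **Twisted $\mathrm{HH}_0$ and twisted shadow.** For an $\underline R$-bimodule $\underline M$ with actions $\lambda,\rho$, $\underline{\mathrm{HH}}_0(\underline R;\underline M)$ is the coequalizer of $\lambda,\rho\circ\mathfrak s\colon\underline R\square\underline M\rightrightarrows\underline M$ ($\mathfrak s$ the symmetry); it is an ordinary shadow $\langle\!\langle-\rangle\!\rangle$ with cyclicity $\theta$ induced by symmetry. ${}^g\langle\!\langle\underline M\rangle\!\rangle=\underline{\mathrm{HH}}^g_0(\underline R;\underline M)=\underline{\mathrm{HH}}_0(\underline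 R;{}^g\underline M)$, the coequalizer of $\lambda\circ(\alpha_g\square\mathrm{id})$ and $\rho\circ\mathfrak s$, with quotient map $q^{(g)}\colon\underline M\to\underline{\mathrm{HH}}_0^g(\underline R;\underline M)$; $\underline{\mathrm{HH}}^g_0(\underline R)=\underline{\mathrm{HH}}^g_0(\underline R;\underline R)$. Twisted cyclicity ${}^g\theta_{\underline M,\underline N}$: $\langle\!\langle{}^g\underline M\odot\underline N\rangle\!\rangle\xrightarrow{\theta}\langle\!\langle\underline N\odot{}^g\underline M\rangle\!\rangle\cong\langle\!\langle\underline N^{g^{-1}}\odot\underline M\rangle\!\rangle\xrightarrow{g_{\underline N}\odot\mathrm{id}}\langle\!\langle{}^g\underline N\odot\underline M\rangle\!\rangle$. **Twisted trace.** $\underline P\colon\underline R\to\underline S$ is left dualizable if there are ${}^*\underline P\colon\underline S\to\underline R$, $\bar\eta\colon U_{\underline S}\Rightarrow{}^*\underline P\odot\underline P$, $\bar\epsilon\colon\underline P\odot{}^*\underline P\Rightarrow U_{\underline R}$ satisfying the triangle identities; this is equivalent to $\underline P$ being finitely generated projective as a left $\underline R$-module, with ${}^*\underline P=\underline{\mathrm{Hom}}_{\underline R}(\underline P,\underline R)$. $\operatorname{tr}^g(f)\colon\underline{\mathrm{HH}}_0^g(\underline S)\to\underline{\mathrm{HH}}_0^g(\underline R)$ is ${}^g\langle\!\langle U_{\underline S}\rangle\!\rangle\xrightarrow{\bar\eta}{}^g\langle\!\langle{}^*\underline P\odot\underline P\rangle\!\rangle\xrightarrow{\mathrm{id}\odot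 f}{}^g\langle\!\langle{}^*\underline P\odot\underline P\rangle\!\rangle\xrightarrow{{}^g\theta}{}^g\langle\!\langle\underline P\odot{}^*\underline P\rangle\!\rangle\xrightarrow{\bar\epsilon}{}^g\langle\!\langle U_{\underline R}\rangle\!\rangle$. **Twisted Hattori–Stallings trace.** Let $\delta\colon{}^*\underline P\square_{\underline R}{}^g\underline P\xrightarrow{\cong}\underline{\mathrm{Hom}}_{\underline R}(\underline P,{}^g\underline P)$ be the tensor–Hom isomorphism and $\pi^{(g)}\colon{}^*\underline P\square_{\underline R}{}^g\underline P\to\underline{\mathrm{HH}}_0^g(\underline R)$ the unique map induced by ${}^*\underline P\square{}^g\underline P\to{}^g\underline R$ (symmetry followed by evaluation) followed by $q^{(g)}$. $\operatorname{tr}^g_{\mathrm{HS}}=\pi^{(g)}\circ\delta^{-1}$ and $\operatorname{tr}^g_{\mathrm{HS},\gamma}=\operatorname{tr}^g_{\mathrm{HS}}\circ(\gamma_g)_*\colon\underline{\mathrm{End}}_{\underline R}(\underline P)\to\underline{\mathrm{HH}}^g_0(\underline R)$, where $\gamma_g$ is viewed as a left $\underline R$-module map $\underline P\to{}^g\underline P$. **The maps $\varrho_{X,s}$.** For $s\in\underline S(X)$ let $\widehat s\colon\underline S\square\underline A_X\to\underline S$ be the corresponding left $\underline S$-module map. Then $\varrho_X(s)$ is represented by $\varrho_{X,s}\colon\underline P_X\cong\underline P\square_{\underline S}(\underline S\square\underline A_X)\xrightarrow{\mathrm{id}\square\widehat s}\underline P\square_{\underline S}\underline S\cong\underline P$.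 Also $f_X=f\square\mathrm{id}_{\underline A_X}$. *)

theory Defs
  imports "HOL-Algebra.Free_Abelian_Groups" "HOL-Algebra.Elementary_Groups" "HOL-Algebra.Group_Action"
    "HOL-Library.Nat_Bijection"
begin

text \<open>
  The cyclic group of order n is \<open>integer_mod_group n\<close>. Abelian groups are multiplicative
  \<open>comm_group\<close> monoid records. A finite set with action has its points in \<open>nat\<close>; up to isomorphism
  this covers every finite set with action, and it makes the objects of the Burnside category a
  set, so that the coends and quotients below are formed inside HOL types.
\<close>

type_synonym cset = "nat set \<times> (int \<Rightarrow> nat \<Rightarrow> nat)"

abbreviation pts :: "cset \<Rightarrow> nat set" where "pts \<equiv> fst"
abbreviation act :: "cset \<Rightarrow> int \<Rightarrow> nat \<Rightarrow> nat" where "act \<equiv> snd"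

text \<open>A span from X to Y is a triple (U, p, q) with legs p from U to X and q from U to Y.
  A morphism of the Burnside category is a class of formal differences (A, B) of spans.\<close>

type_synonym span = "cset \<times> (nat \<Rightarrow> nat) \<times> (nat \<Rightarrow> nat)"
type_synonym bmor = "(span \<times> span) set"

record 'a mackey =
  obj :: "cset \<Rightarrow> 'a monoid"
  mor :: "cset \<Rightarrow> cset \<Rightarrow> bmor \<Rightarrow> 'a \<Rightarrow> 'a"

text \<open>Generators of the coend defining the value at X of the box product of M and N:
  (Y, Z, b, m, k) with b in B(Y x Z, X), m in M(Y) and k in N(Z).\<close>

type_synonym ('a, 'b) boxgen = "cset \<times> cset \<times> bmor \<times> 'a \<times> 'b"
type_synonym ('a, 'b) boxel = "(('a, 'b) boxgen \<Rightarrow>\<^sub>0 int) set"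

record 'a green = "'a mackey" +
  gmul :: "cset \<Rightarrow> ('a, 'a) boxel \<Rightarrow> 'a"
  gunit :: "cset \<Rightarrow> bmor \<Rightarrow> 'a"

record ('r, 'm) lmod = "'m mackey" +
  lact :: "cset \<Rightarrow> ('r, 'm) boxel \<Rightarrow> 'm"

record ('r, 'm, 's) bimod = "('r, 'm) lmod" +
  ract :: "cset \<Rightarrow> ('m, 's) boxel \<Rightarrow> 'm"

text \<open>Elements of internal Hom objects are transformations out of the box product with a
  representable functor.\<close>

type_synonym ('m, 'k) homel = "cset \<Rightarrow> ('m, bmor) boxel \<Rightarrow> 'k"

definition mid :: "cset \<Rightarrow> 'a \<Rightarrow> 'a"
  where "mid = (\<lambda>X x. x)"

definition mcomp :: "(cset \<Rightarrow> 'b \<Rightarrow> 'c) \<Rightarrow> (cset \<Rightarrow> 'a \<Rightarrow> 'b) \<Rightarrow> cset \<Rightarrow> 'a \<Rightarrow> 'c"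
    (infixr "\<circ>\<^sub>M" 55)
  where "\<psi> \<circ>\<^sub>M \<phi> = (\<lambda>X x. \<psi> X (\<phi> X x))"

definition minv :: "('a, 'z) mackey_scheme \<Rightarrow> (cset \<Rightarrow> 'a \<Rightarrow> 'b) \<Rightarrow> cset \<Rightarrow> 'b \<Rightarrow> 'a"
  where "minv M \<phi> = (\<lambda>X. inv_into (carrier (obj M X)) (\<phi> X))"

text \<open>The map induced on a quotient: h is constant on the coset c, and its value there is taken.\<close>

definition desc :: "(cset \<Rightarrow> 'a \<Rightarrow> 'b) \<Rightarrow> cset \<Rightarrow> 'a set \<Rightarrow> 'b"
  where "desc h = (\<lambda>X c. the_elem (h X ` c))"

context
  fixes n :: nat
begin

subsection \<open>Finite sets with action and the Burnside category\<close>

definition csets :: "cset set"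
  where "csets = {X. finite (pts X) \<and> group_action (integer_mod_group n) (pts X) (act X)}"

definition cmaps :: "cset \<Rightarrow> cset \<Rightarrow> (nat \<Rightarrow> nat) set"
  where "cmaps X Y = {f \<in> pts X \<rightarrow>\<^sub>E pts Y.
    \<forall>g \<in> carrier (integer_mod_group n). \<forall>x \<in> pts X. f (act X g x) = act Y g (f x)}"

definition cpoint :: cset
  where "cpoint = ({0}, \<lambda>g. \<lambda>x \<in> {0}. x)"

definition cprod :: "cset \<Rightarrow> cset \<Rightarrow> cset" (infixr "\<times>\<^sub>C" 75)
  where "X \<times>\<^sub>C Y = (prod_encode ` (pts X \<times> pts Y),
    \<lambda>g. \<lambda>w \<in> prod_encode ` (pts X \<times> pts Y).
      case prod_decode w of (x, y) \<Rightarrow> prod_encode (act X g x, act Y g y))"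

definition spans :: "cset \<Rightarrow> cset \<Rightarrow> span set"
  where "spans X Y = {(U, p, q). U \<in> csets \<and> p \<in> cmaps U X \<and> q \<in> cmaps U Y}"

definition span_iso :: "span \<Rightarrow> span \<Rightarrow> bool"
  where "span_iso = (\<lambda>(U, p, q) (V, r, s).
    \<exists>h \<in> cmaps U V. bij_betw h (pts U) (pts V) \<and> (\<forall>u \<in> pts U. p u = r (h u) \<and> q u = s (h u)))"

definition span_sum :: "span \<Rightarrow> span \<Rightarrow> span"
  where "span_sum = (\<lambda>(U, p, q) (V, r, s).
    let W = sum_encode ` (pts U <+> pts V) in
      ((W, \<lambda>g. \<lambda>w \<in> W. case sum_decode w of
              Inl u \<Rightarrow> sum_encode (Inl (act U g u)) | Inr v \<Rightarrow> sum_encode (Inr (act V g v))),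
       \<lambda>w \<in> W. case sum_decode w of Inl u \<Rightarrow> p u | Inr v \<Rightarrow> r v,
       \<lambda>w \<in> W. case sum_decode w of Inl u \<Rightarrow> q u | Inr v \<Rightarrow> s v))"

definition span_empty :: span
  where "span_empty = (({}, \<lambda>g x. undefined), \<lambda>x. undefined, \<lambda>x. undefined)"

text \<open>Composition (second after first) by pullback.\<close>

definition span_comp :: "span \<Rightarrow> span \<Rightarrow> span"
  where "span_comp = (\<lambda>(V, r, s) (U, p, q).
    let W = prod_encode ` {(u, v). u \<in> pts U \<and> v \<in> pts V \<and> q u = r v} in
      ((W, \<lambda>g. \<lambda>w \<in> W. case prod_decode w of (u, v) \<Rightarrow> prod_encode (act U g u, act V g v)),
       \<lambda>w \<in> W. p (fst (prod_decode w)),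
       \<lambda>w \<in> W. s (snd (prod_decode w))))"

definition span_prod :: "span \<Rightarrow> span \<Rightarrow> span"
  where "span_prod = (\<lambda>(U, p, q) (V, r, s).
    (U \<times>\<^sub>C V,
     \<lambda>w \<in> pts (U \<times>\<^sub>C V). case prod_decode w of (u, v) \<Rightarrow> prod_encode (p u, r v),
     \<lambda>w \<in> pts (U \<times>\<^sub>C V). case prod_decode w of (u, v) \<Rightarrow> prod_encode (q u, s v)))"

text \<open>Group completion of the commutative monoid of isomorphism classes of spans: (A, B) and (C, D)
  are equivalent when A + D + E and C + B + E are isomorphic for some span E.\<close>

definition bcong :: "cset \<Rightarrow> cset \<Rightarrow> ((span \<times> span) \<times> (span \<times> span)) set"
  where "bcong X Y = {((A, B), (C, D)).
    A \<in> spans X Y \<and> B \<in> spans X Y \<and> C \<in> spans X Y \<and> D \<in> spans X Y \<and>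
    (\<exists>E \<in> spans X Y.
      span_iso (span_sum (span_sum A D) E) (span_sum (span_sum C B) E))}"

definition bcls :: "cset \<Rightarrow> cset \<Rightarrow> span \<times> span \<Rightarrow> bmor"
  where "bcls X Y d = bcong X Y `` {d}"

definition bhom :: "cset \<Rightarrow> cset \<Rightarrow> bmor set"
  where "bhom X Y = (spans X Y \<times> spans X Y) // bcong X Y"

definition badd :: "cset \<Rightarrow> cset \<Rightarrow> bmor \<Rightarrow> bmor \<Rightarrow> bmor"
  where "badd X Y \<alpha> \<beta> =
    (\<Union>(A, B) \<in> \<alpha>. \<Union>(C, D) \<in> \<beta>. bcls X Y (span_sum A C, span_sum B D))"

definition bcomp :: "cset \<Rightarrow> cset \<Rightarrow> bmor \<Rightarrow> bmor \<Rightarrow> bmor"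
  where "bcomp X Z \<beta> \<alpha> = (\<Union>(C, D) \<in> \<beta>. \<Union>(A, B) \<in> \<alpha>.
    bcls X Z (span_sum (span_comp C A) (span_comp D B), span_sum (span_comp C B) (span_comp D A)))"

definition bprod :: "cset \<Rightarrow> cset \<Rightarrow> cset \<Rightarrow> cset \<Rightarrow> bmor \<Rightarrow> bmor \<Rightarrow> bmor"
  where "bprod X Y X' Y' \<alpha> \<beta> = (\<Union>(A, B) \<in> \<alpha>. \<Union>(C, D) \<in> \<beta>.
    bcls (X \<times>\<^sub>C X') (Y \<times>\<^sub>C Y')
      (span_sum (span_prod A C) (span_prod B D), span_sum (span_prod A D) (span_prod B C)))"

text \<open>The covariant (transfer) morphism of an equivariant map f, given by the span
  X = X \<open>\<rightarrow>\<close> Y.\<close>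

definition bgraph :: "cset \<Rightarrow> cset \<Rightarrow> (nat \<Rightarrow> nat) \<Rightarrow> bmor"
  where "bgraph X Y f =
    bcls X Y ((X, restrict (\<lambda>x. x) (pts X), restrict f (pts X)), span_empty)"

definition bid :: "cset \<Rightarrow> bmor"
  where "bid X = bgraph X X (\<lambda>x. x)"

definition bassoc :: "cset \<Rightarrow> cset \<Rightarrow> cset \<Rightarrow> bmor"
  where "bassoc X Y Z = bgraph ((X \<times>\<^sub>C Y) \<times>\<^sub>C Z) (X \<times>\<^sub>C Y \<times>\<^sub>C Z)
    (\<lambda>w. case prod_decode w of (u, z) \<Rightarrow> case prod_decode u of (x, y) \<Rightarrow>
      prod_encode (x, prod_encode (y, z)))"

definition bassoc' :: "cset \<Rightarrow> cset \<Rightarrow> cset \<Rightarrow> bmor"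
  where "bassoc' X Y Z = bgraph (X \<times>\<^sub>C Y \<times>\<^sub>C Z) ((X \<times>\<^sub>C Y) \<times>\<^sub>C Z)
    (\<lambda>w. case prod_decode w of (x, v) \<Rightarrow> case prod_decode v of (y, z) \<Rightarrow>
      prod_encode (prod_encode (x, y), z))"

definition bswap :: "cset \<Rightarrow> cset \<Rightarrow> bmor"
  where "bswap X Y = bgraph (X \<times>\<^sub>C Y) (Y \<times>\<^sub>C X)
    (\<lambda>w. case prod_decode w of (x, y) \<Rightarrow> prod_encode (y, x))"

definition blunit :: "cset \<Rightarrow> bmor"
  where "blunit X = bgraph (cpoint \<times>\<^sub>C X) X (\<lambda>w. snd (prod_decode w))"

definition blunit' :: "cset \<Rightarrow> bmor"
  where "blunit' X = bgraph X (cpoint \<times>\<^sub>C X) (\<lambda>x. prod_encode (0, x))"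

definition brunit' :: "cset \<Rightarrow> bmor"
  where "brunit' X = bgraph X (X \<times>\<^sub>C cpoint) (\<lambda>x. prod_encode (x, 0))"

subsection \<open>Mackey functors\<close>

definition mackey_functor :: "('a, 'z) mackey_scheme \<Rightarrow> bool"
  where "mackey_functor M \<longleftrightarrow>
    (\<forall>X \<in> csets. comm_group (obj M X)) \<and>
    (\<forall>X \<in> csets. \<forall>Y \<in> csets. \<forall>\<beta> \<in> bhom X Y. mor M X Y \<beta> \<in> hom (obj M X) (obj M Y)) \<and>
    (\<forall>X \<in> csets. \<forall>x \<in> carrier (obj M X). mor M X X (bid X) x = x) \<and>
    (\<forall>X \<in> csets. \<forall>Y \<in> csets. \<forall>Z \<in> csets. \<forall>\<alpha> \<in> bhom X Y. \<forall>\<beta> \<in> bhom Y Z.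
      \<forall>x \<in> carrier (obj M X). mor M X Z (bcomp X Z \<beta> \<alpha>) x = mor M Y Z \<beta> (mor M X Y \<alpha> x)) \<and>
    (\<forall>X \<in> csets. \<forall>Y \<in> csets. \<forall>\<alpha> \<in> bhom X Y. \<forall>\<beta> \<in> bhom X Y. \<forall>x \<in> carrier (obj M X).
      mor M X Y (badd X Y \<alpha> \<beta>) x = mor M X Y \<alpha> x \<otimes>\<^bsub>obj M Y\<^esub> mor M X Y \<beta> x)"

definition mack_hom :: "('a, 'y) mackey_scheme \<Rightarrow> ('b, 'z) mackey_scheme \<Rightarrow>
    (cset \<Rightarrow> 'a \<Rightarrow> 'b) set"
  where "mack_hom M N = {\<phi>.
    (\<forall>X \<in> csets. \<phi> X \<in> hom (obj M X) (obj N X)) \<and>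
    (\<forall>X \<in> csets. \<forall>Y \<in> csets. \<forall>\<beta> \<in> bhom X Y. \<forall>x \<in> carrier (obj M X).
      \<phi> Y (mor M X Y \<beta> x) = mor N X Y \<beta> (\<phi> X x))}"

definition mack_eq :: "('a, 'z) mackey_scheme \<Rightarrow> (cset \<Rightarrow> 'a \<Rightarrow> 'b) \<Rightarrow>
    (cset \<Rightarrow> 'a \<Rightarrow> 'b) \<Rightarrow> bool"
  where "mack_eq M \<phi> \<psi> \<longleftrightarrow> (\<forall>X \<in> csets. \<forall>x \<in> carrier (obj M X). \<phi> X x = \<psi> X x)"

text \<open>Canonical representative of a transformation out of M.\<close>

definition mrestrict :: "('a, 'z) mackey_scheme \<Rightarrow> (cset \<Rightarrow> 'a \<Rightarrow> 'b) \<Rightarrow> cset \<Rightarrow> 'a \<Rightarrow> 'b"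
  where "mrestrict M \<phi> =
    (\<lambda>X. if X \<in> csets then restrict (\<phi> X) (carrier (obj M X)) else (\<lambda>x. undefined))"

definition repr :: "cset \<Rightarrow> bmor mackey"
  where "repr X = \<lparr>
    obj = (\<lambda>Y. \<lparr>carrier = bhom X Y, monoid.mult = badd X Y,
               one = bcls X Y (span_empty, span_empty)\<rparr>),
    mor = (\<lambda>Y Z \<beta> \<alpha>. bcomp X Z \<beta> \<alpha>)\<rparr>"

text \<open>Coequalizer of two morphisms from K to N, formed objectwise.\<close>

definition coeq_sub :: "('k, 'y) mackey_scheme \<Rightarrow> ('a, 'z) mackey_scheme \<Rightarrow>
    (cset \<Rightarrow> 'k \<Rightarrow> 'a) \<Rightarrow> (cset \<Rightarrow> 'k \<Rightarrow> 'a) \<Rightarrow> cset \<Rightarrow> 'a set"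
  where "coeq_sub K N \<phi> \<psi> X =
    (\<lambda>k. \<phi> X k \<otimes>\<^bsub>obj N X\<^esub> inv\<^bsub>obj N X\<^esub> (\<psi> X k)) ` carrier (obj K X)"

definition coeq_proj :: "('k, 'y) mackey_scheme \<Rightarrow> ('a, 'z) mackey_scheme \<Rightarrow>
    (cset \<Rightarrow> 'k \<Rightarrow> 'a) \<Rightarrow> (cset \<Rightarrow> 'k \<Rightarrow> 'a) \<Rightarrow> cset \<Rightarrow> 'a \<Rightarrow> 'a set"
  where "coeq_proj K N \<phi> \<psi> = (\<lambda>X x. coeq_sub K N \<phi> \<psi> X #>\<^bsub>obj N X\<^esub> x)"

definition coeq :: "('k, 'y) mackey_scheme \<Rightarrow> ('a, 'z) mackey_scheme \<Rightarrow>
    (cset \<Rightarrow> 'k \<Rightarrow> 'a) \<Rightarrow> (cset \<Rightarrow> 'k \<Rightarrow> 'a) \<Rightarrow> 'a set mackey"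
  where "coeq K N \<phi> \<psi> = \<lparr>
    obj = (\<lambda>X. obj N X Mod coeq_sub K N \<phi> \<psi> X),
    mor = (\<lambda>X Y \<beta> c. the_elem ((\<lambda>x. coeq_proj K N \<phi> \<psi> Y (mor N X Y \<beta> x)) ` c))\<rparr>"

subsection \<open>The box product\<close>

definition box_gens :: "('a, 'y) mackey_scheme \<Rightarrow> ('b, 'z) mackey_scheme \<Rightarrow> cset \<Rightarrow>
    ('a, 'b) boxgen set"
  where "box_gens M N X = {(Y, Z, \<beta>, m, k). Y \<in> csets \<and> Z \<in> csets \<and>
    \<beta> \<in> bhom (Y \<times>\<^sub>C Z) X \<and> m \<in> carrier (obj M Y) \<and> k \<in> carrier (obj N Z)}"

definition box_rels :: "('a, 'y) mackey_scheme \<Rightarrow> ('b, 'z) mackey_scheme \<Rightarrow> cset \<Rightarrow>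
    (('a, 'b) boxgen \<Rightarrow>\<^sub>0 int) set"
  where "box_rels M N X =
    {frag_of (Y, Z, badd (Y \<times>\<^sub>C Z) X \<beta> \<beta>', m, k) - frag_of (Y, Z, \<beta>, m, k)
        - frag_of (Y, Z, \<beta>', m, k) | Y Z \<beta> \<beta>' m k.
      (Y, Z, \<beta>, m, k) \<in> box_gens M N X \<and> (Y, Z, \<beta>', m, k) \<in> box_gens M N X} \<union>
    {frag_of (Y, Z, \<beta>, m \<otimes>\<^bsub>obj M Y\<^esub> m', k) - frag_of (Y, Z, \<beta>, m, k)
        - frag_of (Y, Z, \<beta>, m', k) | Y Z \<beta> m m' k.
      (Y, Z, \<beta>, m, k) \<in> box_gens M N X \<and> (Y, Z, \<beta>, m', k) \<in> box_gens M N X} \<union>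
    {frag_of (Y, Z, \<beta>, m, k \<otimes>\<^bsub>obj N Z\<^esub> k') - frag_of (Y, Z, \<beta>, m, k)
        - frag_of (Y, Z, \<beta>, m, k') | Y Z \<beta> m k k'.
      (Y, Z, \<beta>, m, k) \<in> box_gens M N X \<and> (Y, Z, \<beta>, m, k') \<in> box_gens M N X} \<union>
    {frag_of (Y, Z, bcomp (Y \<times>\<^sub>C Z) X \<beta> (bprod Y Y' Z Z' \<xi> \<zeta>), m, k)
        - frag_of (Y', Z', \<beta>, mor M Y Y' \<xi> m, mor N Z Z' \<zeta> k) | Y Z Y' Z' \<beta> \<xi> \<zeta> m k.
      Y \<in> csets \<and> Z \<in> csets \<and> Y' \<in> csets \<and> Z' \<in> csets \<and> \<beta> \<in> bhom (Y' \<times>\<^sub>C Z') X \<and>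
      \<xi> \<in> bhom Y Y' \<and> \<zeta> \<in> bhom Z Z' \<and> m \<in> carrier (obj M Y) \<and> k \<in> carrier (obj N Z)}"

definition box_sub :: "('a, 'y) mackey_scheme \<Rightarrow> ('b, 'z) mackey_scheme \<Rightarrow> cset \<Rightarrow>
    (('a, 'b) boxgen \<Rightarrow>\<^sub>0 int) set"
  where "box_sub M N X = generate (free_Abelian_group (box_gens M N X)) (box_rels M N X)"

definition box_cls :: "('a, 'y) mackey_scheme \<Rightarrow> ('b, 'z) mackey_scheme \<Rightarrow> cset \<Rightarrow>
    (('a, 'b) boxgen \<Rightarrow>\<^sub>0 int) \<Rightarrow> ('a, 'b) boxel"
  where "box_cls M N X z = box_sub M N X #>\<^bsub>free_Abelian_group (box_gens M N X)\<^esub> z"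

definition box :: "('a, 'y) mackey_scheme \<Rightarrow> ('b, 'z) mackey_scheme \<Rightarrow> ('a, 'b) boxel mackey"
  where "box M N = \<lparr>
    obj = (\<lambda>X. free_Abelian_group (box_gens M N X) Mod box_sub M N X),
    mor = (\<lambda>X X' \<xi> c. the_elem ((\<lambda>z. box_cls M N X' (frag_extend
      (\<lambda>(Y, Z, \<beta>, m, k). frag_of (Y, Z, bcomp (Y \<times>\<^sub>C Z) X' \<xi> \<beta>, m, k)) z)) ` c))\<rparr>"

text \<open>The universal pairing: m in M(Y) and k in N(Z) give an element at Y x Z. Conversely,
  \<open>box_lift L \<pi>\<close> is the morphism from the box product to L determined by a natural biadditive
  pairing \<open>\<pi>\<close> of M(Y) and N(Z) into L(Y x Z).\<close>

definition box_pair :: "('a, 'y) mackey_scheme \<Rightarrow> ('b, 'z) mackey_scheme \<Rightarrow> cset \<Rightarrow> cset \<Rightarrow>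
    'a \<Rightarrow> 'b \<Rightarrow> ('a, 'b) boxel"
  where "box_pair M N Y Z m k = box_cls M N (Y \<times>\<^sub>C Z) (frag_of (Y, Z, bid (Y \<times>\<^sub>C Z), m, k))"

definition box_lift :: "('c, 'z) mackey_scheme \<Rightarrow> (cset \<Rightarrow> cset \<Rightarrow> 'a \<Rightarrow> 'b \<Rightarrow> 'c) \<Rightarrow>
    cset \<Rightarrow> ('a, 'b) boxel \<Rightarrow> 'c"
  where "box_lift L \<pi> = (\<lambda>X c. the_elem ((\<lambda>z.
    finprod (obj L X)
      (\<lambda>(Y, Z, \<beta>, m, k). mor L (Y \<times>\<^sub>C Z) X \<beta> (\<pi> Y Z m k)
          [^]\<^bsub>obj L X\<^esub> Poly_Mapping.lookup z (Y, Z, \<beta>, m, k))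
      (Poly_Mapping.keys z)) ` c))"

text \<open>\<open>box_map M' N' \<phi> \<psi>\<close> is the box product of two morphisms with codomains M' and N'.\<close>

definition box_map :: "('c, 'y) mackey_scheme \<Rightarrow> ('d, 'z) mackey_scheme \<Rightarrow>
    (cset \<Rightarrow> 'a \<Rightarrow> 'c) \<Rightarrow> (cset \<Rightarrow> 'b \<Rightarrow> 'd) \<Rightarrow> cset \<Rightarrow> ('a, 'b) boxel \<Rightarrow> ('c, 'd) boxel"
  where "box_map M' N' \<phi> \<psi> =
    box_lift (box M' N') (\<lambda>Y Z m k. box_pair M' N' Y Z (\<phi> Y m) (\<psi> Z k))"

definition box_sym :: "('a, 'y) mackey_scheme \<Rightarrow> ('b, 'z) mackey_scheme \<Rightarrow> cset \<Rightarrow>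
    ('a, 'b) boxel \<Rightarrow> ('b, 'a) boxel"
  where "box_sym M N = box_lift (box N M) (\<lambda>Y Z m k.
    mor (box N M) (Z \<times>\<^sub>C Y) (Y \<times>\<^sub>C Z) (bswap Z Y) (box_pair N M Z Y k m))"

definition shift :: "('a, 'z) mackey_scheme \<Rightarrow> cset \<Rightarrow> 'a mackey"
  where "shift K Z = \<lparr>
    obj = (\<lambda>X. obj K (X \<times>\<^sub>C Z)),
    mor = (\<lambda>X Y \<beta>. mor K (X \<times>\<^sub>C Z) (Y \<times>\<^sub>C Z) (bprod X Y Z Z \<beta> (bid Z)))\<rparr>"

text \<open>The associator is determined by its effect on iterated pairings; for fixed third factor k in
  N(Z), it is a morphism from the box product of L and M into the shift of the target by Z.\<close>

definition box_assoc :: "('a, 'x) mackey_scheme \<Rightarrow> ('b, 'y) mackey_scheme \<Rightarrow>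
    ('c, 'z) mackey_scheme \<Rightarrow> cset \<Rightarrow> (('a, 'b) boxel, 'c) boxel \<Rightarrow> ('a, ('b, 'c) boxel) boxel"
  where "box_assoc L M N = (let K = box L (box M N) in
    box_lift K (\<lambda>Y Z t k.
      box_lift (shift K Z) (\<lambda>A B l m.
        mor K (A \<times>\<^sub>C B \<times>\<^sub>C Z) ((A \<times>\<^sub>C B) \<times>\<^sub>C Z) (bassoc' A B Z)
          (box_pair L (box M N) A (B \<times>\<^sub>C Z) l (box_pair M N B Z m k))) Y t))"

definition box_assoc' :: "('a, 'x) mackey_scheme \<Rightarrow> ('b, 'y) mackey_scheme \<Rightarrow>
    ('c, 'z) mackey_scheme \<Rightarrow> cset \<Rightarrow> ('a, ('b, 'c) boxel) boxel \<Rightarrow> (('a, 'b) boxel, 'c) boxel"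
  where "box_assoc' L M N = minv (box (box L M) N) (box_assoc L M N)"

text \<open>The monoidal unit is the representable functor of a point.\<close>

definition box_lunit :: "('a, 'z) mackey_scheme \<Rightarrow> cset \<Rightarrow> (bmor, 'a) boxel \<Rightarrow> 'a"
  where "box_lunit M = box_lift M (\<lambda>Y Z a m.
    mor M Z (Y \<times>\<^sub>C Z) (bcomp Z (Y \<times>\<^sub>C Z) (bprod cpoint Y Z Z a (bid Z)) (blunit' Z)) m)"

definition box_runit :: "('a, 'z) mackey_scheme \<Rightarrow> cset \<Rightarrow> ('a, bmor) boxel \<Rightarrow> 'a"
  where "box_runit M = box_lift M (\<lambda>Y Z m a.
    mor M Y (Y \<times>\<^sub>C Z) (bcomp Y (Y \<times>\<^sub>C Z) (bprod Y Y cpoint Z (bid Y) a) (brunit' Y)) m)"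

subsection \<open>Green functors, modules, bimodules\<close>

definition green_functor :: "('r, 'z) green_scheme \<Rightarrow> bool"
  where "green_functor R \<longleftrightarrow>
    mackey_functor R \<and>
    gmul R \<in> mack_hom (box R R) R \<and>
    gunit R \<in> mack_hom (repr cpoint) R \<and>
    mack_eq (box (box R R) R)
      (gmul R \<circ>\<^sub>M box_map R R (gmul R) mid)
      (gmul R \<circ>\<^sub>M box_map R R mid (gmul R) \<circ>\<^sub>M box_assoc R R R) \<and>
    mack_eq (box (repr cpoint) R) (gmul R \<circ>\<^sub>M box_map R R (gunit R) mid) (box_lunit R) \<and>
    mack_eq (box R (repr cpoint)) (gmul R \<circ>\<^sub>M box_map R R mid (gunit R)) (box_runit R)"

definition gone :: "('r, 'z) green_scheme \<Rightarrow> 'r"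
  where "gone R = gunit R cpoint (bid cpoint)"

definition bimodule :: "('r, 'x) green_scheme \<Rightarrow> ('s, 'y) green_scheme \<Rightarrow>
    ('r, 'm, 's, 'z) bimod_scheme \<Rightarrow> bool"
  where "bimodule R S M \<longleftrightarrow>
    mackey_functor M \<and>
    lact M \<in> mack_hom (box R M) M \<and>
    ract M \<in> mack_hom (box M S) M \<and>
    mack_eq (box (box R R) M)
      (lact M \<circ>\<^sub>M box_map R M (gmul R) mid)
      (lact M \<circ>\<^sub>M box_map R M mid (lact M) \<circ>\<^sub>M box_assoc R R M) \<and>
    mack_eq (box (repr cpoint) M) (lact M \<circ>\<^sub>M box_map R M (gunit R) mid) (box_lunit M) \<and>
    mack_eq (box (box M S) S)
      (ract M \<circ>\<^sub>M box_map M S (ract M) mid)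
      (ract M \<circ>\<^sub>M box_map M S mid (gmul S) \<circ>\<^sub>M box_assoc M S S) \<and>
    mack_eq (box M (repr cpoint)) (ract M \<circ>\<^sub>M box_map M S mid (gunit S)) (box_runit M) \<and>
    mack_eq (box (box R M) S)
      (ract M \<circ>\<^sub>M box_map M S (lact M) mid)
      (lact M \<circ>\<^sub>M box_map R M mid (ract M) \<circ>\<^sub>M box_assoc R M S)"

definition bimod_hom :: "('r, 'w) green_scheme \<Rightarrow> ('s, 'x) green_scheme \<Rightarrow>
    ('r, 'm, 's, 'y) bimod_scheme \<Rightarrow> ('r, 'k, 's, 'z) bimod_scheme \<Rightarrow> (cset \<Rightarrow> 'm \<Rightarrow> 'k) set"
  where "bimod_hom R S M N = {\<phi> \<in> mack_hom M N.
    mack_eq (box R M) (\<phi> \<circ>\<^sub>M lact M) (lact N \<circ>\<^sub>M box_map R N mid \<phi>) \<and>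
    mack_eq (box M S) (\<phi> \<circ>\<^sub>M ract M) (ract N \<circ>\<^sub>M box_map N S \<phi> mid)}"

definition bimod_iso :: "('r, 'w) green_scheme \<Rightarrow> ('s, 'x) green_scheme \<Rightarrow>
    ('r, 'm, 's, 'y) bimod_scheme \<Rightarrow> ('r, 'k, 's, 'z) bimod_scheme \<Rightarrow> (cset \<Rightarrow> 'm \<Rightarrow> 'k) set"
  where "bimod_iso R S M N = {\<phi> \<in> bimod_hom R S M N.
    \<forall>X \<in> csets. bij_betw (\<phi> X) (carrier (obj M X)) (carrier (obj N X))}"

text \<open>The free left module on the box product of R with M.\<close>

definition free_lmod :: "('r, 'y) green_scheme \<Rightarrow> ('m, 'z) mackey_scheme \<Rightarrow>
    ('r, ('r, 'm) boxel) lmod"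
  where "free_lmod R M = \<lparr>obj = obj (box R M), mor = mor (box R M),
    lact = box_map R M (gmul R) mid \<circ>\<^sub>M box_assoc' R R M\<rparr>"

subsection \<open>The bicategory of bimodules\<close>

text \<open>\<open>rbox S M N\<close> is the box product of M and N over S, with quotient map \<open>rproj S M N\<close>.\<close>

definition rproj :: "('s, 'x) green_scheme \<Rightarrow> ('r, 'm, 's, 'y) bimod_scheme \<Rightarrow>
    ('s, 'k, 'z) lmod_scheme \<Rightarrow> cset \<Rightarrow> ('m, 'k) boxel \<Rightarrow> ('m, 'k) boxel set"
  where "rproj S M N = coeq_proj (box (box M S) N) (box M N)
    (box_map M N (ract M) mid) (box_map M N mid (lact N) \<circ>\<^sub>M box_assoc M S N)"

definition rbox :: "('s, 'x) green_scheme \<Rightarrow> ('r, 'm, 's, 'y) bimod_scheme \<Rightarrow>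
    ('s, 'k, 'z) lmod_scheme \<Rightarrow> ('m, 'k) boxel set mackey"
  where "rbox S M N = coeq (box (box M S) N) (box M N)
    (box_map M N (ract M) mid) (box_map M N mid (lact N) \<circ>\<^sub>M box_assoc M S N)"

definition odot :: "('r, 'v) green_scheme \<Rightarrow> ('s, 'w) green_scheme \<Rightarrow> ('t, 'x) green_scheme \<Rightarrow>
    ('r, 'm, 's, 'y) bimod_scheme \<Rightarrow> ('s, 'k, 't, 'z) bimod_scheme \<Rightarrow>
    ('r, ('m, 'k) boxel set, 't) bimod"
  where "odot R S T M N = \<lparr>
    obj = obj (rbox S M N), mor = mor (rbox S M N),
    lact = box_lift (rbox S M N) (\<lambda>Y Z r c. the_elem ((\<lambda>t.
      rproj S M N (Y \<times>\<^sub>C Z) ((box_map M N (lact M) mid \<circ>\<^sub>M box_assoc' R M N) (Y \<times>\<^sub>C Z)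
        (box_pair R (box M N) Y Z r t))) ` c)),
    ract = box_lift (rbox S M N) (\<lambda>Y Z c k. the_elem ((\<lambda>t.
      rproj S M N (Y \<times>\<^sub>C Z) ((box_map M N mid (ract N) \<circ>\<^sub>M box_assoc M N T) (Y \<times>\<^sub>C Z)
        (box_pair (box M N) T Y Z t k))) ` c))\<rparr>"

definition odot_map :: "('s, 'x) green_scheme \<Rightarrow> ('r, 'm, 's, 'y) bimod_scheme \<Rightarrow>
    ('s, 'k, 'z) lmod_scheme \<Rightarrow> (cset \<Rightarrow> 'a \<Rightarrow> 'm) \<Rightarrow> (cset \<Rightarrow> 'b \<Rightarrow> 'k) \<Rightarrow>
    cset \<Rightarrow> ('a, 'b) boxel set \<Rightarrow> ('m, 'k) boxel set"
  where "odot_map S M' N' \<phi> \<psi> = desc (rproj S M' N' \<circ>\<^sub>M box_map M' N' \<phi> \<psi>)"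

definition oassoc :: "('s, 'u) green_scheme \<Rightarrow> ('t, 'v) green_scheme \<Rightarrow> ('q, 'w) green_scheme \<Rightarrow>
    ('r, 'a, 's, 'x) bimod_scheme \<Rightarrow> ('s, 'b, 't, 'y) bimod_scheme \<Rightarrow>
    ('t, 'c, 'q, 'z) bimod_scheme \<Rightarrow>
    cset \<Rightarrow> (('a, 'b) boxel set, 'c) boxel set \<Rightarrow> ('a, ('b, 'c) boxel set) boxel set"
  where "oassoc S T Q L M N = (let MN = odot S T Q M N in
    desc (box_lift (rbox S L MN) (\<lambda>Y Z c k. the_elem ((\<lambda>t.
      (rproj S L MN \<circ>\<^sub>M box_map L MN mid (rproj T M N) \<circ>\<^sub>M box_assoc L M N) (Y \<times>\<^sub>C Z)
        (box_pair (box L M) N Y Z t k)) ` c))))"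

definition oassoc' :: "('r, 'd) green_scheme \<Rightarrow> ('s, 'u) green_scheme \<Rightarrow> ('t, 'v) green_scheme \<Rightarrow>
    ('q, 'w) green_scheme \<Rightarrow> ('r, 'a, 's, 'x) bimod_scheme \<Rightarrow> ('s, 'b, 't, 'y) bimod_scheme \<Rightarrow>
    ('t, 'c, 'q, 'z) bimod_scheme \<Rightarrow>
    cset \<Rightarrow> ('a, ('b, 'c) boxel set) boxel set \<Rightarrow> (('a, 'b) boxel set, 'c) boxel set"
  where "oassoc' R S T Q L M N =
    minv (odot R T Q (odot R S T L M) N) (oassoc S T Q L M N)"

definition ubimod :: "('r, 'z) green_scheme \<Rightarrow> ('r, 'r, 'r) bimod"
  where "ubimod R = \<lparr>obj = obj R, mor = mor R, lact = gmul R, ract = gmul R\<rparr>"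

definition olunit :: "('r, 'm, 's, 'z) bimod_scheme \<Rightarrow> cset \<Rightarrow> ('r, 'm) boxel set \<Rightarrow> 'm"
  where "olunit M = desc (lact M)"

definition orunit :: "('r, 'm, 's, 'z) bimod_scheme \<Rightarrow> cset \<Rightarrow> ('m, 's) boxel set \<Rightarrow> 'm"
  where "orunit M = desc (ract M)"

definition olunit' :: "('r, 'w) green_scheme \<Rightarrow> ('s, 'x) green_scheme \<Rightarrow>
    ('r, 'm, 's, 'z) bimod_scheme \<Rightarrow> cset \<Rightarrow> 'm \<Rightarrow> ('r, 'm) boxel set"
  where "olunit' R S M = minv (odot R R S (ubimod R) M) (olunit M)"

definition orunit' :: "('r, 'w) green_scheme \<Rightarrow> ('s, 'x) green_scheme \<Rightarrow>
    ('r, 'm, 's, 'z) bimod_scheme \<Rightarrow> cset \<Rightarrow> 'm \<Rightarrow> ('m, 's) boxel set"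
  where "orunit' R S M = minv (odot R S S M (ubimod S)) (orunit M)"

subsection \<open>Twisting\<close>

text \<open>\<open>\<alpha>\<^sub>g\<close>: covariant functoriality along the automorphism of X given by the action of g.\<close>

definition galpha :: "('a, 'z) mackey_scheme \<Rightarrow> int \<Rightarrow> cset \<Rightarrow> 'a \<Rightarrow> 'a"
  where "galpha M g = (\<lambda>X. mor M X X (bgraph X X (act X g)))"

text \<open>Precomposition of the left, respectively right, action with \<open>\<alpha>\<^sub>g\<close>.\<close>

definition ltw :: "('r, 'y) green_scheme \<Rightarrow> int \<Rightarrow> ('r, 'm, 's, 'z) bimod_scheme \<Rightarrow>
    ('r, 'm, 's, 'z) bimod_scheme"
  where "ltw R g M = M\<lparr>lact := lact M \<circ>\<^sub>M box_map R M (galpha R g) mid\<rparr>"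

definition rtw :: "('s, 'y) green_scheme \<Rightarrow> int \<Rightarrow> ('r, 'm, 's, 'z) bimod_scheme \<Rightarrow>
    ('r, 'm, 's, 'z) bimod_scheme"
  where "rtw S g M = M\<lparr>ract := ract M \<circ>\<^sub>M box_map M S mid (galpha S g)\<rparr>"

definition Theta :: "('r, 'z) green_scheme \<Rightarrow> int \<Rightarrow> ('r, 'r, 'r) bimod"
  where "Theta R g = rtw R g (ubimod R)"

text \<open>The canonical isomorphism from \<open>\<Theta>(g) \<odot> \<Theta>(h)\<close> to \<open>\<Theta>(gh)\<close>, sending r, s to r times
  \<open>\<alpha>\<^sub>g\<close>(s). The canonical isomorphism of the unit bimodule with \<open>\<Theta>(e)\<close> is the identity on
  underlying Mackey functors and is not written.\<close>

definition Theta_comp :: "('r, 'z) green_scheme \<Rightarrow> int \<Rightarrow> cset \<Rightarrow> ('r, 'r) boxel set \<Rightarrow> 'r"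
  where "Theta_comp R g = desc (gmul R \<circ>\<^sub>M box_map R R mid (galpha R g))"

text \<open>The identifications of \<open>\<Theta>(g\<inverse>) \<odot> M\<close> with \<open>ltw R g M\<close> (sending r, m to \<open>\<alpha>\<^sub>g\<close>(r) m) and of
  \<open>M \<odot> \<Theta>(g)\<close> with \<open>rtw S g M\<close> (sending m, s to m s).\<close>

definition ltw_iso :: "('r, 'y) green_scheme \<Rightarrow> int \<Rightarrow> ('r, 'm, 's, 'z) bimod_scheme \<Rightarrow>
    cset \<Rightarrow> ('r, 'm) boxel set \<Rightarrow> 'm"
  where "ltw_iso R g M = desc (lact (ltw R g M))"

definition rtw_iso :: "('r, 'm, 's, 'z) bimod_scheme \<Rightarrow> cset \<Rightarrow> ('m, 's) boxel set \<Rightarrow> 'm"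
  where "rtw_iso M = desc (ract M)"

subsection \<open>The bicategory of twists\<close>

text \<open>1-cells. The coherence for \<open>\<tau>\<close> at a product is stated on
  \<open>(\<Theta>(g) \<odot> \<Theta>(h)) \<odot> M\<close>, with all associators written out.\<close>

definition twist_cell :: "('r, 'x) green_scheme \<Rightarrow> ('s, 'y) green_scheme \<Rightarrow>
    ('r, 'm, 's, 'z) bimod_scheme \<Rightarrow>
    (int \<Rightarrow> cset \<Rightarrow> ('r, 'm) boxel set \<Rightarrow> ('m, 's) boxel set) \<Rightarrow> bool"
  where "twist_cell R S M \<tau> \<longleftrightarrow>
    bimodule R S M \<and>
    (\<forall>g \<in> carrier (integer_mod_group n).
      \<tau> g \<in> bimod_iso R S (odot R R S (Theta R g) M) (odot R S S M (Theta S g))) \<and>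
    mack_eq (odot R R S (Theta R 0) M) (\<tau> 0) (orunit' R S M \<circ>\<^sub>M olunit M) \<and>
    (\<forall>g \<in> carrier (integer_mod_group n). \<forall>h \<in> carrier (integer_mod_group n).
      mack_eq (odot R R S (odot R R R (Theta R g) (Theta R h)) M)
        (\<tau> (g \<otimes>\<^bsub>integer_mod_group n\<^esub> h) \<circ>\<^sub>M
          odot_map R (Theta R (g \<otimes>\<^bsub>integer_mod_group n\<^esub> h)) M (Theta_comp R g) mid)
        (odot_map S M (Theta S (g \<otimes>\<^bsub>integer_mod_group n\<^esub> h)) mid (Theta_comp S g) \<circ>\<^sub>M
          oassoc S S S M (Theta S g) (Theta S h) \<circ>\<^sub>M
          odot_map S (odot R S S M (Theta S g)) (Theta S h) (\<tau> g) mid \<circ>\<^sub>M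
          oassoc' R R S S (Theta R g) M (Theta S h) \<circ>\<^sub>M
          odot_map R (Theta R g) (odot R S S M (Theta S h)) mid (\<tau> h) \<circ>\<^sub>M
          oassoc R R S (Theta R g) (Theta R h) M))"

definition twist_2cell :: "('r, 'w) green_scheme \<Rightarrow> ('s, 'x) green_scheme \<Rightarrow>
    ('r, 'm, 's, 'y) bimod_scheme \<Rightarrow>
    (int \<Rightarrow> cset \<Rightarrow> ('r, 'm) boxel set \<Rightarrow> ('m, 's) boxel set) \<Rightarrow>
    ('r, 'k, 's, 'z) bimod_scheme \<Rightarrow>
    (int \<Rightarrow> cset \<Rightarrow> ('r, 'k) boxel set \<Rightarrow> ('k, 's) boxel set) \<Rightarrow>
    (cset \<Rightarrow> 'm \<Rightarrow> 'k) \<Rightarrow> bool"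
  where "twist_2cell R S M \<tau> N \<sigma> f \<longleftrightarrow>
    f \<in> bimod_hom R S M N \<and>
    (\<forall>g \<in> carrier (integer_mod_group n).
      mack_eq (odot R R S (Theta R g) M)
        (\<sigma> g \<circ>\<^sub>M odot_map R (Theta R g) N mid f)
        (odot_map S N (Theta S g) f mid \<circ>\<^sub>M \<tau> g))"

definition twist_unit :: "('r, 'z) green_scheme \<Rightarrow> int \<Rightarrow> cset \<Rightarrow>
    ('r, 'r) boxel set \<Rightarrow> ('r, 'r) boxel set"
  where "twist_unit R g = olunit' R R (Theta R g) \<circ>\<^sub>M orunit (Theta R g)"

definition twist_comp :: "('r, 'v) green_scheme \<Rightarrow> ('s, 'w) green_scheme \<Rightarrow>
    ('t, 'x) green_scheme \<Rightarrow>
    ('r, 'm, 's, 'y) bimod_scheme \<Rightarrow>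
    (int \<Rightarrow> cset \<Rightarrow> ('r, 'm) boxel set \<Rightarrow> ('m, 's) boxel set) \<Rightarrow>
    ('s, 'k, 't, 'z) bimod_scheme \<Rightarrow>
    (int \<Rightarrow> cset \<Rightarrow> ('s, 'k) boxel set \<Rightarrow> ('k, 't) boxel set) \<Rightarrow>
    int \<Rightarrow> cset \<Rightarrow> ('r, ('m, 'k) boxel set) boxel set \<Rightarrow> (('m, 'k) boxel set, 't) boxel set"
  where "twist_comp R S T M \<tau> N \<sigma> g =
    oassoc' R S T T M N (Theta T g) \<circ>\<^sub>M
    odot_map S M (odot S T T N (Theta T g)) mid (\<sigma> g) \<circ>\<^sub>M
    oassoc S S T M (Theta S g) N \<circ>\<^sub>M
    odot_map S (odot R S S M (Theta S g)) N (\<tau> g) mid \<circ>\<^sub>M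
    oassoc' R R S T (Theta R g) M N"

text \<open>\<open>(D, \<sigma>)\<close> with \<open>\<eta>\<close> and \<open>\<epsilon>\<close> is a left dual of \<open>(P, \<tau>)\<close> in the bicategory of twists; the last two
  clauses are the triangle identities.\<close>

definition left_dual :: "('r, 'w) green_scheme \<Rightarrow> ('s, 'x) green_scheme \<Rightarrow>
    ('r, 'p, 's, 'y) bimod_scheme \<Rightarrow>
    (int \<Rightarrow> cset \<Rightarrow> ('r, 'p) boxel set \<Rightarrow> ('p, 's) boxel set) \<Rightarrow>
    ('s, 'd, 'r, 'z) bimod_scheme \<Rightarrow>
    (int \<Rightarrow> cset \<Rightarrow> ('s, 'd) boxel set \<Rightarrow> ('d, 'r) boxel set) \<Rightarrow>
    (cset \<Rightarrow> 's \<Rightarrow> ('d, 'p) boxel set) \<Rightarrow> (cset \<Rightarrow> ('p, 'd) boxel set \<Rightarrow> 'r) \<Rightarrow> bool"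
  where "left_dual R S P \<tau> D \<sigma> \<eta> \<epsilon> \<longleftrightarrow>
    twist_cell R S P \<tau> \<and> twist_cell S R D \<sigma> \<and>
    twist_2cell S S (ubimod S) (twist_unit S)
      (odot S R S D P) (twist_comp S R S D \<sigma> P \<tau>) \<eta> \<and>
    twist_2cell R R (odot R S R P D) (twist_comp R S R P \<tau> D \<sigma>)
      (ubimod R) (twist_unit R) \<epsilon> \<and>
    mack_eq P
      (olunit P \<circ>\<^sub>M odot_map R (ubimod R) P \<epsilon> mid \<circ>\<^sub>M oassoc' R S R S P D P \<circ>\<^sub>M
        odot_map S P (odot S R S D P) mid \<eta> \<circ>\<^sub>M orunit' R S P)
      mid \<and>
    mack_eq D
      (orunit D \<circ>\<^sub>M odot_map R D (ubimod R) mid \<epsilon> \<circ>\<^sub>M oassoc R S R D P D \<circ>\<^sub>M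
        odot_map S (odot S R S D P) D \<eta> mid \<circ>\<^sub>M olunit' S R D)
      mid"

text \<open>The bi-twist isomorphism \<open>\<gamma>\<^sub>g\<close> from P to \<open>rtw S g (ltw R g P)\<close>, whose target is identified with
  \<open>\<Theta>(g\<inverse>) \<odot> (P \<odot> \<Theta>(g))\<close> by the first two factors.\<close>

definition gamma :: "('r, 'x) green_scheme \<Rightarrow> ('s, 'y) green_scheme \<Rightarrow>
    ('r, 'p, 's, 'z) bimod_scheme \<Rightarrow>
    (int \<Rightarrow> cset \<Rightarrow> ('r, 'p) boxel set \<Rightarrow> ('p, 's) boxel set) \<Rightarrow> int \<Rightarrow> cset \<Rightarrow> 'p \<Rightarrow> 'p"
  where "gamma R S P \<tau> g = (let g' = inv\<^bsub>integer_mod_group n\<^esub> g in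
    ltw_iso R g (rtw S g P) \<circ>\<^sub>M
    odot_map R (Theta R g') (rtw S g P) mid (rtw_iso P) \<circ>\<^sub>M
    odot_map R (Theta R g') (odot R S S P (Theta S g)) mid (\<tau> g) \<circ>\<^sub>M
    oassoc R R S (Theta R g') (Theta R g) P \<circ>\<^sub>M
    minv (odot R R S (odot R R R (Theta R g') (Theta R g)) P)
      (odot_map R (ubimod R) P (Theta_comp R g') mid) \<circ>\<^sub>M
    olunit' R S P)"

text \<open>The transport map from \<open>rtw S (g\<inverse>) P\<close> to \<open>ltw R g P\<close>.\<close>

definition transport :: "('r, 'x) green_scheme \<Rightarrow> ('s, 'y) green_scheme \<Rightarrow>
    ('r, 'p, 's, 'z) bimod_scheme \<Rightarrow>
    (int \<Rightarrow> cset \<Rightarrow> ('r, 'p) boxel set \<Rightarrow> ('p, 's) boxel set) \<Rightarrow> int \<Rightarrow> cset \<Rightarrow> 'p \<Rightarrow> 'p"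
  where "transport R S P \<tau> g = (let g' = inv\<^bsub>integer_mod_group n\<^esub> g in
    ltw_iso R g P \<circ>\<^sub>M
    minv (odot R R S (Theta R g') P) (\<tau> g') \<circ>\<^sub>M
    minv (odot R S S P (Theta S g')) (rtw_iso P))"

subsection \<open>Twisted Hochschild homology and the twisted trace\<close>

definition HH0_proj :: "('r, 'y) green_scheme \<Rightarrow> ('r, 'm, 'r, 'z) bimod_scheme \<Rightarrow>
    cset \<Rightarrow> 'm \<Rightarrow> 'm set"
  where "HH0_proj R M = coeq_proj (box R M) M (lact M) (ract M \<circ>\<^sub>M box_sym R M)"

definition HH0 :: "('r, 'y) green_scheme \<Rightarrow> ('r, 'm, 'r, 'z) bimod_scheme \<Rightarrow> 'm set mackey"
  where "HH0 R M = coeq (box R M) M (lact M) (ract M \<circ>\<^sub>M box_sym R M)"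

definition HH0_map :: "('r, 'y) green_scheme \<Rightarrow> ('r, 'k, 'r, 'z) bimod_scheme \<Rightarrow>
    (cset \<Rightarrow> 'm \<Rightarrow> 'k) \<Rightarrow> cset \<Rightarrow> 'm set \<Rightarrow> 'k set"
  where "HH0_map R N \<phi> = desc (HH0_proj R N \<circ>\<^sub>M \<phi>)"

definition tHH0_proj :: "('r, 'y) green_scheme \<Rightarrow> int \<Rightarrow> ('r, 'm, 'r, 'z) bimod_scheme \<Rightarrow>
    cset \<Rightarrow> 'm \<Rightarrow> 'm set"
  where "tHH0_proj R g M = HH0_proj R (ltw R g M)"

definition tHH0 :: "('r, 'y) green_scheme \<Rightarrow> int \<Rightarrow> ('r, 'm, 'r, 'z) bimod_scheme \<Rightarrow>
    'm set mackey"
  where "tHH0 R g M = HH0 R (ltw R g M)"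

definition tHH0_map :: "('r, 'y) green_scheme \<Rightarrow> int \<Rightarrow> ('r, 'k, 'r, 'z) bimod_scheme \<Rightarrow>
    (cset \<Rightarrow> 'm \<Rightarrow> 'k) \<Rightarrow> cset \<Rightarrow> 'm set \<Rightarrow> 'k set"
  where "tHH0_map R g N \<phi> = HH0_map R (ltw R g N) \<phi>"

text \<open>Untwisted cyclicity for M from R to S and N from S to R.\<close>

definition cyclicity :: "('r, 'w) green_scheme \<Rightarrow> ('s, 'x) green_scheme \<Rightarrow>
    ('r, 'm, 's, 'y) bimod_scheme \<Rightarrow> ('s, 'k, 'r, 'z) bimod_scheme \<Rightarrow>
    cset \<Rightarrow> ('m, 'k) boxel set set \<Rightarrow> ('k, 'm) boxel set set"
  where "cyclicity R S M N =
    desc (desc (HH0_proj S (odot S R S N M) \<circ>\<^sub>M rproj R N M \<circ>\<^sub>M box_sym M N))"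

text \<open>Twisted cyclicity for M from R to S and \<open>(N, \<sigma>)\<close> from S to R. The middle factor is the
  isomorphism induced by the identity of the box product of N and M: balancing over R with the left
  action on M twisted by g is balancing with the right action on N twisted by the inverse of g.\<close>

definition twisted_cyclicity :: "('r, 'w) green_scheme \<Rightarrow> ('s, 'x) green_scheme \<Rightarrow> int \<Rightarrow>
    ('r, 'm, 's, 'y) bimod_scheme \<Rightarrow> ('s, 'k, 'r, 'z) bimod_scheme \<Rightarrow>
    (int \<Rightarrow> cset \<Rightarrow> ('s, 'k) boxel set \<Rightarrow> ('k, 'r) boxel set) \<Rightarrow>
    cset \<Rightarrow> ('m, 'k) boxel set set \<Rightarrow> ('k, 'm) boxel set set"
  where "twisted_cyclicity R S g M N \<sigma> = (let N' = rtw R (inv\<^bsub>integer_mod_group n\<^esub> g) N in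
    HH0_map S (odot S R S (ltw S g N) M)
      (odot_map R (ltw S g N) M (transport S R N \<sigma> g) mid) \<circ>\<^sub>M
    desc (desc (HH0_proj S (odot S R S N' M) \<circ>\<^sub>M rproj R N' M)) \<circ>\<^sub>M
    cyclicity R S (ltw R g M) N)"

definition twisted_trace :: "('r, 'w) green_scheme \<Rightarrow> ('s, 'x) green_scheme \<Rightarrow>
    ('r, 'p, 's, 'y) bimod_scheme \<Rightarrow>
    (int \<Rightarrow> cset \<Rightarrow> ('r, 'p) boxel set \<Rightarrow> ('p, 's) boxel set) \<Rightarrow>
    ('s, 'd, 'r, 'z) bimod_scheme \<Rightarrow>
    (cset \<Rightarrow> 's \<Rightarrow> ('d, 'p) boxel set) \<Rightarrow> (cset \<Rightarrow> ('p, 'd) boxel set \<Rightarrow> 'r) \<Rightarrow>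
    int \<Rightarrow> (cset \<Rightarrow> 'p \<Rightarrow> 'p) \<Rightarrow> cset \<Rightarrow> 's set \<Rightarrow> 'r set"
  where "twisted_trace R S P \<tau> D \<eta> \<epsilon> g f =
    tHH0_map R g (ubimod R) \<epsilon> \<circ>\<^sub>M
    twisted_cyclicity S R g D P \<tau> \<circ>\<^sub>M
    tHH0_map S g (odot S R S D P) (odot_map R D P mid f) \<circ>\<^sub>M
    tHH0_map S g (odot S R S D P) \<eta>"

subsection \<open>Internal Hom\<close>

text \<open>The internal Hom object at X consists of the morphisms from the box product of M and the
  representable functor of X to N; it is covariant in X through precomposition of spans.\<close>

definition mhom :: "('m, 'y) mackey_scheme \<Rightarrow> ('k, 'z) mackey_scheme \<Rightarrow> ('m, 'k) homel mackey"
  where "mhom M N = \<lparr>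
    obj = (\<lambda>X. \<lparr>
      carrier = {h \<in> mack_hom (box M (repr X)) N. mrestrict (box M (repr X)) h = h},
      monoid.mult = (\<lambda>h k. mrestrict (box M (repr X)) (\<lambda>Y t. h Y t \<otimes>\<^bsub>obj N Y\<^esub> k Y t)),
      one = mrestrict (box M (repr X)) (\<lambda>Y t. \<one>\<^bsub>obj N Y\<^esub>)\<rparr>),
    mor = (\<lambda>X X' \<beta> h. mrestrict (box M (repr X'))
      (h \<circ>\<^sub>M box_map M (repr X) mid (\<lambda>Y a. bcomp X Y a \<beta>)))\<rparr>"

text \<open>The equalizer of the two maps from \<open>mhom M N\<close> to the internal Hom from the box product of R and
  M to N, given by precomposition with the action on M and by the action on N.\<close>

definition rhom :: "('r, 'x) green_scheme \<Rightarrow> ('r, 'm, 'y) lmod_scheme \<Rightarrow>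
    ('r, 'k, 'z) lmod_scheme \<Rightarrow> ('m, 'k) homel mackey"
  where "rhom R M N = \<lparr>
    obj = (\<lambda>X. (obj (mhom M N) X)\<lparr>carrier := {h \<in> carrier (obj (mhom M N) X).
      mack_eq (box (box R M) (repr X))
        (h \<circ>\<^sub>M box_map M (repr X) (lact M) mid)
        (lact N \<circ>\<^sub>M box_map R N mid h \<circ>\<^sub>M box_assoc R M (repr X))}\<rparr>),
    mor = mor (mhom M N)\<rparr>"

text \<open>Yoneda: h corresponds to the natural family from M(W) to N(W x X) obtained by pairing with the
  identity of X, and \<open>hom_ext\<close> recovers h from this family.\<close>

definition hom_ev :: "('m, 'z) mackey_scheme \<Rightarrow> cset \<Rightarrow> ('m, 'k) homel \<Rightarrow> cset \<Rightarrow> 'm \<Rightarrow> 'k"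
  where "hom_ev M X h W m = h (W \<times>\<^sub>C X) (box_pair M (repr X) W X m (bid X))"

definition hom_ext :: "('m, 'y) mackey_scheme \<Rightarrow> ('k, 'z) mackey_scheme \<Rightarrow> cset \<Rightarrow>
    (cset \<Rightarrow> 'm \<Rightarrow> 'k) \<Rightarrow> ('m, 'k) homel"
  where "hom_ext M N X \<kappa> = mrestrict (box M (repr X)) (box_lift N (\<lambda>W V m a.
    mor N (W \<times>\<^sub>C X) (W \<times>\<^sub>C V) (bprod W W X V (bid W) a) (\<kappa> W m)))"

definition post_comp :: "('m, 'z) mackey_scheme \<Rightarrow> (cset \<Rightarrow> 'k \<Rightarrow> 'l) \<Rightarrow>
    cset \<Rightarrow> ('m, 'k) homel \<Rightarrow> ('m, 'l) homel"
  where "post_comp M \<phi> = (\<lambda>X h. mrestrict (box M (repr X)) (\<phi> \<circ>\<^sub>M h))"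

text \<open>The dual bimodule of left module maps from P to R: (s d)(p) = d(p s) and
  (d r)(p) = d(p) r.\<close>

definition dual_bimod :: "('r, 'x) green_scheme \<Rightarrow> ('s, 'y) green_scheme \<Rightarrow>
    ('r, 'p, 's, 'z) bimod_scheme \<Rightarrow> ('s, ('p, 'r) homel, 'r) bimod"
  where "dual_bimod R S P = \<lparr>
    obj = obj (rhom R P (ubimod R)), mor = mor (rhom R P (ubimod R)),
    lact = box_lift (rhom R P (ubimod R)) (\<lambda>Y X s d. hom_ext P R (Y \<times>\<^sub>C X) (\<lambda>W p.
      mor R ((W \<times>\<^sub>C Y) \<times>\<^sub>C X) (W \<times>\<^sub>C Y \<times>\<^sub>C X) (bassoc W Y X)
        (hom_ev P X d (W \<times>\<^sub>C Y) (ract P (W \<times>\<^sub>C Y) (box_pair P S W Y p s))))),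
    ract = box_lift (rhom R P (ubimod R)) (\<lambda>X Y d r. hom_ext P R (X \<times>\<^sub>C Y) (\<lambda>W p.
      mor R ((W \<times>\<^sub>C X) \<times>\<^sub>C Y) (W \<times>\<^sub>C X \<times>\<^sub>C Y) (bassoc W X Y)
        (gmul R ((W \<times>\<^sub>C X) \<times>\<^sub>C Y) (box_pair R R (W \<times>\<^sub>C X) Y (hom_ev P X d W p) r))))\<rparr>"

subsection \<open>The twisted Hattori--Stallings trace\<close>

definition dual_eval :: "('r, 'y) green_scheme \<Rightarrow> ('r, 'p, 's, 'z) bimod_scheme \<Rightarrow>
    cset \<Rightarrow> ('p, ('p, 'r) homel) boxel \<Rightarrow> 'r"
  where "dual_eval R P = box_lift R (\<lambda>Y X p d. hom_ev P X d Y p)"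

text \<open>The tensor-Hom map for the left module N, sending d, x to the map taking q to d(q) x.\<close>

definition tensor_hom :: "('r, 'x) green_scheme \<Rightarrow> ('r, 'p, 's, 'y) bimod_scheme \<Rightarrow>
    ('r, 'k, 'z) lmod_scheme \<Rightarrow> cset \<Rightarrow> (('p, 'r) homel, 'k) boxel set \<Rightarrow> ('p, 'k) homel"
  where "tensor_hom R P N = desc (box_lift (rhom R P N) (\<lambda>X Y d x.
    hom_ext P N (X \<times>\<^sub>C Y) (\<lambda>W q.
      mor N ((W \<times>\<^sub>C X) \<times>\<^sub>C Y) (W \<times>\<^sub>C X \<times>\<^sub>C Y) (bassoc W X Y)
        (lact N ((W \<times>\<^sub>C X) \<times>\<^sub>C Y) (box_pair R N (W \<times>\<^sub>C X) Y (hom_ev P X d W q) x)))))"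

definition HS_trace :: "('r, 'x) green_scheme \<Rightarrow> ('s, 'y) green_scheme \<Rightarrow>
    ('r, 'p, 's, 'z) bimod_scheme \<Rightarrow> int \<Rightarrow> cset \<Rightarrow> ('p, 'p) homel \<Rightarrow> 'r set"
  where "HS_trace R S P g = (let P' = dual_bimod R S P in
    desc (tHH0_proj R g (ubimod R) \<circ>\<^sub>M dual_eval R P \<circ>\<^sub>M box_sym P' P) \<circ>\<^sub>M
    minv (rbox R P' (ltw R g P)) (tensor_hom R P (ltw R g P)))"

definition HS_trace_gamma :: "('r, 'x) green_scheme \<Rightarrow> ('s, 'y) green_scheme \<Rightarrow>
    ('r, 'p, 's, 'z) bimod_scheme \<Rightarrow>
    (int \<Rightarrow> cset \<Rightarrow> ('r, 'p) boxel set \<Rightarrow> ('p, 's) boxel set) \<Rightarrow>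
    int \<Rightarrow> cset \<Rightarrow> ('p, 'p) homel \<Rightarrow> 'r set"
  where "HS_trace_gamma R S P \<tau> g = HS_trace R S P g \<circ>\<^sub>M post_comp P (gamma R S P \<tau> g)"

text \<open>The adjunct of the right action of S on P.\<close>

definition varrho :: "('s, 'y) green_scheme \<Rightarrow> ('r, 'p, 's, 'z) bimod_scheme \<Rightarrow>
    cset \<Rightarrow> 's \<Rightarrow> ('p, 'p) homel"
  where "varrho S P = (\<lambda>X s. mrestrict (box P (repr X))
    (ract P \<circ>\<^sub>M box_map P S mid (\<lambda>Y a. mor S X Y a s)))"

text \<open>The left module map from the free module on the representable functor of X to S classified by
  s in S(X).\<close>

definition hat :: "('s, 'z) green_scheme \<Rightarrow> cset \<Rightarrow> 's \<Rightarrow> cset \<Rightarrow> ('s, bmor) boxel \<Rightarrow> 's"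
  where "hat S X s = gmul S \<circ>\<^sub>M box_map S S mid (\<lambda>Y a. mor S X Y a s)"

text \<open>The first factor sends p, a to p, 1, a, where 1 in S(point) is the unit.\<close>

definition varrho_rep :: "('s, 'y) green_scheme \<Rightarrow> ('r, 'p, 's, 'z) bimod_scheme \<Rightarrow>
    cset \<Rightarrow> 's \<Rightarrow> ('p, 'p) homel"
  where "varrho_rep S P X s = (let F = free_lmod S (repr X) in
    orunit P \<circ>\<^sub>M odot_map S P (ubimod S) mid (hat S X s) \<circ>\<^sub>M
    box_lift (rbox S P F) (\<lambda>W V p a. rproj S P F (W \<times>\<^sub>C V)
      (box_pair P F W V p (mor F (cpoint \<times>\<^sub>C V) V (blunit V)
        (box_pair S (repr X) cpoint V (gone S) a)))))"

end

end

theory Submission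
  imports Defs
begin

text \<open>
Write r.p and p.s for the actions on P, t for the transport map of P at g, q for the quotient map
onto twisted HH_0 of R, and suppress the reindexing of cartesian factors. Every twist isomorphism is
determined by its values on unit elements, so that (P, \<tau>) amounts to maps t = t_g of the Mackey
functor P with t(r.p) = \<alpha>_g(r).t(p) and t(p.s) = t(p).\<alpha>_g(s); coherence of \<tau> gives t_0 = id and
t_{g+h} = t_g t_h, and hence both \<open>gamma\<close> and \<open>transport\<close> are t (\<open>gamma_eq\<close>, \<open>transport_eq\<close>).

Running a class d \<otimes> p through the definition of the twisted trace then gives a map \<Lambda> on
D \<otimes> P with \<Lambda>(d \<otimes> p) = q(\<epsilon>(t f p \<otimes> d)) and tr(f)(q(s)) = \<Lambda>(\<eta>(s)) (\<open>twisted_trace_value\<close>).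

The Hattori--Stallings side needs an inverse of the tensor-Hom map T(e \<otimes> x)(p) = e(p).x, for which
the duality data suffice. Let Z(d \<otimes> p, h) = \<epsilon>(- \<otimes> d) \<otimes> h(p) (\<open>dual_tensor_pairing\<close>). If
G(x, d \<otimes> p) = \<epsilon>(x \<otimes> d).p, then T(Z(y, h))(x) = h(G(x, y)) and the trace of Z(y, T(e \<otimes> x)) is
q(e(G(x, y))) (\<open>tensor_Z\<close>, \<open>trace_Z\<close>). A triangle identity says G(x, \<eta>(1)) = x. Hence
Z(\<eta>(1), h) is a preimage of h under T, and every preimage has the same trace. For h(p) = t f (p.s)
the trace of Z(d \<otimes> p, h) is q(\<epsilon>(t f (p.s) \<otimes> d)) = \<Lambda>(d \<otimes> p.s), and d \<otimes> p = \<eta>(1) turns this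
into \<Lambda>(\<eta>(s)) (\<open>traces_agree\<close>). Since f is linear over S, it may be applied before or after
the action of s, which is the second identity.

Elementwise reasoning of this kind is possible because box products are generated, as Mackey functors,
by the classes of pairs, and a map of Mackey functors is determined on generators (\<open>mgen_box\<close>,
\<open>mack_hom_eqI\<close>). All the coherence this requires of reindexing isomorphisms takes place in the Burnside
category, where a morphism is determined by its marks (\<open>bhom_eqI\<close>): composition becomes a matrix
product and naturality of a graph becomes a pointwise check.
\<close>

section \<open>Quotients of abelian groups\<close>

lemma quotient_facts:
 assumes "comm_group A" "subgroup N A"
 shows "comm_group (A Mod N)" "(%x. N #>\<^bsub>A\<^esub> x) : hom A (A Mod N)"
  "carrier (A Mod N) = (%x. N #>\<^bsub>A\<^esub> x) ` carrier A"
  "x : N ==> N #>\<^bsub>A\<^esub> x = \<one>\<^bsub>A Mod N\<^esub>"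
proof -
 interpret A: comm_group A by fact
 have n: "N \<lhd> A" by (simp add: assms(2) A.normal_iff_subgroup)
 show "comm_group (A Mod N)" using assms(2) by (rule A.abelian_FactGroup)
 show "(%x. N #>\<^bsub>A\<^esub> x) : hom A (A Mod N)" using n by (rule normal.r_coset_hom_Mod)
 show "carrier (A Mod N) = (%x. N #>\<^bsub>A\<^esub> x) ` carrier A" by (rule carrier_FactGroup)
 show "x : N ==> N #>\<^bsub>A\<^esub> x = \<one>\<^bsub>A Mod N\<^esub>"
  using assms(2) by (simp add: subgroup.rcos_const[OF _ A.is_group])
qed

lemma hom_image_coset:
 assumes "comm_group A" "subgroup N A" "h : hom A B" "group B" "!!k. k : N ==> h k = \<one>\<^bsub>B\<^esub>" "x : carrier A"
 shows "h ` (N #>\<^bsub>A\<^esub> x) = {h x}"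
proof -
 interpret A: comm_group A by fact
 have "h y = h x" if y: "y : N #>\<^bsub>A\<^esub> x" for y
 proof -
  obtain k where k: "k : N" "y = k \<otimes>\<^bsub>A\<^esub> x" using y unfolding r_coset_def by blast
  have "k : carrier A" using k(1) assms(2) subgroup.mem_carrier by metis
  then have "h y = h k \<otimes>\<^bsub>B\<^esub> h x" using k(2) assms(3,6) by (simp add: hom_mult)
  then show ?thesis using assms(5)[OF k(1)] monoid.l_one[OF group.is_monoid[OF assms(4)] hom_in_carrier[OF assms(3,6)]] by simp
 qed
 moreover have "x : N #>\<^bsub>A\<^esub> x" using A.rcos_self[OF assms(6,2)] .
 ultimately show ?thesis by blast
qed

text \<open>The induced map is expressed as the value of h on a whole coset, since h is constant there.\<close>

lemma quotient_desc_hom: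
 assumes A: "comm_group A" "subgroup N A" and h: "h : hom A B" "group B" and k: "!!k. k : N ==> h k = \<one>\<^bsub>B\<^esub>"
 shows "(%c. the_elem (h ` c)) : hom (A Mod N) B"
proof (rule homI)
 have im: "h ` (N #>\<^bsub>A\<^esub> x) = {h x}" if "x : carrier A" for x
  by (rule hom_image_coset[OF A h k that])
 fix c assume "c : carrier (A Mod N)"
 then obtain x where x: "x : carrier A" "c = N #>\<^bsub>A\<^esub> x" unfolding quotient_facts(3)[OF A] by blast
 then show "the_elem (h ` c) : carrier B" using im hom_in_carrier[OF h(1)] by simp
 fix d assume "d : carrier (A Mod N)"
 then obtain y where y: "y : carrier A" "d = N #>\<^bsub>A\<^esub> y" unfolding quotient_facts(3)[OF A] by blast
 have xy: "x \<otimes>\<^bsub>A\<^esub> y : carrier A" using A(1) x y by (simp add: comm_group_def group.is_monoid monoid.m_closed)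
 have "c \<otimes>\<^bsub>A Mod N\<^esub> d = N #>\<^bsub>A\<^esub> (x \<otimes>\<^bsub>A\<^esub> y)"
  unfolding x(2) y(2) by (rule hom_mult[OF quotient_facts(2)[OF A] x(1) y(1), symmetric])
 then show "the_elem (h ` (c \<otimes>\<^bsub>A Mod N\<^esub> d)) = the_elem (h ` c) \<otimes>\<^bsub>B\<^esub> the_elem (h ` d)"
  using im[OF xy] im[OF x(1)] im[OF y(1)] x y hom_mult[OF h(1) x(1) y(1)] by simp
qed

section \<open>Finite sets with an action of the cyclic group\<close>

locale burnside = fixes n :: nat assumes n_pos: "n \<ge> 1"
begin

text \<open>The order n of the group is fixed throughout, so that the abbreviations leave it out.\<close>

abbreviation G where "G == integer_mod_group n"
abbreviation CG where "CG == carrier G"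
abbreviation CS where "CS == csets n"
abbreviation "bhm == bhom n"
abbreviation "bco == bcomp n"
abbreviation "bpr == bprod n"
abbreviation "bd == bid n"
abbreviation "mackey M == mackey_functor n M"
abbreviation "mhm M N == mack_hom n M N"
abbreviation "rpr == repr n"
abbreviation "bx M N == box n M N"
abbreviation "bp M N == box_pair n M N"
abbreviation "bmap M N == box_map n M N"
abbreviation "rbx S M N == rbox n S M N"
abbreviation "odo R S T M N == odot n R S T M N"
abbreviation "rh R M N == rhom n R M N"
abbreviation "hev M == hom_ev n M"
abbreviation "pt == cpoint"
abbreviation ob_add ("(_ +[_,_] _)" [70, 0, 0, 71] 70) where "a +[M,X] b == a \<otimes>\<^bsub>obj M X\<^esub> b"
notation cprod (infixr "**" 75) and mcomp (infixr "oM" 55)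

lemma carrier_G: "CG = {0..<int n}"
 using n_pos by (simp add: carrier_integer_mod_group)

lemma finite_G: "finite (CG)"
 by (simp add: carrier_G)

lemma G_closed [simp]: "g : CG ==> h : CG ==> (g + h) mod int n : CG"
 "g : CG ==> (- g) mod int n : CG"
 using n_pos by (simp_all add: carrier_G)

lemma G_inv: "g : CG ==> (g + (- g) mod int n) mod int n = 0"
 "g : CG ==> ((- g) mod int n + g) mod int n = 0"
 by (simp_all add: mod_add_right_eq mod_add_left_eq)

lemma csets_finite: "X : CS ==> finite (pts X)"
 by (simp add: csets_def)

lemma act_closed [simp]: "X : CS ==> g : CG ==> x : pts X ==> act X g x : pts X"
 unfolding csets_def by (auto dest: group_action.surj_prop)

lemma act_comp: "X : CS ==> g : CG ==> h : CG ==> x : pts X ==>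
  act X ((g + h) mod int n) x = act X g (act X h x)"
 unfolding csets_def using group_action.composition_rule[of G "pts X" "act X" x g h] by simp

lemma act_zero [simp]: "X : CS ==> x : pts X ==> act X 0 x = x"
 unfolding csets_def using group_action.id_eq_one[of G "pts X" "act X"] by (metis (mono_tags, lifting) mem_Collect_eq one_integer_mod_group restrict_apply')

lemma act_commute: "X : CS ==> g : CG ==> h : CG ==> x : pts X ==>
  act X g (act X h x) = act X h (act X g x)"
 by (simp add: act_comp[symmetric] add.commute)

lemma act_inv [simp]: "X : CS ==> g : CG ==> x : pts X ==>
  act X g (act X ((- g) mod int n) x) = x"
 "X : CS ==> g : CG ==> x : pts X ==>
  act X ((- g) mod int n) (act X g x) = x"
 by (subst act_comp[symmetric]; simp add: G_inv[simplified])+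

lemma csetsI:
 assumes "finite E" "!!g. g : CG ==> ph g : extensional E"
  "!!g x. g : CG ==> x : E ==> ph g x : E" "!!x. x : E ==> ph 0 x = x"
  "!!g h x. g : CG ==> h : CG ==> x : E ==> ph ((g + h) mod int n) x = ph g (ph h x)"
 shows "(E, ph) : CS"
proof -
 have b: "ph g : Bij E" if g: "g : CG" for g
 proof -
  have "bij_betw (ph g) E E"
  proof (rule bij_betwI[where g = "ph ((- g) mod int n)"])
   show "ph g : E \<rightarrow> E" "ph ((- g) mod int n) : E \<rightarrow> E"
    using assms(3) g by auto
   show "ph ((- g) mod int n) (ph g x) = x" if "x : E" for x
    using assms(5)[OF G_closed(2)[OF g] g that] assms(4)[OF that] unfolding G_inv(2)[OF g] by metis
   show "ph g (ph ((- g) mod int n) x) = x" if "x : E" for x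
    using assms(5)[OF g G_closed(2)[OF g] that] assms(4)[OF that] unfolding G_inv(1)[OF g] by metis
  qed
  then show ?thesis using assms(2) g by (simp add: Bij_def)
 qed
 have "group_action G E ph"
 proof (intro group_action.intro group_hom.intro group_hom_axioms.intro)
  show "ph : hom G (BijGroup E)"
  proof (rule homI)
   fix g h assume gh: "g : CG" "h : CG"
   show "ph (g \<otimes>\<^bsub>G\<^esub> h) = ph g \<otimes>\<^bsub>BijGroup E\<^esub> ph h"
    using gh b[OF gh(1)] b[OF gh(2)] b[OF G_closed(1)[OF gh]] assms(5)
    by (auto simp: BijGroup_def compose_def fun_eq_iff Bij_def extensional_def)
  qed (simp add: BijGroup_def b)
 qed (simp_all add: group_BijGroup)
 then show ?thesis using assms(1) by (simp add: csets_def)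
qed

lemma pts_cprod: "pts (X ** Y) = prod_encode ` (pts X \<times> pts Y)"
 by (simp add: cprod_def)

lemma enc_in_cprod [simp]: "prod_encode (x, y) : pts (X ** Y) \<longleftrightarrow> x : pts X & y : pts Y"
 by (auto simp: pts_cprod)

lemma ball_cprod [simp]: "(ALL w : pts (X ** Y). P w) \<longleftrightarrow> (ALL x : pts X. ALL y : pts Y. P (prod_encode (x, y)))"
 by (auto simp: pts_cprod)

lemma cprodE: assumes "w : pts (X ** Y)"
 obtains x y where "w = prod_encode (x, y)" "x : pts X" "y : pts Y"
 using assms by (auto simp: pts_cprod)

lemma act_cprod [simp]: "x : pts X ==> y : pts Y ==>
  act (X ** Y) g (prod_encode (x, y)) = prod_encode (act X g x, act Y g y)"
 by (auto simp: cprod_def)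

lemma cprod_csets [simp]: "X : CS ==> Y : CS ==> X ** Y : CS"
 unfolding cprod_def
 by (rule csetsI) (auto simp: csets_finite act_comp[simplified])

lemma cpoint_csets [simp]: "pt : CS"
 unfolding cpoint_def by (rule csetsI) auto

lemma pts_cpoint [simp]: "pts pt = {0}" and act_cpoint [simp]: "act pt g 0 = 0"
 by (simp_all add: cpoint_def)

section \<open>Spans and marks\<close>

definition fixd where
 "fixd U H u \<longleftrightarrow> (ALL h : H. act U h u = u)"

text \<open>The numbers of fixed points over (x, y) play the role of the marks of a finite set.\<close>

fun smk :: "span => int set => nat => nat => nat" where
 "smk (U, p, q) H x y = card {u : pts U. fixd U H u & p u = x & q u = y}"

lemma cmapsD: assumes "f : cmaps n U X"
 shows "u : pts U ==> f u : pts X" "g : CG ==> u : pts U ==> f (act U g u) = act X g (f u)"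
 using assms by (auto simp: cmaps_def)

text \<open>Burnside's theorem relative to a base, by removing one orbit at a time. A point u of A with largest
stabilizer has, by equality of counts, a point v of B over the same point of the base fixed by
that stabilizer; comparing back, the maximality of the stabilizer of u forces the two stabilizers to agree.
The orbits of u and v are then isomorphic over the base, and removing them preserves equality of counts.\<close>

lemma equal_fixed_points_bij:
 assumes U: "U : CS" and V: "V : CS"
  and pp: "!!g u v. g : CG ==> u : pts U ==> v : pts V ==> pp u = rho v ==> pp (act U g u) = rho (act V g v)"
 shows "A <= pts U ==> B <= pts V ==>
  (ALL g : CG. ALL u : A. act U g u : A) ==> (ALL g : CG. ALL v : B. act V g v : B) ==>
  (ALL H <= CG. ALL z. card {u : A. fixd U H u & pp u = z} = card {v : B. fixd V H v & rho v = z}) ==>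
  EX h. bij_betw h A B & (ALL g : CG. ALL u : A. h (act U g u) = act V g (h u)) & (ALL u : A. pp u = rho (h u))"
proof (induction "card A" arbitrary: A B rule: less_induct)
 case less
 have finA: "finite A" and finB: "finite B"
  using less.prems(1,2) csets_finite[OF U] csets_finite[OF V] finite_subset by auto
 note AU = less.prems(1) and BV = less.prems(2) and Aact = less.prems(3) and Bact = less.prems(4)
 have cnt: "card {u : A. fixd U H u & pp u = z} = card {v : B. fixd V H v & rho v = z}"
  if "H <= CG" for H z using less.prems(5) that by blast
 show ?case
 proof (cases "A = {}")
  case True
  have "B = {}"
  proof (rule ccontr)
   assume "B ~= {}"
   then obtain v where v: "v : B" by auto
   then have "v : {w : B. fixd V {} w & rho w = rho v}" by (simp add: fixd_def)
   then have "card {w : B. fixd V {} w & rho w = rho v} ~= 0" using finB by auto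
   then show False using cnt[of "{}" "rho v"] True by simp
  qed
  then show ?thesis using True by (auto simp: bij_betw_def)
 next
  case False
  define St where "St W w = {h : CG. act W h w = w}" for W :: cset and w
  have St_fin: "finite (St W w)" for W w unfolding St_def using finite_G by auto
  have St_G: "St W w <= CG" for W w by (auto simp: St_def)
  have fM: "finite ((%u. card (St U u)) ` A)" and neM: "(%u. card (St U u)) ` A ~= {}"
   using False finA by auto
  obtain u where u: "u : A" and uM: "card (St U u) = Max ((%u. card (St U u)) ` A)"
   using Max_in[OF fM neM] by auto
  have umax: "card (St U u') \<le> card (St U u)" if "u' : A" for u'
   unfolding uM by (rule Max_ge[OF fM]) (use that in simp)
  have ex_over: "EX v : B. fixd V H v & rho v = z" if "H <= CG" "EX u : A. fixd U H u & pp u = z" for H z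
  proof -
   have "card {u : A. fixd U H u & pp u = z} ~= 0" using that(2) finA by auto
   then have "card {v : B. fixd V H v & rho v = z} ~= 0" using cnt[OF that(1)] by simp
   then have "{v : B. fixd V H v & rho v = z} ~= {}" by (metis card.empty)
   then show ?thesis by blast
  qed
  have ex_over': "EX u : A. fixd U H u & pp u = z" if "H <= CG" "EX v : B. fixd V H v & rho v = z" for H z
  proof -
   have "card {v : B. fixd V H v & rho v = z} ~= 0" using that(2) finB by auto
   then have "card {u : A. fixd U H u & pp u = z} ~= 0" using cnt[OF that(1)] by simp
   then have "{u : A. fixd U H u & pp u = z} ~= {}" by (metis card.empty)
   then show ?thesis by blast
  qed
  obtain v where v: "v : B" "fixd V (St U u) v" "rho v = pp u"
   using ex_over[OF St_G, of U u "pp u"] u by (auto simp: fixd_def St_def)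
  obtain u2 where u2: "u2 : A" "fixd U (St V v) u2"
   using ex_over'[OF St_G, of V v "rho v"] v by (auto simp: fixd_def St_def)
  have sub1: "St U u <= St V v" using v(2) by (auto simp: fixd_def St_def)
  have sub2: "St V v <= St U u2" using u2(2) by (auto simp: fixd_def St_def)
  have St_eq: "St V v = St U u"
   using card_seteq[OF St_fin sub1] card_mono[OF St_fin sub2] umax[OF u2(1)] by simp
  have uU: "u : pts U" and vV: "v : pts V" using u v AU BV by auto
  have act_eq: "act W g w = act W g' w \<longleftrightarrow> ((- g) mod int n + g') mod int n : St W w"
   if "W : CS" "w : pts W" "g : CG" "g' : CG" for W g g' w
  proof
   assume "act W g w = act W g' w"
   then have "act W ((- g) mod int n) (act W g' w) = w"
    using that by (metis act_inv(2))
   then show "((- g) mod int n + g') mod int n : St W w"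
    using that act_comp[OF that(1) G_closed(2) that(4,2)] G_closed unfolding St_def by simp
  next
   assume "((- g) mod int n + g') mod int n : St W w"
   then have "act W ((- g) mod int n) (act W g' w) = w"
    using that act_comp[OF that(1) G_closed(2) that(4,2)] unfolding St_def by simp
   then show "act W g w = act W g' w"
    using that by (metis act_inv(1) act_closed)
  qed
  define h0 where "h0 w = act V (SOME g. g : CG & act U g u = w) v" for w
  have h0: "h0 (act U g u) = act V g v" if "g : CG" for g
  proof -
   define g' where "g' = (SOME g'. g' : CG & act U g' u = act U g u)"
   have "g' : CG & act U g' u = act U g u" unfolding g'_def
    by (rule someI[of _ g]) (use that in simp)
   then have "act V g' v = act V g v"
    using act_eq[OF U uU] act_eq[OF V vV] that St_eq by blast
   then show ?thesis by (simp add: h0_def g'_def)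
  qed
  define Ou where "Ou = (%g. act U g u) ` CG"
  define Ov where "Ov = (%g. act V g v) ` CG"
  have bij0: "bij_betw h0 Ou Ov"
   unfolding bij_betw_def
  proof
   show "inj_on h0 Ou"
    unfolding inj_on_def Ou_def using h0 act_eq[OF U uU] act_eq[OF V vV] St_eq by auto
   show "h0 ` Ou = Ov" by (simp add: Ou_def Ov_def image_image h0 cong: image_cong)
  qed
  have Ou_A: "Ou <= A" using Aact u unfolding Ou_def by auto
  have Ov_B: "Ov <= B" using Bact v unfolding Ov_def by auto
  have Ou_act: "!!g w. g : CG ==> w : Ou ==> act U g w : Ou"
   unfolding Ou_def using act_comp[OF U _ _ uU, symmetric] by (auto intro!: imageI)
  have Ov_act: "!!g w. g : CG ==> w : Ov ==> act V g w : Ov"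
   unfolding Ov_def using act_comp[OF V _ _ vV, symmetric] by (auto intro!: imageI)
  have h0_eq: "h0 (act U g w) = act V g (h0 w)" if "g : CG" "w : Ou" for g w
  proof -
   obtain k where k: "k : CG" "w = act U k u" using `w : Ou` by (auto simp: Ou_def)
   have "act U g w = act U ((g + k) mod int n) u" using act_comp[OF U that(1) k(1) uU] k by simp
   then show ?thesis using h0 k that(1) act_comp[OF V that(1) k(1) vV] by simp
  qed
  have h0_pi: "pp w = rho (h0 w)" if "w : Ou" for w
   using that h0 pp[OF _ uU vV] v(3) unfolding Ou_def by auto
  have co: "act U g w : A - Ou" if "g : CG" "w : A - Ou" for g w
  proof -
   have "act U g w \<notin> Ou"
   proof
    assume "act U g w : Ou"
    then have "act U ((- g) mod int n) (act U g w) : Ou" using Ou_act G_closed(2) that by blast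
    then show False using that AU U by auto
   qed
   then show ?thesis using Aact that by auto
  qed
  have co': "act V g w : B - Ov" if "g : CG" "w : B - Ov" for g w
  proof -
   have "act V g w \<notin> Ov"
   proof
    assume "act V g w : Ov"
    then have "act V ((- g) mod int n) (act V g w) : Ov" using Ov_act G_closed(2) that by blast
    then show False using that BV V by auto
   qed
   then show ?thesis using Bact that by auto
  qed
  have cardO: "card {w : Ou. fixd U H w & pp w = z} = card {w : Ov. fixd V H w & rho w = z}"
   if H: "H <= CG" for H z
  proof (rule bij_betw_same_card)
   have fx: "fixd U H w \<longleftrightarrow> fixd V H (h0 w)" if "w : Ou" for w
   proof -
    have "act V h (h0 w) = h0 w \<longleftrightarrow> act U h w = w" if "h : H" for h
     using h0_eq[of h w] inj_on_eq_iff[OF bij_betw_imp_inj_on[OF bij0] Ou_act[of h w] `w : Ou`]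
      `w : Ou` H `h : H` by auto
    then show ?thesis unfolding fixd_def by simp
   qed
   show "bij_betw h0 {w : Ou. fixd U H w & pp w = z} {w : Ov. fixd V H w & rho w = z}"
    unfolding bij_betw_def
   proof
    show "inj_on h0 {w : Ou. fixd U H w & pp w = z}"
     using bij0 by (auto simp: bij_betw_def inj_on_def)
    have "w : h0 ` {w : Ou. fixd U H w & pp w = z}" if "w : Ov" "fixd V H w" "rho w = z" for w
    proof -
     obtain w' where "w' : Ou" "w = h0 w'" using bij_betw_imp_surj_on[OF bij0] `w : Ov` by blast
     then show ?thesis using fx h0_pi that by auto
    qed
    moreover have "h0 w : Ov" if "w : Ou" for w using bij0 that by (auto simp: bij_betw_def)
    ultimately show "h0 ` {w : Ou. fixd U H w & pp w = z} = {w : Ov. fixd V H w & rho w = z}"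
     using fx h0_pi by auto
   qed
  qed
  have cnt': "card {w : A - Ou. fixd U H w & pp w = z} = card {w : B - Ov. fixd V H w & rho w = z}"
   if H: "H <= CG" for H z
  proof -
   have "{w : A - Ou. fixd U H w & pp w = z} = {w : A. fixd U H w & pp w = z} - {w : Ou. fixd U H w & pp w = z}"
    by auto
   moreover have "{w : B - Ov. fixd V H w & rho w = z} = {w : B. fixd V H w & rho w = z} - {w : Ov. fixd V H w & rho w = z}"
    by auto
   moreover have "finite Ou" "finite Ov" using Ou_A Ov_B finA finB finite_subset by auto
   moreover have "{w : Ou. fixd U H w & pp w = z} <= {w : A. fixd U H w & pp w = z}"
    "{w : Ov. fixd V H w & rho w = z} <= {w : B. fixd V H w & rho w = z}" using Ou_A Ov_B by auto
   ultimately show ?thesis using cnt[OF H] cardO[OF H] by (simp add: card_Diff_subset)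
  qed
  have uOu: "u : Ou" unfolding Ou_def by (rule image_eqI[where x = 0 and f = "%g. act U g u"]) (use U uU in simp_all)
  have "card (A - Ou) < card A" using uOu u by (intro psubset_card_mono[OF finA]) auto
  moreover have "A - Ou <= pts U" "B - Ov <= pts V" using AU BV by auto
  ultimately obtain h1 where h1: "bij_betw h1 (A - Ou) (B - Ov)"
   "ALL g : CG. ALL w : A - Ou. h1 (act U g w) = act V g (h1 w)" "ALL w : A - Ou. pp w = rho (h1 w)"
   using less.hyps[of "A - Ou" "B - Ov"] co co' cnt' by auto
  define h where "h w = (if w : Ou then h0 w else h1 w)" for w
  have "bij_betw h (Ou \<union> (A - Ou)) (Ov \<union> (B - Ov))"
  proof (rule bij_betw_combine)
   show "bij_betw h Ou Ov" using bij0 by (simp add: h_def cong: bij_betw_cong)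
   show "bij_betw h (A - Ou) (B - Ov)" by (rule bij_betw_cong[THEN iffD1, OF _ h1(1)]) (simp add: h_def)
  qed auto
  then have "bij_betw h A B" using Ou_A Ov_B by (simp add: Un_absorb1)
  moreover have "ALL g : CG. ALL w : A. h (act U g w) = act V g (h w)"
   using h0_eq h1(2) Ou_act co by (auto simp: h_def)
  moreover have "ALL w : A. pp w = rho (h w)" using h0_pi h1(3) by (auto simp: h_def)
  ultimately show ?thesis by blast
 qed
qed

lemma spansD: assumes "(U, p, q) : spans n X Y"
 shows "U : CS" "p : cmaps n U X" "q : cmaps n U Y"
 using assms by (auto simp: spans_def)

theorem span_iso_iff_marks:
 assumes A: "A : spans n X Y" and B: "B : spans n X Y"
 shows "span_iso n A B \<longleftrightarrow> (ALL H <= CG. ALL x y. smk A H x y = smk B H x y)"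
proof -
 obtain U p q where AU: "A = (U, p, q)" by (cases A)
 obtain V r s where BV: "B = (V, r, s)" by (cases B)
 note U = spansD[OF A[unfolded AU]] and V = spansD[OF B[unfolded BV]]
 show ?thesis
 proof
  assume "span_iso n A B"
  then obtain h where h: "h : cmaps n U V" "bij_betw h (pts U) (pts V)"
   "!!u. u : pts U ==> p u = r (h u) & q u = s (h u)"
   unfolding span_iso_def AU BV by auto
  show "ALL H <= CG. ALL x y. smk A H x y = smk B H x y"
  proof (intro allI impI)
   fix H x y assume H: "H <= CG"
   have fx: "fixd U H u \<longleftrightarrow> fixd V H (h u)" if "u : pts U" for u
   proof -
    have "act V k (h u) = h u \<longleftrightarrow> act U k u = u" if "k : H" for k
     using cmapsD(2)[OF h(1), of k u] inj_on_eq_iff[OF bij_betw_imp_inj_on[OF h(2)], of "act U k u" u]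
      `u : pts U` H `k : H` U(1) by auto
    then show ?thesis unfolding fixd_def by simp
   qed
   have "bij_betw h {u : pts U. fixd U H u & p u = x & q u = y} {v : pts V. fixd V H v & r v = x & s v = y}"
    unfolding bij_betw_def
   proof
    show "inj_on h {u : pts U. fixd U H u & p u = x & q u = y}"
     using h(2) by (auto simp: bij_betw_def inj_on_def)
    show "h ` {u : pts U. fixd U H u & p u = x & q u = y} = {v : pts V. fixd V H v & r v = x & s v = y}"
    proof (intro equalityI subsetI)
     fix v assume v: "v : {v : pts V. fixd V H v & r v = x & s v = y}"
     then obtain u where "u : pts U" "v = h u" using h(2) by (auto simp: bij_betw_def)
     then show "v : h ` {u : pts U. fixd U H u & p u = x & q u = y}" using v fx h(3) by auto
    qed (use fx h(3) bij_betwE[OF h(2)] in auto)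
   qed
   then show "smk A H x y = smk B H x y" unfolding AU BV by (simp add: bij_betw_same_card)
  qed
 next
  assume eq: "ALL H <= CG. ALL x y. smk A H x y = smk B H x y"
  have "EX h. bij_betw h (pts U) (pts V) & (ALL g : CG. ALL u : pts U. h (act U g u) = act V g (h u))
    & (ALL u : pts U. (%u. (p u, q u)) u = (%v. (r v, s v)) (h u))"
  proof (rule equal_fixed_points_bij[OF U(1) V(1)])
   show "ALL H <= CG. ALL z. card {u : pts U. fixd U H u & (p u, q u) = z} =
     card {v : pts V. fixd V H v & (r v, s v) = z}"
    using eq unfolding AU BV by auto
  qed (use U(1) V(1) cmapsD[OF U(2)] cmapsD[OF U(3)] cmapsD[OF V(2)] cmapsD[OF V(3)] in auto)
  then obtain h where h: "bij_betw h (pts U) (pts V)"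
   "ALL g : CG. ALL u : pts U. h (act U g u) = act V g (h u)" "ALL u : pts U. p u = r (h u) & q u = s (h u)"
   by auto
  have "restrict h (pts U) : cmaps n U V" unfolding cmaps_def using h bij_betwE[OF h(1)] U(1) by auto
  moreover have "bij_betw (restrict h (pts U)) (pts U) (pts V)" using h(1) by (simp cong: bij_betw_cong)
  ultimately show "span_iso n A B" unfolding AU BV span_iso_def prod.case using h(3)
   by (intro bexI[where x = "restrict h (pts U)"] conjI) simp_all
 qed
qed

lemma span_empty_spans [simp]: "span_empty : spans n X Y"
proof -
 have "({}, %g x. undefined) : CS" by (rule csetsI) auto
 then show ?thesis by (simp add: span_empty_def spans_def cmaps_def)
qed

lemma smk_empty [simp]: "smk span_empty H x y = 0"
 by (simp add: span_empty_def)

lemma cmapsI: "(!!u. u : pts U ==> f u : pts X) ==>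
 (!!g u. g : CG ==> u : pts U ==> f (act U g u) = act X g (f u)) ==> f : extensional (pts U) ==>
 f : cmaps n U X"
 by (auto simp: cmaps_def PiE_def)

lemma span_sum_spans [simp]:
 assumes "A : spans n X Y" "B : spans n X Y" shows "span_sum A B : spans n X Y"
proof -
 obtain U p q where AU: "A = (U, p, q)" by (cases A)
 obtain V r s where BV: "B = (V, r, s)" by (cases B)
 note U = spansD[OF assms(1)[unfolded AU]] and V = spansD[OF assms(2)[unfolded BV]]
 note c = cmapsD[OF U(2)] cmapsD[OF U(3)] cmapsD[OF V(2)] cmapsD[OF V(3)]
 show ?thesis unfolding AU BV span_sum_def Let_def spans_def
  by (auto intro!: csetsI cmapsI simp: c U(1) V(1) csets_finite act_comp[simplified]
    inj_image_mem_iff[OF inj_sum_encode] sum_encode_eq)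
qed

lemma smk_sum [simp]:
 assumes "A : spans n X Y" "B : spans n X Y"
 shows "smk (span_sum A B) H x y = smk A H x y + smk B H x y"
proof -
 obtain U p q where AU: "A = (U, p, q)" by (cases A)
 obtain V r s where BV: "B = (V, r, s)" by (cases B)
 note U = spansD[OF assms(1)[unfolded AU]] and V = spansD[OF assms(2)[unfolded BV]]
 let ?S = "{u : pts U. fixd U H u & p u = x & q u = y}"
 let ?T = "{v : pts V. fixd V H v & r v = x & s v = y}"
 obtain W om k l where W: "span_sum A B = ((W, om), k, l)" by (metis surj_pair)
 have W': "W = sum_encode ` (pts U <+> pts V)"
  and L: "u : pts U ==> k (sum_encode (Inl u)) = p u & l (sum_encode (Inl u)) = q u &
   (ALL h. om h (sum_encode (Inl u)) = sum_encode (Inl (act U h u)))"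
  and R: "v : pts V ==> k (sum_encode (Inr v)) = r v & l (sum_encode (Inr v)) = s v &
   (ALL h. om h (sum_encode (Inr v)) = sum_encode (Inr (act V h v)))" for u v
  using W unfolding AU BV span_sum_def Let_def by auto
 have "{w : W. fixd (W, om) H w & k w = x & l w = y} = sum_encode ` (Inl ` ?S \<union> Inr ` ?T)"
  unfolding W' by (auto simp: fixd_def L R sum_encode_eq inj_image_mem_iff[OF inj_sum_encode])
 moreover have "card (sum_encode ` (Inl ` ?S \<union> Inr ` ?T)) = card ?S + card ?T"
  using csets_finite[OF U(1)] csets_finite[OF V(1)]
  by (subst card_image, simp add: inj_sum_encode, subst card_Un_disjoint) (auto simp: card_image inj_on_def)
 ultimately show ?thesis unfolding W unfolding AU BV by simp
qed

lemma span_comp_spans [simp]: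
 assumes "A : spans n X Y" "B : spans n Y Z" shows "span_comp B A : spans n X Z"
proof -
 obtain U p q where AU: "A = (U, p, q)" by (cases A)
 obtain V r s where BV: "B = (V, r, s)" by (cases B)
 note U = spansD[OF assms(1)[unfolded AU]] and V = spansD[OF assms(2)[unfolded BV]]
 note c = cmapsD[OF U(2)] cmapsD[OF U(3)] cmapsD[OF V(2)] cmapsD[OF V(3)]
 have "finite {(u, v). u : pts U & v : pts V & q u = r v}"
  by (rule finite_subset[of _ "pts U \<times> pts V"]) (auto simp: csets_finite U(1) V(1))
 then show ?thesis unfolding AU BV span_comp_def Let_def spans_def
  by (auto intro!: csetsI cmapsI simp: c U(1) V(1) act_comp[simplified] inj_image_mem_iff[OF inj_prod_encode])
qed

lemma smk_comp:
 assumes "A : spans n X Y" "B : spans n Y Z" "Y : CS"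
 shows "smk (span_comp B A) H x z = (\<Sum>y\<in>pts Y. smk A H x y * smk B H y z)"
proof -
 obtain U p q where AU: "A = (U, p, q)" by (cases A)
 obtain V r s where BV: "B = (V, r, s)" by (cases B)
 note U = spansD[OF assms(1)[unfolded AU]] and V = spansD[OF assms(2)[unfolded BV]]
 let ?S = "%y. {u : pts U. fixd U H u & p u = x & q u = y}"
 let ?T = "%y. {v : pts V. fixd V H v & r v = y & s v = z}"
 obtain W om k l where W: "span_comp B A = ((W, om), k, l)" by (metis surj_pair)
 have "{w : W. fixd (W, om) H w & k w = x & l w = z} = prod_encode ` (\<Union>y\<in>pts Y. ?S y \<times> ?T y)"
  using W cmapsD(1)[OF V(2)] unfolding AU BV span_comp_def Let_def
  by (auto simp: fixd_def inj_image_mem_iff[OF inj_prod_encode])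
 moreover have "card (prod_encode ` (\<Union>y\<in>pts Y. ?S y \<times> ?T y)) = card (\<Union>y\<in>pts Y. ?S y \<times> ?T y)"
  by (rule card_image) (auto simp: inj_on_def)
 moreover have "... = (\<Sum>y\<in>pts Y. card (?S y \<times> ?T y))"
  by (rule card_UN_disjoint) (auto simp: csets_finite assms(3) U(1) V(1))
 ultimately show ?thesis unfolding W unfolding AU BV by (simp add: card_cartesian_product)
qed

lemma span_prod_spans [simp]:
 assumes "A : spans n X Y" "B : spans n X' Y'" shows "span_prod A B : spans n (X ** X') (Y ** Y')"
proof -
 obtain U p q where AU: "A = (U, p, q)" by (cases A)
 obtain V r s where BV: "B = (V, r, s)" by (cases B)
 note U = spansD[OF assms(1)[unfolded AU]] and V = spansD[OF assms(2)[unfolded BV]]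
 note c = cmapsD[OF U(2)] cmapsD[OF U(3)] cmapsD[OF V(2)] cmapsD[OF V(3)]
 show ?thesis unfolding AU BV span_prod_def spans_def
  by (auto intro!: cmapsI simp: c U(1) V(1) elim!: cprodE)
qed

lemma smk_prod:
 assumes "A : spans n X Y" "B : spans n X' Y'"
 shows "smk (span_prod A B) H (prod_encode (x, x')) (prod_encode (y, y')) = smk A H x y * smk B H x' y'"
proof -
 obtain U p q where AU: "A = (U, p, q)" by (cases A)
 obtain V r s where BV: "B = (V, r, s)" by (cases B)
 note U = spansD[OF assms(1)[unfolded AU]] and V = spansD[OF assms(2)[unfolded BV]]
 let ?S = "{u : pts U. fixd U H u & p u = x & q u = y}"
 let ?T = "{v : pts V. fixd V H v & r v = x' & s v = y'}"
 obtain W om k l where W: "span_prod A B = ((W, om), k, l)" by (metis surj_pair)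
 have "{w : W. fixd (W, om) H w & k w = prod_encode (x, x') & l w = prod_encode (y, y')} = prod_encode ` (?S \<times> ?T)"
  using W unfolding AU BV span_prod_def cprod_def by (auto simp: fixd_def)
 moreover have "card (prod_encode ` (?S \<times> ?T)) = card (?S \<times> ?T)"
  by (rule card_image) (auto simp: inj_on_def)
 ultimately show ?thesis unfolding W unfolding AU BV by (simp add: card_cartesian_product)
qed

lemma smk_support:
 assumes "A : spans n X Y" "X : CS" "Y : CS" "H <= CG"
  "\<not> (x : pts X & y : pts Y & fixd X H x & fixd Y H y)"
 shows "smk A H x y = 0"
proof -
 obtain U p q where AU: "A = (U, p, q)" by (cases A)
 note U = spansD[OF assms(1)[unfolded AU]]
 have "\<not> (u : pts U & fixd U H u & p u = x & q u = y)" for u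
 proof
  assume u: "u : pts U & fixd U H u & p u = x & q u = y"
  have "act X h (p u) = p u" "act Y h (q u) = q u" if "h : H" for h
   using cmapsD(2)[OF U(2), of h u] cmapsD(2)[OF U(3), of h u] u that assms(4) by (auto simp: fixd_def)
  then show False using assms(5) u cmapsD(1)[OF U(2)] cmapsD(1)[OF U(3)] by (auto simp: fixd_def)
 qed
 then have "{u : pts U. fixd U H u & p u = x & q u = y} = {}" by blast
 then show ?thesis unfolding AU by (simp only: smk.simps card.empty)
qed

lemma smk_act:
 assumes A: "A : spans n X Y" and X: "X : CS" and Y: "Y : CS" and H: "H <= CG"
  and g: "g : CG" and x: "x : pts X" and y: "y : pts Y"
 shows "smk A H (act X g x) (act Y g y) = smk A H x y"
proof -
 obtain U p q where AU: "A = (U, p, q)" by (cases A)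
 note U = spansD[OF assms(1)[unfolded AU]]
 let ?S = "%x y. {u : pts U. fixd U H u & p u = x & q u = y}"
 have st: "act U k u : ?S (act X k x) (act Y k y)" if "u : ?S x y" "k : CG" for u k x y
  using that H cmapsD(2)[OF U(2)] cmapsD(2)[OF U(3)] act_commute[OF U(1), of _ k u] U(1)
  by (auto simp: fixd_def)
 have "bij_betw (act U g) (?S x y) (?S (act X g x) (act Y g y))"
 proof (rule bij_betwI[where g = "act U ((- g) mod int n)"])
  show "act U g : ?S x y \<rightarrow> ?S (act X g x) (act Y g y)" using st[OF _ g] by blast
  show "act U ((- g) mod int n) : ?S (act X g x) (act Y g y) \<rightarrow> ?S x y"
   using st[OF _ G_closed(2)[OF g], of _ "act X g x" "act Y g y"] act_inv(2)[OF X g x] act_inv(2)[OF Y g y] by auto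
 qed (use g U(1) in auto)
 then show ?thesis unfolding AU by (simp add: bij_betw_same_card)
qed

section \<open>Burnside morphisms as families of matrices\<close>

text \<open>Marks are additive, so that the stable isomorphism relation of the group completion needs no extra summand.\<close>

lemma bcong_iff:
 "((A, B), (C, D)) : bcong n X Y \<longleftrightarrow>
  A : spans n X Y & B : spans n X Y & C : spans n X Y & D : spans n X Y &
  (ALL H <= CG. ALL x y. smk A H x y + smk D H x y = smk C H x y + smk B H x y)"
proof -
 have "(EX E : spans n X Y. span_iso n (span_sum (span_sum A D) E) (span_sum (span_sum C B) E)) \<longleftrightarrow>
   (ALL H <= CG. ALL x y. smk A H x y + smk D H x y = smk C H x y + smk B H x y)"
  if s: "A : spans n X Y" "B : spans n X Y" "C : spans n X Y" "D : spans n X Y"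
 proof -
  have sm: "smk (span_sum (span_sum P Q) E) H x y = smk P H x y + smk Q H x y + smk E H x y"
   if "P : spans n X Y" "Q : spans n X Y" "E : spans n X Y" for P Q E H x y
   using that by (simp add: smk_sum[where X = X and Y = Y])
  have iff: "span_iso n (span_sum (span_sum A D) E) (span_sum (span_sum C B) E) \<longleftrightarrow>
   (ALL H <= CG. ALL x y. smk A H x y + smk D H x y = smk C H x y + smk B H x y)"
   if E: "E : spans n X Y" for E
   by (subst span_iso_iff_marks[where X = X and Y = Y]) (simp_all add: s E sm)
  show ?thesis
  proof
   assume "ALL H <= CG. ALL x y. smk A H x y + smk D H x y = smk C H x y + smk B H x y"
   then have "span_iso n (span_sum (span_sum A D) span_empty) (span_sum (span_sum C B) span_empty)"
    using iff[OF span_empty_spans] by simp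
   then show "EX E : spans n X Y. span_iso n (span_sum (span_sum A D) E) (span_sum (span_sum C B) E)"
    by (rule bexI) (rule span_empty_spans)
  qed (use iff in \<open>elim bexE, simp\<close>)
 qed
 then show ?thesis unfolding bcong_def by auto
qed

text \<open>A virtual span has integral marks; they do not depend on the chosen difference of spans.\<close>

definition mk where
 "mk be H x y = (case SOME d. d : be of (A, B) => int (smk A H x y) - int (smk B H x y))"

lemma bcls_mem: "(C, D) : bcls n X Y (A, B) \<longleftrightarrow> ((A, B), (C, D)) : bcong n X Y"
 by (simp add: bcls_def)

lemma mk_bcls [simp]:
 assumes "A : spans n X Y" "B : spans n X Y" "H <= CG"
 shows "mk (bcls n X Y (A, B)) H x y = int (smk A H x y) - int (smk B H x y)"
proof -
 have "(A, B) : bcls n X Y (A, B)" using assms by (simp add: bcls_mem bcong_iff)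
 then have "(SOME d. d : bcls n X Y (A, B)) : bcls n X Y (A, B)" by (rule someI)
 moreover obtain C D where CD: "(SOME d. d : bcls n X Y (A, B)) = (C, D)" by (metis surj_pair)
 ultimately have "smk A H x y + smk D H x y = smk C H x y + smk B H x y"
  using assms(3) by (simp add: bcls_mem bcong_iff)
 then show ?thesis unfolding mk_def CD by simp
qed

lemma bhomE:
 assumes "be : bhm X Y"
 obtains A B where "A : spans n X Y" "B : spans n X Y" "be = bcls n X Y (A, B)"
proof -
 have "EX d : spans n X Y \<times> spans n X Y. be = bcls n X Y d"
  using assms by (simp only: bhom_def bcls_def quotient_def UN_iff singleton_iff)
 then obtain d where d: "d : spans n X Y \<times> spans n X Y" "be = bcls n X Y d" by (rule bexE)
 have "d = (fst d, snd d)" by (rule surjective_pairing)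
 then have "be = bcls n X Y (fst d, snd d)" using d(2) by metis
 moreover have "fst d : spans n X Y" "snd d : spans n X Y" using d(1) by (simp_all only: mem_Times_iff)
 ultimately show thesis using that by simp
qed

lemma bcls_bhom [simp]: "A : spans n X Y ==> B : spans n X Y ==> bcls n X Y (A, B) : bhm X Y"
 unfolding bhom_def bcls_def by (rule quotientI) simp

lemma bcls_eqI:
 assumes "A : spans n X Y" "B : spans n X Y" "C : spans n X Y" "D : spans n X Y"
  "!!H x y. H <= CG ==> smk A H x y + smk D H x y = smk C H x y + smk B H x y"
 shows "bcls n X Y (A, B) = bcls n X Y (C, D)"
proof -
 have "((A, B), (P, Q)) : bcong n X Y \<longleftrightarrow> ((C, D), (P, Q)) : bcong n X Y" for P Q
 proof -
  have "smk A H x y + smk Q H x y = smk P H x y + smk B H x y \<longleftrightarrow>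
    smk C H x y + smk Q H x y = smk P H x y + smk D H x y" if "H <= CG" for H x y
   using assms(5)[OF that, of x y] by linarith
  then show ?thesis using assms(1-4) unfolding bcong_iff by blast
 qed
 then show ?thesis unfolding bcls_def by auto
qed

text \<open>The injectivity of marks; marks at points moved by H vanish on both sides, so only fixed points matter.\<close>

lemma bhom_eqI:
 assumes "be : bhm X Y" "ga : bhm X Y" "X : CS" "Y : CS"
  "!!H x y. H <= CG ==> x : pts X ==> y : pts Y ==> fixd X H x ==> fixd Y H y ==> mk be H x y = mk ga H x y"
 shows "be = ga"
proof -
 obtain A B where AB: "A : spans n X Y" "B : spans n X Y" "be = bcls n X Y (A, B)" by (rule bhomE[OF assms(1)])
 obtain C D where CD: "C : spans n X Y" "D : spans n X Y" "ga = bcls n X Y (C, D)" by (rule bhomE[OF assms(2)])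
 show ?thesis unfolding AB(3) CD(3)
 proof (rule bcls_eqI[OF AB(1,2) CD(1,2)])
  fix H x y assume H: "H <= CG"
  show "smk A H x y + smk D H x y = smk C H x y + smk B H x y"
  proof (cases "x : pts X & y : pts Y & fixd X H x & fixd Y H y")
   case True
   then have "mk be H x y = mk ga H x y" using assms(5)[OF H] by simp
   then have "int (smk A H x y) - int (smk B H x y) = int (smk C H x y) - int (smk D H x y)"
    unfolding AB(3) CD(3) mk_bcls[OF AB(1,2) H] mk_bcls[OF CD(1,2) H] .
   then show ?thesis by linarith
  next
   case False
   show ?thesis
    using smk_support[OF AB(1) assms(3,4) H False] smk_support[OF AB(2) assms(3,4) H False]
     smk_support[OF CD(1) assms(3,4) H False] smk_support[OF CD(2) assms(3,4) H False] by simp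
  qed
 qed
qed

lemma mk_support:
 assumes "be : bhm X Y" "X : CS" "Y : CS" "H <= CG"
  "\<not> (x : pts X & y : pts Y & fixd X H x & fixd Y H y)"
 shows "mk be H x y = 0"
proof -
 obtain A B where "A : spans n X Y" "B : spans n X Y" "be = bcls n X Y (A, B)" by (rule bhomE[OF assms(1)])
 then show ?thesis using smk_support[OF _ assms(2-5)] assms(4) by simp
qed

lemma mk_act:
 assumes "be : bhm X Y" "X : CS" "Y : CS" "H <= CG" "g : CG" "x : pts X" "y : pts Y"
 shows "mk be H (act X g x) (act Y g y) = mk be H x y"
proof -
 obtain A B where "A : spans n X Y" "B : spans n X Y" "be = bcls n X Y (A, B)" by (rule bhomE[OF assms(1)])
 then show ?thesis using smk_act[OF _ assms(2-7)] assms(4) by simp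
qed

lemma UN_const_eq: "(!!d. d : S ==> F d = c) ==> S ~= {} ==> (\<Union>d\<in>S. F d) = c"
 by auto

lemma bcls_nonempty: "A : spans n X Y ==> B : spans n X Y ==> bcls n X Y (A, B) ~= {}"
proof -
 assume "A : spans n X Y" "B : spans n X Y"
 then have "(A, B) : bcls n X Y (A, B)" by (simp add: bcls_mem bcong_iff)
 then show ?thesis by blast
qed

lemma UN2_bcls:
 assumes "A : spans n X Y" "B : spans n X Y" "C : spans n X' Y'" "D : spans n X' Y'"
  and "!!A' B' C' D'. ((A, B), (A', B')) : bcong n X Y ==> ((C, D), (C', D')) : bcong n X' Y' ==>
   F A' B' C' D' = F A B C D"
 shows "(\<Union>(A, B)\<in>bcls n X Y (A, B). \<Union>(C, D)\<in>bcls n X' Y' (C, D). F A B C D) = F A B C D"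
proof (rule UN_const_eq)
 show "bcls n X Y (A, B) ~= {}" by (rule bcls_nonempty[OF assms(1,2)])
 fix d assume d: "d : bcls n X Y (A, B)"
 obtain A' B' where d': "d = (A', B')" by (rule prod.exhaust)
 have "(\<Union>(C, D)\<in>bcls n X' Y' (C, D). F A' B' C D) = F A B C D"
 proof (rule UN_const_eq)
  show "bcls n X' Y' (C, D) ~= {}" by (rule bcls_nonempty[OF assms(3,4)])
  fix e assume e: "e : bcls n X' Y' (C, D)"
  obtain C' D' where e': "e = (C', D')" by (rule prod.exhaust)
  show "(case e of (C, D) => F A' B' C D) = F A B C D"
   using assms(5) d e unfolding d' e' bcls_mem prod.case by blast
 qed
 then show "(case d of (A, B) => \<Union>(C, D)\<in>bcls n X' Y' (C, D). F A B C D) = F A B C D"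
  unfolding d' prod.case .
qed

lemma badd_bcls [simp]:
 assumes "A : spans n X Y" "B : spans n X Y" "C : spans n X Y" "D : spans n X Y"
 shows "badd n X Y (bcls n X Y (A, B)) (bcls n X Y (C, D)) = bcls n X Y (span_sum A C, span_sum B D)"
 unfolding badd_def
proof (rule UN2_bcls[OF assms])
 fix A' B' C' D' assume a: "((A, B), (A', B')) : bcong n X Y" "((C, D), (C', D')) : bcong n X Y"
 then have s': "A' : spans n X Y" "B' : spans n X Y" "C' : spans n X Y" "D' : spans n X Y"
  by (simp_all add: bcong_iff)
 show "bcls n X Y (span_sum A' C', span_sum B' D') = bcls n X Y (span_sum A C, span_sum B D)"
 proof (rule bcls_eqI)
  fix H x y assume H: "H <= CG"
  have "smk A H x y + smk B' H x y = smk A' H x y + smk B H x y"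
    "smk C H x y + smk D' H x y = smk C' H x y + smk D H x y"
   using a H by (simp_all add: bcong_iff)
  then show "smk (span_sum A' C') H x y + smk (span_sum B D) H x y = smk (span_sum A C) H x y + smk (span_sum B' D') H x y"
   by (simp add: smk_sum[where X = X and Y = Y] assms s')
 qed (simp_all add: assms s')
qed

lemma badd_closed [simp]: "be : bhm X Y ==> ga : bhm X Y ==> badd n X Y be ga : bhm X Y"
 by (elim bhomE) simp

lemma mk_badd [simp]: "be : bhm X Y ==> ga : bhm X Y ==> H <= CG ==>
  mk (badd n X Y be ga) H x y = mk be H x y + mk ga H x y"
 by (elim bhomE) (simp add: smk_sum[where X = X and Y = Y])

lemma bcomp_bcls:
 assumes s: "A : spans n X Y" "B : spans n X Y" "C : spans n Y Z" "D : spans n Y Z" and Y: "Y : CS"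
 shows "bco X Z (bcls n Y Z (C, D)) (bcls n X Y (A, B)) =
  bcls n X Z (span_sum (span_comp C A) (span_comp D B), span_sum (span_comp C B) (span_comp D A))"
 unfolding bcomp_def
proof (rule UN2_bcls[OF s(3,4,1,2)])
 fix C' D' A' B' assume a: "((C, D), (C', D')) : bcong n Y Z" "((A, B), (A', B')) : bcong n X Y"
 then have s': "A' : spans n X Y" "B' : spans n X Y" "C' : spans n Y Z" "D' : spans n Y Z"
  by (auto simp: bcong_iff)
 note sp = span_comp_spans[of _ X Y _ Z]
 show "bcls n X Z (span_sum (span_comp C' A') (span_comp D' B'), span_sum (span_comp C' B') (span_comp D' A')) =
  bcls n X Z (span_sum (span_comp C A) (span_comp D B), span_sum (span_comp C B) (span_comp D A))"
 proof (rule bcls_eqI)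
  fix H x z assume H: "H <= CG"
  have key: "int (smk A' H x y) - int (smk B' H x y) = int (smk A H x y) - int (smk B H x y)"
   "int (smk C' H y z) - int (smk D' H y z) = int (smk C H y z) - int (smk D H y z)" for y
  proof -
   have "smk A H x y + smk B' H x y = smk A' H x y + smk B H x y"
    "smk C H y z + smk D' H y z = smk C' H y z + smk D H y z"
    using a H by (simp_all add: bcong_iff)
   then show "int (smk A' H x y) - int (smk B' H x y) = int (smk A H x y) - int (smk B H x y)"
    "int (smk C' H y z) - int (smk D' H y z) = int (smk C H y z) - int (smk D H y z)" by linarith+
  qed
  have "(\<Sum>y\<in>pts Y. (int (smk A' H x y) - int (smk B' H x y)) * (int (smk C' H y z) - int (smk D' H y z))) =
   (\<Sum>y\<in>pts Y. (int (smk A H x y) - int (smk B H x y)) * (int (smk C H y z) - int (smk D H y z)))"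
   by (simp only: key)
  then have "int (smk (span_sum (span_comp C' A') (span_comp D' B')) H x z + smk (span_sum (span_comp C B) (span_comp D A)) H x z)
   = int (smk (span_sum (span_comp C A) (span_comp D B)) H x z + smk (span_sum (span_comp C' B') (span_comp D' A')) H x z)"
   by (simp add: smk_sum[where X = X and Y = Z] sp s s' smk_comp[where X = X and Y = Y and Z = Z] Y
     algebra_simps sum.distrib sum_subtractf of_nat_sum)
  then show "smk (span_sum (span_comp C' A') (span_comp D' B')) H x z + smk (span_sum (span_comp C B) (span_comp D A)) H x z
   = smk (span_sum (span_comp C A) (span_comp D B)) H x z + smk (span_sum (span_comp C' B') (span_comp D' A')) H x z"
   by (simp only: of_nat_eq_iff)
 qed (simp_all add: sp s s')
qed

lemma bcomp_closed [simp]: "al : bhm X Y ==> be : bhm Y Z ==> Y : CS ==> bco X Z be al : bhm X Z"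
 by (elim bhomE) (simp add: bcomp_bcls span_comp_spans[of _ X Y _ Z])

text \<open>Fixed points of a pullback are pairs of fixed points, so that marks multiply as matrices.\<close>

lemma mk_bcomp: "al : bhm X Y ==> be : bhm Y Z ==> Y : CS ==> H <= CG ==>
  mk (bco X Z be al) H x z = (\<Sum>y\<in>pts Y. mk al H x y * mk be H y z)"
 by (elim bhomE) (simp add: bcomp_bcls span_comp_spans[of _ X Y _ Z] smk_sum[where X = X and Y = Z]
   smk_comp[where X = X and Y = Y and Z = Z] algebra_simps sum.distrib sum_subtractf)

lemma bprod_bcls:
 assumes s: "A : spans n X Y" "B : spans n X Y" "C : spans n X' Y'" "D : spans n X' Y'"
 shows "bpr X Y X' Y' (bcls n X Y (A, B)) (bcls n X' Y' (C, D)) =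
  bcls n (X ** X') (Y ** Y')
   (span_sum (span_prod A C) (span_prod B D), span_sum (span_prod A D) (span_prod B C))"
 unfolding bprod_def
proof (rule UN2_bcls[OF s])
 fix C' D' A' B' assume a: "((A, B), (A', B')) : bcong n X Y" "((C, D), (C', D')) : bcong n X' Y'"
 then have s': "A' : spans n X Y" "B' : spans n X Y" "C' : spans n X' Y'" "D' : spans n X' Y'"
  by (auto simp: bcong_iff)
 note sp = span_prod_spans[of _ X Y _ X' Y']
 show "bcls n (X ** X') (Y ** Y')
   (span_sum (span_prod A' C') (span_prod B' D'), span_sum (span_prod A' D') (span_prod B' C')) =
  bcls n (X ** X') (Y ** Y')
   (span_sum (span_prod A C) (span_prod B D), span_sum (span_prod A D) (span_prod B C))"
 proof (rule bcls_eqI)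
  fix H w v assume H: "H <= CG"
  obtain x x' y y' where w: "w = prod_encode (x, x')" and v: "v = prod_encode (y, y')"
   by (metis prod_decode_inverse surj_pair)
  have key: "int (smk A' H x y) - int (smk B' H x y) = int (smk A H x y) - int (smk B H x y)"
   "int (smk C' H x' y') - int (smk D' H x' y') = int (smk C H x' y') - int (smk D H x' y')"
  proof -
   have "smk A H x y + smk B' H x y = smk A' H x y + smk B H x y"
    "smk C H x' y' + smk D' H x' y' = smk C' H x' y' + smk D H x' y'"
    using a H by (simp_all add: bcong_iff)
   then show "int (smk A' H x y) - int (smk B' H x y) = int (smk A H x y) - int (smk B H x y)"
    "int (smk C' H x' y') - int (smk D' H x' y') = int (smk C H x' y') - int (smk D H x' y')" by linarith+
  qed
  have "(int (smk A' H x y) - int (smk B' H x y)) * (int (smk C' H x' y') - int (smk D' H x' y')) =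
   (int (smk A H x y) - int (smk B H x y)) * (int (smk C H x' y') - int (smk D H x' y'))"
   by (simp only: key)
  then have "int (smk (span_sum (span_prod A' C') (span_prod B' D')) H w v + smk (span_sum (span_prod A D) (span_prod B C)) H w v)
   = int (smk (span_sum (span_prod A C) (span_prod B D)) H w v + smk (span_sum (span_prod A' D') (span_prod B' C')) H w v)"
   by (simp add: smk_sum[where X = "X ** X'" and Y = "Y ** Y'"] sp s s' w v smk_prod[where X = X and Y = Y and X' = X' and Y' = Y']
     algebra_simps)
  then show "smk (span_sum (span_prod A' C') (span_prod B' D')) H w v + smk (span_sum (span_prod A D) (span_prod B C)) H w v
   = smk (span_sum (span_prod A C) (span_prod B D)) H w v + smk (span_sum (span_prod A' D') (span_prod B' C')) H w v"
   by (simp only: of_nat_eq_iff)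
 qed (simp_all add: sp s s')
qed

lemma bprod_closed [simp]: "al : bhm X Y ==> be : bhm X' Y' ==>
  bpr X Y X' Y' al be : bhm (X ** X') (Y ** Y')"
 by (elim bhomE) (simp add: bprod_bcls)

lemma mk_bprod [simp]: "al : bhm X Y ==> be : bhm X' Y' ==> H <= CG ==>
  mk (bpr X Y X' Y' al be) H (prod_encode (x, x')) (prod_encode (y, y')) = mk al H x y * mk be H x' y'"
 by (elim bhomE) (simp add: bprod_bcls span_prod_spans[of _ X Y _ X' Y'] smk_sum[where X = "X ** X'" and Y = "Y ** Y'"]
   smk_prod[where X = X and Y = Y and X' = X' and Y' = Y'] algebra_simps)

text \<open>Behaviour off the source is left free, so that one formula such as the swap serves for all products.\<close>

definition emaps where
 "emaps X Y = {f. ALL x : pts X. f x : pts Y & (ALL g : CG. f (act X g x) = act Y g (f x))}"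

lemma emaps_iff [simp]: "f : emaps X Y \<longleftrightarrow> (ALL x : pts X. f x : pts Y & (ALL g : CG. f (act X g x) = act Y g (f x)))"
 by (simp add: emaps_def)

lemma emaps_fixd: "f : emaps X Y ==> x : pts X ==> H <= CG ==> fixd X H x ==> fixd Y H (f x)"
 by (auto simp: fixd_def subset_iff) (metis)

lemma bgraph_span: assumes "f : emaps X Y" "X : CS"
 shows "(X, restrict (%x. x) (pts X), restrict f (pts X)) : spans n X Y"
 using assms by (auto simp: spans_def intro!: cmapsI)

lemma bgraph_closed [simp]: "f : emaps X Y ==> X : CS ==> bgraph n X Y f : bhm X Y"
 unfolding bgraph_def using bgraph_span by (blast intro: bcls_bhom span_empty_spans)

lemma mk_bgraph: assumes "f : emaps X Y" "X : CS" "H <= CG"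
 shows "mk (bgraph n X Y f) H x y = (if x : pts X & fixd X H x & f x = y then 1 else 0)"
proof -
 have "{u : pts X. fixd X H u & restrict (%x. x) (pts X) u = x & restrict f (pts X) u = y} =
  (if x : pts X & fixd X H x & f x = y then {x} else {})" by auto
 then show ?thesis
  unfolding bgraph_def using mk_bcls[OF bgraph_span[OF assms(1,2)] span_empty_spans assms(3), of x y] by simp
qed

lemma bgraph_cong: "(!!x. x : pts X ==> f x = f' x) ==> bgraph n X Y f = bgraph n X Y f'"
proof -
 assume "!!x. x : pts X ==> f x = f' x"
 then have "restrict f (pts X) = restrict f' (pts X)" by (rule restrict_ext)
 then show ?thesis unfolding bgraph_def by simp
qed

end

declare split_paired_All [simp del] split_paired_Ex [simp del]

context burnside begin

section \<open>The Burnside category\<close>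

text \<open>Associator, swap and unitors of products of finite sets, as maps of codes that are independent of
the sets. A primed name is the inverse.\<close>

definition fas where
 "fas = (%w. case prod_decode w of (u, z) => case prod_decode u of (x, y) =>
   prod_encode (x, prod_encode (y, z)))"
definition fas' where
 "fas' = (%w. case prod_decode w of (x, v) => case prod_decode v of (y, z) =>
   prod_encode (prod_encode (x, y), z))"
definition fsw where
 "fsw = (%w. case prod_decode w of (x, y) => prod_encode (y, x))"
definition flu where "flu = (%w. snd (prod_decode w))"
definition fru where "fru = (%w. fst (prod_decode w))"
definition flu' where "flu' = (%x. prod_encode (0, x))"
definition fru' where "fru' = (%x. prod_encode (x, 0))"
definition fpm where
 "fpm f f' = (%w. case prod_decode w of (x, y) => prod_encode (f x, f' y))"

lemma structure_maps [simp]: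
 "fas (prod_encode (prod_encode (x, y), z)) = prod_encode (x, prod_encode (y, z))"
 "fas' (prod_encode (x, prod_encode (y, z))) = prod_encode (prod_encode (x, y), z)"
 "fsw (prod_encode (x, y)) = prod_encode (y, x)"
 "flu (prod_encode (x, y)) = y" "fru (prod_encode (x, y)) = x"
 "flu' x = prod_encode (0, x)" "fru' x = prod_encode (x, 0)"
 "fpm f f' (prod_encode (x, y)) = prod_encode (f x, f' y)"
 by (simp_all add: fas_def fas'_def fsw_def flu_def fru_def flu'_def fru'_def fpm_def)

lemma structure_graphs:
 "bassoc n X Y Z = bgraph n ((X ** Y) ** Z) (X ** Y ** Z) fas"
 "bassoc' n X Y Z = bgraph n (X ** Y ** Z) ((X ** Y) ** Z) fas'"
 "bswap n X Y = bgraph n (X ** Y) (Y ** X) fsw"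
 "blunit n X = bgraph n (pt ** X) X flu"
 "blunit' n X = bgraph n X (pt ** X) flu'"
 "brunit' n X = bgraph n X (X ** pt) fru'"
 "bd X = bgraph n X X (%x. x)"
 by (simp_all add: bassoc_def bassoc'_def bswap_def blunit_def blunit'_def brunit'_def bid_def
   fas_def fas'_def fsw_def flu_def flu'_def fru'_def)

lemma enc_fixd [simp]: "x : pts X ==> y : pts Y ==>
  fixd (X ** Y) H (prod_encode (x, y)) \<longleftrightarrow> fixd X H x & fixd Y H y"
 by (auto simp: fixd_def)

lemma fixd_cpoint [simp]: "fixd pt H 0"
 by (simp add: fixd_def)

lemma mk_bcomp_graph_right:
 assumes "f : emaps X Y" "X : CS" "Y : CS" "be : bhm Y Z" "H <= CG" "x : pts X" "fixd X H x"
 shows "mk (bco X Z be (bgraph n X Y f)) H x z = mk be H (f x) z"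
proof -
 have fx: "f x : pts Y" using assms by simp
 have "mk (bco X Z be (bgraph n X Y f)) H x z = (\<Sum>y\<in>pts Y. (if f x = y then 1 else 0) * mk be H y z)"
  using assms by (simp add: mk_bcomp[OF bgraph_closed] mk_bgraph del: emaps_iff)
 also have "... = (\<Sum>y\<in>pts Y. if f x = y then mk be H y z else 0)"
  by (rule sum.cong) auto
 also have "... = mk be H (f x) z" using fx csets_finite[OF assms(3)] by simp
 finally show ?thesis .
qed

lemma mk_bcomp_graph_left:
 assumes "f : emaps Y Z" "f' : emaps Z Y" "!!y. y : pts Y ==> f' (f y) = y" "!!z. z : pts Z ==> f (f' z) = z"
  "X : CS" "Y : CS" "Z : CS" "al : bhm X Y" "H <= CG" "z : pts Z"
 shows "mk (bco X Z (bgraph n Y Z f) al) H x z = mk al H x (f' z)"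
proof -
 have f'z: "f' z : pts Y" using assms by simp
 have "mk (bco X Z (bgraph n Y Z f) al) H x z = (\<Sum>y\<in>pts Y. mk al H x y * mk (bgraph n Y Z f) H y z)"
  by (rule mk_bcomp[OF assms(8) bgraph_closed]) (use assms in auto)
 also have "... = (\<Sum>y\<in>pts Y. if y = f' z then mk al H x y else 0)"
 proof (rule sum.cong)
  fix y assume y: "y : pts Y"
  show "mk al H x y * mk (bgraph n Y Z f) H y z = (if y = f' z then mk al H x y else 0)"
  proof (cases "fixd Y H y")
   case True
   then show ?thesis using mk_bgraph[OF assms(1,6,9), of y z] y assms(3)[OF y] assms(4,10) by auto
  next
   case False
   then show ?thesis using mk_support[OF assms(8,5,6,9), of x y] by auto
  qed
 qed simp
 also have "... = mk al H x (f' z)" using f'z csets_finite[OF assms(6)] by simp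
 finally show ?thesis .
qed

lemma bid_closed [simp]: "X : CS ==> bd X : bhm X X"
 by (simp add: structure_graphs)

lemma bcomp_bid_right [simp]: assumes "be : bhm X Y" "X : CS" "Y : CS" shows "bco X Y be (bd X) = be"
 unfolding structure_graphs
 by (rule bhom_eqI[of _ X Y]) (use assms in \<open>simp_all add: mk_bcomp_graph_right bcomp_closed[of _ X X]\<close>)

lemma bcomp_bid_left [simp]: assumes "be : bhm X Y" "X : CS" "Y : CS" shows "bco X Y (bd Y) be = be"
 unfolding structure_graphs
 by (rule bhom_eqI[of _ X Y]) (use assms in \<open>simp_all add: mk_bcomp_graph_left[where f' = "%x. x"] bcomp_closed[of _ X Y]\<close>)

lemma bcomp_assoc:
 assumes "al : bhm W X" "be : bhm X Y" "ga : bhm Y Z"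
  "W : CS" "X : CS" "Y : CS" "Z : CS"
 shows "bco W Z ga (bco W Y be al) = bco W Z (bco X Z ga be) al"
proof (rule bhom_eqI[of _ W Z])
 fix H w z assume H: "H <= CG"
 have "mk (bco W Z ga (bco W Y be al)) H w z =
   (\<Sum>y\<in>pts Y. (\<Sum>x\<in>pts X. mk al H w x * mk be H x y) * mk ga H y z)"
  using assms H by (simp add: mk_bcomp[of _ W Y] mk_bcomp[of _ W X])
 also have "... = (\<Sum>x\<in>pts X. mk al H w x * (\<Sum>y\<in>pts Y. mk be H x y * mk ga H y z))"
  by (simp add: sum_distrib_left sum_distrib_right mult.assoc) (rule sum.swap)
 also have "... = mk (bco W Z (bco X Z ga be) al) H w z"
  using assms H by (simp add: mk_bcomp[of _ W X] mk_bcomp[of _ X Y])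
 finally show "mk (bco W Z ga (bco W Y be al)) H w z = mk (bco W Z (bco X Z ga be) al) H w z" .
qed (use assms in \<open>simp_all add: bcomp_closed[of _ W Y] bcomp_closed[of _ W X] bcomp_closed[of _ X Y]\<close>)

lemma bcomp_badd_left:
 assumes "al : bhm X Y" "be : bhm Y Z" "be' : bhm Y Z" "X : CS" "Y : CS" "Z : CS"
 shows "bco X Z (badd n Y Z be be') al = badd n X Z (bco X Z be al) (bco X Z be' al)"
 by (rule bhom_eqI[of _ X Z]) (use assms in \<open>simp_all add: bcomp_closed[of _ X Y] mk_bcomp[of _ X Y] algebra_simps sum.distrib\<close>)

lemma bcomp_badd_right:
 assumes "al : bhm X Y" "al' : bhm X Y" "be : bhm Y Z" "X : CS" "Y : CS" "Z : CS"
 shows "bco X Z be (badd n X Y al al') = badd n X Z (bco X Z be al) (bco X Z be al')"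
 by (rule bhom_eqI[of _ X Z]) (use assms in \<open>simp_all add: bcomp_closed[of _ X Y] mk_bcomp[of _ X Y] algebra_simps sum.distrib\<close>)

lemma bprod_eqI:
 assumes "be : bhm (X ** X') (Y ** Y')" "ga : bhm (X ** X') (Y ** Y')"
  "X : CS" "X' : CS" "Y : CS" "Y' : CS"
  "!!H x x' y y'. H <= CG ==> x : pts X ==> x' : pts X' ==> y : pts Y ==> y' : pts Y' ==>
   fixd X H x ==> fixd X' H x' ==> fixd Y H y ==> fixd Y' H y' ==>
   mk be H (prod_encode (x, x')) (prod_encode (y, y')) = mk ga H (prod_encode (x, x')) (prod_encode (y, y'))"
 shows "be = ga"
 by (rule bhom_eqI[OF assms(1,2)]) (use assms in \<open>auto elim!: cprodE\<close>)

lemma bprod_badd_left: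
 assumes "al : bhm X Y" "al' : bhm X Y" "be : bhm X' Y'" "X : CS" "Y : CS" "X' : CS" "Y' : CS"
 shows "bpr X Y X' Y' (badd n X Y al al') be =
  badd n (X ** X') (Y ** Y') (bpr X Y X' Y' al be) (bpr X Y X' Y' al' be)"
 by (rule bprod_eqI[of _ X X' Y Y']) (use assms in \<open>simp_all add: algebra_simps\<close>)

lemma bprod_badd_right:
 assumes "al : bhm X Y" "be : bhm X' Y'" "be' : bhm X' Y'" "X : CS" "Y : CS" "X' : CS" "Y' : CS"
 shows "bpr X Y X' Y' al (badd n X' Y' be be') =
  badd n (X ** X') (Y ** Y') (bpr X Y X' Y' al be) (bpr X Y X' Y' al be')"
 by (rule bprod_eqI[of _ X X' Y Y']) (use assms in \<open>simp_all add: algebra_simps\<close>)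

lemma sum_cprod: "(\<Sum>w\<in>pts (X ** Y). F w) = (\<Sum>x\<in>pts X. \<Sum>y\<in>pts Y. F (prod_encode (x, y)))"
 unfolding pts_cprod by (subst sum.reindex) (auto simp: inj_on_def sum.cartesian_product case_prod_unfold)

lemma bprod_bcomp:
 assumes "al : bhm X Y" "be : bhm Y Z" "al' : bhm X' Y'" "be' : bhm Y' Z'"
  "X : CS" "Y : CS" "Z : CS" "X' : CS" "Y' : CS" "Z' : CS"
 shows "bpr X Z X' Z' (bco X Z be al) (bco X' Z' be' al') =
  bco (X ** X') (Z ** Z') (bpr Y Z Y' Z' be be') (bpr X Y X' Y' al al')"
 by (rule bprod_eqI[of _ X X' Z Z'])
  (use assms in \<open>simp_all add: bcomp_closed[of _ X Y] bcomp_closed[of _ X' Y'] bcomp_closed[of _ "X ** X'" "Y ** Y'"]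
   mk_bcomp[of _ X Y] mk_bcomp[of _ X' Y'] mk_bcomp[of _ "X ** X'" "Y ** Y'"]
   sum_cprod sum_product mult_ac\<close>)

lemma bprod_bgraph:
 assumes "f : emaps X Y" "f' : emaps X' Y'" "X : CS" "Y : CS" "X' : CS" "Y' : CS"
 shows "bpr X Y X' Y' (bgraph n X Y f) (bgraph n X' Y' f') = bgraph n (X ** X') (Y ** Y') (fpm f f')"
proof (rule bprod_eqI[of _ X X' Y Y'])
 have e: "fpm f f' : emaps (X ** X') (Y ** Y')" using assms by simp
 show "bgraph n (X ** X') (Y ** Y') (fpm f f') : bhm (X ** X') (Y ** Y')"
  using bgraph_closed[OF e] assms by simp
 fix H x x' y y' assume "H <= CG" "x : pts X" "x' : pts X'" "fixd X H x" "fixd X' H x'"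
 then show "mk (bpr X Y X' Y' (bgraph n X Y f) (bgraph n X' Y' f')) H (prod_encode (x, x')) (prod_encode (y, y')) =
  mk (bgraph n (X ** X') (Y ** Y') (fpm f f')) H (prod_encode (x, x')) (prod_encode (y, y'))"
  using mk_bprod[OF bgraph_closed[OF assms(1,3)] bgraph_closed[OF assms(2,5)]]
   mk_bgraph[OF e] mk_bgraph[OF assms(1,3)] mk_bgraph[OF assms(2,5)] assms(3-6) by simp
qed (use bgraph_closed[OF assms(1,3)] bgraph_closed[OF assms(2,5)] assms(3-6) in simp_all)

lemma bcomp_bgraph:
 assumes "f : emaps X Y" "f' : emaps Y Z" "X : CS" "Y : CS" "Z : CS"
 shows "bco X Z (bgraph n Y Z f') (bgraph n X Y f) = bgraph n X Z (%x. f' (f x))"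
proof (rule bhom_eqI[of _ X Z])
 have e: "(%x. f' (f x)) : emaps X Z" using assms by simp
 show "bgraph n X Z (%x. f' (f x)) : bhm X Z" using bgraph_closed[OF e assms(3)] .
 fix H x z assume h: "H <= CG" "x : pts X" "fixd X H x"
 show "mk (bco X Z (bgraph n Y Z f') (bgraph n X Y f)) H x z = mk (bgraph n X Z (%x. f' (f x))) H x z"
  using mk_bcomp_graph_right[OF assms(1,3,4) bgraph_closed[OF assms(2,4)] h]
   mk_bgraph[OF e assms(3) h(1)] mk_bgraph[OF assms(2,4) h(1)] h emaps_fixd[OF assms(1)] assms(1) by simp
qed (use bgraph_closed[OF assms(1,3)] bgraph_closed[OF assms(2,4)] assms(3-5) in simp_all)

lemma bprod_bid [simp]: "X : CS ==> Y : CS ==> bpr X X Y Y (bd X) (bd Y) = bd (X ** Y)"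
 unfolding structure_graphs by (subst bprod_bgraph) (auto intro!: bgraph_cong elim!: cprodE)

text \<open>Naturality squares for isomorphisms of finite sets reduce to an entrywise comparison of marks. The
naturality of the structure maps and of the actions are special cases.\<close>

lemma bgraph_natural:
 assumes "f : emaps X X'" "f' : emaps Y Y'" "k : emaps Y' Y"
  "!!y. y : pts Y ==> k (f' y) = y" "!!y. y : pts Y' ==> f' (k y) = y"
  "be : bhm X Y" "be' : bhm X' Y'" "X : CS" "Y : CS" "X' : CS" "Y' : CS"
  "!!H x y. H <= CG ==> x : pts X ==> y : pts Y' ==> mk be H x (k y) = mk be' H (f x) y"
 shows "bco X Y' (bgraph n Y Y' f') be = bco X Y' be' (bgraph n X X' f)"
 by (rule bhom_eqI[of _ X Y'])
  (use assms bgraph_closed[OF assms(1,8)] bgraph_closed[OF assms(2,9)] in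
   \<open>simp_all add: mk_bcomp_graph_left[OF assms(2-5)] mk_bcomp_graph_right[OF assms(1)]
    bcomp_closed[of _ X Y] bcomp_closed[of _ X X'] del: emaps_iff\<close>)

lemma fas'_natural:
 assumes "al : bhm X X'" "be : bhm Y Y'" "ga : bhm Z Z'"
  "X : CS" "Y : CS" "Z : CS" "X' : CS" "Y' : CS" "Z' : CS"
 shows "bco (X ** Y ** Z) ((X' ** Y') ** Z') (bgraph n (X' ** Y' ** Z') ((X' ** Y') ** Z') fas')
   (bpr X X' (Y ** Z) (Y' ** Z') al (bpr Y Y' Z Z' be ga)) =
  bco (X ** Y ** Z) ((X' ** Y') ** Z') (bpr (X ** Y) (X' ** Y') Z Z' (bpr X X' Y Y' al be) ga)
   (bgraph n (X ** Y ** Z) ((X ** Y) ** Z) fas')"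
 by (rule bgraph_natural[where k = fas]) (use assms in \<open>auto simp: mult.assoc elim!: cprodE\<close>)

lemma fsw_natural:
 assumes "al : bhm X X'" "be : bhm Y Y'" "X : CS" "Y : CS" "X' : CS" "Y' : CS"
 shows "bco (X ** Y) (Y' ** X') (bgraph n (X' ** Y') (Y' ** X') fsw) (bpr X X' Y Y' al be) =
  bco (X ** Y) (Y' ** X') (bpr Y Y' X X' be al) (bgraph n (X ** Y) (Y ** X) fsw)"
 by (rule bgraph_natural[where k = fsw]) (use assms in \<open>auto simp: mult.commute elim!: cprodE\<close>)

lemma mk_bid_cpoint [simp]: "H <= CG ==> mk (bd pt) H 0 0 = 1"
 unfolding structure_graphs by (subst mk_bgraph) auto

lemma flu_natural:
 assumes "al : bhm X X'" "X : CS" "X' : CS"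
 shows "bco (pt ** X) X' (bgraph n (pt ** X') X' flu) (bpr pt pt X X' (bd pt) al) =
  bco (pt ** X) X' al (bgraph n (pt ** X) X flu)"
 by (rule bgraph_natural[where k = flu']) (use assms in \<open>auto elim!: cprodE\<close>)

lemma flu'_natural:
 assumes "al : bhm X X'" "X : CS" "X' : CS"
 shows "bco X (pt ** X') (bgraph n X' (pt ** X') flu') al =
  bco X (pt ** X') (bpr pt pt X X' (bd pt) al) (bgraph n X (pt ** X) flu')"
 by (rule bgraph_natural[where k = flu]) (use assms in \<open>auto elim!: cprodE\<close>)

lemma fru_natural:
 assumes "al : bhm X X'" "X : CS" "X' : CS"
 shows "bco (X ** pt) X' (bgraph n (X' ** pt) X' fru) (bpr X X' pt pt al (bd pt)) =
  bco (X ** pt) X' al (bgraph n (X ** pt) X fru)"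
 by (rule bgraph_natural[where k = fru']) (use assms in \<open>auto elim!: cprodE\<close>)

lemma act_emaps: "X : CS ==> g : CG ==> act X g : emaps X X"
 by (simp add: act_commute)

text \<open>Marks are constant along orbits of the diagonal action; this is what makes the orbit automorphisms natural.\<close>

lemma act_natural:
 assumes "al : bhm X Y" "X : CS" "Y : CS" "g : CG"
 shows "bco X Y (bgraph n Y Y (act Y g)) al = bco X Y al (bgraph n X X (act X g))"
proof (rule bgraph_natural[where k = "act Y ((- g) mod int n)"])
 fix H x y assume "H <= CG" "x : pts X" "y : pts Y"
 then show "mk al H x (act Y (- g mod int n) y) = mk al H (act X g x) y"
  using mk_act[OF assms(1-3) _ assms(4), of H x "act Y ((- g) mod int n) y"] assms by simp
qed (use assms act_emaps G_closed(2)[OF assms(4)] in \<open>simp_all add: act_commute\<close>)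

abbreviation bzero where "bzero X Y == bcls n X Y (span_empty, span_empty)"

lemma repr_simps [simp]:
 "carrier (obj (rpr X) Y) = bhm X Y" "monoid.mult (obj (rpr X) Y) = badd n X Y"
 "one (obj (rpr X) Y) = bzero X Y" "mor (rpr X) Y Z be al = bco X Z be al"
 by (simp_all add: repr_def)

lemma bhom_comm_group: assumes "X : CS" "Y : CS"
 shows "comm_group (obj (rpr X) Y)"
proof (rule comm_groupI)
 fix al assume "al : carrier (obj (rpr X) Y)"
 then have "al : bhm X Y" by simp
 then obtain A B where AB: "A : spans n X Y" "B : spans n X Y" "al = bcls n X Y (A, B)"
  by (rule bhomE)
 have "badd n X Y (bcls n X Y (B, A)) al = bzero X Y"
  by (rule bhom_eqI[of _ X Y]) (simp_all add: AB assms smk_sum[where X = X and Y = Y])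
 then show "EX be : carrier (obj (rpr X) Y). be +[(rpr X),Y] al = \<one>\<^bsub>obj (rpr X) Y\<^esub>"
  using AB(1,2) by (intro bexI[of _ "bcls n X Y (B, A)"]) simp_all
next
 fix al assume "al : carrier (obj (rpr X) Y)"
 then show "\<one>\<^bsub>obj (rpr X) Y\<^esub> +[(rpr X),Y] al = al"
  unfolding repr_simps by (intro bhom_eqI[of _ X Y]) (simp_all add: assms)
next
 fix al be ga assume "al : carrier (obj (rpr X) Y)" "be : carrier (obj (rpr X) Y)" "ga : carrier (obj (rpr X) Y)"
 then show "al +[(rpr X),Y] be +[(rpr X),Y] ga = al +[(rpr X),Y] (be +[(rpr X),Y] ga)"
  unfolding repr_simps by (intro bhom_eqI[of _ X Y]) (simp_all add: assms)
next
 fix al be assume "al : carrier (obj (rpr X) Y)" "be : carrier (obj (rpr X) Y)"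
 then show "al +[(rpr X),Y] be = be +[(rpr X),Y] al"
  unfolding repr_simps by (intro bhom_eqI[of _ X Y]) (simp_all add: assms)
qed simp_all

section \<open>Mackey functors\<close>

abbreviation ob where "ob M X == carrier (obj M X)"

lemma mackeyD:
 assumes "mackey M"
 shows "X : CS ==> comm_group (obj M X)"
  "X : CS ==> Y : CS ==> be : bhm X Y ==> mor M X Y be : hom (obj M X) (obj M Y)"
  "X : CS ==> x : ob M X ==> mor M X X (bd X) x = x"
  "X : CS ==> Y : CS ==> Z : CS ==> al : bhm X Y ==> be : bhm Y Z ==>
   x : ob M X ==> mor M Y Z be (mor M X Y al x) = mor M X Z (bco X Z be al) x"
  "X : CS ==> Y : CS ==> al : bhm X Y ==> be : bhm X Y ==> x : ob M X ==>
   mor M X Y (badd n X Y al be) x = mor M X Y al x +[M,Y] mor M X Y be x"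
 using assms unfolding mackey_functor_def by auto

lemma ob_group: "mackey M ==> X : CS ==> group (obj M X)"
 using mackeyD(1) comm_group.axioms(2) by blast

lemma mor_closed [simp]: "mackey M ==> X : CS ==> Y : CS ==> be : bhm X Y ==>
  x : ob M X ==> mor M X Y be x : ob M Y"
 by (rule hom_in_carrier[OF mackeyD(2)])

lemma ob_mult [simp]: "mackey M ==> X : CS ==> x : ob M X ==> y : ob M X ==> x +[M,X] y : ob M X"
 using ob_group by (metis group.is_monoid monoid.m_closed)

lemma mor_mult: "mackey M ==> X : CS ==> Y : CS ==> be : bhm X Y ==>
  x : ob M X ==> y : ob M X ==> mor M X Y be (x +[M,X] y) = mor M X Y be x +[M,Y] mor M X Y be y"
 by (rule hom_mult[OF mackeyD(2)])

lemma repr_mackey [simp]: assumes "X : CS" shows "mackey (rpr X)"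
 unfolding mackey_functor_def
 by (intro conjI ballI homI)
  (simp_all add: assms bhom_comm_group bcomp_assoc[where W = X] bcomp_closed[of _ X]
   bcomp_badd_left[where X = X] bcomp_badd_right[where X = X])

lemma mhD:
 assumes "ph : mhm M N" "X : CS"
 shows "x : ob M X ==> ph X x : ob N X"
  "x : ob M X ==> y : ob M X ==> ph X (x +[M,X] y) = ph X x +[N,X] ph X y"
  "Y : CS ==> be : bhm X Y ==> x : ob M X ==> ph Y (mor M X Y be x) = mor N X Y be (ph X x)"
 using assms unfolding mack_hom_def by (auto simp: hom_def Pi_iff)

lemma mack_homI:
 assumes "!!X x. X : CS ==> x : ob M X ==> ph X x : ob N X"
  "!!X x y. X : CS ==> x : ob M X ==> y : ob M X ==> ph X (x +[M,X] y) = ph X x +[N,X] ph X y"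
  "!!X Y be x. X : CS ==> Y : CS ==> be : bhm X Y ==> x : ob M X ==> ph Y (mor M X Y be x) = mor N X Y be (ph X x)"
 shows "ph : mhm M N"
 using assms unfolding mack_hom_def by (auto simp: hom_def Pi_iff)

lemma mh_comp: "ph : mhm M N ==> ps : mhm N L ==> ps oM ph : mhm M L"
 by (rule mack_homI) (simp_all add: mcomp_def mhD)

lemma mid_hom [simp]: "mid : mhm M M"
 by (rule mack_homI) (simp_all add: mid_def)

lemma mack_hom_one_inv:
 assumes "ph : mhm M N" "mackey M" "mackey N" "X : CS"
 shows "ph X \<one>\<^bsub>obj M X\<^esub> = \<one>\<^bsub>obj N X\<^esub>"
  "x : ob M X ==> ph X (inv\<^bsub>obj M X\<^esub> x) = inv\<^bsub>obj N X\<^esub> (ph X x)"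
proof -
 have "group_hom (obj M X) (obj N X) (ph X)"
  using assms(1,4) ob_group[OF assms(2,4)] ob_group[OF assms(3,4)] unfolding mack_hom_def
  by (intro group_hom.intro group_hom_axioms.intro) auto
 then show "ph X \<one>\<^bsub>obj M X\<^esub> = \<one>\<^bsub>obj N X\<^esub>"
  "x : ob M X ==> ph X (inv\<^bsub>obj M X\<^esub> x) = inv\<^bsub>obj N X\<^esub> (ph X x)"
  by (rule group_hom.hom_one, rule group_hom.hom_inv)
qed

text \<open>The transfer along an equivariant map, which for a bijection is reindexing.\<close>

definition tr where
 "tr M X Y f = mor M X Y (bgraph n X Y f)"

lemma tr_closed [simp]: "mackey M ==> X : CS ==> Y : CS ==> f : emaps X Y ==> x : ob M X ==>
  tr M X Y f x : ob M Y"
 unfolding tr_def by (rule mor_closed[OF _ _ _ bgraph_closed])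

lemma tr_tr [simp]: "mackey M ==> X : CS ==> Y : CS ==> Z : CS ==>
  f : emaps X Y ==> f' : emaps Y Z ==> x : ob M X ==> tr M Y Z f' (tr M X Y f x) = tr M X Z (%x. f' (f x)) x"
 unfolding tr_def by (subst mackeyD(4)) (simp_all add: bcomp_bgraph del: emaps_iff)

lemma tr_mult: "mackey M ==> X : CS ==> Y : CS ==> f : emaps X Y ==> x : ob M X ==> y : ob M X ==>
  tr M X Y f (x +[M,X] y) = tr M X Y f x +[M,Y] tr M X Y f y"
 unfolding tr_def by (rule mor_mult) (simp_all del: emaps_iff)

lemma tr_cong: "(!!x. x : pts X ==> f x = f' x) ==> tr M X Y f = tr M X Y f'"
 unfolding tr_def by (subst bgraph_cong) simp_all

lemma tr_id [simp]: "mackey M ==> X : CS ==> x : ob M X ==> tr M X X (%x. x) x = x"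
 unfolding tr_def by (simp add: structure_graphs[symmetric] mackeyD(3))

lemma tr_idI: "mackey M ==> X : CS ==> x : ob M X ==> (!!x. x : pts X ==> f x = x) ==> tr M X X f x = x"
 by (subst tr_cong[of X f "%x. x" M X]) simp_all

lemma mh_tr: "ph : mhm M N ==> X : CS ==> Y : CS ==> f : emaps X Y ==> x : ob M X ==>
  ph Y (tr M X Y f x) = tr N X Y f (ph X x)"
 unfolding tr_def by (simp add: mhD(3) del: emaps_iff)

definition subfun where
 "subfun K P \<longleftrightarrow> (ALL X : CS. P X \<one>\<^bsub>obj K X\<^esub> &
  (ALL x : ob K X. ALL y : ob K X. P X x --> P X y --> P X (x +[K,X] y)) &
  (ALL x : ob K X. P X x --> P X (inv\<^bsub>obj K X\<^esub> x)) &
  (ALL Y : CS. ALL be : bhm X Y. ALL x : ob K X. P X x --> P Y (mor K X Y be x)))"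

text \<open>Q generates K if a subfunctor of K that contains the elements satisfying Q is all of K. Stating this
through arbitrary predicates closed under the operations makes it an induction rule.\<close>

definition mgen where
 "mgen K Q \<longleftrightarrow> (ALL X x. X : CS --> Q X x --> x : ob K X) &
  (ALL P. subfun K P --> (ALL X : CS. ALL x. Q X x --> P X x) --> (ALL X : CS. ALL x : ob K X. P X x))"

lemma mgen_all: "mgen K (%X x. x : ob K X)"
 by (simp add: mgen_def)

lemma mgenD: "mgen K Q ==> X : CS ==> Q X x ==> x : ob K X"
 by (simp add: mgen_def)

lemma mgen_induct: "mgen K Q ==> subfun K P ==> (!!X x. X : CS ==> Q X x ==> P X x) ==>
  X : CS ==> x : ob K X ==> P X x"
 unfolding mgen_def by blast

lemma mack_hom_subfun_eq:
 assumes "ph : mhm K L" "ps : mhm K L" "mackey K" "mackey L"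
 shows "subfun K (%X x. ph X x = ps X x)"
 unfolding subfun_def
 using mack_hom_one_inv[OF assms(1,3,4)] mack_hom_one_inv[OF assms(2,3,4)] mhD[OF assms(1)] mhD[OF assms(2)]
 by simp

text \<open>The equalizer of two maps is a subfunctor.\<close>

lemma mack_hom_eqI:
 assumes "mgen K Q" "ph : mhm K L" "ps : mhm K L" "mackey K" "mackey L"
  "!!X x. X : CS ==> Q X x ==> ph X x = ps X x" "X : CS" "x : ob K X"
 shows "ph X x = ps X x"
 by (rule mgen_induct[OF assms(1) mack_hom_subfun_eq[OF assms(2-5)] _ assms(7,8)]) (rule assms(6))

section \<open>Coequalizers\<close>

lemma coeq_sub_subgroup:
 assumes "mackey K" "mackey N" "ph : mhm K N" "ps : mhm K N" "X : CS"
 shows "subgroup (coeq_sub K N ph ps X) (obj N X)"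
proof -
 interpret A: comm_group "obj N X" using mackeyD(1)[OF assms(2,5)] .
 have "(%k. ph X k +[N,X] inv\<^bsub>obj N X\<^esub> (ps X k)) : hom (obj K X) (obj N X)"
  using mhD(1,2)[OF assms(3,5)] mhD(1,2)[OF assms(4,5)]
  by (intro homI) (simp_all add: A.inv_mult A.m_ac)
 then have "group_hom (obj K X) (obj N X) (%k. ph X k +[N,X] inv\<^bsub>obj N X\<^esub> (ps X k))"
  using ob_group[OF assms(1,5)] by (intro group_hom.intro group_hom_axioms.intro) auto
 then show ?thesis unfolding coeq_sub_def by (rule group_hom.img_is_subgroup)
qed

context
 fixes K :: "('k, 'y) mackey_scheme" and N :: "('a, 'z) mackey_scheme" and ph ps :: "cset => 'k => 'a"
 assumes K: "mackey K" and N: "mackey N"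
  and ph: "ph : mhm K N" and ps: "ps : mhm K N"
begin

lemma ob_coeq: "ob (coeq K N ph ps) X = coeq_proj K N ph ps X ` ob N X"
 by (simp add: coeq_def carrier_FactGroup coeq_proj_def)

lemma coeq_ob_E: assumes "c : ob (coeq K N ph ps) X"
 obtains x where "x : ob N X" "c = coeq_proj K N ph ps X x"
 using assms by (auto simp: ob_coeq)

lemma coeq_group: "X : CS ==> comm_group (obj (coeq K N ph ps) X)"
 using quotient_facts(1)[OF mackeyD(1)[OF N] coeq_sub_subgroup[OF K N ph ps]] by (simp add: coeq_def)

lemma coeq_proj_mult: "X : CS ==> coeq_proj K N ph ps X : hom (obj N X) (obj (coeq K N ph ps) X)"
 using quotient_facts(2)[OF mackeyD(1)[OF N] coeq_sub_subgroup[OF K N ph ps]] by (simp add: coeq_def coeq_proj_def)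

lemma coeq_image:
 assumes X: "X : CS" and h: "h : hom (obj N X) B" "group B"
  and eq: "!!k. k : ob K X ==> h (ph X k) = h (ps X k)" and x: "x : ob N X"
 shows "h ` (coeq_proj K N ph ps X x) = {h x}"
 unfolding coeq_proj_def
proof (rule hom_image_coset[OF mackeyD(1)[OF N X] coeq_sub_subgroup[OF K N ph ps X] h _ x])
 fix l assume "l : coeq_sub K N ph ps X"
 then obtain k where k: "k : ob K X" "l = ph X k +[N,X] inv\<^bsub>obj N X\<^esub> (ps X k)"
  unfolding coeq_sub_def by blast
 interpret h: group_hom "obj N X" B h
  using ob_group[OF N X] h by (intro group_hom.intro group_hom_axioms.intro) auto
 show "h l = \<one>\<^bsub>B\<^esub>"
  using k mhD(1)[OF ph X k(1)] mhD(1)[OF ps X k(1)] eq[OF k(1)] by simp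
qed

lemma coeq_eq:
 assumes X: "X : CS" and k: "k : ob K X"
 shows "coeq_proj K N ph ps X (ph X k) = coeq_proj K N ph ps X (ps X k)"
proof -
 interpret A: comm_group "obj N X" using mackeyD(1)[OF N X] .
 have c: "ph X k : ob N X" "ps X k : ob N X" using mhD(1)[OF ph X k] mhD(1)[OF ps X k] .
 have "ph X k = (ph X k +[N,X] inv\<^bsub>obj N X\<^esub> (ps X k)) +[N,X] ps X k"
  using c by (simp add: A.m_assoc)
 then have "ph X k : coeq_sub K N ph ps X #>\<^bsub>obj N X\<^esub> ps X k"
  unfolding r_coset_def coeq_sub_def using k by blast
 then show ?thesis unfolding coeq_proj_def
  using A.repr_independence[OF _ c(2) coeq_sub_subgroup[OF K N ph ps X]] by simp
qed

lemma coeq_mor: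
 assumes XY: "X : CS" "Y : CS" "be : bhm X Y" and x: "x : ob N X"
 shows "mor (coeq K N ph ps) X Y be (coeq_proj K N ph ps X x) = coeq_proj K N ph ps Y (mor N X Y be x)"
proof -
 have "(%x. coeq_proj K N ph ps Y (mor N X Y be x)) ` (coeq_proj K N ph ps X x) = {coeq_proj K N ph ps Y (mor N X Y be x)}"
 proof (rule coeq_image[OF XY(1) _ comm_group.axioms(2)[OF coeq_group[OF XY(2)]] _ x])
  show "(%x. coeq_proj K N ph ps Y (mor N X Y be x)) : hom (obj N X) (obj (coeq K N ph ps) Y)"
   using hom_compose[OF mackeyD(2)[OF N XY] coeq_proj_mult[OF XY(2)]] by (simp add: o_def)
  show "coeq_proj K N ph ps Y (mor N X Y be (ph X k)) = coeq_proj K N ph ps Y (mor N X Y be (ps X k))" if "k : ob K X" for k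
   using coeq_eq[OF XY(2), of "mor K X Y be k"] mhD(3)[OF ph XY(1) XY(2,3) that]
    mhD(3)[OF ps XY(1) XY(2,3) that] mor_closed[OF K XY that] by simp
 qed
 then show ?thesis by (simp add: coeq_def)
qed

lemma coeq_proj_hom: "coeq_proj K N ph ps : mhm N (coeq K N ph ps)"
 using coeq_proj_mult coeq_mor unfolding mack_hom_def by simp

lemma coeq_mackey: "mackey (coeq K N ph ps)"
 unfolding mackey_functor_def
proof (intro conjI ballI)
 fix X Y be assume XY: "X : CS" "Y : CS" "be : bhm X Y"
 show "mor (coeq K N ph ps) X Y be : hom (obj (coeq K N ph ps) X) (obj (coeq K N ph ps) Y)"
 proof (rule homI)
  fix c assume "c : ob (coeq K N ph ps) X"
  then show "mor (coeq K N ph ps) X Y be c : ob (coeq K N ph ps) Y"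
   by (elim coeq_ob_E) (simp add: coeq_mor XY mhD(1)[OF coeq_proj_hom] N)
 next
  fix c d assume "c : ob (coeq K N ph ps) X" "d : ob (coeq K N ph ps) X"
  then show "mor (coeq K N ph ps) X Y be (c +[(coeq K N ph ps),X] d) =
   mor (coeq K N ph ps) X Y be c +[(coeq K N ph ps),Y] mor (coeq K N ph ps) X Y be d"
   by (elim coeq_ob_E) (simp add: coeq_mor XY mhD(2)[OF coeq_proj_hom, symmetric] N mor_mult)
 qed
next
 fix X c assume "X : CS" "c : ob (coeq K N ph ps) X"
 then show "mor (coeq K N ph ps) X X (bd X) c = c"
  by (elim coeq_ob_E) (simp add: coeq_mor mackeyD(3)[OF N])
next
 fix X Y Z al be c assume "X : CS" "Y : CS" "Z : CS" "al : bhm X Y" "be : bhm Y Z"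
  "c : ob (coeq K N ph ps) X"
 then show "mor (coeq K N ph ps) X Z (bco X Z be al) c = mor (coeq K N ph ps) Y Z be (mor (coeq K N ph ps) X Y al c)"
  by (elim coeq_ob_E) (simp add: coeq_mor mackeyD(4)[OF N] bcomp_closed[of _ X Y] N)
next
 fix X Y al be c assume "X : CS" "Y : CS" "al : bhm X Y" "be : bhm X Y"
  "c : ob (coeq K N ph ps) X"
 then show "mor (coeq K N ph ps) X Y (badd n X Y al be) c =
   mor (coeq K N ph ps) X Y al c +[(coeq K N ph ps),Y] mor (coeq K N ph ps) X Y be c"
  by (elim coeq_ob_E) (simp add: coeq_mor mackeyD(5)[OF N] mhD(2)[OF coeq_proj_hom] N)
qed (rule coeq_group)

lemma coeq_desc_value:
 assumes L: "mackey L" and h: "h : mhm N L"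
  and eq: "!!X k. X : CS ==> k : ob K X ==> h X (ph X k) = h X (ps X k)" and X: "X : CS" and x: "x : ob N X"
 shows "desc h X (coeq_proj K N ph ps X x) = h X x"
proof -
 have "h X : hom (obj N X) (obj L X)" using h X unfolding mack_hom_def by simp
 from coeq_image[OF X this ob_group[OF L X] eq[OF X] x] show ?thesis by (simp add: desc_def)
qed

lemma coeq_desc_hom:
 assumes L: "mackey L" and h: "h : mhm N L"
  and eq: "!!X k. X : CS ==> k : ob K X ==> h X (ph X k) = h X (ps X k)"
 shows "desc h : mhm (coeq K N ph ps) L"
proof (rule mack_homI)
 fix X c assume "X : CS" "c : ob (coeq K N ph ps) X"
 then show "desc h X c : ob L X"
  by (elim coeq_ob_E) (simp add: coeq_desc_value[OF L h eq] mhD(1)[OF h])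
next
 fix X c d assume "X : CS" "c : ob (coeq K N ph ps) X" "d : ob (coeq K N ph ps) X"
 then show "desc h X (c +[(coeq K N ph ps),X] d) = desc h X c +[L,X] desc h X d"
  by (elim coeq_ob_E) (simp add: coeq_desc_value[OF L h eq] mhD(2)[OF h] mhD(2)[OF coeq_proj_hom, symmetric] N)
next
 fix X Y be c assume "X : CS" "Y : CS" "be : bhm X Y" "c : ob (coeq K N ph ps) X"
 then show "desc h Y (mor (coeq K N ph ps) X Y be c) = mor L X Y be (desc h X c)"
  by (elim coeq_ob_E) (simp add: coeq_desc_value[OF L h eq] coeq_mor mhD(3)[OF h] N)
qed

end

lemma subfun_pullback:
 assumes ph: "ph : mhm M L" and M: "mackey M" and L: "mackey L" and P: "subfun L P"
 shows "subfun M (%X x. P X (ph X x))"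
 using P mack_hom_one_inv[OF ph M L] mhD[OF ph] unfolding subfun_def by simp

text \<open>Generators pass to quotients, because subfunctors pull back.\<close>

lemma mgen_surj:
 assumes ph: "ph : mhm M L" and M: "mackey M" and L: "mackey L" and Q: "mgen M Q"
  and surj: "!!X y. X : CS ==> y : ob L X ==> EX x : ob M X. y = ph X x"
 shows "mgen L (%X y. EX x. Q X x & y = ph X x)"
 unfolding mgen_def
proof (intro conjI allI impI ballI)
 fix X y assume "X : CS" "EX x. Q X x & y = ph X x"
 then show "y : ob L X" using mgenD[OF Q] mhD(1)[OF ph] by blast
next
 fix P X y assume P: "subfun L P" "ALL X : CS. ALL y. (EX x. Q X x & y = ph X x) --> P X y" "X : CS" "y : ob L X"
 obtain x where x: "x : ob M X" "y = ph X x" using surj[OF P(3,4)] by blast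
 have "P X (ph X x)"
  by (rule mgen_induct[OF Q subfun_pullback[OF ph M L P(1)] _ P(3) x(1)]) (use P(2) in blast)
 then show "P X y" using x by simp
qed

lemma mgen_mono: "mgen K Q ==> (!!X x. X : CS ==> Q X x ==> Q' X x) ==> (!!X x. X : CS ==> Q' X x ==> x : ob K X) ==> mgen K Q'"
 unfolding mgen_def by blast

section \<open>The box product\<close>

text \<open>The pairings M(Y) \<times> N(Z) \<rightarrow> L(Y \<times> Z) that the box product represents.\<close>

definition bilin where
 "bilin M N L pp \<longleftrightarrow> (ALL Y : CS. ALL Z : CS.
  (ALL m : ob M Y. ALL k : ob N Z. pp Y Z m k : ob L (Y ** Z)) &
  (ALL m : ob M Y. ALL m' : ob M Y. ALL k : ob N Z.
   pp Y Z (m +[M,Y] m') k = pp Y Z m k +[L,(Y ** Z)] pp Y Z m' k) &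
  (ALL m : ob M Y. ALL k : ob N Z. ALL k' : ob N Z.
   pp Y Z m (k +[N,Z] k') = pp Y Z m k +[L,(Y ** Z)] pp Y Z m k') &
  (ALL Y' : CS. ALL Z' : CS. ALL xi : bhm Y Y'. ALL ze : bhm Z Z'. ALL m : ob M Y. ALL k : ob N Z.
   pp Y' Z' (mor M Y Y' xi m) (mor N Z Z' ze k) =
    mor L (Y ** Z) (Y' ** Z') (bpr Y Y' Z Z' xi ze) (pp Y Z m k)))"

lemma bilinD:
 assumes "bilin M N L pp" "Y : CS" "Z : CS"
 shows "m : ob M Y ==> k : ob N Z ==> pp Y Z m k : ob L (Y ** Z)"
  "m : ob M Y ==> m' : ob M Y ==> k : ob N Z ==>
   pp Y Z (m +[M,Y] m') k = pp Y Z m k +[L,(Y ** Z)] pp Y Z m' k"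
  "m : ob M Y ==> k : ob N Z ==> k' : ob N Z ==>
   pp Y Z m (k +[N,Z] k') = pp Y Z m k +[L,(Y ** Z)] pp Y Z m k'"
  "Y' : CS ==> Z' : CS ==> xi : bhm Y Y' ==> ze : bhm Z Z' ==> m : ob M Y ==> k : ob N Z ==>
   pp Y' Z' (mor M Y Y' xi m) (mor N Z Z' ze k) =
    mor L (Y ** Z) (Y' ** Z') (bpr Y Y' Z Z' xi ze) (pp Y Z m k)"
 using assms unfolding bilin_def by simp_all

lemma bilinI:
 assumes "!!Y Z m k. Y : CS ==> Z : CS ==> m : ob M Y ==> k : ob N Z ==> pp Y Z m k : ob L (Y ** Z)"
  "!!Y Z m m' k. Y : CS ==> Z : CS ==> m : ob M Y ==> m' : ob M Y ==> k : ob N Z ==>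
   pp Y Z (m +[M,Y] m') k = pp Y Z m k +[L,(Y ** Z)] pp Y Z m' k"
  "!!Y Z m k k'. Y : CS ==> Z : CS ==> m : ob M Y ==> k : ob N Z ==> k' : ob N Z ==>
   pp Y Z m (k +[N,Z] k') = pp Y Z m k +[L,(Y ** Z)] pp Y Z m k'"
  "!!Y Z Y' Z' xi ze m k. Y : CS ==> Z : CS ==> Y' : CS ==> Z' : CS ==> xi : bhm Y Y' ==>
   ze : bhm Z Z' ==> m : ob M Y ==> k : ob N Z ==>
   pp Y' Z' (mor M Y Y' xi m) (mor N Z Z' ze k) =
    mor L (Y ** Z) (Y' ** Z') (bpr Y Y' Z Z' xi ze) (pp Y Z m k)"
 shows "bilin M N L pp"
 using assms unfolding bilin_def by simp

lemma free_hom_finprod: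
 assumes B: "comm_group B" and f: "f ` S <= carrier B"
 shows "EX h : hom (free_Abelian_group S) B. (ALL x : S. h (frag_of x) = f x) &
  (ALL z. Poly_Mapping.keys z <= S -->
   h z = finprod B (%a. f a [^]\<^bsub>B\<^esub> Poly_Mapping.lookup z a) (Poly_Mapping.keys z))"
proof -
 interpret B: comm_group B by fact
 obtain h where h: "h : hom (free_Abelian_group S) B" "!!x. x : S ==> h (frag_of x) = f x"
  using B.free_Abelian_group_universal[OF f] by metis
 interpret h: group_hom "free_Abelian_group S" B h
  using h(1) by (intro group_hom.intro group_hom_axioms.intro) (auto simp: group_free_Abelian_group)
 have *: "h z = finprod B (%a. f a [^]\<^bsub>B\<^esub> Poly_Mapping.lookup z a) T"
  if "finite T" "T <= S" "Poly_Mapping.keys z <= T" for T z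
  using that
 proof (induction T arbitrary: z rule: finite_induct)
  case empty
  then have "z = 0" by auto
  then show ?case using h.hom_one by simp
 next
  case (insert a T)
  let ?z = "z - frag_cmul (Poly_Mapping.lookup z a) (frag_of a)"
  have fS: "f : insert a T \<rightarrow> carrier B" using f insert.prems(1) by auto
  have look: "Poly_Mapping.lookup ?z b = (if b = a then 0 else Poly_Mapping.lookup z b)" for b
   by (simp add: lookup_minus)
  have keys: "Poly_Mapping.keys ?z <= T"
  proof
   fix b assume "b : Poly_Mapping.keys ?z"
   then have "Poly_Mapping.lookup ?z b ~= 0" by (simp add: in_keys_iff)
   then have "b ~= a" "Poly_Mapping.lookup z b ~= 0" unfolding look by (auto split: if_splits)
   then show "b : T" using insert.prems(2) by (auto simp: in_keys_iff)
  qed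
  have kS: "Poly_Mapping.keys ?z <= S" "Poly_Mapping.keys (frag_cmul (Poly_Mapping.lookup z a) (frag_of a)) <= S" "a : S"
   using keys insert.prems(1) keys_cmul[of "Poly_Mapping.lookup z a" "frag_of a"] by auto
  have "h z = h (frag_cmul (Poly_Mapping.lookup z a) (frag_of a)) \<otimes>\<^bsub>B\<^esub> h ?z"
   using h.hom_mult[of "frag_cmul (Poly_Mapping.lookup z a) (frag_of a)" ?z] kS by simp
  also have "h (frag_cmul (Poly_Mapping.lookup z a) (frag_of a)) = f a [^]\<^bsub>B\<^esub> Poly_Mapping.lookup z a"
   using h.hom_int_pow[of "frag_of a" "Poly_Mapping.lookup z a"] kS(3) h(2)[of a] by simp
  also have "h ?z = finprod B (%b. f b [^]\<^bsub>B\<^esub> Poly_Mapping.lookup ?z b) T"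
   using insert.IH[OF _ keys] insert.prems(1) by simp
  also have "... = finprod B (%b. f b [^]\<^bsub>B\<^esub> Poly_Mapping.lookup z b) T"
   by (rule B.finprod_cong') (use insert.hyps(2) fS look in auto)
  also have "(f a [^]\<^bsub>B\<^esub> Poly_Mapping.lookup z a) \<otimes>\<^bsub>B\<^esub> ... = finprod B (%b. f b [^]\<^bsub>B\<^esub> Poly_Mapping.lookup z b) (insert a T)"
   by (rule B.finprod_insert[symmetric]) (use insert.hyps fS in auto)
  finally show ?case .
 qed
 show ?thesis by (intro bexI[OF _ h(1)] conjI ballI allI impI h(2) *) auto
qed

lemma hom_diff3:
 assumes h: "h : hom (free_Abelian_group S) B" "comm_group B" and abc: "a : S" "b : S" "c : S"
 shows "h (frag_of a - frag_of b - frag_of c) = \<one>\<^bsub>B\<^esub> \<longleftrightarrow> h (frag_of a) = h (frag_of b) \<otimes>\<^bsub>B\<^esub> h (frag_of c)"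
  "h (frag_of a - frag_of b) = \<one>\<^bsub>B\<^esub> \<longleftrightarrow> h (frag_of a) = h (frag_of b)"
proof -
 interpret B: comm_group B by fact
 interpret h: group_hom "free_Abelian_group S" B h
  using h(1) by (intro group_hom.intro group_hom_axioms.intro) (auto simp: group_free_Abelian_group)
 have k: "Poly_Mapping.keys (frag_of x) <= S" if "x : S" for x :: 'a using that by simp
 have inB: "h (frag_of x) : carrier B" if "x : S" for x using h.hom_closed[of "frag_of x"] that by simp
 have neg: "h (- frag_of x) = inv\<^bsub>B\<^esub> h (frag_of x)" if "x : S" for x
  using h.hom_inv[of "frag_of x"] that by simp
 have d: "h (frag_of a - frag_of b) = h (frag_of a) \<otimes>\<^bsub>B\<^esub> inv\<^bsub>B\<^esub> h (frag_of b)"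
  using h.hom_mult[of "frag_of a" "- frag_of b"] abc neg by simp
 have kd: "Poly_Mapping.keys (frag_of a - frag_of b) <= S"
  using keys_diff[of "frag_of a" "frag_of b"] abc by auto
 have "h (frag_of a - frag_of b - frag_of c) = h (frag_of a) \<otimes>\<^bsub>B\<^esub> inv\<^bsub>B\<^esub> h (frag_of b) \<otimes>\<^bsub>B\<^esub> inv\<^bsub>B\<^esub> h (frag_of c)"
  using h.hom_mult[of "frag_of a - frag_of b" "- frag_of c"] abc neg d kd by simp
 then show "h (frag_of a - frag_of b - frag_of c) = \<one>\<^bsub>B\<^esub> \<longleftrightarrow> h (frag_of a) = h (frag_of b) \<otimes>\<^bsub>B\<^esub> h (frag_of c)"
  using inB abc B.m_comm[OF inB[OF abc(2)] inB[OF abc(3)]] by (simp add: B.inv_solve_right')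
 show "h (frag_of a - frag_of b) = \<one>\<^bsub>B\<^esub> \<longleftrightarrow> h (frag_of a) = h (frag_of b)"
  unfolding d using inB abc by (simp add: B.inv_solve_right')
qed

text \<open>The relations of the coend, read as conditions on a function of its generators.\<close>

definition coend_compatible where
 "coend_compatible M N X B f \<longleftrightarrow> (ALL Y : CS. ALL Z : CS. ALL be : bhm (Y ** Z) X. ALL m : ob M Y. ALL k : ob N Z.
  (ALL be' : bhm (Y ** Z) X. f (Y, Z, badd n (Y ** Z) X be be', m, k) = f (Y, Z, be, m, k) \<otimes>\<^bsub>B\<^esub> f (Y, Z, be', m, k)) &
  (ALL m' : ob M Y. f (Y, Z, be, m +[M,Y] m', k) = f (Y, Z, be, m, k) \<otimes>\<^bsub>B\<^esub> f (Y, Z, be, m', k)) &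
  (ALL k' : ob N Z. f (Y, Z, be, m, k +[N,Z] k') = f (Y, Z, be, m, k) \<otimes>\<^bsub>B\<^esub> f (Y, Z, be, m, k'))) &
  (ALL Y : CS. ALL Z : CS. ALL Y' : CS. ALL Z' : CS. ALL be : bhm (Y' ** Z') X.
   ALL xi : bhm Y Y'. ALL ze : bhm Z Z'. ALL m : ob M Y. ALL k : ob N Z.
   f (Y, Z, bco (Y ** Z) X be (bpr Y Y' Z Z' xi ze), m, k) =
    f (Y', Z', be, mor M Y Y' xi m, mor N Z Z' ze k))"

definition bg where
 "bg M N X g = box_cls n M N X (frag_of g)"

context
 fixes M :: "('a, 'y) mackey_scheme" and N :: "('b, 'z) mackey_scheme"
 assumes M: "mackey M" and N: "mackey N"
begin

lemma mem_box_gens: "(Y, Z, be, m, k) : box_gens n M N X \<longleftrightarrow> Y : CS & Z : CS &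
  be : bhm (Y ** Z) X & m : ob M Y & k : ob N Z"
 by (simp add: box_gens_def)

lemma box_rels_kill_iff:
 assumes X: "X : CS" and h: "h : hom (free_Abelian_group (box_gens n M N X)) B" and B: "comm_group B"
 shows "(ALL r : box_rels n M N X. h r = \<one>\<^bsub>B\<^esub>) \<longleftrightarrow> coend_compatible M N X B (%g. h (frag_of g))"
proof -
 note d = hom_diff3[OF h B]
 note bc = bcomp_closed[OF bprod_closed]
 show ?thesis
 proof
  assume r: "ALL r : box_rels n M N X. h r = \<one>\<^bsub>B\<^esub>"
  show "coend_compatible M N X B (%g. h (frag_of g))"
   unfolding coend_compatible_def
  proof (intro conjI ballI)
   fix Y Z be m k be' assume a: "Y : CS" "Z : CS" "be : bhm (Y ** Z) X" "m : ob M Y" "k : ob N Z"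
    "be' : bhm (Y ** Z) X"
   then have "frag_of (Y, Z, badd n (Y ** Z) X be be', m, k) - frag_of (Y, Z, be, m, k) - frag_of (Y, Z, be', m, k) : box_rels n M N X"
    unfolding box_rels_def
    by - (rule UnI1, rule UnI1, rule UnI1, rule CollectI, (rule exI)+, rule conjI, rule refl, simp add: mem_box_gens)
   then show "h (frag_of (Y, Z, badd n (Y ** Z) X be be', m, k)) = h (frag_of (Y, Z, be, m, k)) \<otimes>\<^bsub>B\<^esub> h (frag_of (Y, Z, be', m, k))"
    using r a by (subst d(1)[symmetric]) (simp_all add: mem_box_gens)
  next
   fix Y Z be m k m' assume a: "Y : CS" "Z : CS" "be : bhm (Y ** Z) X" "m : ob M Y" "k : ob N Z"
    "m' : ob M Y"
   then have "frag_of (Y, Z, be, m +[M,Y] m', k) - frag_of (Y, Z, be, m, k) - frag_of (Y, Z, be, m', k) : box_rels n M N X"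
    unfolding box_rels_def
    by - (rule UnI1, rule UnI1, rule UnI2, rule CollectI, (rule exI)+, rule conjI, rule refl, simp add: mem_box_gens)
   then show "h (frag_of (Y, Z, be, m +[M,Y] m', k)) = h (frag_of (Y, Z, be, m, k)) \<otimes>\<^bsub>B\<^esub> h (frag_of (Y, Z, be, m', k))"
    using r a by (subst d(1)[symmetric]) (simp_all add: mem_box_gens M)
  next
   fix Y Z be m k k' assume a: "Y : CS" "Z : CS" "be : bhm (Y ** Z) X" "m : ob M Y" "k : ob N Z"
    "k' : ob N Z"
   then have "frag_of (Y, Z, be, m, k +[N,Z] k') - frag_of (Y, Z, be, m, k) - frag_of (Y, Z, be, m, k') : box_rels n M N X"
    unfolding box_rels_def
    by - (rule UnI1, rule UnI2, rule CollectI, (rule exI)+, rule conjI, rule refl, simp add: mem_box_gens)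
   then show "h (frag_of (Y, Z, be, m, k +[N,Z] k')) = h (frag_of (Y, Z, be, m, k)) \<otimes>\<^bsub>B\<^esub> h (frag_of (Y, Z, be, m, k'))"
    using r a by (subst d(1)[symmetric]) (simp_all add: mem_box_gens N)
  next
   fix Y Z Y' Z' be xi ze m k
   assume a: "Y : CS" "Z : CS" "Y' : CS" "Z' : CS" "be : bhm (Y' ** Z') X"
    "xi : bhm Y Y'" "ze : bhm Z Z'" "m : ob M Y" "k : ob N Z"
   then have "frag_of (Y, Z, bco (Y ** Z) X be (bpr Y Y' Z Z' xi ze), m, k)
    - frag_of (Y', Z', be, mor M Y Y' xi m, mor N Z Z' ze k) : box_rels n M N X"
    unfolding box_rels_def
    by - (rule UnI2, rule CollectI, (rule exI)+, rule conjI, rule refl, simp add: mem_box_gens)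
   then show "h (frag_of (Y, Z, bco (Y ** Z) X be (bpr Y Y' Z Z' xi ze), m, k)) =
    h (frag_of (Y', Z', be, mor M Y Y' xi m, mor N Z Z' ze k))"
    using r a bc[OF a(6,7) a(5)] by (subst d(2)[where c = "(Y', Z', be, mor M Y Y' xi m, mor N Z Z' ze k)", symmetric]) (simp_all add: mem_box_gens M N)
  qed
 next
  assume c: "coend_compatible M N X B (%g. h (frag_of g))"
  show "ALL r : box_rels n M N X. h r = \<one>\<^bsub>B\<^esub>"
  proof
   fix r assume "r : box_rels n M N X"
   then show "h r = \<one>\<^bsub>B\<^esub>" unfolding box_rels_def
   proof (elim UnE CollectE exE conjE)
    fix Y Z be be' m k assume a: "r = frag_of (Y, Z, badd n (Y ** Z) X be be', m, k) - frag_of (Y, Z, be, m, k) - frag_of (Y, Z, be', m, k)"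
     "(Y, Z, be, m, k) : box_gens n M N X" "(Y, Z, be', m, k) : box_gens n M N X"
    have g: "(Y, Z, badd n (Y ** Z) X be be', m, k) : box_gens n M N X" using a by (simp add: mem_box_gens)
    show ?thesis using d(1)[OF g a(2,3)] c a by (simp add: coend_compatible_def mem_box_gens)
   next
    fix Y Z be m m' k assume a: "r = frag_of (Y, Z, be, m +[M,Y] m', k) - frag_of (Y, Z, be, m, k) - frag_of (Y, Z, be, m', k)"
     "(Y, Z, be, m, k) : box_gens n M N X" "(Y, Z, be, m', k) : box_gens n M N X"
    have g: "(Y, Z, be, m +[M,Y] m', k) : box_gens n M N X" using a by (simp add: mem_box_gens M)
    show ?thesis using d(1)[OF g a(2,3)] c a by (simp add: coend_compatible_def mem_box_gens)
   next
    fix Y Z be m k k' assume a: "r = frag_of (Y, Z, be, m, k +[N,Z] k') - frag_of (Y, Z, be, m, k) - frag_of (Y, Z, be, m, k')"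
     "(Y, Z, be, m, k) : box_gens n M N X" "(Y, Z, be, m, k') : box_gens n M N X"
    have g: "(Y, Z, be, m, k +[N,Z] k') : box_gens n M N X" using a by (simp add: mem_box_gens N)
    show ?thesis using d(1)[OF g a(2,3)] c a by (simp add: coend_compatible_def mem_box_gens)
   next
    fix Y Z Y' Z' be xi ze m k
    assume a: "r = frag_of (Y, Z, bco (Y ** Z) X be (bpr Y Y' Z Z' xi ze), m, k)
     - frag_of (Y', Z', be, mor M Y Y' xi m, mor N Z Z' ze k)"
     "Y : CS" "Z : CS" "Y' : CS" "Z' : CS" "be : bhm (Y' ** Z') X"
     "xi : bhm Y Y'" "ze : bhm Z Z'" "m : ob M Y" "k : ob N Z"
    have g: "(Y, Z, bco (Y ** Z) X be (bpr Y Y' Z Z' xi ze), m, k) : box_gens n M N X"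
     "(Y', Z', be, mor M Y Y' xi m, mor N Z Z' ze k) : box_gens n M N X"
     using a bc[OF a(7,8,6)] by (simp_all add: mem_box_gens M N)
    show ?thesis using d(2)[OF g g(2)] c a by (simp add: coend_compatible_def)
   qed
  qed
 qed
qed

lemma box_rels_gens: assumes X: "X : CS" shows "box_rels n M N X <= carrier (free_Abelian_group (box_gens n M N X))"
proof -
 have k3: "frag_of a - frag_of b - frag_of c : carrier (free_Abelian_group S)" if "a : S" "b : S" "c : S" for a b c :: 'g and S
  using keys_diff[of "frag_of a - frag_of b" "frag_of c"] keys_diff[of "frag_of a" "frag_of b"] that by auto
 have k2: "frag_of a - frag_of b : carrier (free_Abelian_group S)" if "a : S" "b : S" for a b :: 'g and S
  using keys_diff[of "frag_of a" "frag_of b"] that by auto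
 show ?thesis
 proof
  fix r assume "r : box_rels n M N X"
  then show "r : carrier (free_Abelian_group (box_gens n M N X))" unfolding box_rels_def
  proof (elim UnE CollectE exE conjE)
   fix Y Z Y' Z' be xi ze m k
   assume a: "r = frag_of (Y, Z, bco (Y ** Z) X be (bpr Y Y' Z Z' xi ze), m, k)
     - frag_of (Y', Z', be, mor M Y Y' xi m, mor N Z Z' ze k)"
     "Y : CS" "Z : CS" "Y' : CS" "Z' : CS" "be : bhm (Y' ** Z') X"
     "xi : bhm Y Y'" "ze : bhm Z Z'" "m : ob M Y" "k : ob N Z"
   show ?thesis unfolding a(1)
    by (rule k2) (use a bcomp_closed[OF bprod_closed[OF a(7,8)] a(6)] in \<open>simp_all add: mem_box_gens M N\<close>)
  qed (hypsubst, rule k3; simp add: mem_box_gens M N)+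
 qed
qed

lemma box_sub_subgroup: "X : CS ==> subgroup (box_sub n M N X) (free_Abelian_group (box_gens n M N X))"
 unfolding box_sub_def by (rule group.generate_is_subgroup[OF group_free_Abelian_group box_rels_gens])

lemma box_sub_kill:
 assumes X: "X : CS" and h: "h : hom (free_Abelian_group (box_gens n M N X)) B" and B: "comm_group B"
  and c: "coend_compatible M N X B (%g. h (frag_of g))" and z: "z : box_sub n M N X"
 shows "h z = \<one>\<^bsub>B\<^esub>"
proof -
 interpret h: group_hom "free_Abelian_group (box_gens n M N X)" B h
  using h B by (intro group_hom.intro group_hom_axioms.intro) (auto simp: group_free_Abelian_group comm_group_def)
 have "box_rels n M N X <= kernel (free_Abelian_group (box_gens n M N X)) B h"
  using box_rels_kill_iff[OF X h B] c box_rels_gens[OF X] unfolding kernel_def by blast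
 then have "box_sub n M N X <= kernel (free_Abelian_group (box_gens n M N X)) B h"
  unfolding box_sub_def by (rule group.generate_subgroup_incl[OF group_free_Abelian_group _ h.subgroup_kernel])
 then show ?thesis using z unfolding kernel_def by blast
qed

lemma box_obj: "obj (bx M N) X = free_Abelian_group (box_gens n M N X) Mod box_sub n M N X"
 by (simp add: box_def)

lemma box_cls_eq: "box_cls n M N X = (%z. box_sub n M N X #>\<^bsub>free_Abelian_group (box_gens n M N X)\<^esub> z)"
 by (simp add: box_cls_def fun_eq_iff)

lemmas box_quotient = quotient_facts[OF abelian_free_Abelian_group box_sub_subgroup, folded box_obj box_cls_eq]

lemma box_image:
 assumes X: "X : CS" and h: "h : hom (free_Abelian_group (box_gens n M N X)) B" and B: "comm_group B"
  and c: "coend_compatible M N X B (%g. h (frag_of g))"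
 shows "Poly_Mapping.keys z <= box_gens n M N X ==> h ` (box_cls n M N X z) = {h z}"
  "(%c. the_elem (h ` c)) : hom (obj (bx M N) X) B"
proof -
 show "h ` (box_cls n M N X z) = {h z}" if "Poly_Mapping.keys z <= box_gens n M N X"
  unfolding box_cls_def
  by (rule hom_image_coset[OF abelian_free_Abelian_group box_sub_subgroup[OF X] h comm_group.axioms(2)[OF B]])
   (use box_sub_kill[OF X h B c] that in auto)
 show "(%c. the_elem (h ` c)) : hom (obj (bx M N) X) B"
  unfolding box_obj
  by (rule quotient_desc_hom[OF abelian_free_Abelian_group box_sub_subgroup[OF X] h comm_group.axioms(2)[OF B]])
   (rule box_sub_kill[OF X h B c])
qed

lemma bg_closed: "X : CS ==> g : box_gens n M N X ==> bg M N X g : ob (bx M N) X"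
 unfolding bg_def using box_quotient(2) by (rule hom_in_carrier) simp_all

lemma bg_compatible: "X : CS ==> coend_compatible M N X (obj (bx M N) X) (bg M N X)"
 unfolding bg_def
 by (subst box_rels_kill_iff[symmetric])
  (use box_quotient box_rels_gens in \<open>auto simp: box_sub_def intro!: box_quotient(4)[unfolded box_sub_def] generate.incl\<close>)

lemma box_induct:
 assumes X: "X : CS" and t: "t : ob (bx M N) X"
  and 1: "P \<one>\<^bsub>obj (bx M N) X\<^esub>" and m: "!!x y. x : ob (bx M N) X ==> y : ob (bx M N) X ==> P x ==> P y ==>
   P (x +[(bx M N),X] inv\<^bsub>obj (bx M N) X\<^esub> y)"
  and g: "!!g. g : box_gens n M N X ==> P (bg M N X g)"
 shows "P t"
proof -
 obtain z where z: "Poly_Mapping.keys z <= box_gens n M N X" "t = box_cls n M N X z"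
  using t unfolding box_quotient(3)[OF X] by auto
 interpret cls: group_hom "free_Abelian_group (box_gens n M N X)" "obj (bx M N) X" "box_cls n M N X"
  using box_quotient(1,2)[OF X] by (intro group_hom.intro group_hom_axioms.intro) (auto simp: group_free_Abelian_group comm_group_def)
 have "P (box_cls n M N X z)"
 proof (rule free_Abelian_group_induct[OF z(1)])
  show "P (box_cls n M N X 0)" using cls.hom_one 1 by simp
 next
  fix x y assume a: "Poly_Mapping.keys x <= box_gens n M N X" "Poly_Mapping.keys y <= box_gens n M N X"
   "P (box_cls n M N X x)" "P (box_cls n M N X y)"
  have "box_cls n M N X (x - y) = box_cls n M N X x +[(bx M N),X] inv\<^bsub>obj (bx M N) X\<^esub> box_cls n M N X y"
   using cls.hom_mult[of x "- y"] cls.hom_inv[of y] a by simp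
  then show "P (box_cls n M N X (x - y))"
   using m[of "box_cls n M N X x" "box_cls n M N X y"] a cls.hom_closed by simp
 next
  fix a assume "a : box_gens n M N X"
  then show "P (box_cls n M N X (frag_of a))" using g[of a] by (simp add: bg_def)
 qed
 then show ?thesis using z by simp
qed

text \<open>The classes of the generators of the coend generate its value as an abelian group.\<close>

lemma box_hom_eqI:
 assumes X: "X : CS" and t: "t : ob (bx M N) X" and B: "group B"
  and h: "h : hom (obj (bx M N) X) B" and h': "h' : hom (obj (bx M N) X) B"
  and eq: "!!g. g : box_gens n M N X ==> h (bg M N X g) = h' (bg M N X g)"
 shows "h t = h' t"
proof -
 interpret h: group_hom "obj (bx M N) X" B h
  using box_quotient(1)[OF X] B h by (intro group_hom.intro group_hom_axioms.intro) (auto simp: comm_group_def)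
 interpret h': group_hom "obj (bx M N) X" B h'
  using box_quotient(1)[OF X] B h' by (intro group_hom.intro group_hom_axioms.intro) (auto simp: comm_group_def)
 show ?thesis by (rule box_induct[OF X t]) (simp_all add: eq)
qed

lemma box_mor_facts:
 assumes X: "X : CS" "X' : CS" "xi : bhm X X'"
 shows "mor (bx M N) X X' xi : hom (obj (bx M N) X) (obj (bx M N) X')"
  "(Y, Z, be, m, k) : box_gens n M N X ==>
   mor (bx M N) X X' xi (bg M N X (Y, Z, be, m, k)) = bg M N X' (Y, Z, bco (Y ** Z) X' xi be, m, k)"
proof -
 define F :: "('a, 'b) boxgen => ('a, 'b) boxgen \<Rightarrow>\<^sub>0 int"
  where "F = (%(Y, Z, be, m, k). frag_of (Y, Z, bco (Y ** Z) X' xi be, m, k))"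
 have gen: "(Y, Z, bco (Y ** Z) X' xi be, m, k) : box_gens n M N X'" if "(Y, Z, be, m, k) : box_gens n M N X" for Y Z be m k
  using that X bcomp_closed[of be "Y ** Z" X xi X'] by (simp add: mem_box_gens)
 have kF: "Poly_Mapping.keys (F g) <= box_gens n M N X'" if "g : box_gens n M N X" for g
 proof -
  obtain Y Z be m k where g: "g = (Y, Z, be, m, k)" by (rule prod_cases5)
  show ?thesis using gen that unfolding F_def g by simp
 qed
 define H where "H = (%z. box_cls n M N X' (frag_extend F z))"
 have H: "H : hom (free_Abelian_group (box_gens n M N X)) (obj (bx M N) X')"
 proof (rule homI)
  have kFz: "Poly_Mapping.keys (frag_extend F z) <= box_gens n M N X'" if "Poly_Mapping.keys z <= box_gens n M N X" for z
   using keys_frag_extend[of F z] kF that by blast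
  fix z w assume "z : carrier (free_Abelian_group (box_gens n M N X))" "w : carrier (free_Abelian_group (box_gens n M N X))"
  then have zw: "frag_extend F z : carrier (free_Abelian_group (box_gens n M N X'))" "frag_extend F w : carrier (free_Abelian_group (box_gens n M N X'))"
   using kFz by simp_all
  show "H z : ob (bx M N) X'" unfolding H_def using box_quotient(2)[OF X(2)] zw(1) by (rule hom_in_carrier)
  show "H (z \<otimes>\<^bsub>free_Abelian_group (box_gens n M N X)\<^esub> w) = H z \<otimes>\<^bsub>obj (bx M N) X'\<^esub> H w"
   unfolding H_def using hom_mult[OF box_quotient(2)[OF X(2)] zw] by (simp add: frag_extend_add)
 qed
 have Hg: "H (frag_of (Y, Z, be, m, k)) = bg M N X' (Y, Z, bco (Y ** Z) X' xi be, m, k)" for Y Z be m k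
  by (simp add: H_def F_def bg_def)
 note bc = bg_compatible[OF X(2), unfolded coend_compatible_def]
 have c: "coend_compatible M N X (obj (bx M N) X') (%g. H (frag_of g))"
  unfolding coend_compatible_def Hg
 proof (intro conjI ballI)
  fix Y Z be m k be' assume a: "Y : CS" "Z : CS" "be : bhm (Y ** Z) X" "m : ob M Y" "k : ob N Z"
    "be' : bhm (Y ** Z) X"
  show "bg M N X' (Y, Z, bco (Y ** Z) X' xi (badd n (Y ** Z) X be be'), m, k) =
   bg M N X' (Y, Z, bco (Y ** Z) X' xi be, m, k) \<otimes>\<^bsub>obj (bx M N) X'\<^esub> bg M N X' (Y, Z, bco (Y ** Z) X' xi be', m, k)"
   using bc a X bcomp_closed[OF a(3) X(3) X(1)] bcomp_closed[OF a(6) X(3) X(1)] by (simp add: bcomp_badd_right[where Y = X])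
 next
  fix Y Z be m k m' assume a: "Y : CS" "Z : CS" "be : bhm (Y ** Z) X" "m : ob M Y" "k : ob N Z" "m' : ob M Y"
  show "bg M N X' (Y, Z, bco (Y ** Z) X' xi be, m +[M,Y] m', k) =
   bg M N X' (Y, Z, bco (Y ** Z) X' xi be, m, k) \<otimes>\<^bsub>obj (bx M N) X'\<^esub> bg M N X' (Y, Z, bco (Y ** Z) X' xi be, m', k)"
   using bc a bcomp_closed[OF a(3) X(3) X(1)] by simp
 next
  fix Y Z be m k k' assume a: "Y : CS" "Z : CS" "be : bhm (Y ** Z) X" "m : ob M Y" "k : ob N Z" "k' : ob N Z"
  show "bg M N X' (Y, Z, bco (Y ** Z) X' xi be, m, k +[N,Z] k') =
   bg M N X' (Y, Z, bco (Y ** Z) X' xi be, m, k) \<otimes>\<^bsub>obj (bx M N) X'\<^esub> bg M N X' (Y, Z, bco (Y ** Z) X' xi be, m, k')"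
   using bc a bcomp_closed[OF a(3) X(3) X(1)] by simp
 next
  fix Y Z Y' Z' be xi' ze m k
  assume a: "Y : CS" "Z : CS" "Y' : CS" "Z' : CS" "be : bhm (Y' ** Z') X"
    "xi' : bhm Y Y'" "ze : bhm Z Z'" "m : ob M Y" "k : ob N Z"
  show "bg M N X' (Y, Z, bco (Y ** Z) X' xi (bco (Y ** Z) X be (bpr Y Y' Z Z' xi' ze)), m, k) =
    bg M N X' (Y', Z', bco (Y' ** Z') X' xi be, mor M Y Y' xi' m, mor N Z Z' ze k)"
   using bc a bcomp_closed[OF a(5) X(3) X(1)] bcomp_assoc[OF bprod_closed[OF a(6,7)] a(5) X(3)] X by simp
 qed
 have mor: "mor (bx M N) X X' xi = (%c. the_elem (H ` c))"
  by (simp add: box_def H_def F_def fun_eq_iff)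
 show "mor (bx M N) X X' xi : hom (obj (bx M N) X) (obj (bx M N) X')"
  unfolding mor by (rule box_image(2)[OF X(1) H box_quotient(1)[OF X(2)] c])
 show "mor (bx M N) X X' xi (bg M N X (Y, Z, be, m, k)) = bg M N X' (Y, Z, bco (Y ** Z) X' xi be, m, k)"
  if "(Y, Z, be, m, k) : box_gens n M N X"
  unfolding mor bg_def[of M N X] using box_image(1)[OF X(1) H box_quotient(1)[OF X(2)] c, of "frag_of (Y, Z, be, m, k)"] that Hg by simp
qed

lemma box_mackey: "mackey (bx M N)"
 unfolding mackey_functor_def
proof (intro conjI ballI)
 note grp = comm_group.axioms(2)[OF box_quotient(1)]
 fix X t assume X: "X : CS" and t: "t : ob (bx M N) X"
 have "mor (bx M N) X X (bd X) t = (%t. t) t"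
 proof (rule box_hom_eqI[OF X t grp[OF X] box_mor_facts(1)[OF X X bid_closed[OF X]]])
  fix g assume g: "g : box_gens n M N X"
  obtain Y Z be m k where g': "g = (Y, Z, be, m, k)" by (rule prod_cases5)
  show "mor (bx M N) X X (bd X) (bg M N X g) = bg M N X g"
   using g box_mor_facts(2)[OF X X bid_closed[OF X] g[unfolded g']] X unfolding g' by (simp add: mem_box_gens)
 qed (simp add: hom_def)
 then show "mor (bx M N) X X (bd X) t = t" .
next
 note grp = comm_group.axioms(2)[OF box_quotient(1)]
 fix X Y Z al be t assume a: "X : CS" "Y : CS" "Z : CS" "al : bhm X Y" "be : bhm Y Z"
  and t: "t : ob (bx M N) X"
 note ba = bcomp_closed[OF a(4,5,2)]
 show "mor (bx M N) X Z (bco X Z be al) t = mor (bx M N) Y Z be (mor (bx M N) X Y al t)"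
 proof (rule box_hom_eqI[OF a(1) t grp[OF a(3)] box_mor_facts(1)[OF a(1,3) ba],
    where h' = "%t. mor (bx M N) Y Z be (mor (bx M N) X Y al t)"])
  show "(%t. mor (bx M N) Y Z be (mor (bx M N) X Y al t)) : hom (obj (bx M N) X) (obj (bx M N) Z)"
   using hom_compose[OF box_mor_facts(1)[OF a(1,2,4)] box_mor_facts(1)[OF a(2,3,5)]] by (simp add: o_def)
  fix g assume g: "g : box_gens n M N X"
  obtain V W ga m k where g': "g = (V, W, ga, m, k)" by (rule prod_cases5)
  have g2: "(V, W, bco (V ** W) Y al ga, m, k) : box_gens n M N Y"
   using g a bcomp_closed[of ga "V ** W" X al Y] unfolding g' by (simp add: mem_box_gens)
  show "mor (bx M N) X Z (bco X Z be al) (bg M N X g) = mor (bx M N) Y Z be (mor (bx M N) X Y al (bg M N X g))"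
   using g unfolding g' box_mor_facts(2)[OF a(1,3) ba g[unfolded g']] box_mor_facts(2)[OF a(1,2,4) g[unfolded g']]
    box_mor_facts(2)[OF a(2,3,5) g2] by (subst bcomp_assoc[of ga _ X]) (use a in \<open>simp_all add: mem_box_gens\<close>)
 qed
next
 note grp = comm_group.axioms(2)[OF box_quotient(1)]
 fix X Y al be t assume a: "X : CS" "Y : CS" "al : bhm X Y" "be : bhm X Y"
  and t: "t : ob (bx M N) X"
 show "mor (bx M N) X Y (badd n X Y al be) t = mor (bx M N) X Y al t +[(bx M N),Y] mor (bx M N) X Y be t"
 proof (rule box_hom_eqI[OF a(1) t grp[OF a(2)] box_mor_facts(1)[OF a(1,2) badd_closed[OF a(3,4)]],
    where h' = "%t. mor (bx M N) X Y al t +[(bx M N),Y] mor (bx M N) X Y be t"])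
  show "(%t. mor (bx M N) X Y al t +[(bx M N),Y] mor (bx M N) X Y be t) : hom (obj (bx M N) X) (obj (bx M N) Y)"
   by (rule comm_group.hom_group_mult[OF box_quotient(1)[OF a(2)] box_mor_facts(1)[OF a(1,2,3)] box_mor_facts(1)[OF a(1,2,4)]])
  fix g assume g: "g : box_gens n M N X"
  obtain V W ga m k where g': "g = (V, W, ga, m, k)" by (rule prod_cases5)
  have v: "V : CS" "W : CS" "ga : bhm (V ** W) X" "m : ob M V" "k : ob N W"
   using g unfolding g' by (simp_all add: mem_box_gens)
  show "mor (bx M N) X Y (badd n X Y al be) (bg M N X g) = mor (bx M N) X Y al (bg M N X g) +[(bx M N),Y] mor (bx M N) X Y be (bg M N X g)"
   unfolding g' box_mor_facts(2)[OF a(1,2) badd_closed[OF a(3,4)] g[unfolded g']]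
    box_mor_facts(2)[OF a(1,2,3) g[unfolded g']] box_mor_facts(2)[OF a(1,2,4) g[unfolded g']]
   using bg_compatible[OF a(2), unfolded coend_compatible_def] v a bcomp_closed[OF v(3) a(3) a(1)] bcomp_closed[OF v(3) a(4) a(1)]
   by (simp add: bcomp_badd_left[where Y = X])
 qed
qed (simp_all add: box_quotient(1) box_mor_facts(1))

end

declare box_mackey [simp]

lemma coend_compatible_natural:
 assumes "coend_compatible M N X B f" "Y : CS" "Z : CS" "Y' : CS" "Z' : CS"
  "be : bhm (Y' ** Z') X" "xi : bhm Y Y'" "ze : bhm Z Z'" "m : ob M Y" "k : ob N Z"
 shows "f (Y, Z, bco (Y ** Z) X be (bpr Y Y' Z Z' xi ze), m, k) = f (Y', Z', be, mor M Y Y' xi m, mor N Z Z' ze k)"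
 using assms unfolding coend_compatible_def by blast

lemma bg_pair:
 assumes M: "mackey M" and N: "mackey N" and X: "X : CS"
  and g: "(Y, Z, be, m, k) : box_gens n M N X"
 shows "bg M N X (Y, Z, be, m, k) = mor (bx M N) (Y ** Z) X be (bp M N Y Z m k)"
proof -
 have g': "Y : CS" "Z : CS" "be : bhm (Y ** Z) X" "m : ob M Y" "k : ob N Z"
  using g by (simp_all add: mem_box_gens[OF M N])
 have "(Y, Z, bd (Y ** Z), m, k) : box_gens n M N (Y ** Z)"
  using g' by (simp add: mem_box_gens[OF M N])
 from box_mor_facts(2)[OF M N _ X g'(3) this] show ?thesis
  using g' X by (simp add: bg_def box_pair_def)
qed

lemma bilin_pair: assumes M: "mackey M" and N: "mackey N"
 shows "bilin M N (bx M N) (bp M N)"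
proof -
 have bp: "bp M N Y Z m k = bg M N (Y ** Z) (Y, Z, bd (Y ** Z), m, k)" for Y Z m k
  by (simp add: bg_def box_pair_def)
 note bc = bg_compatible[OF M N, unfolded coend_compatible_def]
 show ?thesis
 proof (rule bilinI)
  fix Y Z m k assume "Y : CS" "Z : CS" "m : ob M Y" "k : ob N Z"
  then show "bp M N Y Z m k : ob (bx M N) (Y ** Z)"
   unfolding bp by (intro bg_closed[OF M N]) (simp_all add: mem_box_gens[OF M N])
 next
  fix Y Z m m' k assume "Y : CS" "Z : CS" "m : ob M Y" "m' : ob M Y" "k : ob N Z"
  then show "bp M N Y Z (m +[M,Y] m') k = bp M N Y Z m k +[(bx M N),(Y ** Z)] bp M N Y Z m' k"
   unfolding bp using bc[of "Y ** Z"] by simp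
 next
  fix Y Z m k k' assume "Y : CS" "Z : CS" "m : ob M Y" "k : ob N Z" "k' : ob N Z"
  then show "bp M N Y Z m (k +[N,Z] k') = bp M N Y Z m k +[(bx M N),(Y ** Z)] bp M N Y Z m k'"
   unfolding bp using bc[of "Y ** Z"] by simp
 next
  fix Y Z Y' Z' xi ze m k
  assume a: "Y : CS" "Z : CS" "Y' : CS" "Z' : CS" "xi : bhm Y Y'" "ze : bhm Z Z'"
   "m : ob M Y" "k : ob N Z"
  note b = bprod_closed[OF a(5,6)]
  have "bg M N (Y' ** Z') (Y', Z', bd (Y' ** Z'), mor M Y Y' xi m, mor N Z Z' ze k) =
   bg M N (Y' ** Z') (Y, Z, bco (Y ** Z) (Y' ** Z') (bd (Y' ** Z')) (bpr Y Y' Z Z' xi ze), m, k)"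
   by (rule coend_compatible_natural[OF bg_compatible[OF M N], symmetric]) (use a in simp_all)
  also have "... = bg M N (Y' ** Z') (Y, Z, bpr Y Y' Z Z' xi ze, m, k)" using a b by simp
  also have "... = mor (bx M N) (Y ** Z) (Y' ** Z') (bpr Y Y' Z Z' xi ze) (bp M N Y Z m k)"
   by (rule bg_pair[OF M N]) (use a b in \<open>simp_all add: mem_box_gens[OF M N]\<close>)
  finally show "bp M N Y' Z' (mor M Y Y' xi m) (mor N Z Z' ze k) =
   mor (bx M N) (Y ** Z) (Y' ** Z') (bpr Y Y' Z Z' xi ze) (bp M N Y Z m k)"
   unfolding bp .
 qed
qed

lemma box_pair_closed [simp]: "mackey M ==> mackey N ==> Y : CS ==> Z : CS ==>
  m : ob M Y ==> k : ob N Z ==> bp M N Y Z m k : ob (bx M N) (Y ** Z)"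
 by (rule bilinD(1)[OF bilin_pair])

lemma hom_eq_on:
 assumes "h : hom A B" "group A" "!!x. x : carrier A ==> h x = h' x"
 shows "h' : hom A B"
proof (rule homI)
 fix x y assume xy: "x : carrier A" "y : carrier A"
 then show "h' x : carrier B" using assms(3)[of x] hom_in_carrier[OF assms(1)] by metis
 have "x \<otimes>\<^bsub>A\<^esub> y : carrier A" using xy assms(2) by (simp add: group.is_monoid monoid.m_closed)
 then show "h' (x \<otimes>\<^bsub>A\<^esub> y) = h' x \<otimes>\<^bsub>B\<^esub> h' y"
  using hom_mult[OF assms(1) xy] assms(3) xy by metis
qed

text \<open>Universal property of the box product. The lift sends the class of (\<beta>, m, k) to the image of
the pairing of m and k under \<beta>, which respects the coend relations because the pairing is natural and biadditive.\<close>

theorem box_lift_facts: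
 assumes M: "mackey M" and N: "mackey N" and L: "mackey L" and pp: "bilin M N L pp"
 shows "box_lift L pp : mhm (bx M N) L"
  "Y : CS ==> Z : CS ==> m : ob M Y ==> k : ob N Z ==> box_lift L pp (Y ** Z) (bp M N Y Z m k) = pp Y Z m k"
proof -
 note ppD = bilinD[OF pp]
 define f where "f X = (%(Y, Z, be, m, k). mor L (Y ** Z) X be (pp Y Z m k))" for X
 have f_closed: "f X ` box_gens n M N X <= ob L X" if X: "X : CS" for X
 proof
  fix y assume "y : f X ` box_gens n M N X"
  then obtain g where g: "g : box_gens n M N X" "y = f X g" by blast
  obtain Y Z be m k where "g = (Y, Z, be, m, k)" by (rule prod_cases5)
  then show "y : ob L X" using g X by (simp add: f_def mem_box_gens[OF M N] L ppD(1))
 qed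
 have *: "box_lift L pp X : hom (obj (bx M N) X) (obj L X) &
   (ALL g : box_gens n M N X. box_lift L pp X (bg M N X g) = f X g)" if X: "X : CS" for X
 proof -
  note LX = mackeyD(1)[OF L X]
  let ?F = "%z. finprod (obj L X) (%a. f X a [^]\<^bsub>obj L X\<^esub> Poly_Mapping.lookup z a) (Poly_Mapping.keys z)"
  obtain h where h: "h : hom (free_Abelian_group (box_gens n M N X)) (obj L X)"
   and h2: "ALL x : box_gens n M N X. h (frag_of x) = f X x"
   and h3: "ALL z. Poly_Mapping.keys z <= box_gens n M N X --> h z = ?F z"
   using free_hom_finprod[OF LX f_closed[OF X]] by (elim bexE conjE)
  have c0: "coend_compatible M N X (obj L X) (f X)"
   unfolding coend_compatible_def
  proof (intro conjI ballI)
   fix Y Z Y' Z' be xi ze m k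
   assume a: "Y : CS" "Z : CS" "Y' : CS" "Z' : CS" "be : bhm (Y' ** Z') X"
     "xi : bhm Y Y'" "ze : bhm Z Z'" "m : ob M Y" "k : ob N Z"
   show "f X (Y, Z, bco (Y ** Z) X be (bpr Y Y' Z Z' xi ze), m, k) = f X (Y', Z', be, mor M Y Y' xi m, mor N Z Z' ze k)"
    using mackeyD(4)[OF L _ _ X bprod_closed[OF a(6,7)] a(5) ppD(1)[OF a(1,2,8,9)]] ppD(4)[OF a(1,2,3,4,6,7,8,9)] a
    by (simp add: f_def)
  qed (use X in \<open>simp_all add: f_def mackeyD(5)[OF L] ppD mor_mult[OF L]\<close>)
  have c: "coend_compatible M N X (obj L X) (%g. h (frag_of g))"
  proof -
   have eq: "h (frag_of (Y, Z, be, m, k)) = f X (Y, Z, be, m, k)"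
    if "Y : CS" "Z : CS" "be : bhm (Y ** Z) X" "m : ob M Y" "k : ob N Z" for Y Z be m k
    using h2 that by (simp add: mem_box_gens[OF M N])
   show ?thesis using c0 bcomp_closed[OF bprod_closed]
    unfolding coend_compatible_def by (simp add: eq M N)
  qed
  have lift: "box_lift L pp X = (%c. the_elem (?F ` c))"
   by (simp add: box_lift_def f_def case_prod_unfold)
  have F: "?F ` c = h ` c" if cob: "c : ob (bx M N) X" for c
  proof -
   obtain z where z: "Poly_Mapping.keys z <= box_gens n M N X" "c = box_cls n M N X z"
    using cob unfolding box_quotient(3)[OF M N X] by auto
   have "c <= carrier (free_Abelian_group (box_gens n M N X))"
    unfolding z(2) box_cls_def by (rule monoid.r_coset_subset_G[OF group.is_monoid[OF group_free_Abelian_group]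
      subgroup.subset[OF box_sub_subgroup[OF M N X]]]) (use z in simp)
   then show ?thesis using h3 by (intro image_cong) auto
  qed
  have "box_lift L pp X : hom (obj (bx M N) X) (obj L X)"
  proof (rule hom_eq_on[OF box_image(2)[OF M N X h LX c] ob_group[OF box_mackey[OF M N] X]])
   show "the_elem (h ` c) = box_lift L pp X c" if "c : ob (bx M N) X" for c
    unfolding lift using F[OF that] by simp
  qed
  moreover have "box_lift L pp X (bg M N X g) = f X g" if g: "g : box_gens n M N X" for g
   using F[OF bg_closed[OF M N X g]] box_image(1)[OF M N X h LX c, of "frag_of g"] h2 g
   unfolding lift bg_def by simp
  ultimately show ?thesis by blast
 qed
 have val: "box_lift L pp X (bg M N X (Y, Z, be, m, k)) = mor L (Y ** Z) X be (pp Y Z m k)"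
  if "X : CS" "(Y, Z, be, m, k) : box_gens n M N X" for X Y Z be m k
  using *[OF that(1)] that(2) unfolding f_def by fastforce
 show "box_lift L pp : mhm (bx M N) L"
  unfolding mack_hom_def
 proof (intro CollectI conjI ballI)
  fix X X' xi t assume X: "X : CS" "X' : CS" "xi : bhm X X'" and t: "t : ob (bx M N) X"
  show "box_lift L pp X' (mor (bx M N) X X' xi t) = mor L X X' xi (box_lift L pp X t)"
  proof (rule box_hom_eqI[OF M N X(1) t ob_group[OF L X(2)],
    where h = "%t. box_lift L pp X' (mor (bx M N) X X' xi t)" and h' = "%t. mor L X X' xi (box_lift L pp X t)"])
   show "(%t. box_lift L pp X' (mor (bx M N) X X' xi t)) : hom (obj (bx M N) X) (obj L X')"
    using hom_compose[OF box_mor_facts(1)[OF M N X] conjunct1[OF *[OF X(2)]]] by (simp add: o_def)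
   show "(%t. mor L X X' xi (box_lift L pp X t)) : hom (obj (bx M N) X) (obj L X')"
    using hom_compose[OF conjunct1[OF *[OF X(1)]] mackeyD(2)[OF L X]] by (simp add: o_def)
   fix g assume g: "g : box_gens n M N X"
   obtain Y Z be m k where g': "g = (Y, Z, be, m, k)" by (rule prod_cases5)
   have v: "Y : CS" "Z : CS" "be : bhm (Y ** Z) X" "m : ob M Y" "k : ob N Z"
    using g unfolding g' by (simp_all add: mem_box_gens[OF M N])
   have g2: "(Y, Z, bco (Y ** Z) X' xi be, m, k) : box_gens n M N X'"
    using v bcomp_closed[OF v(3) X(3) X(1)] by (simp add: mem_box_gens[OF M N])
   show "box_lift L pp X' (mor (bx M N) X X' xi (bg M N X g)) = mor L X X' xi (box_lift L pp X (bg M N X g))"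
    unfolding g' box_mor_facts(2)[OF M N X g[unfolded g']] val[OF X(1) g[unfolded g']] val[OF X(2) g2]
    using v X by (simp add: mackeyD(4)[OF L] ppD(1))
  qed
 qed (use * in blast)
 assume v: "Y : CS" "Z : CS" "m : ob M Y" "k : ob N Z"
 have "(Y, Z, bd (Y ** Z), m, k) : box_gens n M N (Y ** Z)" using v by (simp add: mem_box_gens[OF M N])
 from val[OF _ this] show "box_lift L pp (Y ** Z) (bp M N Y Z m k) = pp Y Z m k"
  using v by (simp add: bg_def box_pair_def mackeyD(3)[OF L] ppD(1))
qed

section \<open>Generators of box products, and biadditive pairings\<close>

text \<open>The class of (\<beta>, m, k) is the image under \<beta> of the class of the pair (m, k).\<close>

lemma mgen_box_pair:
 assumes M: "mackey M" and N: "mackey N"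
 shows "mgen (bx M N) (%X t. EX Y Z m k. Y : CS & Z : CS & m : ob M Y & k : ob N Z &
  X = Y ** Z & t = bp M N Y Z m k)"
 unfolding mgen_def
proof (intro conjI allI impI ballI)
 fix P X t assume P: "subfun (bx M N) P" "ALL X : CS. ALL t. (EX Y Z m k. Y : CS & Z : CS & m : ob M Y &
   k : ob N Z & X = Y ** Z & t = bp M N Y Z m k) --> P X t"
  and X: "X : CS" and t: "t : ob (bx M N) X"
 interpret B: comm_group "obj (bx M N) X" using box_quotient(1)[OF M N X] .
 show "P X t"
 proof (rule box_induct[OF M N X t])
  fix g assume g: "g : box_gens n M N X"
  obtain Y Z be m k where g': "g = (Y, Z, be, m, k)" by (rule prod_cases5)
  have v: "Y : CS" "Z : CS" "be : bhm (Y ** Z) X" "m : ob M Y" "k : ob N Z"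
   using g unfolding g' by (simp_all add: mem_box_gens[OF M N])
  have "P (Y ** Z) (bp M N Y Z m k)" using P(2) v cprod_csets[OF v(1,2)] by blast
  then show "P X (bg M N X g)" unfolding g' bg_pair[OF M N X g[unfolded g']]
   using P(1) v X cprod_csets[OF v(1,2)] box_pair_closed[OF M N v(1,2,4,5)] unfolding subfun_def by blast
 qed (use P(1) X in \<open>auto simp: subfun_def\<close>)
qed (use M N in auto)

text \<open>With one variable fixed, a pairing is a map into the functor shifted by the other variable.\<close>

definition lshift where
 "lshift K Z = \<lparr>obj = (%X. obj K (Z ** X)),
  mor = (%X Y be. mor K (Z ** X) (Z ** Y) (bpr Z Z X Y (bd Z) be))\<rparr>"

lemma shift_simps [simp]:
 "obj (shift n K Z) X = obj K (X ** Z)" "obj (lshift K Z) X = obj K (Z ** X)"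
 "mor (shift n K Z) X Y be = mor K (X ** Z) (Y ** Z) (bpr X Y Z Z be (bd Z))"
 "mor (lshift K Z) X Y be = mor K (Z ** X) (Z ** Y) (bpr Z Z X Y (bd Z) be)"
 by (simp_all add: shift_def lshift_def)

lemma bprod_bcomp_bid:
 assumes "al : bhm X Y" "be : bhm Y Z" "X : CS" "Y : CS" "Z : CS" "W : CS"
 shows "bpr X Z W W (bco X Z be al) (bd W) =
   bco (X ** W) (Z ** W) (bpr Y Z W W be (bd W)) (bpr X Y W W al (bd W))"
  "bpr W W X Z (bd W) (bco X Z be al) =
   bco (W ** X) (W ** Z) (bpr W W Y Z (bd W) be) (bpr W W X Y (bd W) al)"
 using bprod_bcomp[OF assms(1,2) bid_closed bid_closed] bprod_bcomp[OF bid_closed bid_closed assms(1,2)] assms by simp_all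

lemma shift_mackey [simp]: assumes K: "mackey K" and Z: "Z : CS" shows "mackey (shift n K Z)"
 unfolding mackey_functor_def
 using mackeyD(1)[OF K] mackeyD(2)[OF K] Z
 by (simp add: mackeyD(3,4,5)[OF K] bprod_bcomp_bid bprod_badd_left)

lemma lshift_mackey [simp]: assumes K: "mackey K" and Z: "Z : CS" shows "mackey (lshift K Z)"
 unfolding mackey_functor_def
 using mackeyD(1)[OF K] mackeyD(2)[OF K] Z
 by (simp add: mackeyD(3,4,5)[OF K] bprod_bcomp_bid bprod_badd_right)

lemma bilin_fix_right: assumes b: "bilin M N L pp" and N: "mackey N" and Z: "Z : CS" and k: "k : ob N Z"
 shows "(%Y m. pp Y Z m k) : mhm M (shift n L Z)"
proof (rule mack_homI)
 fix X Y be x assume a: "X : CS" "Y : CS" "be : bhm X Y" "x : ob M X"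
 show "pp Y Z (mor M X Y be x) k = mor (shift n L Z) X Y be (pp X Z x k)"
  using bilinD(4)[OF b a(1) Z a(2) Z a(3) bid_closed[OF Z] a(4) k] mackeyD(3)[OF N Z k] by simp
qed (use bilinD[OF b _ Z] k in simp_all)

lemma bilin_fix_left: assumes b: "bilin M N L pp" and M: "mackey M" and Y: "Y : CS" and m: "m : ob M Y"
 shows "(%Z k. pp Y Z m k) : mhm N (lshift L Y)"
proof (rule mack_homI)
 fix X Z be x assume a: "X : CS" "Z : CS" "be : bhm X Z" "x : ob N X"
 show "pp Y Z m (mor N X Z be x) = mor (lshift L Y) X Z be (pp Y X m x)"
  using bilinD(4)[OF b Y a(1) Y a(2) bid_closed[OF Y] a(3) m a(4)] mackeyD(3)[OF M Y m] by simp
qed (use bilinD[OF b Y] m in simp_all)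

lemma subfun_shift: assumes P: "subfun L P" and Z: "Z : CS"
 shows "subfun (shift n L Z) (%X. P (X ** Z))" "subfun (lshift L Z) (%X. P (Z ** X))"
 using P Z unfolding subfun_def by simp_all

text \<open>Generation in two variables, from generation in each with the other variable fixed.\<close>

lemma bilin_gen:
 assumes b: "bilin M N L pp" and M: "mackey M" and N: "mackey N" and L: "mackey L"
  and Q: "mgen M Q" "mgen N Q'" and P: "subfun L P"
  and gen: "!!Y Z m k. Y : CS ==> Z : CS ==> Q Y m ==> Q' Z k ==> P (Y ** Z) (pp Y Z m k)"
  and v: "Y : CS" "Z : CS" "m : ob M Y" "k : ob N Z"
 shows "P (Y ** Z) (pp Y Z m k)"
proof -
 have 1: "P (Y ** Z) (pp Y Z m k)" if v: "Y : CS" "Z : CS" "m : ob M Y" and k: "Q' Z k" for Y Z m k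
 proof (rule mgen_induct[OF Q(1) _ _ v(1,3)])
  show "subfun M (%Y m. P (Y ** Z) (pp Y Z m k))"
   by (rule subfun_pullback[OF bilin_fix_right[OF b N v(2) mgenD[OF Q(2) v(2) k]] M shift_mackey[OF L v(2)] subfun_shift(1)[OF P v(2)]])
 qed (use gen v k in blast)
 show ?thesis
 proof (rule mgen_induct[OF Q(2) _ _ v(2,4)])
  show "subfun N (%Z k. P (Y ** Z) (pp Y Z m k))"
   by (rule subfun_pullback[OF bilin_fix_left[OF b M v(1,3)] N lshift_mackey[OF L v(1)] subfun_shift(2)[OF P v(1)]])
 qed (use 1 v in blast)
qed

lemma bilin_eqI:
 assumes b: "bilin M N L pp" "bilin M N L pp'" and M: "mackey M" and N: "mackey N" and L: "mackey L"
  and Q: "mgen M Q" "mgen N Q'"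
  and gen: "!!Y Z m k. Y : CS ==> Z : CS ==> Q Y m ==> Q' Z k ==> pp Y Z m k = pp' Y Z m k"
  and v: "Y : CS" "Z : CS" "m : ob M Y" "k : ob N Z"
 shows "pp Y Z m k = pp' Y Z m k"
proof -
 have 1: "pp Y Z m k = pp' Y Z m k" if v: "Y : CS" "Z : CS" "m : ob M Y" and k: "Q' Z k" for Y Z m k
  by (rule mack_hom_eqI[OF Q(1) bilin_fix_right[OF b(1) N v(2) mgenD[OF Q(2) v(2) k]]
     bilin_fix_right[OF b(2) N v(2) mgenD[OF Q(2) v(2) k]] M shift_mackey[OF L v(2)] _ v(1,3)])
   (use gen v k in blast)
 show ?thesis
  by (rule mack_hom_eqI[OF Q(2) bilin_fix_left[OF b(1) M v(1,3)] bilin_fix_left[OF b(2) M v(1,3)] N lshift_mackey[OF L v(1)] _ v(2,4)])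
   (use 1 v in blast)
qed

lemma mgen_bilin:
 assumes b: "bilin M N L pp" and M: "mackey M" and N: "mackey N" and L: "mackey L"
  and Q: "mgen M Q" "mgen N Q'"
  and all: "mgen L (%X t. EX Y Z m k. Y : CS & Z : CS & m : ob M Y & k : ob N Z & X = Y ** Z & t = pp Y Z m k)"
 shows "mgen L (%X t. EX Y Z m k. Y : CS & Z : CS & Q Y m & Q' Z k & X = Y ** Z & t = pp Y Z m k)"
 unfolding mgen_def
proof (intro conjI allI impI ballI)
 fix X t assume "X : CS" "EX Y Z m k. Y : CS & Z : CS & Q Y m & Q' Z k & X = Y ** Z & t = pp Y Z m k"
 then show "t : ob L X" using bilinD(1)[OF b] mgenD[OF Q(1)] mgenD[OF Q(2)] by blast
next
 fix P X t assume P: "subfun L P" "ALL X : CS. ALL t. (EX Y Z m k. Y : CS & Z : CS & Q Y m & Q' Z k &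
   X = Y ** Z & t = pp Y Z m k) --> P X t" and X: "X : CS" and t: "t : ob L X"
 show "P X t"
 proof (rule mgen_induct[OF all P(1) _ X t])
  fix X t assume "X : CS" "EX Y Z m k. Y : CS & Z : CS & m : ob M Y & k : ob N Z & X = Y ** Z & t = pp Y Z m k"
  then obtain Y Z m k where v: "Y : CS" "Z : CS" "m : ob M Y" "k : ob N Z" "X = Y ** Z" "t = pp Y Z m k" by blast
  have "P (Y ** Z) (pp Y Z m k)"
   by (rule bilin_gen[OF b M N L Q P(1) _ v(1-4)]) (use P(2) cprod_csets in blast)
  then show "P X t" using v by simp
 qed
qed

lemma bilin_comp: "ph : mhm L L' ==> bilin M N L pp ==> bilin M N L' (%Y Z m k. ph (Y ** Z) (pp Y Z m k))"
 by (rule bilinI) (simp_all add: bilinD[of M N L pp] mhD[of ph L L'])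

lemma bilin_pre: "ph : mhm M' M ==> ps : mhm N' N ==> bilin M N L pp ==> bilin M' N' L (%Y Z m k. pp Y Z (ph Y m) (ps Z k))"
 by (rule bilinI) (simp_all add: bilinD[of M N L pp] mhD[of ph M' M] mhD[of ps N' N])

lemma mack_hom_bilin: "ph : mhm (bx M N) L ==> mackey M ==> mackey N ==>
  bilin M N L (%Y Z m k. ph (Y ** Z) (bp M N Y Z m k))"
 by (rule bilin_comp[OF _ bilin_pair])

lemma bilin_swap: assumes b: "bilin M N L pp" and L: "mackey L"
 shows "bilin N M L (%Y Z k m. tr L (Z ** Y) (Y ** Z) fsw (pp Z Y m k))"
proof (rule bilinI)
 fix Y Z Y' Z' xi ze m k
 assume a: "Y : CS" "Z : CS" "Y' : CS" "Z' : CS" "xi : bhm Y Y'" "ze : bhm Z Z'"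
   "m : ob N Y" "k : ob M Z"
 have e: "fsw : emaps (Z ** Y) (Y ** Z)" "fsw : emaps (Z' ** Y') (Y' ** Z')" using a by simp_all
 show "tr L (Z' ** Y') (Y' ** Z') fsw (pp Z' Y' (mor M Z Z' ze k) (mor N Y Y' xi m)) =
  mor L (Y ** Z) (Y' ** Z') (bpr Y Y' Z Z' xi ze) (tr L (Z ** Y) (Y ** Z) fsw (pp Z Y k m))"
  unfolding tr_def using bgraph_closed[OF e(1)] bgraph_closed[OF e(2)] a
  by (simp add: bilinD(4)[OF b] bilinD(1)[OF b] mackeyD(4)[OF L] fsw_natural)
qed (simp_all add: bilinD[OF b] L tr_mult)

lemma bilin_tr: assumes b: "bilin M N L pp" and f: "f : emaps Y Y'" "f' : emaps Z Z'"
  and v: "Y : CS" "Z : CS" "Y' : CS" "Z' : CS" "m : ob M Y" "k : ob N Z"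
 shows "pp Y' Z' (tr M Y Y' f m) (tr N Z Z' f' k) = tr L (Y ** Z) (Y' ** Z') (fpm f f') (pp Y Z m k)"
 unfolding tr_def bilinD(4)[OF b v(1-4) bgraph_closed[OF f(1) v(1)] bgraph_closed[OF f(2) v(2)] v(5,6)]
 by (simp add: bprod_bgraph[OF f v(1,3,2,4)])

lemma bilin_tr_left: assumes b: "bilin M N L pp" and N: "mackey N" and f: "f : emaps Y Y'"
  and v: "Y : CS" "Z : CS" "Y' : CS" "m : ob M Y" "k : ob N Z"
 shows "pp Y' Z (tr M Y Y' f m) k = tr L (Y ** Z) (Y' ** Z) (fpm f (%x. x)) (pp Y Z m k)"
 using bilin_tr[OF b f, of "%x. x" Z Z m k] v N by simp

lemma bilin_tr_right: assumes b: "bilin M N L pp" and M: "mackey M" and f: "f : emaps Z Z'"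
  and v: "Y : CS" "Z : CS" "Z' : CS" "m : ob M Y" "k : ob N Z"
 shows "pp Y Z' m (tr N Z Z' f k) = tr L (Y ** Z) (Y ** Z') (fpm (%x. x) f) (pp Y Z m k)"
 using bilin_tr[OF b _ f, of "%x. x" Y Y m k] v M by simp

lemma mid_apply [simp]: "mid X x = x"
 by (simp add: mid_def)

lemma tr_eqI: "(!!x. x : pts X ==> f x = f' x) ==> tr M X Y f x = tr M X Y f' x"
 by (subst tr_cong[of X f f' M Y]) simp_all

lemma tr_eqI_ball: "ALL x : pts X. f x = f' x ==> tr M X Y f x = tr M X Y f' x"
 by (rule tr_eqI) simp

lemma tr_id_ball: "mackey M ==> X : CS ==> x : ob M X ==> ALL x : pts X. f x = x ==> tr M X X f x = x"
 by (rule tr_idI) simp_all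

lemma mack_hom_mult:
 assumes "ph : mhm M L" "ps : mhm M L" "mackey L"
 shows "(%X x. ph X x +[L,X] ps X x) : mhm M L"
proof (rule mack_homI)
 fix X x y assume a: "X : CS" "x : ob M X" "y : ob M X"
 interpret comm_group "obj L X" using mackeyD(1)[OF assms(3) a(1)] .
 show "ph X (x +[M,X] y) +[L,X] ps X (x +[M,X] y) =
   ph X x +[L,X] ps X x +[L,X] (ph X y +[L,X] ps X y)"
  using a by (simp add: mhD[OF assms(1)] mhD[OF assms(2)] m_ac)
qed (simp_all add: mhD[OF assms(1)] mhD[OF assms(2)] assms(3) mor_mult)

lemma mack_hom_shift_mor:
 assumes "ph : mhm M (shift n K Z)" "mackey K" "Z : CS" "Z' : CS" "ze : bhm Z Z'"
 shows "(%X x. mor K (X ** Z) (X ** Z') (bpr X X Z Z' (bd X) ze) (ph X x)) : mhm M (shift n K Z')"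
proof (rule mack_homI)
 note ph = mhD[OF assms(1), unfolded shift_simps]
 fix X Y be x assume a: "X : CS" "Y : CS" "be : bhm X Y" "x : ob M X"
 have "bco (X ** Z) (Y ** Z') (bpr Y Y Z Z' (bd Y) ze) (bpr X Y Z Z be (bd Z)) =
  bco (X ** Z) (Y ** Z') (bpr X Y Z' Z' be (bd Z')) (bpr X X Z Z' (bd X) ze)"
  using a assms by (simp add: bprod_bcomp[symmetric])
 then show "mor K (Y ** Z) (Y ** Z') (bpr Y Y Z Z' (bd Y) ze) (ph Y (mor M X Y be x)) =
   mor (shift n K Z') X Y be (mor K (X ** Z) (X ** Z') (bpr X X Z Z' (bd X) ze) (ph X x))"
  using a assms by (simp add: ph mackeyD(4)[OF assms(2)])
next
 note ph = mhD[OF assms(1), unfolded shift_simps]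
 fix X x y assume a: "X : CS" "x : ob M X" "y : ob M X"
 then show "mor K (X ** Z) (X ** Z') (bpr X X Z Z' (bd X) ze) (ph X (x +[M,X] y)) =
  mor K (X ** Z) (X ** Z') (bpr X X Z Z' (bd X) ze) (ph X x) +[(shift n K Z'),X]
  mor K (X ** Z) (X ** Z') (bpr X X Z Z' (bd X) ze) (ph X y)"
  using assms by (simp add: ph mor_mult)
qed (use assms mhD(1)[OF assms(1)] in simp)

text \<open>Additivity and naturality in the parameter may be tested on generators of the other variable.\<close>

lemma bilin_family:
 assumes T: "mackey T" "mgen T Q" and N: "mackey N" and K: "mackey K"
  and F: "!!Z k. Z : CS ==> k : ob N Z ==> F Z k : mhm T (shift n K Z)"
  and add: "!!Z k k' Y t. Z : CS ==> k : ob N Z ==> k' : ob N Z ==> Y : CS ==> Q Y t ==>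
   F Z (k +[N,Z] k') Y t = F Z k Y t +[K,(Y ** Z)] F Z k' Y t"
  and nat: "!!Z Z' ze k Y t. Z : CS ==> Z' : CS ==> ze : bhm Z Z' ==> k : ob N Z ==> Y : CS ==> Q Y t ==>
   F Z' (mor N Z Z' ze k) Y t = mor K (Y ** Z) (Y ** Z') (bpr Y Y Z Z' (bd Y) ze) (F Z k Y t)"
 shows "bilin T N K (%Y Z t k. F Z k Y t)"
proof -
 have add': "F Z (k +[N,Z] k') Y t = F Z k Y t +[K,(Y ** Z)] F Z k' Y t"
  if a: "Z : CS" "k : ob N Z" "k' : ob N Z" "Y : CS" "t : ob T Y" for Z k k' Y t
  using mack_hom_eqI[OF T(2) F[OF a(1) ob_mult[OF N a(1,2,3)]] mack_hom_mult[OF F[OF a(1,2)] F[OF a(1,3)] shift_mackey[OF K a(1)]]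
    T(1) shift_mackey[OF K a(1)] _ a(4,5)] add a(1-3) by simp
 have nat': "F Z' (mor N Z Z' ze k) Y t = mor K (Y ** Z) (Y ** Z') (bpr Y Y Z Z' (bd Y) ze) (F Z k Y t)"
  if a: "Z : CS" "Z' : CS" "ze : bhm Z Z'" "k : ob N Z" "Y : CS" "t : ob T Y" for Z Z' ze k Y t
  by (rule mack_hom_eqI[OF T(2) F[OF a(2) mor_closed[OF N a(1,2,3,4)]] mack_hom_shift_mor[OF F[OF a(1,4)] K a(1,2,3)]
    T(1) shift_mackey[OF K a(2)] _ a(5,6)]) (use nat a(1-4) in simp)
 show ?thesis
 proof (rule bilinI)
  fix Y Z Y' Z' xi ze m k
  assume a: "Y : CS" "Z : CS" "Y' : CS" "Z' : CS" "xi : bhm Y Y'" "ze : bhm Z Z'"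
   "m : ob T Y" "k : ob N Z"
  have b: "bpr Y Y' Z Z' xi ze = bco (Y ** Z) (Y' ** Z') (bpr Y' Y' Z Z' (bd Y') ze) (bpr Y Y' Z Z xi (bd Z))"
   using a by (simp add: bprod_bcomp[symmetric])
  show "F Z' (mor N Z Z' ze k) Y' (mor T Y Y' xi m) = mor K (Y ** Z) (Y' ** Z') (bpr Y Y' Z Z' xi ze) (F Z k Y m)"
   using a mhD(1)[OF F, of Z k Y m]
   by (simp add: nat' T(1) mhD(3)[OF F] mackeyD(4)[OF K] b)
 qed (use mhD[OF F, unfolded shift_simps] add' in simp_all)
qed

lemma minv_eq:
 assumes ph: "ph : mhm A B" and ps: "ps : mhm B A"
  and 1: "!!X x. X : CS ==> x : ob A X ==> ps X (ph X x) = x"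
  and 2: "!!X x. X : CS ==> x : ob B X ==> ph X (ps X x) = x"
  and X: "X : CS" and y: "y : ob B X"
 shows "minv A ph X y = ps X y"
 unfolding minv_def
proof (rule inv_into_f_eq)
 show "inj_on (ph X) (ob A X)" by (rule inj_on_inverseI[of _ "ps X"]) (rule 1[OF X])
 show "ps X y : ob A X" using mhD(1)[OF ps X y] .
 show "ph X (ps X y) = y" by (rule 2[OF X y])
qed

lemma mack_hom_cong: assumes "ph : mhm A B" "mackey A"
  "!!X x. X : CS ==> x : ob A X ==> ph X x = ph' X x"
 shows "ph' : mhm A B"
proof (rule mack_homI)
 fix X x y assume a: "X : CS" "x : ob A X" "y : ob A X"
 then show "ph' X (x +[A,X] y) = ph' X x +[B,X] ph' X y"
  using mhD(2)[OF assms(1) a] assms(2) by (simp add: assms(3)[symmetric])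
next
 fix X x assume a: "X : CS" "x : ob A X"
 then show "ph' X x : ob B X" using mhD(1)[OF assms(1) a] by (simp add: assms(3)[symmetric])
next
 fix X Y be x assume a: "X : CS" "Y : CS" "be : bhm X Y" "x : ob A X"
 then show "ph' Y (mor A X Y be x) = mor B X Y be (ph' X x)"
  using mhD(3)[OF assms(1) a] assms(2) by (simp add: assms(3)[symmetric])
qed

section \<open>Structure maps of the box product\<close>

lemma box_map_facts:
 assumes "ph : mhm M M'" "ps : mhm N N'" "mackey M" "mackey N" "mackey M'" "mackey N'"
 shows "bmap M' N' ph ps : mhm (bx M N) (bx M' N')"
  "Y : CS ==> Z : CS ==> m : ob M Y ==> k : ob N Z ==>
   bmap M' N' ph ps (Y ** Z) (bp M N Y Z m k) = bp M' N' Y Z (ph Y m) (ps Z k)"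
 unfolding box_map_def
 using box_lift_facts[OF assms(3,4) box_mackey[OF assms(5,6)] bilin_pre[OF assms(1,2) bilin_pair[OF assms(5,6)]]] by simp_all

lemma box_sym_facts:
 assumes M: "mackey M" and N: "mackey N"
 shows "box_sym n M N : mhm (bx M N) (bx N M)"
  "Y : CS ==> Z : CS ==> m : ob M Y ==> k : ob N Z ==>
   box_sym n M N (Y ** Z) (bp M N Y Z m k) = tr (bx N M) (Z ** Y) (Y ** Z) fsw (bp N M Z Y k m)"
 unfolding box_sym_def structure_graphs tr_def[symmetric]
 using box_lift_facts[OF M N box_mackey[OF N M] bilin_swap[OF bilin_pair[OF N M] box_mackey[OF N M]]] by simp_all

lemma pair_tr [simp]:
 assumes "mackey M" "mackey N" "Y : CS" "Z : CS"
 shows "Y' : CS ==> f : emaps Y Y' ==> m : ob M Y ==> k : ob N Z ==> bp M N Y' Z (tr M Y Y' f m) k =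
   tr (bx M N) (Y ** Z) (Y' ** Z) (fpm f (%x. x)) (bp M N Y Z m k)"
  "Z' : CS ==> f : emaps Z Z' ==> m : ob M Y ==> k : ob N Z ==> bp M N Y Z' m (tr N Z Z' f k) =
   tr (bx M N) (Y ** Z) (Y ** Z') (fpm (%x. x) f) (bp M N Y Z m k)"
proof -
 show "Y' : CS ==> f : emaps Y Y' ==> m : ob M Y ==> k : ob N Z ==> bp M N Y' Z (tr M Y Y' f m) k =
   tr (bx M N) (Y ** Z) (Y' ** Z) (fpm f (%x. x)) (bp M N Y Z m k)"
  by (rule bilin_tr_left[OF bilin_pair[OF assms(1,2)] assms(2) _ assms(3,4)])
 show "Z' : CS ==> f : emaps Z Z' ==> m : ob M Y ==> k : ob N Z ==> bp M N Y Z' m (tr N Z Z' f k) =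
   tr (bx M N) (Y ** Z) (Y ** Z') (fpm (%x. x) f) (bp M N Y Z m k)"
  by (rule bilin_tr_right[OF bilin_pair[OF assms(1,2)] assms(1) _ assms(3,4)])
qed

lemma box_assoc_facts:
 assumes L: "mackey L" and M: "mackey M" and N: "mackey N"
 shows "box_assoc n L M N : mhm (bx (bx L M) N) (bx L (bx M N))"
  "A : CS ==> B : CS ==> C : CS ==> l : ob L A ==> m : ob M B ==> k : ob N C ==>
   box_assoc n L M N ((A ** B) ** C) (bp (bx L M) N (A ** B) C (bp L M A B l m) k) =
   tr (bx L (bx M N)) (A ** B ** C) ((A ** B) ** C) fas' (bp L (bx M N) A (B ** C) l (bp M N B C m k))"
proof -
 let ?K = "bx L (bx M N)"
 have K: "mackey ?K" using L M N by simp
 define T where "T Z k = (%A B l m. tr ?K (A ** B ** Z) ((A ** B) ** Z) fas'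
     (bp L (bx M N) A (B ** Z) l (bp M N B Z m k)))" for Z k
 note pD = bilinD[OF bilin_pair[OF M N]] and qD = bilinD[OF bilin_pair[OF L box_mackey[OF M N]]]
 have nat: "mor ?K (A' ** B' ** Z') ((A' ** B') ** Z') (bgraph n (A' ** B' ** Z') ((A' ** B') ** Z') fas')
   (bp L (bx M N) A' (B' ** Z') (mor L A A' al l) (bp M N B' Z' (mor M B B' be m) (mor N Z Z' ze k))) =
   mor ?K ((A ** B) ** Z) ((A' ** B') ** Z') (bpr (A ** B) (A' ** B') Z Z' (bpr A A' B B' al be) ze)
    (T Z k A B l m)"
  if a: "A : CS" "B : CS" "Z : CS" "A' : CS" "B' : CS" "Z' : CS"
   "al : bhm A A'" "be : bhm B B'" "ze : bhm Z Z'" "l : ob L A" "m : ob M B" "k : ob N Z"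
  for A B Z A' B' Z' al be ze l m k
 proof -
  have e: "fas' : emaps (A' ** B' ** Z') ((A' ** B') ** Z')" "fas' : emaps (A ** B ** Z) ((A ** B) ** Z)"
   using a by simp_all
  show ?thesis
   using a bgraph_closed[OF e(1)] bgraph_closed[OF e(2)] L M N
   by (simp add: T_def tr_def pD(4) qD(4) mackeyD(4)[OF K] fas'_natural)
 qed
 have T: "bilin L M (shift n ?K Z) (T Z k)" if Z: "Z : CS" and k: "k : ob N Z" for Z k
 proof (rule bilinI)
  fix A B A' B' xi ze l m assume a: "A : CS" "B : CS" "A' : CS" "B' : CS" "xi : bhm A A'" "ze : bhm B B'"
   "l : ob L A" "m : ob M B"
  show "T Z k A' B' (mor L A A' xi l) (mor M B B' ze m) = mor (shift n ?K Z) (A ** B) (A' ** B') (bpr A A' B B' xi ze) (T Z k A B l m)"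
   using nat[OF a(1,2) Z a(3,4) Z a(5,6) bid_closed[OF Z] a(7,8) k] mackeyD(3)[OF N Z k]
   by (simp add: T_def tr_def)
 qed (use Z k L M N in \<open>simp_all add: T_def pD qD tr_mult\<close>)
 note lf = box_lift_facts[OF L M shift_mackey[OF K] T]
 have b: "bilin (bx L M) N ?K (%Y Z t k. box_lift (shift n ?K Z) (T Z k) Y t)"
 proof (rule bilin_family[OF box_mackey[OF L M] mgen_box_pair[OF L M] N K])
  fix Z k k' Y t assume a: "Z : CS" "k : ob N Z" "k' : ob N Z" "Y : CS"
   "EX A B l m. A : CS & B : CS & l : ob L A & m : ob M B & Y = A ** B & t = bp L M A B l m"
  from a(5) show "box_lift (shift n ?K Z) (T Z (k +[N,Z] k')) Y t =
   box_lift (shift n ?K Z) (T Z k) Y t \<otimes>\<^bsub>obj ?K (Y ** Z)\<^esub> box_lift (shift n ?K Z) (T Z k') Y t"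
   by (elim exE conjE) (use a(1-4) N L M in \<open>simp add: lf(2), simp add: T_def pD qD tr_mult\<close>)
 next
  fix Z Z' ze k Y t assume a: "Z : CS" "Z' : CS" "ze : bhm Z Z'" "k : ob N Z" "Y : CS"
   "EX A B l m. A : CS & B : CS & l : ob L A & m : ob M B & Y = A ** B & t = bp L M A B l m"
  from a(6) obtain A B l m where v: "A : CS" "B : CS" "l : ob L A" "m : ob M B" "Y = A ** B" "t = bp L M A B l m"
   by (elim exE conjE)
  show "box_lift (shift n ?K Z') (T Z' (mor N Z Z' ze k)) Y t =
   mor ?K (Y ** Z) (Y ** Z') (bpr Y Y Z Z' (bd Y) ze) (box_lift (shift n ?K Z) (T Z k) Y t)"
   using nat[OF v(1,2) a(1) v(1,2) a(2) bid_closed[OF v(1)] bid_closed[OF v(2)] a(3) v(3,4) a(4)] a v N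
   by (simp add: lf(2)) (simp add: T_def tr_def mackeyD(3)[OF L] mackeyD(3)[OF M])
 qed (rule lf(1))
 have ba: "box_assoc n L M N = box_lift ?K (%Y Z t k. box_lift (shift n ?K Z) (T Z k) Y t)"
  by (simp add: box_assoc_def T_def tr_def structure_graphs Let_def)
 note bf = box_lift_facts[OF box_mackey[OF L M] N K b, folded ba]
 show "box_assoc n L M N : mhm (bx (bx L M) N) ?K" by (rule bf(1))
 assume v: "A : CS" "B : CS" "C : CS" "l : ob L A" "m : ob M B" "k : ob N C"
 show "box_assoc n L M N ((A ** B) ** C) (bp (bx L M) N (A ** B) C (bp L M A B l m) k) =
   tr ?K (A ** B ** C) ((A ** B) ** C) fas' (bp L (bx M N) A (B ** C) l (bp M N B C m k))"
  using v L M by (simp add: bf(2) lf(2)) (simp add: T_def)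
qed

lemma mgen_box:
 assumes M: "mackey M" and N: "mackey N" and Q: "mgen M Q" "mgen N Q'"
 shows "mgen (bx M N) (%X t. EX Y Z m k. Y : CS & Z : CS & Q Y m & Q' Z k & X = Y ** Z & t = bp M N Y Z m k)"
 by (rule mgen_bilin[OF bilin_pair[OF M N] M N box_mackey[OF M N] Q mgen_box_pair[OF M N]])

text \<open>The inverse associator, conjugate to an associator under the symmetry.\<close>

definition box_assoc_inv where "box_assoc_inv L M N = box_sym n N (bx L M) oM bmap N (bx L M) mid (box_sym n M L) oM
  box_assoc n N M L oM bmap (bx N M) L (box_sym n M N) mid oM box_sym n L (bx M N)"

lemma box_assoc_inv_facts:
 assumes L: "mackey L" and M: "mackey M" and N: "mackey N"
 shows "box_assoc_inv L M N : mhm (bx L (bx M N)) (bx (bx L M) N)"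
  "A : CS ==> B : CS ==> C : CS ==> l : ob L A ==> m : ob M B ==> k : ob N C ==>
   box_assoc_inv L M N (A ** B ** C) (bp L (bx M N) A (B ** C) l (bp M N B C m k)) =
   tr (bx (bx L M) N) ((A ** B) ** C) (A ** B ** C) fas (bp (bx L M) N (A ** B) C (bp L M A B l m) k)"
proof -
 note f1 = box_sym_facts[OF L box_mackey[OF M N]]
  and f2 = box_map_facts[OF box_sym_facts(1)[OF M N] mid_hom box_mackey[OF M N] L box_mackey[OF N M] L]
  and f3 = box_assoc_facts[OF N M L]
  and f4 = box_map_facts[OF mid_hom box_sym_facts(1)[OF M L] N box_mackey[OF M L] N box_mackey[OF L M]]
  and f5 = box_sym_facts[OF N box_mackey[OF L M]]
 show "box_assoc_inv L M N : mhm (bx L (bx M N)) (bx (bx L M) N)"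
  unfolding box_assoc_inv_def by (rule mh_comp[OF mh_comp[OF mh_comp[OF mh_comp[OF f1(1) f2(1)] f3(1)] f4(1)] f5(1)])
 assume v: "A : CS" "B : CS" "C : CS" "l : ob L A" "m : ob M B" "k : ob N C"
 show "box_assoc_inv L M N (A ** B ** C) (bp L (bx M N) A (B ** C) l (bp M N B C m k)) =
   tr (bx (bx L M) N) ((A ** B) ** C) (A ** B ** C) fas (bp (bx L M) N (A ** B) C (bp L M A B l m) k)"
  unfolding box_assoc_inv_def mcomp_def using v L M N
  by (simp add: f1(2) f2(2) f3(2) f4(2) f5(2) mh_tr[OF f2(1)] mh_tr[OF f3(1)] mh_tr[OF f4(1)] mh_tr[OF f5(1)]
    box_sym_facts(2)) (rule tr_eqI_ball, simp)
qed

lemma box_assoc'_facts: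
 assumes L: "mackey L" and M: "mackey M" and N: "mackey N"
 shows "box_assoc' n L M N : mhm (bx L (bx M N)) (bx (bx L M) N)"
  "A : CS ==> B : CS ==> C : CS ==> l : ob L A ==> m : ob M B ==> k : ob N C ==>
   box_assoc' n L M N (A ** B ** C) (bp L (bx M N) A (B ** C) l (bp M N B C m k)) =
   tr (bx (bx L M) N) ((A ** B) ** C) (A ** B ** C) fas (bp (bx L M) N (A ** B) C (bp L M A B l m) k)"
proof -
 note a = box_assoc_facts[OF L M N] and i = box_assoc_inv_facts[OF L M N]
 note m1 = box_mackey[OF box_mackey[OF L M] N] and m2 = box_mackey[OF L box_mackey[OF M N]]
 have 1: "box_assoc_inv L M N X (box_assoc n L M N X x) = x" if X: "X : CS" "x : ob (bx (bx L M) N) X" for X x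
  using mack_hom_eqI[OF mgen_box[OF box_mackey[OF L M] N mgen_box[OF L M mgen_all mgen_all] mgen_all]
    mh_comp[OF a(1) i(1)] mid_hom m1 m1 _ X]
  unfolding mcomp_def mid_def
 proof this
  fix X x assume "EX Y Z m k. Y : CS & Z : CS & (EX A B l b. A : CS & B : CS & l : ob L A & b : ob M B &
   Y = A ** B & m = bp L M A B l b) & k : ob N Z & X = Y ** Z & x = bp (bx L M) N Y Z m k"
  then show "box_assoc_inv L M N X (box_assoc n L M N X x) = x"
   by (elim exE conjE) (use L M N in \<open>simp add: a(2) i(2) mh_tr[OF i(1)] tr_id_ball\<close>)
 qed
 have 2: "box_assoc n L M N X (box_assoc_inv L M N X x) = x" if X: "X : CS" "x : ob (bx L (bx M N)) X" for X x
  using mack_hom_eqI[OF mgen_box[OF L box_mackey[OF M N] mgen_all mgen_box[OF M N mgen_all mgen_all]]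
    mh_comp[OF i(1) a(1)] mid_hom m2 m2 _ X]
  unfolding mcomp_def mid_def
 proof this
  fix X x assume "EX Y Z m k. Y : CS & Z : CS & m : ob L Y & (EX A B l b. A : CS & B : CS & l : ob M A & b : ob N B &
   Z = A ** B & k = bp M N A B l b) & X = Y ** Z & x = bp L (bx M N) Y Z m k"
  then show "box_assoc n L M N X (box_assoc_inv L M N X x) = x"
   by (elim exE conjE) (use L M N in \<open>simp add: a(2) i(2) mh_tr[OF a(1)] tr_id_ball\<close>)
 qed
 have eq: "box_assoc' n L M N X x = box_assoc_inv L M N X x" if X: "X : CS" "x : ob (bx L (bx M N)) X" for X x
  unfolding box_assoc'_def by (rule minv_eq[OF a(1) i(1) 1 2 X])
 show "box_assoc' n L M N : mhm (bx L (bx M N)) (bx (bx L M) N)"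
  by (rule mack_hom_cong[OF i(1) m2]) (simp add: eq)
 assume v: "A : CS" "B : CS" "C : CS" "l : ob L A" "m : ob M B" "k : ob N C"
 then show "box_assoc' n L M N (A ** B ** C) (bp L (bx M N) A (B ** C) l (bp M N B C m k)) =
   tr (bx (bx L M) N) ((A ** B) ** C) (A ** B ** C) fas (bp (bx L M) N (A ** B) C (bp L M A B l m) k)"
  using L M N by (simp add: eq i(2))
qed

section \<open>Actions and balanced products\<close>

text \<open>The actions and the projection to a relative box product, as pairings. Almost everything below is
formulated with these three.\<close>

definition lm where
 "lm R M Y Z r m = lact M (Y ** Z) (bp R M Y Z r m)"

definition rm where
 "rm M S Y Z m s = ract M (Y ** Z) (bp M S Y Z m s)"

definition rp where
 "rp S M N Y Z m k = rproj n S M N (Y ** Z) (bp M N Y Z m k)"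

definition lactor where
 "lactor R M \<longleftrightarrow> mackey R & mackey M & lact M : mhm (bx R M) M"

definition ractor where
 "ractor S M \<longleftrightarrow> mackey S & mackey M & ract M : mhm (bx M S) M"

lemma lactorD: "lactor R M ==> mackey R" "lactor R M ==> mackey M"
  "lactor R M ==> lact M : mhm (bx R M) M"
 and ractorD: "ractor S M' ==> mackey S" "ractor S M' ==> mackey M'"
  "ractor S M' ==> ract M' : mhm (bx M' S) M'"
 by (simp_all add: lactor_def ractor_def)

lemma bilin_lm: "lactor R M ==> bilin R M M (lm R M)"
 unfolding lm_def[abs_def] by (rule mack_hom_bilin) (simp_all add: lactorD)

lemma bilin_rm: "ractor S M ==> bilin M S M (rm M S)"
 unfolding rm_def[abs_def] by (rule mack_hom_bilin) (simp_all add: ractorD)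

lemma lm_closed [simp]: "lactor R M ==> Y : CS ==> Z : CS ==> r : ob R Y ==> m : ob M Z ==> lm R M Y Z r m : ob M (Y ** Z)"
 by (rule bilinD(1)[OF bilin_lm])

lemma rm_closed [simp]: "ractor S M ==> Y : CS ==> Z : CS ==> m : ob M Y ==> s : ob S Z ==> rm M S Y Z m s : ob M (Y ** Z)"
 by (rule bilinD(1)[OF bilin_rm])

lemma lm_tr [simp]:
 assumes "lactor R M" "Y : CS" "Z : CS"
 shows "Y' : CS ==> f : emaps Y Y' ==> r : ob R Y ==> m : ob M Z ==>
   lm R M Y' Z (tr R Y Y' f r) m = tr M (Y ** Z) (Y' ** Z) (fpm f (%x. x)) (lm R M Y Z r m)"
  "Z' : CS ==> f : emaps Z Z' ==> r : ob R Y ==> m : ob M Z ==>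
   lm R M Y Z' r (tr M Z Z' f m) = tr M (Y ** Z) (Y ** Z') (fpm (%x. x) f) (lm R M Y Z r m)"
 using bilin_tr_left[OF bilin_lm[OF assms(1)] lactorD(2)[OF assms(1)] _ assms(2,3)]
  bilin_tr_right[OF bilin_lm[OF assms(1)] lactorD(1)[OF assms(1)] _ assms(2,3)] by blast+

lemma rm_tr [simp]:
 assumes "ractor S M" "Y : CS" "Z : CS"
 shows "Y' : CS ==> f : emaps Y Y' ==> m : ob M Y ==> s : ob S Z ==>
   rm M S Y' Z (tr M Y Y' f m) s = tr M (Y ** Z) (Y' ** Z) (fpm f (%x. x)) (rm M S Y Z m s)"
  "Z' : CS ==> f : emaps Z Z' ==> m : ob M Y ==> s : ob S Z ==>
   rm M S Y Z' m (tr S Z Z' f s) = tr M (Y ** Z) (Y ** Z') (fpm (%x. x) f) (rm M S Y Z m s)"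
 using bilin_tr_left[OF bilin_rm[OF assms(1)] ractorD(1)[OF assms(1)] _ assms(2,3)]
  bilin_tr_right[OF bilin_rm[OF assms(1)] ractorD(2)[OF assms(1)] _ assms(2,3)] by blast+

text \<open>Boxing with a fixed functor is right exact: a pairing with a quotient is a pairing that identifies
the two images.\<close>

lemma coeq_right:
 assumes K: "mackey K" and N: "mackey N" and ph: "ph : mhm K N" and ps: "ps : mhm K N"
  and R: "mackey R" and L: "mackey L" and H: "H : mhm (bx R N) L"
  and eq: "!!A X r k. A : CS ==> X : CS ==> r : ob R A ==> k : ob K X ==>
   H (A ** X) (bp R N A X r (ph X k)) = H (A ** X) (bp R N A X r (ps X k))"
 shows "bilin R (coeq K N ph ps) L (%A X r c. the_elem ((%t. H (A ** X) (bp R N A X r t)) ` c))"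
  "A : CS ==> X : CS ==> r : ob R A ==> x : ob N X ==>
   the_elem ((%t. H (A ** X) (bp R N A X r t)) ` coeq_proj K N ph ps X x) = H (A ** X) (bp R N A X r x)"
proof -
 note b = mack_hom_bilin[OF H R N]
 have val: "the_elem ((%t. H (A ** X) (bp R N A X r t)) ` coeq_proj K N ph ps X x) = H (A ** X) (bp R N A X r x)"
  if a: "A : CS" "X : CS" "r : ob R A" "x : ob N X" for A X r x
 proof -
  have "(%t. H (A ** X) (bp R N A X r t)) : hom (obj N X) (obj L (A ** X))"
   using bilin_fix_left[OF b R a(1,3)] a(2) unfolding mack_hom_def by simp
  from coeq_image[OF K N ph ps a(2) this ob_group[OF L cprod_csets[OF a(1,2)]] eq[OF a(1,2,3)] a(4)]
  show ?thesis by simp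
 qed
 show "A : CS ==> X : CS ==> r : ob R A ==> x : ob N X ==>
   the_elem ((%t. H (A ** X) (bp R N A X r t)) ` coeq_proj K N ph ps X x) = H (A ** X) (bp R N A X r x)"
  by (rule val)
 note p = coeq_proj_hom[OF K N ph ps]
 show "bilin R (coeq K N ph ps) L (%A X r c. the_elem ((%t. H (A ** X) (bp R N A X r t)) ` c))"
 proof (rule bilinI)
  fix A X r c assume a: "A : CS" "X : CS" "r : ob R A" "c : ob (coeq K N ph ps) X"
  from a(4) show "the_elem ((%t. H (A ** X) (bp R N A X r t)) ` c) : ob L (A ** X)"
   by (rule coeq_ob_E[OF K N ph ps]) (use a(1-3) in \<open>simp add: val bilinD(1)[OF b]\<close>)
 next
  fix A X r r' c assume a: "A : CS" "X : CS" "r : ob R A" "r' : ob R A" "c : ob (coeq K N ph ps) X"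
  from a(5) show "the_elem ((%t. H (A ** X) (bp R N A X (r +[R,A] r') t)) ` c) =
    the_elem ((%t. H (A ** X) (bp R N A X r t)) ` c) +[L,(A ** X)]
    the_elem ((%t. H (A ** X) (bp R N A X r' t)) ` c)"
   by (rule coeq_ob_E[OF K N ph ps]) (use a(1-4) R in \<open>simp add: val bilinD(2)[OF b]\<close>)
 next
  fix A X r c c' assume a: "A : CS" "X : CS" "r : ob R A" "c : ob (coeq K N ph ps) X" "c' : ob (coeq K N ph ps) X"
  obtain x where x: "x : ob N X" "c = coeq_proj K N ph ps X x" using a(4) by (rule coeq_ob_E[OF K N ph ps])
  obtain x' where x': "x' : ob N X" "c' = coeq_proj K N ph ps X x'" using a(5) by (rule coeq_ob_E[OF K N ph ps])
  show "the_elem ((%t. H (A ** X) (bp R N A X r t)) ` (c +[(coeq K N ph ps),X] c')) =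
    the_elem ((%t. H (A ** X) (bp R N A X r t)) ` c) +[L,(A ** X)]
    the_elem ((%t. H (A ** X) (bp R N A X r t)) ` c')"
   unfolding x(2) x'(2) mhD(2)[OF p a(2) x(1) x'(1), symmetric]
   using a(1-3) x(1) x'(1) N by (simp add: val bilinD(3)[OF b])
 next
  fix A X A' X' xi ze r c
  assume a: "A : CS" "X : CS" "A' : CS" "X' : CS" "xi : bhm A A'" "ze : bhm X X'"
   "r : ob R A" "c : ob (coeq K N ph ps) X"
  obtain x where x: "x : ob N X" "c = coeq_proj K N ph ps X x" using a(8) by (rule coeq_ob_E[OF K N ph ps])
  show "the_elem ((%t. H (A' ** X') (bp R N A' X' (mor R A A' xi r) t)) ` mor (coeq K N ph ps) X X' ze c) =
   mor L (A ** X) (A' ** X') (bpr A A' X X' xi ze) (the_elem ((%t. H (A ** X) (bp R N A X r t)) ` c))"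
   unfolding x(2) coeq_mor[OF K N ph ps a(2,4,6) x(1)]
   using a(1-7) x(1) N R by (simp add: val bilinD(4)[OF b])
 qed
qed

lemma coeq_left:
 assumes K: "mackey K" and N: "mackey N" and ph: "ph : mhm K N" and ps: "ps : mhm K N"
  and R: "mackey R" and L: "mackey L" and H: "H : mhm (bx N R) L"
  and eq: "!!A X r k. A : CS ==> X : CS ==> r : ob R A ==> k : ob K X ==>
   H (X ** A) (bp N R X A (ph X k) r) = H (X ** A) (bp N R X A (ps X k) r)"
 shows "bilin (coeq K N ph ps) R L (%X A c r. the_elem ((%t. H (X ** A) (bp N R X A t r)) ` c))"
  "A : CS ==> X : CS ==> r : ob R A ==> x : ob N X ==>
   the_elem ((%t. H (X ** A) (bp N R X A t r)) ` coeq_proj K N ph ps X x) = H (X ** A) (bp N R X A x r)"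
proof -
 note b = mack_hom_bilin[OF H N R]
 have val: "the_elem ((%t. H (X ** A) (bp N R X A t r)) ` coeq_proj K N ph ps X x) = H (X ** A) (bp N R X A x r)"
  if a: "A : CS" "X : CS" "r : ob R A" "x : ob N X" for A X r x
 proof -
  have "(%t. H (X ** A) (bp N R X A t r)) : hom (obj N X) (obj L (X ** A))"
   using bilin_fix_right[OF b R a(1,3)] a(2) unfolding mack_hom_def by simp
  from coeq_image[OF K N ph ps a(2) this ob_group[OF L cprod_csets[OF a(2,1)]] eq[OF a(1,2,3)] a(4)]
  show ?thesis by simp
 qed
 show "A : CS ==> X : CS ==> r : ob R A ==> x : ob N X ==>
   the_elem ((%t. H (X ** A) (bp N R X A t r)) ` coeq_proj K N ph ps X x) = H (X ** A) (bp N R X A x r)"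
  by (rule val)
 note p = coeq_proj_hom[OF K N ph ps]
 show "bilin (coeq K N ph ps) R L (%X A c r. the_elem ((%t. H (X ** A) (bp N R X A t r)) ` c))"
 proof (rule bilinI)
  fix X A c r assume a: "X : CS" "A : CS" "c : ob (coeq K N ph ps) X" "r : ob R A"
  from a(3) show "the_elem ((%t. H (X ** A) (bp N R X A t r)) ` c) : ob L (X ** A)"
   by (rule coeq_ob_E[OF K N ph ps]) (use a(1,2,4) in \<open>simp add: val bilinD(1)[OF b]\<close>)
 next
  fix X A c r r' assume a: "X : CS" "A : CS" "c : ob (coeq K N ph ps) X" "r : ob R A" "r' : ob R A"
  from a(3) show "the_elem ((%t. H (X ** A) (bp N R X A t (r +[R,A] r'))) ` c) =
    the_elem ((%t. H (X ** A) (bp N R X A t r)) ` c) +[L,(X ** A)]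
    the_elem ((%t. H (X ** A) (bp N R X A t r')) ` c)"
   by (rule coeq_ob_E[OF K N ph ps]) (use a(1,2,4,5) R in \<open>simp add: val bilinD(3)[OF b]\<close>)
 next
  fix X A c c' r assume a: "X : CS" "A : CS" "c : ob (coeq K N ph ps) X" "c' : ob (coeq K N ph ps) X" "r : ob R A"
  obtain x where x: "x : ob N X" "c = coeq_proj K N ph ps X x" using a(3) by (rule coeq_ob_E[OF K N ph ps])
  obtain x' where x': "x' : ob N X" "c' = coeq_proj K N ph ps X x'" using a(4) by (rule coeq_ob_E[OF K N ph ps])
  show "the_elem ((%t. H (X ** A) (bp N R X A t r)) ` (c +[(coeq K N ph ps),X] c')) =
    the_elem ((%t. H (X ** A) (bp N R X A t r)) ` c) +[L,(X ** A)]
    the_elem ((%t. H (X ** A) (bp N R X A t r)) ` c')"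
   unfolding x(2) x'(2) mhD(2)[OF p a(1) x(1) x'(1), symmetric]
   using a(1,2,5) x(1) x'(1) N by (simp add: val bilinD(2)[OF b])
 next
  fix X A X' A' xi ze c r
  assume a: "X : CS" "A : CS" "X' : CS" "A' : CS" "xi : bhm X X'" "ze : bhm A A'"
   "c : ob (coeq K N ph ps) X" "r : ob R A"
  obtain x where x: "x : ob N X" "c = coeq_proj K N ph ps X x" using a(7) by (rule coeq_ob_E[OF K N ph ps])
  show "the_elem ((%t. H (X' ** A') (bp N R X' A' t (mor R A A' ze r))) ` mor (coeq K N ph ps) X X' xi c) =
   mor L (X ** A) (X' ** A') (bpr X X' A A' xi ze) (the_elem ((%t. H (X ** A) (bp N R X A t r)) ` c))"
   unfolding x(2) coeq_mor[OF K N ph ps a(1,3,5) x(1)]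
   using a(1-6,8) x(1) N R by (simp add: val bilinD(4)[OF b])
 qed
qed

context
 fixes S :: "('s, 'x) green_scheme" and M :: "('r, 'm, 's, 'y) bimod_scheme" and N :: "('s, 'k, 'z) lmod_scheme"
 assumes M: "ractor S M" and N: "lactor S N"
begin

abbreviation (input) "bal1 == bmap M N (ract M) mid"
abbreviation (input) "bal2 == bmap M N mid (lact N) oM box_assoc n M S N"
abbreviation (input) "balK == bx (bx M S) N"

lemma bal_facts:
 shows "bal1 : mhm balK (bx M N)" "bal2 : mhm balK (bx M N)"
  "Y : CS ==> A : CS ==> Z : CS ==> m : ob M Y ==> s : ob S A ==> k : ob N Z ==>
   bal1 ((Y ** A) ** Z) (bp (bx M S) N (Y ** A) Z (bp M S Y A m s) k) =
   bp M N (Y ** A) Z (rm M S Y A m s) k"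
  "Y : CS ==> A : CS ==> Z : CS ==> m : ob M Y ==> s : ob S A ==> k : ob N Z ==>
   bal2 ((Y ** A) ** Z) (bp (bx M S) N (Y ** A) Z (bp M S Y A m s) k) =
   tr (bx M N) (Y ** A ** Z) ((Y ** A) ** Z) fas' (bp M N Y (A ** Z) m (lm S N A Z s k))"
proof -
 note D = ractorD[OF M] lactorD[OF N]
 note f1 = box_map_facts[OF D(3) mid_hom box_mackey[OF D(2,1)] D(5) D(2) D(5)]
 note f2 = box_map_facts[OF mid_hom D(6) D(2) box_mackey[OF D(4,5)] D(2) D(5)]
 note f3 = box_assoc_facts[OF D(2,1) D(5)]
 show "bal1 : mhm balK (bx M N)" by (rule f1(1))
 show "bal2 : mhm balK (bx M N)" by (rule mh_comp[OF f3(1) f2(1)])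
 assume v: "Y : CS" "A : CS" "Z : CS" "m : ob M Y" "s : ob S A" "k : ob N Z"
 show "bal1 ((Y ** A) ** Z) (bp (bx M S) N (Y ** A) Z (bp M S Y A m s) k) =
   bp M N (Y ** A) Z (rm M S Y A m s) k"
  using v D by (simp add: f1(2) rm_def)
 show "bal2 ((Y ** A) ** Z) (bp (bx M S) N (Y ** A) Z (bp M S Y A m s) k) =
   tr (bx M N) (Y ** A ** Z) ((Y ** A) ** Z) fas' (bp M N Y (A ** Z) m (lm S N A Z s k))"
  using v D by (simp add: mcomp_def f3(2) f2(2) mh_tr[OF f2(1)] lm_def)
qed

lemma balK_mackey: "mackey balK" "mackey (bx M N)"
 using ractorD[OF M] lactorD[OF N] by simp_all

lemmas rbox_coeq = balK_mackey bal_facts(1,2)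

lemma rbox_mackey: "mackey (rbx S M N)"
 unfolding rbox_def by (rule coeq_mackey[OF rbox_coeq])

lemma rproj_hom: "rproj n S M N : mhm (bx M N) (rbx S M N)"
 unfolding rbox_def rproj_def by (rule coeq_proj_hom[OF rbox_coeq])

lemma bilin_rp: "bilin M N (rbx S M N) (rp S M N)"
 unfolding rp_def[abs_def] by (rule mack_hom_bilin[OF rproj_hom]) (simp_all add: ractorD[OF M] lactorD[OF N])

lemma rp_balanced:
 assumes "Y : CS" "A : CS" "Z : CS" "m : ob M Y" "s : ob S A" "k : ob N Z"
 shows "rp S M N (Y ** A) Z (rm M S Y A m s) k =
  tr (rbx S M N) (Y ** A ** Z) ((Y ** A) ** Z) fas' (rp S M N Y (A ** Z) m (lm S N A Z s k))"
proof -
 note D = ractorD[OF M] lactorD[OF N]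
 have "rproj n S M N ((Y ** A) ** Z) (bal1 ((Y ** A) ** Z) (bp (bx M S) N (Y ** A) Z (bp M S Y A m s) k)) =
  rproj n S M N ((Y ** A) ** Z) (bal2 ((Y ** A) ** Z) (bp (bx M S) N (Y ** A) Z (bp M S Y A m s) k))"
  unfolding rproj_def by (rule coeq_eq[OF rbox_coeq]) (use assms D in simp_all)
 then show ?thesis
  using assms D N unfolding bal_facts(3,4)[OF assms] by (simp add: rp_def mh_tr[OF rproj_hom])
qed

lemma mgen_rbox: assumes "mgen M Q" "mgen N Q'"
 shows "mgen (rbx S M N) (%X t. EX Y Z m k. Y : CS & Z : CS & Q Y m & Q' Z k & X = Y ** Z & t = rp S M N Y Z m k)"
proof -
 note D = ractorD[OF M] lactorD[OF N]
 have "mgen (rbx S M N) (%X t. EX x. (EX Y Z m k. Y : CS & Z : CS & Q Y m & Q' Z k & X = Y ** Z & x = bp M N Y Z m k) &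
   t = rproj n S M N X x)"
 proof (rule mgen_surj[OF rproj_hom balK_mackey(2) rbox_mackey mgen_box[OF D(2) D(5) assms]])
  fix X y assume "X : CS" "y : ob (rbx S M N) X"
  then show "EX x : ob (bx M N) X. y = rproj n S M N X x"
   unfolding rbox_def rproj_def ob_coeq[OF rbox_coeq] by blast
 qed
 then show ?thesis
 proof (rule mgen_mono)
  fix X t assume "EX x. (EX Y Z m k. Y : CS & Z : CS & Q Y m & Q' Z k & X = Y ** Z & x = bp M N Y Z m k) & t = rproj n S M N X x"
  then show "EX Y Z m k. Y : CS & Z : CS & Q Y m & Q' Z k & X = Y ** Z & t = rp S M N Y Z m k"
   unfolding rp_def by blast
 next
  fix X t assume "EX Y Z m k. Y : CS & Z : CS & Q Y m & Q' Z k & X = Y ** Z & t = rp S M N Y Z m k"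
  then show "t : ob (rbx S M N) X"
   using bilinD(1)[OF bilin_rp] mgenD[OF assms(1)] mgenD[OF assms(2)] by blast
 qed
qed

text \<open>A map descends to the relative box product as soon as it is balanced on generators.\<close>

lemma rbox_desc:
 assumes L: "mackey L" and h: "h : mhm (bx M N) L" and Q: "mgen M Q" "mgen S Qs" "mgen N Q'"
  and bal: "!!Y A Z m s k. Y : CS ==> A : CS ==> Z : CS ==> Q Y m ==> Qs A s ==> Q' Z k ==>
   h ((Y ** A) ** Z) (bp M N (Y ** A) Z (rm M S Y A m s) k) =
   tr L (Y ** A ** Z) ((Y ** A) ** Z) fas' (h (Y ** A ** Z) (bp M N Y (A ** Z) m (lm S N A Z s k)))"
 shows "desc h : mhm (rbx S M N) L"
  "X : CS ==> x : ob (bx M N) X ==> desc h X (rproj n S M N X x) = h X x"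
  "Y : CS ==> Z : CS ==> m : ob M Y ==> k : ob N Z ==>
   desc h (Y ** Z) (rp S M N Y Z m k) = h (Y ** Z) (bp M N Y Z m k)"
proof -
 note D = ractorD[OF M] lactorD[OF N]
 have eq: "(h oM bal1) X ka = (h oM bal2) X ka" if X: "X : CS" "ka : ob balK X" for X ka
 proof (rule mack_hom_eqI[OF mgen_box[OF box_mackey[OF D(2,1)] D(5) mgen_box[OF D(2,1) Q(1,2)] Q(3)]
   mh_comp[OF bal_facts(1) h] mh_comp[OF bal_facts(2) h] balK_mackey(1) L _ X], goal_cases)
  case (1 X x)
  then obtain Y A Z m s k where v: "Y : CS" "A : CS" "Z : CS" "Q Y m" "Qs A s" "Q' Z k"
   "X = (Y ** A) ** Z" "x = bp (bx M S) N (Y ** A) Z (bp M S Y A m s) k"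
   by (elim exE conjE) simp
  have w: "m : ob M Y" "s : ob S A" "k : ob N Z" using mgenD[OF Q(1) v(1,4)] mgenD[OF Q(2) v(2,5)] mgenD[OF Q(3) v(3,6)] .
  show ?case
   using v(1-3) w D N bal[OF v(1-6)] unfolding v(7,8) mcomp_def[of h] bal_facts(3,4)[OF v(1-3) w]
   by (simp add: mh_tr[OF h])
 qed
 note eq' = eq[unfolded mcomp_def[of h]]
 show "desc h : mhm (rbx S M N) L"
  unfolding rbox_def by (rule coeq_desc_hom[OF rbox_coeq L h eq'])
 show val: "desc h X (rproj n S M N X x) = h X x" if "X : CS" "x : ob (bx M N) X" for X x
  unfolding rproj_def by (rule coeq_desc_value[OF rbox_coeq L h eq' that])
 show "Y : CS ==> Z : CS ==> m : ob M Y ==> k : ob N Z ==>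
   desc h (Y ** Z) (rp S M N Y Z m k) = h (Y ** Z) (bp M N Y Z m k)"
  unfolding rp_def by (rule val) (use D in simp_all)
qed

text \<open>Right exactness for relative box products, used for the left action on a composite.\<close>

lemma rbox_right:
 assumes R: "mackey R" and L: "mackey L" and H: "H : mhm (bx R (bx M N)) L"
  and bal: "!!B Y A Z r m s k. B : CS ==> Y : CS ==> A : CS ==> Z : CS ==> r : ob R B ==>
   m : ob M Y ==> s : ob S A ==> k : ob N Z ==>
   H (B ** (Y ** A) ** Z) (bp R (bx M N) B ((Y ** A) ** Z) r (bp M N (Y ** A) Z (rm M S Y A m s) k)) =
   tr L (B ** Y ** A ** Z) (B ** (Y ** A) ** Z) (fpm (%x. x) fas')
    (H (B ** Y ** A ** Z) (bp R (bx M N) B (Y ** A ** Z) r (bp M N Y (A ** Z) m (lm S N A Z s k))))"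
 shows "bilin R (rbx S M N) L (%A X r c. the_elem ((%t. H (A ** X) (bp R (bx M N) A X r t)) ` c))"
  "A : CS ==> Y : CS ==> Z : CS ==> r : ob R A ==> m : ob M Y ==> k : ob N Z ==>
   the_elem ((%t. H (A ** Y ** Z) (bp R (bx M N) A (Y ** Z) r t)) ` rp S M N Y Z m k) =
   H (A ** Y ** Z) (bp R (bx M N) A (Y ** Z) r (bp M N Y Z m k))"
proof -
 note D = ractorD[OF M] lactorD[OF N]
 have b: "bilin R balK L (%A X r k. H (A ** X) (bp R (bx M N) A X r (ph X k)))" if "ph : mhm balK (bx M N)" for ph
  using bilin_pre[OF mid_hom that mack_hom_bilin[OF H R balK_mackey(2)]] by simp
 have eq: "H (A ** X) (bp R (bx M N) A X r (bal1 X k)) = H (A ** X) (bp R (bx M N) A X r (bal2 X k))"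
  if a: "A : CS" "X : CS" "r : ob R A" "k : ob balK X" for A X r k
 proof (rule bilin_eqI[OF b[OF bal_facts(1)] b[OF bal_facts(2)] R balK_mackey(1) L mgen_all
   mgen_box[OF box_mackey[OF D(2,1)] D(5) mgen_box[OF D(2,1) mgen_all mgen_all] mgen_all] _ a])
  fix B X r x assume B: "B : CS" "X : CS" "r : ob R B" and "EX Y Z m k. Y : CS & Z : CS & (EX A B l b. A : CS & B : CS &
   l : ob M A & b : ob S B & Y = A ** B & m = bp M S A B l b) & k : ob N Z & X = Y ** Z & x = bp (bx M S) N Y Z m k"
  then obtain Y A Z m s k where v: "Y : CS" "A : CS" "Z : CS" "m : ob M Y" "s : ob S A" "k : ob N Z"
   "X = (Y ** A) ** Z" "x = bp (bx M S) N (Y ** A) Z (bp M S Y A m s) k"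
   by (elim exE conjE) simp
  show "H (B ** X) (bp R (bx M N) B X r (bal1 X x)) = H (B ** X) (bp R (bx M N) B X r (bal2 X x))"
   using v(1-6) B D R N bal[OF B(1) v(1-3) B(3) v(4-6)] unfolding v(7,8) bal_facts(3,4)[OF v(1-6)]
   by (simp add: mh_tr[OF H])
 qed
 note c = coeq_right[OF rbox_coeq R L H eq, folded rbox_def rproj_def]
 show "bilin R (rbx S M N) L (%A X r c. the_elem ((%t. H (A ** X) (bp R (bx M N) A X r t)) ` c))"
  by (rule c(1))
 show "A : CS ==> Y : CS ==> Z : CS ==> r : ob R A ==> m : ob M Y ==> k : ob N Z ==>
   the_elem ((%t. H (A ** Y ** Z) (bp R (bx M N) A (Y ** Z) r t)) ` rp S M N Y Z m k) =
   H (A ** Y ** Z) (bp R (bx M N) A (Y ** Z) r (bp M N Y Z m k))"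
  unfolding rp_def by (rule c(2)) (use D in simp_all)
qed

lemma rbox_left:
 assumes R: "mackey R" and L: "mackey L" and H: "H : mhm (bx (bx M N) R) L"
  and bal: "!!B Y A Z r m s k. B : CS ==> Y : CS ==> A : CS ==> Z : CS ==> r : ob R B ==>
   m : ob M Y ==> s : ob S A ==> k : ob N Z ==>
   H (((Y ** A) ** Z) ** B) (bp (bx M N) R ((Y ** A) ** Z) B (bp M N (Y ** A) Z (rm M S Y A m s) k) r) =
   tr L ((Y ** A ** Z) ** B) (((Y ** A) ** Z) ** B) (fpm fas' (%x. x))
    (H ((Y ** A ** Z) ** B) (bp (bx M N) R (Y ** A ** Z) B (bp M N Y (A ** Z) m (lm S N A Z s k)) r))"
 shows "bilin (rbx S M N) R L (%X A c r. the_elem ((%t. H (X ** A) (bp (bx M N) R X A t r)) ` c))"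
  "A : CS ==> Y : CS ==> Z : CS ==> r : ob R A ==> m : ob M Y ==> k : ob N Z ==>
   the_elem ((%t. H ((Y ** Z) ** A) (bp (bx M N) R (Y ** Z) A t r)) ` rp S M N Y Z m k) =
   H ((Y ** Z) ** A) (bp (bx M N) R (Y ** Z) A (bp M N Y Z m k) r)"
proof -
 note D = ractorD[OF M] lactorD[OF N]
 have b: "bilin balK R L (%X A k r. H (X ** A) (bp (bx M N) R X A (ph X k) r))" if "ph : mhm balK (bx M N)" for ph
  using bilin_pre[OF that mid_hom mack_hom_bilin[OF H balK_mackey(2) R]] by simp
 have eq: "H (X ** A) (bp (bx M N) R X A (bal1 X k) r) = H (X ** A) (bp (bx M N) R X A (bal2 X k) r)"
  if a: "A : CS" "X : CS" "r : ob R A" "k : ob balK X" for A X r k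
 proof (rule bilin_eqI[OF b[OF bal_facts(1)] b[OF bal_facts(2)] balK_mackey(1) R L
   mgen_box[OF box_mackey[OF D(2,1)] D(5) mgen_box[OF D(2,1) mgen_all mgen_all] mgen_all] mgen_all _ a(2,1,4,3)])
  fix X B x r assume B: "X : CS" "B : CS" and "EX Y Z m k. Y : CS & Z : CS & (EX A B l b. A : CS & B : CS &
   l : ob M A & b : ob S B & Y = A ** B & m = bp M S A B l b) & k : ob N Z & X = Y ** Z & x = bp (bx M S) N Y Z m k"
   and r: "r : ob R B"
  then obtain Y A Z m s k where v: "Y : CS" "A : CS" "Z : CS" "m : ob M Y" "s : ob S A" "k : ob N Z"
   "X = (Y ** A) ** Z" "x = bp (bx M S) N (Y ** A) Z (bp M S Y A m s) k"
   by (elim exE conjE) simp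
  show "H (X ** B) (bp (bx M N) R X B (bal1 X x) r) = H (X ** B) (bp (bx M N) R X B (bal2 X x) r)"
   using v(1-6) B D R N r bal[OF B(2) v(1-3) r v(4-6)] unfolding v(7,8) bal_facts(3,4)[OF v(1-6)]
   by (simp add: mh_tr[OF H])
 qed
 note c = coeq_left[OF rbox_coeq R L H eq, folded rbox_def rproj_def]
 show "bilin (rbx S M N) R L (%X A c r. the_elem ((%t. H (X ** A) (bp (bx M N) R X A t r)) ` c))"
  by (rule c(1))
 show "A : CS ==> Y : CS ==> Z : CS ==> r : ob R A ==> m : ob M Y ==> k : ob N Z ==>
   the_elem ((%t. H ((Y ** Z) ** A) (bp (bx M N) R (Y ** Z) A t r)) ` rp S M N Y Z m k) =
   H ((Y ** Z) ** A) (bp (bx M N) R (Y ** Z) A (bp M N Y Z m k) r)"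
  unfolding rp_def by (rule c(2)) (use D in simp_all)
qed

end

declare rbox_mackey [simp]

lemma rp_closed [simp]: "ractor S M ==> lactor S N ==> Y : CS ==> Z : CS ==> m : ob M Y ==> k : ob N Z ==>
  rp S M N Y Z m k : ob (rbx S M N) (Y ** Z)"
 by (rule bilinD(1)[OF bilin_rp])

lemma rp_tr [simp]:
 assumes "ractor S M" "lactor S N" "Y : CS" "Z : CS"
 shows "Y' : CS ==> f : emaps Y Y' ==> m : ob M Y ==> k : ob N Z ==>
   rp S M N Y' Z (tr M Y Y' f m) k = tr (rbx S M N) (Y ** Z) (Y' ** Z) (fpm f (%x. x)) (rp S M N Y Z m k)"
  "Z' : CS ==> f : emaps Z Z' ==> m : ob M Y ==> k : ob N Z ==>
   rp S M N Y Z' m (tr N Z Z' f k) = tr (rbx S M N) (Y ** Z) (Y ** Z') (fpm (%x. x) f) (rp S M N Y Z m k)"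
 using bilin_tr_left[OF bilin_rp[OF assms(1,2)] lactorD(2)[OF assms(2)] _ assms(3,4)]
  bilin_tr_right[OF bilin_rp[OF assms(1,2)] ractorD(2)[OF assms(1)] _ assms(3,4)] by blast+

text \<open>Equality of the underlying Mackey functors. The different records for modules and
their twists share these, and constructions that see only them coincide.\<close>

definition same where
 "same M M' \<longleftrightarrow> obj M = obj M' & mor M = mor M'"

lemma box_cong: assumes "same M M'" "same N N'"
 shows "bx M N = bx M' N'" "bp M N = bp M' N'"
proof -
 have e: "obj M = obj M'" "mor M = mor M'" "obj N = obj N'" "mor N = mor N'" using assms by (simp_all add: same_def)
 have g: "box_gens n M N X = box_gens n M' N' X" for X by (simp add: box_gens_def e)
 have r: "box_rels n M N X = box_rels n M' N' X" for X by (simp add: box_rels_def e g)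
 have s: "box_sub n M N X = box_sub n M' N' X" for X by (simp add: box_sub_def g r)
 have c: "box_cls n M N X = box_cls n M' N' X" for X by (simp add: fun_eq_iff box_cls_def g s)
 show "bx M N = bx M' N'" by (simp add: box_def g s c)
 show "bp M N = bp M' N'" by (simp add: fun_eq_iff box_pair_def c)
qed

lemma same_refl [simp]: "same M M" by (simp add: same_def)

lemma box_map_cong: "same M M' ==> same N N' ==> bmap M N = bmap M' N'"
 using box_cong[of M M' N N'] by (simp add: box_map_def fun_eq_iff)

lemma box_sym_cong: "same M M' ==> same N N' ==> box_sym n M N = box_sym n M' N'"
 using box_cong[of N N' M M'] by (simp add: box_sym_def)

lemma box_assoc_cong: assumes "same L L'" "same M M'" "same N N'"
 shows "box_assoc n L M N = box_assoc n L' M' N'" "box_assoc' n L M N = box_assoc' n L' M' N'"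
proof -
 have 1: "bx M N = bx M' N'" "bp M N = bp M' N'" using box_cong[OF assms(2,3)] .
 have 2: "bx L (bx M' N') = bx L' (bx M' N')" "bp L (bx M' N') = bp L' (bx M' N')"
  using box_cong[OF assms(1) same_refl] .
 have 3: "bx (bx L M) N = bx (bx L' M') N'"
  using box_cong(1)[OF assms(1,2)] box_cong(1)[OF same_refl[of "bx L' M'"] assms(3)] by simp
 show "box_assoc n L M N = box_assoc n L' M' N'"
  by (simp add: box_assoc_def Let_def 1 2)
 then show "box_assoc' n L M N = box_assoc' n L' M' N'"
  by (simp add: box_assoc'_def 3)
qed

lemma rproj_cong: assumes "same M M'" "same N N'" "ract M = ract M'" "lact N = lact N'"
 shows "rproj n S M N = rproj n S M' N'" "rbx S M N = rbx S M' N'" "rp S M N = rp S M' N'"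
proof -
 have 1: "bx M N = bx M' N'" "bp M N = bp M' N'" using box_cong[OF assms(1,2)] .
 have 2: "bx M S = bx M' S" using box_cong(1)[OF assms(1) same_refl] .
 have 3: "bx (bx M' S) N = bx (bx M' S) N'" using box_cong(1)[OF same_refl assms(2)] .
 note 4 = box_map_cong[OF assms(1,2)] box_assoc_cong(1)[OF assms(1) same_refl assms(2)]
 show "rproj n S M N = rproj n S M' N'" by (simp add: rproj_def 1 2 3 4 assms(3,4))
 then show "rp S M N = rp S M' N'" by (simp add: rp_def fun_eq_iff 1)
 show "rbx S M N = rbx S M' N'" by (simp add: rbox_def 1 2 3 4 assms(3,4))
qed

lemma same_rules:
 assumes "same A B"
 shows "obj A = obj B" "mor A = mor B"
  "mackey A = mackey B"
  "bx A L1 = bx B L1" "bx L2 A = bx L2 B" "bp A L1 = bp B L1" "bp L2 A = bp L2 B"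
  "bmap A L1 = bmap B L1" "bmap L2 A = bmap L2 B" "box_sym n A L1 = box_sym n B L1" "box_sym n L2 A = box_sym n L2 B"
  "mhm A L3 = mhm B L3" "mhm L4 A = mhm L4 B" "tr A = tr B"
  "bilin A L5 L6 = bilin B L5 L6" "bilin L7 A L8 = bilin L7 B L8" "bilin L9 L10 A = bilin L9 L10 B" "mgen A = mgen B"
  "mack_eq n A = mack_eq n B" "box_lift A = box_lift B" "minv A = minv B" "galpha n A = galpha n B"
proof -
 show "obj A = obj B" "mor A = mor B" using assms by (simp_all add: same_def)
 show "bx A L1 = bx B L1" "bp A L1 = bp B L1" by (rule box_cong[OF assms same_refl])+
 show "bx L2 A = bx L2 B" "bp L2 A = bp L2 B" by (rule box_cong[OF same_refl assms])+
 show "bmap A L1 = bmap B L1" by (rule box_map_cong[OF assms same_refl])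
 show "bmap L2 A = bmap L2 B" by (rule box_map_cong[OF same_refl assms])
 show "box_sym n A L1 = box_sym n B L1" by (rule box_sym_cong[OF assms same_refl])
 show "box_sym n L2 A = box_sym n L2 B" by (rule box_sym_cong[OF same_refl assms])
qed (use assms in \<open>simp_all add: same_def mackey_functor_def mack_hom_def tr_def[abs_def] bilin_def[abs_def] mgen_def[abs_def] subfun_def
  mack_eq_def[abs_def] box_lift_def[abs_def] minv_def[abs_def] galpha_def[abs_def]\<close>)

lemma same_odot: "same (odo R S T M N) (rbx S M N)"
 and same_ubimod: "same (ubimod R) R" and same_Theta: "same (Theta n R g) R"
 and same_ltw: "same (ltw n R g M) M" and same_rtw: "same (rtw n S g M) M"
 and same_free: "same (free_lmod n R M) (bx R M)" and same_dual: "same (dual_bimod n R S P) (rh R P (ubimod R))"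
 by (simp_all add: same_def odot_def ubimod_def Theta_def ltw_def rtw_def free_lmod_def dual_bimod_def)

lemmas und_simps [simp] = same_rules[OF same_odot] same_rules[OF same_ubimod] same_rules[OF same_Theta]
 same_rules[OF same_ltw] same_rules[OF same_rtw] same_rules[OF same_free] same_rules[OF same_dual]

lemma twist_acts [simp]: "ract (ltw n R g M) = ract M" "lact (rtw n S g M) = lact M"
 by (simp_all add: ltw_def rtw_def)

lemma twist_rbox [simp]:
 "rproj n S (ltw n R g M) N = rproj n S M N" "rbx S (ltw n R g M) N = rbx S M N" "rp S (ltw n R g M) N = rp S M N"
 "rproj n S M (rtw n T g K) = rproj n S M K" "rbx S M (rtw n T g K) = rbx S M K" "rp S M (rtw n T g K) = rp S M K"
 by (rule rproj_cong; simp add: same_ltw same_rtw)+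

lemma lm_cong: "same M M' ==> lact M = lact M' ==> lm R M = lm R M'"
 using box_cong(2)[OF same_refl, of M M' R] by (simp add: lm_def fun_eq_iff)

lemma rm_cong: "same M M' ==> ract M = ract M' ==> rm M S = rm M' S"
 using box_cong(2)[OF _ same_refl, of M M' S] by (simp add: rm_def fun_eq_iff)

lemma twist_lm_rm [simp]: "lm R (rtw n S g M) = lm R M" "rm (ltw n R' g M') S' = rm M' S'"
 by (rule lm_cong rm_cong; simp add: same_ltw same_rtw)+

section \<open>Bimodules and their composition\<close>

text \<open>The data of a bimodule without units: two actions that commute.\<close>

definition bmod where
 "bmod R S M \<longleftrightarrow> lactor R M & ractor S M & (ALL A : CS. ALL Y : CS. ALL B : CS. ALL r : ob R A. ALL m : ob M Y. ALL s : ob S B.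
  lm R M A (Y ** B) r (rm M S Y B m s) =
   tr M ((A ** Y) ** B) (A ** Y ** B) fas (rm M S (A ** Y) B (lm R M A Y r m) s))"

lemma bmodD: "bmod R S M ==> lactor R M" "bmod R S M ==> ractor S M"
 "bmod R S M ==> mackey R" "bmod R S M ==> mackey S" "bmod R S M ==> mackey M"
 by (auto simp: bmod_def lactor_def ractor_def)

lemma bmod_assoc [simp]: "bmod R S M ==> A : CS ==> Y : CS ==> B : CS ==> r : ob R A ==> m : ob M Y ==> s : ob S B ==>
  lm R M A (Y ** B) r (rm M S Y B m s) =
   tr M ((A ** Y) ** B) (A ** Y ** B) fas (rm M S (A ** Y) B (lm R M A Y r m) s)"
 unfolding bmod_def by blast

lemma compat_maps:
 assumes l: "lactor R M" and r: "ractor S M"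
 shows "ract M oM bmap M S (lact M) mid : mhm (bx (bx R M) S) M"
  "lact M oM bmap R M mid (ract M) oM box_assoc n R M S : mhm (bx (bx R M) S) M"
  "A : CS ==> Y : CS ==> B : CS ==> x : ob R A ==> m : ob M Y ==> s : ob S B ==>
   (ract M oM bmap M S (lact M) mid) ((A ** Y) ** B) (bp (bx R M) S (A ** Y) B (bp R M A Y x m) s) =
   rm M S (A ** Y) B (lm R M A Y x m) s"
  "A : CS ==> Y : CS ==> B : CS ==> x : ob R A ==> m : ob M Y ==> s : ob S B ==>
   (lact M oM bmap R M mid (ract M) oM box_assoc n R M S) ((A ** Y) ** B) (bp (bx R M) S (A ** Y) B (bp R M A Y x m) s) =
   tr M (A ** Y ** B) ((A ** Y) ** B) fas' (lm R M A (Y ** B) x (rm M S Y B m s))"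
proof -
 note D = lactorD[OF l] ractorD(1,3)[OF r]
 note f1 = box_map_facts[OF D(3) mid_hom box_mackey[OF D(1,2)] D(4) D(2) D(4)]
 note f2 = box_map_facts[OF mid_hom D(5) D(1) box_mackey[OF D(2,4)] D(1,2)]
 note f3 = box_assoc_facts[OF D(1,2,4)]
 show "ract M oM bmap M S (lact M) mid : mhm (bx (bx R M) S) M"
  by (rule mh_comp[OF f1(1) D(5)])
 show "lact M oM bmap R M mid (ract M) oM box_assoc n R M S : mhm (bx (bx R M) S) M"
  by (rule mh_comp[OF mh_comp[OF f3(1) f2(1)] D(3)])
 assume v: "A : CS" "Y : CS" "B : CS" "x : ob R A" "m : ob M Y" "s : ob S B"
 show "(ract M oM bmap M S (lact M) mid) ((A ** Y) ** B) (bp (bx R M) S (A ** Y) B (bp R M A Y x m) s) =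
   rm M S (A ** Y) B (lm R M A Y x m) s"
  using v D by (simp add: mcomp_def f1(2) rm_def lm_def)
 show "(lact M oM bmap R M mid (ract M) oM box_assoc n R M S) ((A ** Y) ** B) (bp (bx R M) S (A ** Y) B (bp R M A Y x m) s) =
   tr M (A ** Y ** B) ((A ** Y) ** B) fas' (lm R M A (Y ** B) x (rm M S Y B m s))"
  using v D r by (simp add: mcomp_def f3(2) f2(2) mh_tr[OF f2(1)] mh_tr[OF D(3)] lm_def rm_def mhD(1)[OF D(5)])
qed

text \<open>Commutation of the actions is an equality of two maps from a triple box product.\<close>

lemma bmodI:
 assumes l: "lactor R M" and r: "ractor S M" and Q: "mgen M Q"
  and gen: "!!A Y B x m s. A : CS ==> Y : CS ==> B : CS ==> x : ob R A ==> Q Y m ==> s : ob S B ==>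
   rm M S (A ** Y) B (lm R M A Y x m) s = tr M (A ** Y ** B) ((A ** Y) ** B) fas' (lm R M A (Y ** B) x (rm M S Y B m s))"
 shows "bmod R S M"
 unfolding bmod_def
proof (intro conjI ballI l r)
 note D = lactorD[OF l] ractorD(1,3)[OF r]
 note c = compat_maps[OF l r]
 fix A Y B x m s assume v: "A : CS" "Y : CS" "B : CS" "x : ob R A" "m : ob M Y" "s : ob S B"
 have "rm M S (A ** Y) B (lm R M A Y x m) s = tr M (A ** Y ** B) ((A ** Y) ** B) fas' (lm R M A (Y ** B) x (rm M S Y B m s))"
  unfolding c(3,4)[OF v, symmetric]
 proof (rule mack_hom_eqI[OF mgen_box[OF box_mackey[OF D(1,2)] D(4) mgen_box[OF D(1,2) mgen_all Q] mgen_all] c(1,2)])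
  fix X z assume "EX Y Z m k. Y : CS & Z : CS & (EX A B l b. A : CS & B : CS &
   l : ob R A & Q B b & Y = A ** B & m = bp R M A B l b) & k : ob S Z & X = Y ** Z & z = bp (bx R M) S Y Z m k"
  then obtain A Y B x m s where w: "A : CS" "Y : CS" "B : CS" "x : ob R A" "Q Y m" "s : ob S B"
   "X = (A ** Y) ** B" "z = bp (bx R M) S (A ** Y) B (bp R M A Y x m) s"
   by (elim exE conjE) simp
  show "(ract M oM bmap M S (lact M) mid) X z = (lact M oM bmap R M mid (ract M) oM box_assoc n R M S) X z"
   unfolding w(7,8) c(3,4)[OF w(1-4) mgenD[OF Q w(2,5)] w(6)] by (rule gen[OF w(1-6)])
 qed (use v D in simp_all)
 then show "lm R M A (Y ** B) x (rm M S Y B m s) = tr M ((A ** Y) ** B) (A ** Y ** B) fas (rm M S (A ** Y) B (lm R M A Y x m) s)"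
  using v l r D by (simp add: tr_id_ball)
qed

context
 fixes R :: "('r, 'u) green_scheme" and S :: "('s, 'v) green_scheme" and T :: "('t, 'w) green_scheme"
  and M :: "('r, 'm, 's, 'x) bimod_scheme" and N :: "('s, 'k, 't, 'y) bimod_scheme"
 assumes M: "bmod R S M" and N: "bmod S T N"
begin

lemma odot_facts:
 shows "lactor R (odo R S T M N)" "ractor T (odo R S T M N)"
  "A : CS ==> Y : CS ==> Z : CS ==> r : ob R A ==> m : ob M Y ==> k : ob N Z ==>
   lm R (odo R S T M N) A (Y ** Z) r (rp S M N Y Z m k) =
   tr (rbx S M N) ((A ** Y) ** Z) (A ** Y ** Z) fas (rp S M N (A ** Y) Z (lm R M A Y r m) k)"
  "A : CS ==> Y : CS ==> Z : CS ==> t : ob T A ==> m : ob M Y ==> k : ob N Z ==>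
   rm (odo R S T M N) T (Y ** Z) A (rp S M N Y Z m k) t =
   tr (rbx S M N) (Y ** Z ** A) ((Y ** Z) ** A) fas' (rp S M N Y (Z ** A) m (rm N T Z A k t))"
proof -
 note MD = bmodD[OF M] lactorD(3)[OF bmodD(1)[OF M]] ractorD(3)[OF bmodD(2)[OF M]]
 note ND = bmodD[OF N] lactorD(3)[OF bmodD(1)[OF N]] ractorD(3)[OF bmodD(2)[OF N]]
 note m = MD(2) ND(1)
 note rbM = rbox_mackey[OF m] and rpj = rproj_hom[OF m]
 let ?H = "rproj n S M N oM bmap M N (lact M) mid oM box_assoc' n R M N"
 let ?G = "rproj n S M N oM bmap M N mid (ract N) oM box_assoc n M N T"
 note f1 = box_map_facts[OF MD(6) mid_hom box_mackey[OF MD(3,5)] ND(5) MD(5) ND(5)]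
 note f2 = box_assoc'_facts[OF MD(3,5) ND(5)]
 note g1 = box_map_facts[OF mid_hom ND(7) MD(5) box_mackey[OF ND(5,4)] MD(5) ND(5)]
 note g2 = box_assoc_facts[OF MD(5) ND(5,4)]
 have H: "?H : mhm (bx R (bx M N)) (rbx S M N)"
  by (rule mh_comp[OF mh_comp[OF f2(1) f1(1)] rpj])
 have G: "?G : mhm (bx (bx M N) T) (rbx S M N)"
  by (rule mh_comp[OF mh_comp[OF g2(1) g1(1)] rpj])
 have Hv: "?H (A ** Y ** Z) (bp R (bx M N) A (Y ** Z) r (bp M N Y Z x k)) =
   tr (rbx S M N) ((A ** Y) ** Z) (A ** Y ** Z) fas (rp S M N (A ** Y) Z (lm R M A Y r x) k)"
  if "A : CS" "Y : CS" "Z : CS" "r : ob R A" "x : ob M Y" "k : ob N Z" for A Y Z r x k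
  using that MD ND by (simp add: mcomp_def f2(2) f1(2) mh_tr[OF f1(1)] mh_tr[OF rpj] lm_def rp_def mhD(1)[OF MD(6)])
 have Gv: "?G ((Y ** Z) ** A) (bp (bx M N) T (Y ** Z) A (bp M N Y Z x k) t) =
   tr (rbx S M N) (Y ** Z ** A) ((Y ** Z) ** A) fas' (rp S M N Y (Z ** A) x (rm N T Z A k t))"
  if "A : CS" "Y : CS" "Z : CS" "t : ob T A" "x : ob M Y" "k : ob N Z" for A Y Z t x k
  using that MD ND by (simp add: mcomp_def g2(2) g1(2) mh_tr[OF g1(1)] mh_tr[OF rpj] rm_def rp_def mhD(1)[OF ND(7)])
 have l: "lact (odo R S T M N) = box_lift (rbx S M N) (%A X r c. the_elem ((%t. ?H (A ** X) (bp R (bx M N) A X r t)) ` c))"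
  by (simp add: odot_def mcomp_def)
 have rr: "ract (odo R S T M N) = box_lift (rbx S M N) (%X A c r. the_elem ((%t. ?G (X ** A) (bp (bx M N) T X A t r)) ` c))"
  by (simp add: odot_def mcomp_def)
 have b1: "?H (B ** (Y ** A) ** Z) (bp R (bx M N) B ((Y ** A) ** Z) r (bp M N (Y ** A) Z (rm M S Y A m s) k)) =
   tr (rbx S M N) (B ** Y ** A ** Z) (B ** (Y ** A) ** Z) (fpm (%x. x) fas')
    (?H (B ** Y ** A ** Z) (bp R (bx M N) B (Y ** A ** Z) r (bp M N Y (A ** Z) m (lm S N A Z s k))))"
  if "B : CS" "Y : CS" "A : CS" "Z : CS" "r : ob R B" "m : ob M Y" "s : ob S A" "k : ob N Z" for B Y A Z r m s k
  using that MD ND rbM M by (simp add: Hv rp_balanced[OF m]) (rule tr_eqI_ball, simp)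
 have b2: "?G (((Y ** A) ** Z) ** B) (bp (bx M N) T ((Y ** A) ** Z) B (bp M N (Y ** A) Z (rm M S Y A m s) k) r) =
   tr (rbx S M N) ((Y ** A ** Z) ** B) (((Y ** A) ** Z) ** B) (fpm fas' (%x. x))
    (?G ((Y ** A ** Z) ** B) (bp (bx M N) T (Y ** A ** Z) B (bp M N Y (A ** Z) m (lm S N A Z s k)) r))"
  if "B : CS" "Y : CS" "A : CS" "Z : CS" "r : ob T B" "m : ob M Y" "s : ob S A" "k : ob N Z" for B Y A Z r m s k
  using that MD ND rbM N by (simp add: Gv rp_balanced[OF m]) (rule tr_eqI_ball, simp)
 note rr1 = rbox_right[OF m MD(3) rbM H b1] and rl1 = rbox_left[OF m ND(4) rbM G b2]
 note lf = box_lift_facts[OF MD(3) rbM rbM rr1(1), folded l] and rf = box_lift_facts[OF rbM ND(4) rbM rl1(1), folded rr]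
 show "lactor R (odo R S T M N)" using lf(1) MD(3) rbM by (simp add: lactor_def)
 show "ractor T (odo R S T M N)" using rf(1) ND(4) rbM by (simp add: ractor_def)
 show "A : CS ==> Y : CS ==> Z : CS ==> r : ob R A ==> m : ob M Y ==> k : ob N Z ==>
   lm R (odo R S T M N) A (Y ** Z) r (rp S M N Y Z m k) =
   tr (rbx S M N) ((A ** Y) ** Z) (A ** Y ** Z) fas (rp S M N (A ** Y) Z (lm R M A Y r m) k)"
  using MD ND rr1(2)[of A Y Z r m k] Hv[of A Y Z r m k] by (simp add: lm_def[of R "odo R S T M N"] lf(2) mid_def)
 show "A : CS ==> Y : CS ==> Z : CS ==> t : ob T A ==> m : ob M Y ==> k : ob N Z ==>
   rm (odo R S T M N) T (Y ** Z) A (rp S M N Y Z m k) t =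
   tr (rbx S M N) (Y ** Z ** A) ((Y ** Z) ** A) fas' (rp S M N Y (Z ** A) m (rm N T Z A k t))"
  using MD ND rl1(2)[of A Y Z t m k] Gv[of A Y Z t m k] by (simp add: rm_def[of "odo R S T M N" T] rf(2) mid_def)
qed

lemma odot_bmod: "bmod R T (odo R S T M N)"
proof (rule bmodI[OF odot_facts(1,2)])
 note MD = bmodD[OF M] and ND = bmodD[OF N]
 note m = MD(2) ND(1)
 show "mgen (odo R S T M N) (%X t. EX Y Z m k. Y : CS & Z : CS & m : ob M Y & k : ob N Z & X = Y ** Z & t = rp S M N Y Z m k)"
  using mgen_rbox[OF m mgen_all mgen_all] by simp
 fix A X B x c s assume a: "A : CS" "X : CS" "B : CS" "x : ob R A" "s : ob T B"
  "EX Y Z m k. Y : CS & Z : CS & m : ob M Y & k : ob N Z & X = Y ** Z & c = rp S M N Y Z m k"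
 then obtain Y Z m k where v: "Y : CS" "Z : CS" "m : ob M Y" "k : ob N Z" "X = Y ** Z" "c = rp S M N Y Z m k"
  by (elim exE conjE)
 show "rm (odo R S T M N) T (A ** X) B (lm R (odo R S T M N) A X x c) s =
   tr (odo R S T M N) (A ** X ** B) ((A ** X) ** B) fas' (lm R (odo R S T M N) A (X ** B) x (rm (odo R S T M N) T X B c s))"
  using a(1-5) v(1-4) MD ND rm_tr(1)[OF odot_facts(2)] lm_tr(2)[OF odot_facts(1)] unfolding v(5,6)
  by (simp add: odot_facts(3,4)) (rule tr_eqI_ball, simp)
qed

end

section \<open>Associativity of composition of bimodules\<close>

context
 fixes R :: "('r, 'u) green_scheme" and S :: "('s, 'v) green_scheme" and T :: "('t, 'w) green_scheme" and Q :: "('q, 'o) green_scheme"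
  and L :: "('r, 'l, 's, 'x) bimod_scheme" and M :: "('s, 'm, 't, 'y) bimod_scheme" and N :: "('t, 'k, 'q, 'z) bimod_scheme"
 assumes L: "bmod R S L" and M: "bmod S T M" and N: "bmod T Q N"
begin

abbreviation (input) "oLM == odo R S T L M"
abbreviation (input) "oMN == odo S T Q M N"
abbreviation (input) "lhs == rbx T oLM N"
abbreviation (input) "rhs == rbx S L oMN"

text \<open>The candidate inverse of the associator, by descending twice.\<close>

definition oassoc_inv where
 "oassoc_inv = desc (box_lift lhs (%Y Z l c. the_elem ((%t.
   (rproj n T oLM N oM bmap oLM N (rproj n S L M) mid oM box_assoc' n L M N) (Y ** Z)
    (bp L (bx M N) Y Z l t)) ` c)))"

lemma oassoc_maps:
 shows "oassoc n S T Q L M N : mhm lhs rhs"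
  "A : CS ==> B : CS ==> C : CS ==> l : ob L A ==> m : ob M B ==> k : ob N C ==>
   oassoc n S T Q L M N ((A ** B) ** C) (rp T oLM N (A ** B) C (rp S L M A B l m) k) =
   tr rhs (A ** B ** C) ((A ** B) ** C) fas' (rp S L oMN A (B ** C) l (rp T M N B C m k))"
  "oassoc_inv : mhm rhs lhs"
  "A : CS ==> B : CS ==> C : CS ==> l : ob L A ==> m : ob M B ==> k : ob N C ==>
   oassoc_inv (A ** B ** C) (rp S L oMN A (B ** C) l (rp T M N B C m k)) =
   tr lhs ((A ** B) ** C) (A ** B ** C) fas (rp T oLM N (A ** B) C (rp S L M A B l m) k)"
proof -
 note LD = bmodD[OF L] and MD = bmodD[OF M] and ND = bmodD[OF N]
 note LM = odot_facts[OF L M] and MN = odot_facts[OF M N]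
 note m1 = LD(2) MD(1) and m2 = MD(2) ND(1) and m3 = LM(2) ND(1) and m4 = LD(2) MN(1)
 note mk [simp] = rbox_mackey[OF m1] rbox_mackey[OF m2] rbox_mackey[OF m3] rbox_mackey[OF m4]
 note oh = rproj_hom[OF m1] rproj_hom[OF m2] rproj_hom[OF m3, simplified] rproj_hom[OF m4, simplified]
 have rp4: "rproj n S L oMN (Y ** Z) (bp L (rbx T M N) Y Z l c) = rp S L oMN Y Z l c" for Y Z l c
  by (simp add: rp_def)
 have rp3: "rproj n T oLM N (Y ** Z) (bp (rbx S L M) N Y Z l c) = rp T oLM N Y Z l c" for Y Z l c
  by (simp add: rp_def)
 have rc4: "rp S L oMN Y Z l c : ob rhs (Y ** Z)" if "Y : CS" "Z : CS" "l : ob L Y" "c : ob (rbx T M N) Z" for Y Z l c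
  using rp_closed[OF m4 that(1-3)] that(4) by simp
 have rc3: "rp T oLM N Y Z l c : ob lhs (Y ** Z)" if "Y : CS" "Z : CS" "l : ob (rbx S L M) Y" "c : ob N Z" for Y Z l c
  using rp_closed[OF m3 that(1,2) _ that(4)] that(3) by simp
 note b4 = rp_balanced[OF m4, simplified] and b3 = rp_balanced[OF m3, simplified]
 note t4 = rp_tr[OF m4, simplified same_rules[OF same_odot]] and t3 = rp_tr[OF m3, simplified same_rules[OF same_odot]]
 define HH where "HH = rproj n S L oMN oM bmap L oMN mid (rproj n T M N) oM box_assoc n L M N"
 define GG where "GG = rproj n T oLM N oM bmap oLM N (rproj n S L M) mid oM box_assoc' n L M N"
 note f1 = box_map_facts[OF mid_hom oh(2) LD(5) box_mackey[OF MD(5) ND(5)] LD(5) mk(2)]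
 note f2 = box_assoc_facts[OF LD(5) MD(5) ND(5)]
 note g1 = box_map_facts[OF oh(1) mid_hom box_mackey[OF LD(5) MD(5)] ND(5) mk(1) ND(5)]
 note g2 = box_assoc'_facts[OF LD(5) MD(5) ND(5)]
 have H: "HH : mhm (bx (bx L M) N) rhs"
  using mh_comp[OF mh_comp[OF f2(1) f1(1)] oh(4)] by (simp add: HH_def)
 have G: "GG : mhm (bx L (bx M N)) lhs"
  using mh_comp[OF mh_comp[OF g2(1) g1(1)] oh(3)] by (simp add: GG_def)
 have Hv: "HH ((A ** B) ** C) (bp (bx L M) N (A ** B) C (bp L M A B l m) k) =
   tr rhs (A ** B ** C) ((A ** B) ** C) fas' (rp S L oMN A (B ** C) l (rp T M N B C m k))"
  if "A : CS" "B : CS" "C : CS" "l : ob L A" "m : ob M B" "k : ob N C" for A B C l m k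
  using that LD MD ND m2 rp4[of A "B ** C" l "rp T M N B C m k"]
  by (simp add: HH_def mcomp_def f2(2) f1(2) mh_tr[OF f1(1)] mh_tr[OF oh(4)] rp_def[of T M N, symmetric])
 have Gv: "GG (A ** B ** C) (bp L (bx M N) A (B ** C) l (bp M N B C m k)) =
   tr lhs ((A ** B) ** C) (A ** B ** C) fas (rp T oLM N (A ** B) C (rp S L M A B l m) k)"
  if "A : CS" "B : CS" "C : CS" "l : ob L A" "m : ob M B" "k : ob N C" for A B C l m k
  using that LD MD ND m1 rp3[of "A ** B" C "rp S L M A B l m" k]
  by (simp add: GG_def mcomp_def g2(2) g1(2) mh_tr[OF g1(1)] mh_tr[OF oh(3)] rp_def[of S L M, symmetric])
 have bH: "HH (((Y ** A) ** Z) ** B) (bp (bx L M) N ((Y ** A) ** Z) B (bp L M (Y ** A) Z (rm L S Y A m s) k) r) =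
   tr rhs ((Y ** A ** Z) ** B) (((Y ** A) ** Z) ** B) (fpm fas' (%x. x))
    (HH ((Y ** A ** Z) ** B) (bp (bx L M) N (Y ** A ** Z) B (bp L M Y (A ** Z) m (lm S M A Z s k)) r))"
  if "B : CS" "Y : CS" "A : CS" "Z : CS" "r : ob N B" "m : ob L Y" "s : ob S A" "k : ob M Z" for B Y A Z r m s k
  using that LD MD ND m1 m2 by (simp add: Hv b4 t4 rc4 MN(3)) (rule tr_eqI_ball, simp)
 have bG: "GG (B ** (Y ** A) ** Z) (bp L (bx M N) B ((Y ** A) ** Z) r (bp M N (Y ** A) Z (rm M T Y A m s) k)) =
   tr lhs (B ** Y ** A ** Z) (B ** (Y ** A) ** Z) (fpm (%x. x) fas')
    (GG (B ** Y ** A ** Z) (bp L (bx M N) B (Y ** A ** Z) r (bp M N Y (A ** Z) m (lm T N A Z s k))))"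
  if "B : CS" "Y : CS" "A : CS" "Z : CS" "r : ob L B" "m : ob M Y" "s : ob T A" "k : ob N Z" for B Y A Z r m s k
 proof -
  have "rp T oLM N (B ** Y ** A) Z (rp S L M B (Y ** A) r (rm M T Y A m s)) k =
   tr lhs (((B ** Y) ** A) ** Z) ((B ** Y ** A) ** Z) (fpm fas (%x. x))
    (rp T oLM N ((B ** Y) ** A) Z (rm oLM T (B ** Y) A (rp S L M B Y r m) s) k)"
   using that LD MD ND m1 m2 by (simp add: LM(4) t3 rc3 tr_id_ball)
  then show ?thesis
   using that LD MD ND m1 m2 by (simp add: Gv b3 t3 rc3 del: LM(4)) (rule tr_eqI_ball, simp)
 qed
 note l1 = rbox_left[OF m1 ND(5) mk(4) H] and l2 = rbox_right[OF m2 LD(5) mk(3) G]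
 define p1 where "p1 = (%X A c r. the_elem ((%t. HH (X ** A) (bp (bx L M) N X A t r)) ` c))"
 define p2 where "p2 = (%A X r c. the_elem ((%t. GG (A ** X) (bp L (bx M N) A X r t)) ` c))"
 have p1b: "bilin (rbx S L M) N rhs p1" unfolding p1_def by (rule l1(1), rule bH)
 have p1v: "p1 (A ** B) C (rp S L M A B l m) k = tr rhs (A ** B ** C) ((A ** B) ** C) fas' (rp S L oMN A (B ** C) l (rp T M N B C m k))"
  if "A : CS" "B : CS" "C : CS" "l : ob L A" "m : ob M B" "k : ob N C" for A B C l m k
  unfolding p1_def Hv[OF that, symmetric] by (rule l1(2), rule bH) (use that in simp_all)
 have p2b: "bilin L (rbx T M N) lhs p2" unfolding p2_def by (rule l2(1), rule bG)
 have p2v: "p2 A (B ** C) l (rp T M N B C m k) = tr lhs ((A ** B) ** C) (A ** B ** C) fas (rp T oLM N (A ** B) C (rp S L M A B l m) k)"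
  if "A : CS" "B : CS" "C : CS" "l : ob L A" "m : ob M B" "k : ob N C" for A B C l m k
  unfolding p2_def Gv[OF that, symmetric] by (rule l2(2), rule bG) (use that in simp_all)
 note lf1 = box_lift_facts[OF mk(1) ND(5) mk(4) p1b] and lf2 = box_lift_facts[OF LD(5) mk(2) mk(3) p2b]
 have d1: "oassoc n S T Q L M N = desc (box_lift rhs p1)" by (simp add: oassoc_def Let_def p1_def HH_def mcomp_def)
 have d2: "oassoc_inv = desc (box_lift lhs p2)" by (simp add: oassoc_inv_def p2_def GG_def mcomp_def)
 have g1': "mgen oLM (%X t. EX Y Z l m. Y : CS & Z : CS & l : ob L Y & m : ob M Z & X = Y ** Z & t = rp S L M Y Z l m)"
  using mgen_rbox[OF m1 mgen_all mgen_all] by simp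
 have g2': "mgen oMN (%X t. EX Y Z l m. Y : CS & Z : CS & l : ob M Y & m : ob N Z & X = Y ** Z & t = rp T M N Y Z l m)"
  using mgen_rbox[OF m2 mgen_all mgen_all] by simp
 note p1t = bilin_tr_left[OF p1b ND(5)] bilin_tr_right[OF p1b mk(1)] and p2t = bilin_tr_left[OF p2b mk(2)] bilin_tr_right[OF p2b LD(5)]
 have bal1: "box_lift rhs p1 ((X ** A) ** Z) (bp oLM N (X ** A) Z (rm oLM T X A c s) k) =
   tr rhs (X ** A ** Z) ((X ** A) ** Z) fas' (box_lift rhs p1 (X ** A ** Z) (bp oLM N X (A ** Z) c (lm T N A Z s k)))"
  if a: "X : CS" "A : CS" "Z : CS"
   and c: "EX Y Z l m. Y : CS & Z : CS & l : ob L Y & m : ob M Z & X = Y ** Z & c = rp S L M Y Z l m"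
   and s: "s : ob T A" and k: "k : ob N Z" for X A Z c s k
 proof -
  obtain Y W l m where v: "Y : CS" "W : CS" "l : ob L Y" "m : ob M W" "X = Y ** W" "c = rp S L M Y W l m"
   using c by (elim exE conjE)
  have r: "rm oLM T X A c s : ob (rbx S L M) (X ** A)" using rm_closed[OF LM(2), of X A c s] a v s m1 by simp
  show ?thesis
   using a(2,3) v(1-4) s k r LD MD ND m1 m2 unfolding v(5,6)
   by (simp add: lf1(2) mh_tr[OF lf1(1)] p1v LM(4) p1t rp_balanced[OF m2] t4 rc4) (rule tr_eqI_ball, simp)
 qed
 have bal2: "box_lift lhs p2 ((Y ** A) ** X) (bp L oMN (Y ** A) X (rm L S Y A l s) c) =
   tr lhs (Y ** A ** X) ((Y ** A) ** X) fas' (box_lift lhs p2 (Y ** A ** X) (bp L oMN Y (A ** X) l (lm S oMN A X s c)))"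
  if a: "Y : CS" "A : CS" "X : CS" and l: "l : ob L Y" and s: "s : ob S A"
   and c: "EX Y Z m k. Y : CS & Z : CS & m : ob M Y & k : ob N Z & X = Y ** Z & c = rp T M N Y Z m k" for Y A X l s c
 proof -
  obtain B C m k where v: "B : CS" "C : CS" "m : ob M B" "k : ob N C" "X = B ** C" "c = rp T M N B C m k"
   using c by (elim exE conjE)
  have r: "lm S oMN A X s c : ob (rbx T M N) (A ** X)" using lm_closed[OF MN(1), of A X s c] a v s m2 by simp
  show ?thesis
   using a(1,2) v(1-4) l s r LD MD ND m1 m2 unfolding v(5,6)
   by (simp add: lf2(2) mh_tr[OF lf2(1)] p2v MN(3) p2t rp_balanced[OF m1] t3 rc3) (rule tr_eqI_ball, simp)
 qed
 have h1: "box_lift rhs p1 : mhm (bx oLM N) rhs" and h2: "box_lift lhs p2 : mhm (bx L oMN) lhs"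
  using lf1(1) lf2(1) by simp_all
 note D1 = rbox_desc[OF m3 mk(4) h1 g1' mgen_all mgen_all bal1, folded d1]
  and D2 = rbox_desc[OF m4 mk(3) h2 mgen_all mgen_all g2' bal2, folded d2]
 show "oassoc n S T Q L M N : mhm lhs rhs" by (rule D1(1))
 show "oassoc_inv : mhm rhs lhs" by (rule D2(1))
 assume v: "A : CS" "B : CS" "C : CS" "l : ob L A" "m : ob M B" "k : ob N C"
 show "oassoc n S T Q L M N ((A ** B) ** C) (rp T oLM N (A ** B) C (rp S L M A B l m) k) =
   tr rhs (A ** B ** C) ((A ** B) ** C) fas' (rp S L oMN A (B ** C) l (rp T M N B C m k))"
  using D1(3)[of "A ** B" C "rp S L M A B l m" k] v m1 by (simp add: lf1(2) p1v)
 show "oassoc_inv (A ** B ** C) (rp S L oMN A (B ** C) l (rp T M N B C m k)) =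
   tr lhs ((A ** B) ** C) (A ** B ** C) fas (rp T oLM N (A ** B) C (rp S L M A B l m) k)"
  using D2(3)[of A "B ** C" l "rp T M N B C m k"] v m2 by (simp add: lf2(2) p2v)
qed

lemma oassoc'_facts:
 shows "oassoc' n R S T Q L M N : mhm rhs lhs"
  "A : CS ==> B : CS ==> C : CS ==> l : ob L A ==> m : ob M B ==> k : ob N C ==>
   oassoc' n R S T Q L M N (A ** B ** C) (rp S L oMN A (B ** C) l (rp T M N B C m k)) =
   tr lhs ((A ** B) ** C) (A ** B ** C) fas (rp T oLM N (A ** B) C (rp S L M A B l m) k)"
proof -
 note LD = bmodD[OF L] and MD = bmodD[OF M] and ND = bmodD[OF N]
 note LM = odot_facts[OF L M] and MN = odot_facts[OF M N]
 note m1 = LD(2) MD(1) and m2 = MD(2) ND(1) and m3 = LM(2) ND(1) and m4 = LD(2) MN(1)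
 note mk [simp] = rbox_mackey[OF m1] rbox_mackey[OF m2] rbox_mackey[OF m3] rbox_mackey[OF m4]
 note O = oassoc_maps
 have rc4: "rp S L oMN Y Z l c : ob rhs (Y ** Z)" if "Y : CS" "Z : CS" "l : ob L Y" "c : ob (rbx T M N) Z" for Y Z l c
  using rp_closed[OF m4 that(1-3)] that(4) by simp
 have rc3: "rp T oLM N Y Z l c : ob lhs (Y ** Z)" if "Y : CS" "Z : CS" "l : ob (rbx S L M) Y" "c : ob N Z" for Y Z l c
  using rp_closed[OF m3 that(1,2) _ that(4)] that(3) by simp
 have g1': "mgen oLM (%X t. EX Y Z l m. Y : CS & Z : CS & l : ob L Y & m : ob M Z & X = Y ** Z & t = rp S L M Y Z l m)"
  using mgen_rbox[OF m1 mgen_all mgen_all] by simp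
 have g2': "mgen oMN (%X t. EX Y Z l m. Y : CS & Z : CS & l : ob M Y & m : ob N Z & X = Y ** Z & t = rp T M N Y Z l m)"
  using mgen_rbox[OF m2 mgen_all mgen_all] by simp
 have 1: "oassoc_inv X (oassoc n S T Q L M N X x) = x" if X: "X : CS" "x : ob lhs X" for X x
  using mack_hom_eqI[OF mgen_rbox[OF m3 g1' mgen_all] mh_comp[OF O(1) O(3)] mid_hom mk(3) mk(3) _ X]
  unfolding mcomp_def mid_apply
 proof this
  fix X x assume "EX Y Z m k. Y : CS & Z : CS & (EX A B l b. A : CS & B : CS & l : ob L A & b : ob M B &
   Y = A ** B & m = rp S L M A B l b) & k : ob N Z & X = Y ** Z & x = rp T oLM N Y Z m k"
  then show "oassoc_inv X (oassoc n S T Q L M N X x) = x"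
   by (elim exE conjE) (use LD MD ND m1 m2 in \<open>simp add: O(2,4) mh_tr[OF O(3)] rc3 rc4 tr_id_ball\<close>)
 qed
 have 2: "oassoc n S T Q L M N X (oassoc_inv X x) = x" if X: "X : CS" "x : ob rhs X" for X x
  using mack_hom_eqI[OF mgen_rbox[OF m4 mgen_all g2'] mh_comp[OF O(3) O(1)] mid_hom mk(4) mk(4) _ X]
  unfolding mcomp_def mid_apply
 proof this
  fix X x assume "EX Y Z m k. Y : CS & Z : CS & m : ob L Y & (EX A B l b. A : CS & B : CS & l : ob M A & b : ob N B &
   Z = A ** B & k = rp T M N A B l b) & X = Y ** Z & x = rp S L oMN Y Z m k"
  then show "oassoc n S T Q L M N X (oassoc_inv X x) = x"
   by (elim exE conjE) (use LD MD ND m1 m2 in \<open>simp add: O(2,4) mh_tr[OF O(1)] rc3 rc4 tr_id_ball\<close>)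
 qed
 have eq: "oassoc' n R S T Q L M N X x = oassoc_inv X x" if X: "X : CS" "x : ob rhs X" for X x
  unfolding oassoc'_def by (simp, rule minv_eq[OF O(1) O(3) 1 2 X])
 show "oassoc' n R S T Q L M N : mhm rhs lhs"
  by (rule mack_hom_cong[OF O(3) mk(4)]) (simp add: eq)
 assume v: "A : CS" "B : CS" "C : CS" "l : ob L A" "m : ob M B" "k : ob N C"
 then show "oassoc' n R S T Q L M N (A ** B ** C) (rp S L oMN A (B ** C) l (rp T M N B C m k)) =
   tr lhs ((A ** B) ** C) (A ** B ** C) fas (rp T oLM N (A ** B) C (rp S L M A B l m) k)"
  using m2 by (simp add: eq O(4) rc4)
qed

lemmas oassoc_facts = oassoc_maps(1,2)

end

section \<open>Green functors and their modules\<close>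

definition gm where
 "gm R Y Z a b = gmul R (Y ** Z) (bp R R Y Z a b)"

lemma lm_ubimod [simp]: "lm R (ubimod R) = gm R" and rm_ubimod [simp]: "rm (ubimod R) R = gm R"
 by (simp_all add: lm_def[abs_def] rm_def[abs_def] gm_def[abs_def]) (simp_all add: ubimod_def)

lemma lact_ubimod [simp]: "lact (ubimod R) = gmul R" and ract_ubimod [simp]: "ract (ubimod R) = gmul R"
 by (simp_all add: ubimod_def)

lemma lact_Theta [simp]: "lact (Theta n R g) = gmul R"
 by (simp add: Theta_def)

lemma rbox_Theta [simp]: "rbx S M (Theta n S g) = rbx S M (ubimod S)" "rproj n S M (Theta n S g) = rproj n S M (ubimod S)"
  "rp S M (Theta n S g) = rp S M (ubimod S)"
 by (rule rproj_cong; simp add: same_def)+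

text \<open>The left unitor of the box product comes from the Yoneda lemma at the one-point set.\<close>

lemma bilin_lunit: assumes M: "mackey M"
 shows "bilin (rpr pt) M M (%Y Z a m. mor M Z (Y ** Z) (bco Z (Y ** Z) (bpr pt Y Z Z a (bd Z)) (blunit' n Z)) m)"
proof -
 have u: "blunit' n Z : bhm Z (pt ** Z)" if "Z : CS" for Z
  unfolding structure_graphs by (rule bgraph_closed) (use that in simp_all)
 have b: "bco Z (Y ** Z) (bpr pt Y Z Z a (bd Z)) (blunit' n Z) : bhm Z (Y ** Z)"
  if "Y : CS" "Z : CS" "a : bhm pt Y" for Y Z a
  by (rule bcomp_closed[OF u[OF that(2)] bprod_closed[OF that(3) bid_closed[OF that(2)]]]) (use that in simp)
 show ?thesis
 proof (rule bilinI)
  fix Y Z a a' m assume v: "Y : CS" "Z : CS" "a : ob (rpr pt) Y" "a' : ob (rpr pt) Y" "m : ob M Z"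
  show "mor M Z (Y ** Z) (bco Z (Y ** Z) (bpr pt Y Z Z (a +[(rpr pt),Y] a') (bd Z)) (blunit' n Z)) m =
   mor M Z (Y ** Z) (bco Z (Y ** Z) (bpr pt Y Z Z a (bd Z)) (blunit' n Z)) m +[M,(Y ** Z)]
   mor M Z (Y ** Z) (bco Z (Y ** Z) (bpr pt Y Z Z a' (bd Z)) (blunit' n Z)) m"
   using v u b by (simp add: bprod_badd_left bcomp_badd_left[where Y = "pt ** Z"] mackeyD(5)[OF M])
 next
  fix Y Z Y' Z' xi ze a m
  assume v: "Y : CS" "Z : CS" "Y' : CS" "Z' : CS" "xi : bhm Y Y'" "ze : bhm Z Z'"
   "a : ob (rpr pt) Y" "m : ob M Z"
  have a: "a : bhm pt Y" using v by simp
  have xa: "bco pt Y' xi a : bhm pt Y'" using bcomp_closed[OF a v(5,1)] .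
  have "bco Z (Y' ** Z') (bco Z' (Y' ** Z') (bpr pt Y' Z' Z' (bco pt Y' xi a) (bd Z')) (blunit' n Z')) ze =
   bco Z (Y' ** Z') (bpr pt Y' Z' Z' (bco pt Y' xi a) (bd Z')) (bco Z (pt ** Z') (blunit' n Z') ze)"
   using bcomp_assoc[OF v(6) u[OF v(4)] bprod_closed[OF xa bid_closed[OF v(4)]]] v by simp
  also have "bco Z (pt ** Z') (blunit' n Z') ze = bco Z (pt ** Z') (bpr pt pt Z Z' (bd pt) ze) (blunit' n Z)"
   unfolding structure_graphs(5) by (rule flu'_natural[OF v(6,2,4)])
  also have "bco Z (Y' ** Z') (bpr pt Y' Z' Z' (bco pt Y' xi a) (bd Z')) ... =
   bco Z (Y' ** Z') (bco (pt ** Z) (Y' ** Z') (bpr pt Y' Z' Z' (bco pt Y' xi a) (bd Z')) (bpr pt pt Z Z' (bd pt) ze)) (blunit' n Z)"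
   using bcomp_assoc[OF u[OF v(2)] bprod_closed[OF bid_closed[OF cpoint_csets] v(6)] bprod_closed[OF xa bid_closed[OF v(4)]]] v by simp
  also have "bco (pt ** Z) (Y' ** Z') (bpr pt Y' Z' Z' (bco pt Y' xi a) (bd Z')) (bpr pt pt Z Z' (bd pt) ze) =
   bpr pt Y' Z Z' (bco pt Y' xi a) ze"
   using bprod_bcomp[OF bid_closed[OF cpoint_csets] xa v(6) bid_closed[OF v(4)]] v xa by simp
  also have "... = bco (pt ** Z) (Y' ** Z') (bpr Y Y' Z Z' xi ze) (bpr pt Y Z Z a (bd Z))"
   using bprod_bcomp[OF a v(5) bid_closed[OF v(2)] v(6)] v by simp
  also have "bco Z (Y' ** Z') ... (blunit' n Z) = bco Z (Y' ** Z') (bpr Y Y' Z Z' xi ze) (bco Z (Y ** Z) (bpr pt Y Z Z a (bd Z)) (blunit' n Z))"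
   using bcomp_assoc[OF u[OF v(2)] bprod_closed[OF a bid_closed[OF v(2)]] bprod_closed[OF v(5,6)]] v by simp
  finally show "mor M Z' (Y' ** Z') (bco Z' (Y' ** Z') (bpr pt Y' Z' Z' (mor (rpr pt) Y Y' xi a) (bd Z')) (blunit' n Z')) (mor M Z Z' ze m) =
   mor M (Y ** Z) (Y' ** Z') (bpr Y Y' Z Z' xi ze) (mor M Z (Y ** Z) (bco Z (Y ** Z) (bpr pt Y Z Z a (bd Z)) (blunit' n Z)) m)"
   using mackeyD(4)[OF M v(2,4) _ v(6) b[OF v(3,4) xa] v(8)] mackeyD(4)[OF M v(2) _ _ b[OF v(1,2) a] bprod_closed[OF v(5,6)] v(8)] v by simp
 qed (use M b in \<open>simp_all add: mor_mult\<close>)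
qed

lemma bilin_runit: assumes M: "mackey M"
 shows "bilin M (rpr pt) M (%Y Z m a. mor M Y (Y ** Z) (bco Y (Y ** Z) (bpr Y Y pt Z (bd Y) a) (brunit' n Y)) m)"
proof -
 have u: "brunit' n Z : bhm Z (Z ** pt)" if "Z : CS" for Z
  unfolding structure_graphs by (rule bgraph_closed) (use that in simp_all)
 have b: "bco Y (Y ** Z) (bpr Y Y pt Z (bd Y) a) (brunit' n Y) : bhm Y (Y ** Z)"
  if "Y : CS" "Z : CS" "a : bhm pt Z" for Y Z a
  by (rule bcomp_closed[OF u[OF that(1)] bprod_closed[OF bid_closed[OF that(1)] that(3)]]) (use that in simp)
 have eq: "mor M Y (Y ** Z) (bco Y (Y ** Z) (bpr Y Y pt Z (bd Y) a) (brunit' n Y)) m =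
   tr M (Z ** Y) (Y ** Z) fsw (mor M Y (Z ** Y) (bco Y (Z ** Y) (bpr pt Z Y Y a (bd Y)) (blunit' n Y)) m)"
  if v: "Y : CS" "Z : CS" "m : ob M Y" "a : bhm pt Z" for Y Z m a
 proof -
  have l: "blunit' n Y : bhm Y (pt ** Y)" unfolding structure_graphs by (rule bgraph_closed) (use v in simp_all)
  have s: "bgraph n (Z ** Y) (Y ** Z) fsw : bhm (Z ** Y) (Y ** Z)" "bgraph n (pt ** Y) (Y ** pt) fsw : bhm (pt ** Y) (Y ** pt)"
   by (rule bgraph_closed; use v in simp)+
  have p: "bpr pt Z Y Y a (bd Y) : bhm (pt ** Y) (Z ** Y)" using v by simp
  have "bco Y (Y ** Z) (bgraph n (Z ** Y) (Y ** Z) fsw) (bco Y (Z ** Y) (bpr pt Z Y Y a (bd Y)) (blunit' n Y)) =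
   bco Y (Y ** Z) (bco (pt ** Y) (Y ** Z) (bgraph n (Z ** Y) (Y ** Z) fsw) (bpr pt Z Y Y a (bd Y))) (blunit' n Y)"
   using bcomp_assoc[OF l p s(1)] v by simp
  also have "... = bco Y (Y ** Z) (bco (pt ** Y) (Y ** Z) (bpr Y Y pt Z (bd Y) a) (bgraph n (pt ** Y) (Y ** pt) fsw)) (blunit' n Y)"
   by (subst fsw_natural) (use v in simp_all)
  also have "... = bco Y (Y ** Z) (bpr Y Y pt Z (bd Y) a) (bco Y (Y ** pt) (bgraph n (pt ** Y) (Y ** pt) fsw) (blunit' n Y))"
   using bcomp_assoc[OF l s(2) bprod_closed[OF bid_closed[OF v(1)] v(4)]] v by simp
  also have "bco Y (Y ** pt) (bgraph n (pt ** Y) (Y ** pt) fsw) (blunit' n Y) = brunit' n Y"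
   unfolding structure_graphs by (subst bcomp_bgraph) (use v in \<open>auto intro!: bgraph_cong\<close>)
  finally show ?thesis unfolding tr_def
   using mackeyD(4)[OF M v(1) _ _ bcomp_closed[OF l p] s(1) v(3)] v by simp
 qed
 note bs = bilin_swap[OF bilin_lunit[OF M] M]
 show ?thesis
 proof (rule bilinI)
  fix Y Z m a assume "Y : CS" "Z : CS" "m : ob M Y" "a : ob (rpr pt) Z"
  then show "mor M Y (Y ** Z) (bco Y (Y ** Z) (bpr Y Y pt Z (bd Y) a) (brunit' n Y)) m : ob M (Y ** Z)"
   using bilinD(1)[OF bs] by (simp add: eq)
 next
  fix Y Z m m' a assume "Y : CS" "Z : CS" "m : ob M Y" "m' : ob M Y" "a : ob (rpr pt) Z"
  then show "mor M Y (Y ** Z) (bco Y (Y ** Z) (bpr Y Y pt Z (bd Y) a) (brunit' n Y)) (m +[M,Y] m') =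
   mor M Y (Y ** Z) (bco Y (Y ** Z) (bpr Y Y pt Z (bd Y) a) (brunit' n Y)) m +[M,(Y ** Z)]
   mor M Y (Y ** Z) (bco Y (Y ** Z) (bpr Y Y pt Z (bd Y) a) (brunit' n Y)) m'"
   using b M by (simp add: mor_mult)
 next
  fix Y Z m a a' assume v: "Y : CS" "Z : CS" "m : ob M Y" "a : ob (rpr pt) Z" "a' : ob (rpr pt) Z"
  show "mor M Y (Y ** Z) (bco Y (Y ** Z) (bpr Y Y pt Z (bd Y) (a +[(rpr pt),Z] a')) (brunit' n Y)) m =
   mor M Y (Y ** Z) (bco Y (Y ** Z) (bpr Y Y pt Z (bd Y) a) (brunit' n Y)) m +[M,(Y ** Z)]
   mor M Y (Y ** Z) (bco Y (Y ** Z) (bpr Y Y pt Z (bd Y) a') (brunit' n Y)) m"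
   using v u b by (simp add: bprod_badd_right bcomp_badd_left[where Y = "Y ** pt"] mackeyD(5)[OF M])
 next
  fix Y Z Y' Z' xi ze m a
  assume v: "Y : CS" "Z : CS" "Y' : CS" "Z' : CS" "xi : bhm Y Y'" "ze : bhm Z Z'"
   "m : ob M Y" "a : ob (rpr pt) Z"
  have c: "mor (rpr pt) Z Z' ze a : bhm pt Z'" using mor_closed[OF repr_mackey[OF cpoint_csets] v(2,4,6,8)] by simp
  show "mor M Y' (Y' ** Z') (bco Y' (Y' ** Z') (bpr Y' Y' pt Z' (bd Y') (mor (rpr pt) Z Z' ze a)) (brunit' n Y')) (mor M Y Y' xi m) =
   mor M (Y ** Z) (Y' ** Z') (bpr Y Y' Z Z' xi ze) (mor M Y (Y ** Z) (bco Y (Y ** Z) (bpr Y Y pt Z (bd Y) a) (brunit' n Y)) m)"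
   using bilinD(4)[OF bs v(1-8)] eq[OF v(3,4) mor_closed[OF M v(1,3,5,7)] c] eq[OF v(1,2,7)] v(8) by simp
 qed
qed

lemma pair_unit_ops:
 assumes Z: "Z : CS"
 shows "mor M Z (pt ** Z) (bco Z (pt ** Z) (bpr pt pt Z Z (bd pt) (bd Z)) (blunit' n Z)) m =
   tr M Z (pt ** Z) flu' m"
  "mor M Z (Z ** pt) (bco Z (Z ** pt) (bpr Z Z pt pt (bd Z) (bd pt)) (brunit' n Z)) m =
   tr M Z (Z ** pt) fru' m"
proof -
 have 1: "bgraph n Z (pt ** Z) flu' : bhm Z (pt ** Z)" "bgraph n Z (Z ** pt) fru' : bhm Z (Z ** pt)"
  by (rule bgraph_closed; use Z in simp)+
 show "mor M Z (pt ** Z) (bco Z (pt ** Z) (bpr pt pt Z Z (bd pt) (bd Z)) (blunit' n Z)) m =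
   tr M Z (pt ** Z) flu' m" "mor M Z (Z ** pt) (bco Z (Z ** pt) (bpr Z Z pt pt (bd Z) (bd pt)) (brunit' n Z)) m =
   tr M Z (Z ** pt) fru' m"
  using 1 Z by (simp_all add: tr_def structure_graphs(5,6))
qed

lemma box_unit_values:
 assumes M: "mackey M" and Z: "Z : CS" and m: "m : ob M Z"
 shows "box_lunit n M (pt ** Z) (bp (rpr pt) M pt Z (bd pt) m) = tr M Z (pt ** Z) flu' m"
  "box_runit n M (Z ** pt) (bp M (rpr pt) Z pt m (bd pt)) = tr M Z (Z ** pt) fru' m"
 unfolding box_lunit_def box_runit_def pair_unit_ops[OF Z, of M m, symmetric]
 by (rule box_lift_facts(2)[OF repr_mackey[OF cpoint_csets] M M bilin_lunit[OF M]] box_lift_facts(2)[OF M repr_mackey[OF cpoint_csets] M bilin_runit[OF M]];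
   use Z m in simp)+

lemma mack_eqD: "mack_eq n M ph ps ==> X : CS ==> x : ob M X ==> ph X x = ps X x"
 by (simp add: mack_eq_def)

lemma green_facts:
 assumes R: "green_functor n R"
 shows "mackey R" "gmul R : mhm (bx R R) R" "bilin R R R (gm R)" "gone n R : ob R pt"
  "X : CS ==> Y : CS ==> Z : CS ==> a : ob R X ==> b : ob R Y ==> c : ob R Z ==>
   gm R (X ** Y) Z (gm R X Y a b) c = tr R (X ** Y ** Z) ((X ** Y) ** Z) fas' (gm R X (Y ** Z) a (gm R Y Z b c))"
  "Z : CS ==> c : ob R Z ==> gm R pt Z (gone n R) c = tr R Z (pt ** Z) flu' c"
  "Z : CS ==> c : ob R Z ==> gm R Z pt c (gone n R) = tr R Z (Z ** pt) fru' c"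
proof -
 note r = R[unfolded green_functor_def]
 show M: "mackey R" and g: "gmul R : mhm (bx R R) R" using r by simp_all
 have u: "gunit R : mhm (rpr pt) R" using r by simp
 note pt = cpoint_csets and rp = repr_mackey[OF cpoint_csets]
 show bi: "bilin R R R (gm R)" unfolding gm_def[abs_def] by (rule mack_hom_bilin[OF g M M])
 have one: "gunit R pt (bd pt) : ob R pt" using mhD(1)[OF u pt] by simp
 then show "gone n R : ob R pt" by (simp add: gone_def)
 note f1 = box_map_facts[OF g mid_hom box_mackey[OF M M] M M M]
 note f2 = box_map_facts[OF mid_hom g M box_mackey[OF M M] M M]
 note f3 = box_assoc_facts[OF M M M]
 note f4 = box_map_facts[OF u mid_hom rp M M M] and f5 = box_map_facts[OF mid_hom u M rp M M]
 { assume v: "X : CS" "Y : CS" "Z : CS" "a : ob R X" "b : ob R Y" "c : ob R Z"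
  have "(gmul R oM bmap R R (gmul R) mid) ((X ** Y) ** Z) (bp (bx R R) R (X ** Y) Z (bp R R X Y a b) c) =
   (gmul R oM bmap R R mid (gmul R) oM box_assoc n R R R) ((X ** Y) ** Z) (bp (bx R R) R (X ** Y) Z (bp R R X Y a b) c)"
   by (rule mack_eqD[OF r[THEN conjunct2, THEN conjunct2, THEN conjunct2, THEN conjunct1]]) (use v M in simp_all)
  then show "gm R (X ** Y) Z (gm R X Y a b) c = tr R (X ** Y ** Z) ((X ** Y) ** Z) fas' (gm R X (Y ** Z) a (gm R Y Z b c))"
   using v M bilinD(1)[OF bi] by (simp add: mcomp_def f1(2) f3(2) f2(2) mh_tr[OF f2(1)] mh_tr[OF g] gm_def) }
 { assume v: "Z : CS" "c : ob R Z"
  have "(gmul R oM bmap R R (gunit R) mid) (pt ** Z) (bp (rpr pt) R pt Z (bd pt) c) =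
   box_lunit n R (pt ** Z) (bp (rpr pt) R pt Z (bd pt) c)"
   by (rule mack_eqD[OF r[THEN conjunct2, THEN conjunct2, THEN conjunct2, THEN conjunct2, THEN conjunct1]]) (use v M in simp_all)
  then show "gm R pt Z (gone n R) c = tr R Z (pt ** Z) flu' c"
   using v M by (simp add: mcomp_def f4(2) box_unit_values gm_def gone_def)
  have "(gmul R oM bmap R R mid (gunit R)) (Z ** pt) (bp R (rpr pt) Z pt c (bd pt)) =
   box_runit n R (Z ** pt) (bp R (rpr pt) Z pt c (bd pt))"
   by (rule mack_eqD[OF r[THEN conjunct2, THEN conjunct2, THEN conjunct2, THEN conjunct2, THEN conjunct2]]) (use v M in simp_all)
  then show "gm R Z pt c (gone n R) = tr R Z (Z ** pt) fru' c"
   using v M by (simp add: mcomp_def f5(2) box_unit_values gm_def gone_def) }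
qed

lemma bimodule_facts:
 assumes b: "bimodule n R S M" and R: "green_functor n R" and S: "green_functor n S"
 shows "bmod R S M"
  "X : CS ==> Y : CS ==> Z : CS ==> a : ob R X ==> a' : ob R Y ==> m : ob M Z ==>
   lm R M (X ** Y) Z (gm R X Y a a') m = tr M (X ** Y ** Z) ((X ** Y) ** Z) fas' (lm R M X (Y ** Z) a (lm R M Y Z a' m))"
  "Z : CS ==> m : ob M Z ==> lm R M pt Z (gone n R) m = tr M Z (pt ** Z) flu' m"
  "X : CS ==> Y : CS ==> Z : CS ==> m : ob M X ==> s : ob S Y ==> s' : ob S Z ==>
   rm M S (X ** Y) Z (rm M S X Y m s) s' = tr M (X ** Y ** Z) ((X ** Y) ** Z) fas' (rm M S X (Y ** Z) m (gm S Y Z s s'))"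
  "Z : CS ==> m : ob M Z ==> rm M S Z pt m (gone n S) = tr M Z (Z ** pt) fru' m"
proof -
 note r = b[unfolded bimodule_def]
 note gR = green_facts(1,2)[OF R] and gS = green_facts(1,2)[OF S]
 have M: "mackey M" and l: "lact M : mhm (bx R M) M" and ra: "ract M : mhm (bx M S) M" using r by simp_all
 have uR: "gunit R : mhm (rpr pt) R" and uS: "gunit S : mhm (rpr pt) S"
  using R S unfolding green_functor_def by simp_all
 note pt = cpoint_csets and rp = repr_mackey[OF cpoint_csets]
 have lA: "lactor R M" and rA: "ractor S M" using gR gS M l ra by (simp_all add: lactor_def ractor_def)
 have oR: "gunit R pt (bd pt) : ob R pt" and oS: "gunit S pt (bd pt) : ob S pt"
  using mhD(1)[OF uR pt] mhD(1)[OF uS pt] by simp_all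
 show "bmod R S M"
 proof (rule bmodI[OF lA rA mgen_all])
  fix A Y B x m s assume v: "A : CS" "Y : CS" "B : CS" "x : ob R A" "m : ob M Y" "s : ob S B"
  have "(ract M oM bmap M S (lact M) mid) ((A ** Y) ** B) (bp (bx R M) S (A ** Y) B (bp R M A Y x m) s) =
   (lact M oM bmap R M mid (ract M) oM box_assoc n R M S) ((A ** Y) ** B) (bp (bx R M) S (A ** Y) B (bp R M A Y x m) s)"
   by (rule mack_eqD[OF r[THEN conjunct2, THEN conjunct2, THEN conjunct2, THEN conjunct2, THEN conjunct2, THEN conjunct2, THEN conjunct2]]) (use v M gR gS in simp_all)
  then show "rm M S (A ** Y) B (lm R M A Y x m) s = tr M (A ** Y ** B) ((A ** Y) ** B) fas' (lm R M A (Y ** B) x (rm M S Y B m s))"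
   unfolding compat_maps(3,4)[OF lA rA v] .
 qed
 note f1 = box_map_facts[OF gR(2) mid_hom box_mackey[OF gR(1) gR(1)] M gR(1) M]
 note f2 = box_map_facts[OF mid_hom l gR(1) box_mackey[OF gR(1) M] gR(1) M]
 note f3 = box_assoc_facts[OF gR(1) gR(1) M]
 note f4 = box_map_facts[OF uR mid_hom rp M gR(1) M] and f5 = box_map_facts[OF mid_hom uS M rp M gS(1)]
 note g1 = box_map_facts[OF ra mid_hom box_mackey[OF M gS(1)] gS(1) M gS(1)]
 note g2 = box_map_facts[OF mid_hom gS(2) M box_mackey[OF gS(1) gS(1)] M gS(1)]
 note g3 = box_assoc_facts[OF M gS(1) gS(1)]
 { assume v: "X : CS" "Y : CS" "Z : CS" "a : ob R X" "a' : ob R Y" "m : ob M Z"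
  have "(lact M oM bmap R M (gmul R) mid) ((X ** Y) ** Z) (bp (bx R R) M (X ** Y) Z (bp R R X Y a a') m) =
   (lact M oM bmap R M mid (lact M) oM box_assoc n R R M) ((X ** Y) ** Z) (bp (bx R R) M (X ** Y) Z (bp R R X Y a a') m)"
   by (rule mack_eqD[OF r[THEN conjunct2, THEN conjunct2, THEN conjunct2, THEN conjunct1]]) (use v M gR in simp_all)
  then show "lm R M (X ** Y) Z (gm R X Y a a') m = tr M (X ** Y ** Z) ((X ** Y) ** Z) fas' (lm R M X (Y ** Z) a (lm R M Y Z a' m))"
   using v M gR by (simp add: mcomp_def f1(2) f3(2) f2(2) mh_tr[OF f2(1)] mh_tr[OF l] gm_def lm_def mhD(1)[OF l]) }
 { assume v: "X : CS" "Y : CS" "Z : CS" "m : ob M X" "s : ob S Y" "s' : ob S Z"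
  have "(ract M oM bmap M S (ract M) mid) ((X ** Y) ** Z) (bp (bx M S) S (X ** Y) Z (bp M S X Y m s) s') =
   (ract M oM bmap M S mid (gmul S) oM box_assoc n M S S) ((X ** Y) ** Z) (bp (bx M S) S (X ** Y) Z (bp M S X Y m s) s')"
   by (rule mack_eqD[OF r[THEN conjunct2, THEN conjunct2, THEN conjunct2, THEN conjunct2, THEN conjunct2, THEN conjunct1]]) (use v M gS in simp_all)
  then show "rm M S (X ** Y) Z (rm M S X Y m s) s' = tr M (X ** Y ** Z) ((X ** Y) ** Z) fas' (rm M S X (Y ** Z) m (gm S Y Z s s'))"
   using v M gS by (simp add: mcomp_def g1(2) g3(2) g2(2) mh_tr[OF g2(1)] mh_tr[OF ra] gm_def rm_def mhD(1)[OF gS(2)]) }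
 { assume v: "Z : CS" "m : ob M Z"
  have "(lact M oM bmap R M (gunit R) mid) (pt ** Z) (bp (rpr pt) M pt Z (bd pt) m) =
   box_lunit n M (pt ** Z) (bp (rpr pt) M pt Z (bd pt) m)"
   by (rule mack_eqD[OF r[THEN conjunct2, THEN conjunct2, THEN conjunct2, THEN conjunct2, THEN conjunct1]]) (use v M in simp_all)
  then show "lm R M pt Z (gone n R) m = tr M Z (pt ** Z) flu' m"
   using v M by (simp add: mcomp_def f4(2) box_unit_values lm_def gone_def)
  have "(ract M oM bmap M S mid (gunit S)) (Z ** pt) (bp M (rpr pt) Z pt m (bd pt)) =
   box_runit n M (Z ** pt) (bp M (rpr pt) Z pt m (bd pt))"
   by (rule mack_eqD[OF r[THEN conjunct2, THEN conjunct2, THEN conjunct2, THEN conjunct2, THEN conjunct2, THEN conjunct2, THEN conjunct1]]) (use v M in simp_all)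
  then show "rm M S Z pt m (gone n S) = tr M Z (Z ** pt) fru' m"
   using v M by (simp add: mcomp_def f5(2) box_unit_values rm_def gone_def) }
qed

section \<open>The automorphisms of a Green functor and twisting\<close>

text \<open>The orbit automorphisms are transfers along the action of a group element.\<close>

lemma galpha_tr: "galpha n M g X = tr M X X (act X g)"
 by (simp add: galpha_def tr_def)

lemma galpha_hom: assumes M: "mackey M" and g: "g : CG" shows "galpha n M g : mhm M M"
proof (rule mack_homI)
 fix X Y be x assume v: "X : CS" "Y : CS" "be : bhm X Y" "x : ob M X"
 note e = bgraph_closed[OF act_emaps[OF v(1) g] v(1)] bgraph_closed[OF act_emaps[OF v(2) g] v(2)]
 show "galpha n M g Y (mor M X Y be x) = mor M X Y be (galpha n M g X x)"
  using mackeyD(4)[OF M v(1,2,2,3) e(2) v(4)] mackeyD(4)[OF M v(1,1,2) e(1) v(3,4)] act_natural[OF v(3,1,2) g]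
  by (simp add: galpha_tr tr_def)
qed (use M g act_emaps in \<open>simp_all add: galpha_tr tr_mult del: emaps_iff\<close>)

lemma galpha_closed [simp]: "mackey M ==> g : CG ==> X : CS ==> x : ob M X ==> galpha n M g X x : ob M X"
 by (rule mhD(1)[OF galpha_hom])

lemma galpha_zero [simp]: "mackey M ==> X : CS ==> x : ob M X ==> galpha n M 0 X x = x"
 unfolding galpha_tr by (rule tr_idI) simp_all

lemma galpha_inv [simp]: "mackey M ==> g : CG ==> X : CS ==> x : ob M X ==>
  galpha n M g X (galpha n M ((- g) mod int n) X x) = x"
 unfolding galpha_tr by (subst tr_tr) (auto simp: act_commute intro: tr_idI)

lemma galpha_cpoint [simp]: "mackey M ==> x : ob M pt ==> galpha n M g pt x = x"
 unfolding galpha_tr by (rule tr_idI) simp_all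

text \<open>The action of g on a product is diagonal, so pairings are equivariant.\<close>

lemma bilin_galpha: assumes b: "bilin M N L pp" and g: "g : CG"
  and v: "Y : CS" "Z : CS" "m : ob M Y" "k : ob N Z"
 shows "pp Y Z (galpha n M g Y m) (galpha n N g Z k) = galpha n L g (Y ** Z) (pp Y Z m k)"
proof -
 have "pp Y Z (galpha n M g Y m) (galpha n N g Z k) = tr L (Y ** Z) (Y ** Z) (fpm (act Y g) (act Z g)) (pp Y Z m k)"
  unfolding galpha_tr by (rule bilin_tr[OF b act_emaps[OF v(1) g] act_emaps[OF v(2) g] v(1,2,1,2,3,4)])
 also have "... = galpha n L g (Y ** Z) (pp Y Z m k)" unfolding galpha_tr by (rule tr_eqI_ball) simp
 finally show ?thesis .
qed

lemma lm_ltw: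
 assumes "lactor R M" "g : CG" "Y : CS" "Z : CS" "r : ob R Y" "m : ob M Z"
 shows "lm R (ltw n R g M) Y Z r m = lm R M Y Z (galpha n R g Y r) m"
proof -
 note D = lactorD[OF assms(1)]
 have "lact (ltw n R g M) = lact M oM bmap R M (galpha n R g) mid" by (simp add: ltw_def)
 then show ?thesis using assms(3-6) D
  by (simp add: lm_def mcomp_def box_map_facts(2)[OF galpha_hom[OF D(1) assms(2)] mid_hom D(1,2) D(1,2)])
qed

lemma rm_rtw:
 assumes "ractor S M" "g : CG" "Y : CS" "Z : CS" "m : ob M Y" "s : ob S Z"
 shows "rm (rtw n S g M) S Y Z m s = rm M S Y Z m (galpha n S g Z s)"
proof -
 note D = ractorD[OF assms(1)]
 have "ract (rtw n S g M) = ract M oM bmap M S mid (galpha n S g)" by (simp add: rtw_def)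
 then show ?thesis using assms(3-6) D
  by (simp add: rm_def mcomp_def box_map_facts(2)[OF mid_hom galpha_hom[OF D(1) assms(2)] D(2,1) D(2,1)])
qed

lemma lactor_ltw: "lactor R M ==> g : CG ==> lactor R (ltw n R g M)"
 by (simp add: lactor_def) (simp add: ltw_def mh_comp[OF box_map_facts(1)[OF galpha_hom mid_hom]])

lemma ractor_rtw: "ractor S M ==> g : CG ==> ractor S (rtw n S g M)"
 by (simp add: ractor_def) (simp add: rtw_def mh_comp[OF box_map_facts(1)[OF mid_hom galpha_hom]])

lemma ractor_ltw: "ractor S M ==> ractor S (ltw n R g M)" and lactor_rtw: "lactor R' M' ==> lactor R' (rtw n S' g M')"
 by (simp_all add: ractor_def lactor_def)

lemma bmod_ltw: assumes M: "bmod R S M" and g: "g : CG" shows "bmod R S (ltw n R g M)"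
 unfolding bmod_def
proof (intro conjI ballI lactor_ltw ractor_ltw bmodD[OF M] g)
 note D = bmodD[OF M]
 fix A Y B r m s assume "A : CS" "Y : CS" "B : CS" "r : ob R A" "m : ob (ltw n R g M) Y" "s : ob S B"
 then show "lm R (ltw n R g M) A (Y ** B) r (rm (ltw n R g M) S Y B m s) =
  tr (ltw n R g M) ((A ** Y) ** B) (A ** Y ** B) fas (rm (ltw n R g M) S (A ** Y) B (lm R (ltw n R g M) A Y r m) s)"
  using D M g by (simp add: lm_ltw)
qed

lemma bmod_rtw: assumes M: "bmod R S M" and g: "g : CG" shows "bmod R S (rtw n S g M)"
 unfolding bmod_def
proof (intro conjI ballI lactor_rtw ractor_rtw bmodD[OF M] g)
 note D = bmodD[OF M]
 fix A Y B r m s assume "A : CS" "Y : CS" "B : CS" "r : ob R A" "m : ob (rtw n S g M) Y" "s : ob S B"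
 then show "lm R (rtw n S g M) A (Y ** B) r (rm (rtw n S g M) S Y B m s) =
  tr (rtw n S g M) ((A ** Y) ** B) (A ** Y ** B) fas (rm (rtw n S g M) S (A ** Y) B (lm R (rtw n S g M) A Y r m) s)"
  using D M g by (simp add: rm_rtw)
qed

lemma bmod_ubimod: assumes R: "green_functor n R" shows "bmod R R (ubimod R)"
 unfolding bmod_def
proof (intro conjI ballI)
 note D = green_facts[OF R]
 show "lactor R (ubimod R)" "ractor R (ubimod R)" using D by (simp_all add: lactor_def ractor_def)
 fix A Y B r m s assume "A : CS" "Y : CS" "B : CS" "r : ob R A" "m : ob (ubimod R) Y" "s : ob R B"
 then show "lm R (ubimod R) A (Y ** B) r (rm (ubimod R) R Y B m s) =
  tr (ubimod R) ((A ** Y) ** B) (A ** Y ** B) fas (rm (ubimod R) R (A ** Y) B (lm R (ubimod R) A Y r m) s)"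
  using D by (simp add: D(5) bilinD(1)[OF D(3)] tr_id_ball)
qed

lemma bmod_Theta: "green_functor n R ==> g : CG ==> bmod R R (Theta n R g)"
 unfolding Theta_def by (rule bmod_rtw[OF bmod_ubimod])

lemma lm_Theta [simp]: "lm R (Theta n R g) = gm R"
 unfolding Theta_def by simp

lemma rm_Theta: "green_functor n R ==> g : CG ==> Y : CS ==> Z : CS ==> a : ob R Y ==> b : ob R Z ==>
  rm (Theta n R g) R Y Z a b = gm R Y Z a (galpha n R g Z b)"
 unfolding Theta_def using rm_rtw[OF bmodD(2)[OF bmod_ubimod], of R g Y Z a b] by simp

lemma gm_closed [simp]: "green_functor n R ==> Y : CS ==> Z : CS ==> a : ob R Y ==> b : ob R Z ==> gm R Y Z a b : ob R (Y ** Z)"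
 by (rule bilinD(1)[OF green_facts(3)])

lemma gm_tr [simp]:
 assumes "green_functor n R" "Y : CS" "Z : CS"
 shows "Y' : CS ==> f : emaps Y Y' ==> a : ob R Y ==> b : ob R Z ==>
   gm R Y' Z (tr R Y Y' f a) b = tr R (Y ** Z) (Y' ** Z) (fpm f (%x. x)) (gm R Y Z a b)"
  "Z' : CS ==> f : emaps Z Z' ==> a : ob R Y ==> b : ob R Z ==>
   gm R Y Z' a (tr R Z Z' f b) = tr R (Y ** Z) (Y ** Z') (fpm (%x. x) f) (gm R Y Z a b)"
 using bilin_tr_left[OF green_facts(3)[OF assms(1)] green_facts(1)[OF assms(1)] _ assms(2,3)]
  bilin_tr_right[OF green_facts(3)[OF assms(1)] green_facts(1)[OF assms(1)] _ assms(2,3)] by blast+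

section \<open>Modules, unit isomorphisms and maps of balanced products\<close>

lemma unit_pair_hom:
 assumes b: "bilin M N L pp" and M: "mackey M" and L: "mackey L" and e: "e : ob M pt"
 shows "(%X k. tr L (pt ** X) X flu (pp pt X e k)) : mhm N L"
proof (rule mack_homI)
 fix X Y ze k assume v: "X : CS" "Y : CS" "ze : bhm X Y" "k : ob N X"
 have c: "pp pt X e k : ob L (pt ** X)" using bilinD(1)[OF b cpoint_csets v(1) e v(4)] .
 have f: "bgraph n (pt ** X) X flu : bhm (pt ** X) X" "bgraph n (pt ** Y) Y flu : bhm (pt ** Y) Y"
  by (rule bgraph_closed; use v in simp)+
 have p: "pp pt Y e (mor N X Y ze k) = mor L (pt ** X) (pt ** Y) (bpr pt pt X Y (bd pt) ze) (pp pt X e k)"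
  using bilinD(4)[OF b cpoint_csets v(1) cpoint_csets v(2) bid_closed[OF cpoint_csets] v(3) e v(4)] mackeyD(3)[OF M cpoint_csets e] by simp
 have q: "bpr pt pt X Y (bd pt) ze : bhm (pt ** X) (pt ** Y)" using v by simp
 show "tr L (pt ** Y) Y flu (pp pt Y e (mor N X Y ze k)) = mor L X Y ze (tr L (pt ** X) X flu (pp pt X e k))"
  unfolding p tr_def using mackeyD(4)[OF L _ _ v(2) q f(2) c] mackeyD(4)[OF L _ v(1,2) f(1) v(3) c] v flu_natural[OF v(3,1,2)] by simp
qed (use L e in \<open>simp_all add: bilinD[OF b] tr_mult\<close>)

lemma pair_unit_hom:
 assumes b: "bilin N M L pp" and M: "mackey M" and L: "mackey L" and e: "e : ob M pt"
 shows "(%X k. tr L (X ** pt) X fru (pp X pt k e)) : mhm N L"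
proof (rule mack_homI)
 fix X Y ze k assume v: "X : CS" "Y : CS" "ze : bhm X Y" "k : ob N X"
 have c: "pp X pt k e : ob L (X ** pt)" using bilinD(1)[OF b v(1) cpoint_csets v(4) e] .
 have f: "bgraph n (X ** pt) X fru : bhm (X ** pt) X" "bgraph n (Y ** pt) Y fru : bhm (Y ** pt) Y"
  by (rule bgraph_closed; use v in simp)+
 have p: "pp Y pt (mor N X Y ze k) e = mor L (X ** pt) (Y ** pt) (bpr X Y pt pt ze (bd pt)) (pp X pt k e)"
  using bilinD(4)[OF b v(1) cpoint_csets v(2) cpoint_csets v(3) bid_closed[OF cpoint_csets] v(4) e] mackeyD(3)[OF M cpoint_csets e] by simp
 have q: "bpr X Y pt pt ze (bd pt) : bhm (X ** pt) (Y ** pt)" using v by simp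
 show "tr L (Y ** pt) Y fru (pp Y pt (mor N X Y ze k) e) = mor L X Y ze (tr L (X ** pt) X fru (pp X pt k e))"
  unfolding p tr_def using mackeyD(4)[OF L _ _ v(2) q f(2) c] mackeyD(4)[OF L _ v(1,2) f(1) v(3) c] v fru_natural[OF v(3,1,2)] by simp
qed (use L e in \<open>simp_all add: bilinD[OF b] tr_mult\<close>)

definition lmodule where
 "lmodule R M \<longleftrightarrow> lactor R M &
  (ALL X : CS. ALL Y : CS. ALL Z : CS. ALL a : ob R X. ALL b : ob R Y. ALL m : ob M Z.
   lm R M (X ** Y) Z (gm R X Y a b) m = tr M (X ** Y ** Z) ((X ** Y) ** Z) fas' (lm R M X (Y ** Z) a (lm R M Y Z b m))) &
  (ALL Z : CS. ALL m : ob M Z. lm R M pt Z (gone n R) m = tr M Z (pt ** Z) flu' m)"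

definition rmodule where
 "rmodule S M \<longleftrightarrow> ractor S M &
  (ALL X : CS. ALL Y : CS. ALL Z : CS. ALL m : ob M X. ALL s : ob S Y. ALL s' : ob S Z.
   rm M S (X ** Y) Z (rm M S X Y m s) s' = tr M (X ** Y ** Z) ((X ** Y) ** Z) fas' (rm M S X (Y ** Z) m (gm S Y Z s s'))) &
  (ALL Z : CS. ALL m : ob M Z. rm M S Z pt m (gone n S) = tr M Z (Z ** pt) fru' m)"

lemma lmoduleD: assumes "lmodule R M"
 shows "lactor R M" "mackey R" "mackey M"
  "X : CS ==> Y : CS ==> Z : CS ==> a : ob R X ==> b : ob R Y ==> m : ob M Z ==>
   lm R M (X ** Y) Z (gm R X Y a b) m = tr M (X ** Y ** Z) ((X ** Y) ** Z) fas' (lm R M X (Y ** Z) a (lm R M Y Z b m))"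
  "Z : CS ==> m : ob M Z ==> lm R M pt Z (gone n R) m = tr M Z (pt ** Z) flu' m"
 using assms lactorD[of R M] unfolding lmodule_def by blast+

lemma rmoduleD: assumes "rmodule S M"
 shows "ractor S M" "mackey S" "mackey M"
  "X : CS ==> Y : CS ==> Z : CS ==> m : ob M X ==> s : ob S Y ==> s' : ob S Z ==>
   rm M S (X ** Y) Z (rm M S X Y m s) s' = tr M (X ** Y ** Z) ((X ** Y) ** Z) fas' (rm M S X (Y ** Z) m (gm S Y Z s s'))"
  "Z : CS ==> m : ob M Z ==> rm M S Z pt m (gone n S) = tr M Z (Z ** pt) fru' m"
 using assms ractorD[of S M] unfolding rmodule_def by blast+

lemma bimodule_modules:
 assumes "bimodule n R S M" "green_functor n R" "green_functor n S"
 shows "lmodule R M" "rmodule S M"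
proof -
 note F = bimodule_facts[OF assms]
 show "lmodule R M" unfolding lmodule_def by (intro conjI ballI bmodD(1)[OF F(1)] F(2,3))
 show "rmodule S M" unfolding rmodule_def by (intro conjI ballI bmodD(2)[OF F(1)] F(4,5))
qed

lemma lmodule_ltw: assumes M: "lmodule R M" and R: "green_functor n R" and g: "g : CG"
 shows "lmodule R (ltw n R g M)"
 unfolding lmodule_def
proof (intro conjI ballI)
 note D = lmoduleD[OF M] and F = green_facts[OF R]
 show l: "lactor R (ltw n R g M)" by (rule lactor_ltw[OF D(1) g])
 fix X Y Z a b m assume v: "X : CS" "Y : CS" "Z : CS" "a : ob R X" "b : ob R Y" "m : ob (ltw n R g M) Z"
 show "lm R (ltw n R g M) (X ** Y) Z (gm R X Y a b) m =
  tr (ltw n R g M) (X ** Y ** Z) ((X ** Y) ** Z) fas' (lm R (ltw n R g M) X (Y ** Z) a (lm R (ltw n R g M) Y Z b m))"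
  using v D(1-3) R g by (simp add: lm_ltw bilin_galpha[OF F(3) g v(1,2,4,5), symmetric] D(4))
next
 note D = lmoduleD[OF M] and F = green_facts[OF R]
 fix Z m assume v: "Z : CS" "m : ob (ltw n R g M) Z"
 then show "lm R (ltw n R g M) pt Z (gone n R) m = tr (ltw n R g M) Z (pt ** Z) flu' m"
  using D(1-3) F(1,4) g by (simp add: lm_ltw D(5))
qed

text \<open>The inverses m \<mapsto> m \<otimes> 1 and m \<mapsto> 1 \<otimes> m of the unit isomorphisms. The second allows
a twisted right action in the middle factor, which the unit does not see.\<close>

definition kap where
 "kap S M = (%X m. tr (rbx S M (ubimod S)) (X ** pt) X fru (rp S M (ubimod S) X pt m (gone n S)))"

definition iota where
 "iota R A M = (%X m. tr (rbx R A M) (pt ** X) X flu (rp R A M pt X (gone n R) m))"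

lemma iota_hom:
 assumes "ractor R A" "lactor R M" "gone n R : ob A pt"
 shows "iota R A M : mhm M (rbx R A M)"
 unfolding iota_def by (rule unit_pair_hom[OF bilin_rp[OF assms(1,2)] ractorD(2)[OF assms(1)] rbox_mackey[OF assms(1,2)] assms(3)])

lemma orunit_facts:
 assumes S: "green_functor n S" and M: "rmodule S M"
 shows "orunit M : mhm (rbx S M (ubimod S)) M" "kap S M : mhm M (rbx S M (ubimod S))"
  "Y : CS ==> Z : CS ==> m : ob M Y ==> s : ob S Z ==> orunit M (Y ** Z) (rp S M (ubimod S) Y Z m s) = rm M S Y Z m s"
  "X : CS ==> m : ob M X ==> orunit M X (kap S M X m) = m"
  "X : CS ==> x : ob (rbx S M (ubimod S)) X ==> kap S M X (orunit M X x) = x"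
  "Y : CS ==> Z : CS ==> m : ob M Y ==> s : ob S Z ==> rp S M (ubimod S) Y Z m s = kap S M (Y ** Z) (rm M S Y Z m s)"
  "X : CS ==> m : ob M X ==> orunit' n R S M X m = kap S M X m"
proof -
 note D = rmoduleD[OF M] and F = green_facts[OF S] and U = bmodD[OF bmod_ubimod[OF S]]
 note m = D(1) U(1)
 note mk [simp] = rbox_mackey[OF m]
 note h = ractorD(3)[OF D(1)]
 have bal: "ract M ((Y ** A) ** Z) (bp M (ubimod S) (Y ** A) Z (rm M S Y A m s) k) =
   tr M (Y ** A ** Z) ((Y ** A) ** Z) fas' (ract M (Y ** A ** Z) (bp M (ubimod S) Y (A ** Z) m (lm S (ubimod S) A Z s k)))"
  if "Y : CS" "A : CS" "Z : CS" "m : ob M Y" "s : ob S A" "k : ob (ubimod S) Z" for Y A Z m s k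
  using D(4)[of Y A Z m s k] that by (simp add: rm_def)
 have h': "ract M : mhm (bx M (ubimod S)) M" using h by simp
 note d = rbox_desc[OF m D(3) h' mgen_all mgen_all mgen_all bal, folded orunit_def]
 show O: "orunit M : mhm (rbx S M (ubimod S)) M" by (rule d(1))
 show Ov: "orunit M (Y ** Z) (rp S M (ubimod S) Y Z m s) = rm M S Y Z m s"
  if "Y : CS" "Z : CS" "m : ob M Y" "s : ob S Z" for Y Z m s
  using d(3)[of Y Z m s] that by (simp add: rm_def)
 have pu: "rp S M (ubimod S) Y Z m s : ob (rbx S M (ubimod S)) (Y ** Z)" if "Y : CS" "Z : CS" "m : ob M Y" "s : ob S Z" for Y Z m s
  using rp_closed[OF m that(1-3)] that(4) by simp
 show K: "kap S M : mhm M (rbx S M (ubimod S))"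
  unfolding kap_def by (rule pair_unit_hom[OF bilin_rp[OF m] U(5) mk]) (use F in simp)
 show OK: "orunit M X (kap S M X m) = m" if "X : CS" "m : ob M X" for X m
  using that D F(1,4) by (simp add: kap_def mh_tr[OF O] Ov pu tr_id_ball)
 have kr: "kap S M (Y ** Z) (rm M S Y Z m s) = rp S M (ubimod S) Y Z m s" if v: "Y : CS" "Z : CS" "m : ob M Y" "s : ob S Z" for Y Z m s
  using v D(1-3) F(1,4) U(1) by (simp add: kap_def rp_balanced[OF m] F(7) rp_tr(2)[OF m, simplified] pu tr_id_ball)
 show "rp S M (ubimod S) Y Z m s = kap S M (Y ** Z) (rm M S Y Z m s)" if "Y : CS" "Z : CS" "m : ob M Y" "s : ob S Z"
  using kr[OF that] by simp
 show KO: "kap S M X (orunit M X x) = x" if X: "X : CS" "x : ob (rbx S M (ubimod S)) X" for X x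
  using mack_hom_eqI[OF mgen_rbox[OF m mgen_all mgen_all] mh_comp[OF O K] mid_hom mk mk _ X] unfolding mcomp_def mid_apply
 proof this
  fix X x assume "EX Y Z p k. Y : CS & Z : CS & p : ob M Y & k : ob (ubimod S) Z & X = Y ** Z & x = rp S M (ubimod S) Y Z p k"
  then show "kap S M X (orunit M X x) = x"
   by (elim exE conjE) (simp add: Ov kr)
 qed
 show "orunit' n R S M X m = kap S M X m" if "X : CS" "m : ob M X" for X m
  unfolding orunit'_def by (simp, rule minv_eq[OF O K KO OK that])
qed

lemma desc_lact:
 assumes A: "same A R" "ractor R A" and N: "lactor R N" and N': "lactor R N'" "same N' N"
  and bal: "!!Y B Z a r m. Y : CS ==> B : CS ==> Z : CS ==> a : ob R Y ==> r : ob R B ==> m : ob N Z ==>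
   lm R N' (Y ** B) Z (rm A R Y B a r) m = tr N (Y ** B ** Z) ((Y ** B) ** Z) fas' (lm R N' Y (B ** Z) a (lm R N B Z r m))"
 shows "desc (lact N') : mhm (rbx R A N) N"
  "Y : CS ==> Z : CS ==> a : ob R Y ==> m : ob N Z ==> desc (lact N') (Y ** Z) (rp R A N Y Z a m) = lm R N' Y Z a m"
proof -
 note sA = same_rules[OF A(1)] and sN = same_rules[OF N'(2)]
 have h: "lact N' : mhm (bx A N) N" using lactorD(3)[OF N'(1)] unfolding sA sN .
 have bal': "lact N' ((Y ** B) ** Z) (bp A N (Y ** B) Z (rm A R Y B a r) k) =
   tr N (Y ** B ** Z) ((Y ** B) ** Z) fas' (lact N' (Y ** B ** Z) (bp A N Y (B ** Z) a (lm R N B Z r k)))"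
  if "Y : CS" "B : CS" "Z : CS" "a : ob A Y" "r : ob R B" "k : ob N Z" for Y B Z a r k
  using bal[OF that(1-3) _ that(5,6)] that(4) unfolding lm_def[of R N'] sA sN by simp
 note d = rbox_desc[OF A(2) N lactorD(2)[OF N] h mgen_all mgen_all mgen_all bal']
 show "desc (lact N') : mhm (rbx R A N) N" by (rule d(1))
 show "Y : CS ==> Z : CS ==> a : ob R Y ==> m : ob N Z ==> desc (lact N') (Y ** Z) (rp R A N Y Z a m) = lm R N' Y Z a m"
  using d(3)[of Y Z a m] unfolding lm_def sA sN .
qed

lemma olunit_facts:
 assumes R: "green_functor n R" and M: "lmodule R M"
 shows "olunit M : mhm (rbx R (ubimod R) M) M" "iota R (ubimod R) M : mhm M (rbx R (ubimod R) M)"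
  "Y : CS ==> Z : CS ==> r : ob R Y ==> m : ob M Z ==> olunit M (Y ** Z) (rp R (ubimod R) M Y Z r m) = lm R M Y Z r m"
  "X : CS ==> m : ob M X ==> olunit M X (iota R (ubimod R) M X m) = m"
  "X : CS ==> x : ob (rbx R (ubimod R) M) X ==> iota R (ubimod R) M X (olunit M X x) = x"
  "X : CS ==> m : ob M X ==> olunit' n R S M X m = iota R (ubimod R) M X m"
proof -
 note D = lmoduleD[OF M] and F = green_facts[OF R] and U = bmodD[OF bmod_ubimod[OF R]]
 note m = U(2) D(1)
 note mk [simp] = rbox_mackey[OF m]
 note d = desc_lact[OF same_ubimod m D(1) same_refl, folded olunit_def, unfolded rm_ubimod, OF D(4)]
 show O: "olunit M : mhm (rbx R (ubimod R) M) M" by (rule d(1))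
 show Ov: "olunit M (Y ** Z) (rp R (ubimod R) M Y Z r m) = lm R M Y Z r m"
  if "Y : CS" "Z : CS" "r : ob R Y" "m : ob M Z" for Y Z r m
  by (rule d(2)[OF _ _ _ _ _ _ that])
 have pu: "rp R (ubimod R) M Y Z r m : ob (rbx R (ubimod R) M) (Y ** Z)" if "Y : CS" "Z : CS" "r : ob R Y" "m : ob M Z" for Y Z r m
  using rp_closed[OF m that(1,2) _ that(4)] that(3) by simp
 show K: "iota R (ubimod R) M : mhm M (rbx R (ubimod R) M)"
  by (rule iota_hom[OF m]) (use F in simp)
 show OK: "olunit M X (iota R (ubimod R) M X m) = m" if "X : CS" "m : ob M X" for X m
  using that D F(1,4) by (simp add: iota_def mh_tr[OF O] Ov pu tr_id_ball)
 have kr: "iota R (ubimod R) M (Y ** Z) (lm R M Y Z r m) = rp R (ubimod R) M Y Z r m" if v: "Y : CS" "Z : CS" "r : ob R Y" "m : ob M Z" for Y Z r m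
 proof -
  have "rp R (ubimod R) M (pt ** Y) Z (gm R pt Y (gone n R) r) m =
   tr (rbx R (ubimod R) M) (pt ** Y ** Z) ((pt ** Y) ** Z) fas' (rp R (ubimod R) M pt (Y ** Z) (gone n R) (lm R M Y Z r m))"
   using rp_balanced[OF m cpoint_csets v(1,2) _ v(3,4)] F(4) by simp
  then have "rp R (ubimod R) M pt (Y ** Z) (gone n R) (lm R M Y Z r m) =
   tr (rbx R (ubimod R) M) ((pt ** Y) ** Z) (pt ** Y ** Z) fas (rp R (ubimod R) M (pt ** Y) Z (gm R pt Y (gone n R) r) m)"
   using v D F(4) pu[of pt "Y ** Z" "gone n R" "lm R M Y Z r m"] by (simp add: tr_id_ball)
  then show ?thesis using v D(1-3) F(1,4) by (simp add: iota_def F(6) rp_tr(1)[OF m, simplified] pu tr_id_ball)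
 qed
 show KO: "iota R (ubimod R) M X (olunit M X x) = x" if X: "X : CS" "x : ob (rbx R (ubimod R) M) X" for X x
  using mack_hom_eqI[OF mgen_rbox[OF m mgen_all mgen_all] mh_comp[OF O K] mid_hom mk mk _ X] unfolding mcomp_def mid_apply
 proof this
  fix X x assume "EX Y Z p k. Y : CS & Z : CS & p : ob (ubimod R) Y & k : ob M Z & X = Y ** Z & x = rp R (ubimod R) M Y Z p k"
  then show "iota R (ubimod R) M X (olunit M X x) = x"
   by (elim exE conjE) (simp add: Ov kr)
 qed
 show "olunit' n R S M X m = iota R (ubimod R) M X m" if "X : CS" "m : ob M X" for X m
  unfolding olunit'_def by (simp, rule minv_eq[OF O K KO OK that])
qed

lemma odot_map_facts:
 assumes A: "ractor S A" "lactor S B" and M: "ractor S M" "lactor S N" and ph: "ph : mhm A M" "ps : mhm B N"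
  and Q: "mgen A Q" "mgen B Q'"
  and bal: "!!Y C Z a s b. Y : CS ==> C : CS ==> Z : CS ==> Q Y a ==> s : ob S C ==> Q' Z b ==>
   rp S M N (Y ** C) Z (ph (Y ** C) (rm A S Y C a s)) (ps Z b) =
   tr (rbx S M N) (Y ** C ** Z) ((Y ** C) ** Z) fas' (rp S M N Y (C ** Z) (ph Y a) (ps (C ** Z) (lm S B C Z s b)))"
 shows "odot_map n S M N ph ps : mhm (rbx S A B) (rbx S M N)"
  "Y : CS ==> Z : CS ==> a : ob A Y ==> b : ob B Z ==>
   odot_map n S M N ph ps (Y ** Z) (rp S A B Y Z a b) = rp S M N Y Z (ph Y a) (ps Z b)"
proof -
 note D = ractorD[OF A(1)] lactorD[OF A(2)] ractorD[OF M(1)] lactorD[OF M(2)]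
 note mf = box_map_facts[OF ph ractorD(2)[OF A(1)] lactorD(2)[OF A(2)] ractorD(2)[OF M(1)] lactorD(2)[OF M(2)]]
 note r = rproj_hom[OF M]
 have h: "rproj n S M N oM bmap M N ph ps : mhm (bx A B) (rbx S M N)" by (rule mh_comp[OF mf(1) r])
 have hv: "(rproj n S M N oM bmap M N ph ps) (Y ** Z) (bp A B Y Z a b) = rp S M N Y Z (ph Y a) (ps Z b)"
  if "Y : CS" "Z : CS" "a : ob A Y" "b : ob B Z" for Y Z a b
  using that by (simp add: mcomp_def mf(2) rp_def)
 have bal': "(rproj n S M N oM bmap M N ph ps) ((Y ** C) ** Z) (bp A B (Y ** C) Z (rm A S Y C a s) b) =
   tr (rbx S M N) (Y ** C ** Z) ((Y ** C) ** Z) fas'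
    ((rproj n S M N oM bmap M N ph ps) (Y ** C ** Z) (bp A B Y (C ** Z) a (lm S B C Z s b)))"
  if "Y : CS" "C : CS" "Z : CS" "Q Y a" "s : ob S C" "Q' Z b" for Y C Z a s b
  using bal[OF that] that A mgenD[OF Q(1) that(1,4)] mgenD[OF Q(2) that(3,6)] by (simp add: hv)
 note d = rbox_desc[OF A rbox_mackey[OF M] h Q(1) mgen_all Q(2) bal', folded odot_map_def]
 show "odot_map n S M N ph ps : mhm (rbx S A B) (rbx S M N)" by (rule d(1))
 show "Y : CS ==> Z : CS ==> a : ob A Y ==> b : ob B Z ==>
   odot_map n S M N ph ps (Y ** Z) (rp S A B Y Z a b) = rp S M N Y Z (ph Y a) (ps Z b)"
  using d(3) hv by simp
qed

text \<open>A pair of linear maps induces a map of relative box products; linearity is tested on generators.\<close>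

lemma odot_map_linear:
 assumes A: "ractor S A" "lactor S B" and M: "ractor S M" "lactor S N" and ph: "ph : mhm A M" "ps : mhm B N"
  and Q: "mgen A Q" "mgen B Q'"
  and lin: "!!Y C a s. Y : CS ==> C : CS ==> Q Y a ==> s : ob S C ==> ph (Y ** C) (rm A S Y C a s) = rm M S Y C (ph Y a) s"
   "!!C Z s b. C : CS ==> Z : CS ==> s : ob S C ==> Q' Z b ==> ps (C ** Z) (lm S B C Z s b) = lm S N C Z s (ps Z b)"
 shows "odot_map n S M N ph ps : mhm (rbx S A B) (rbx S M N)"
  "Y : CS ==> Z : CS ==> a : ob A Y ==> b : ob B Z ==>
   odot_map n S M N ph ps (Y ** Z) (rp S A B Y Z a b) = rp S M N Y Z (ph Y a) (ps Z b)"
proof -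
 have bal: "rp S M N (Y ** C) Z (ph (Y ** C) (rm A S Y C a s)) (ps Z b) =
   tr (rbx S M N) (Y ** C ** Z) ((Y ** C) ** Z) fas' (rp S M N Y (C ** Z) (ph Y a) (ps (C ** Z) (lm S B C Z s b)))"
  if v: "Y : CS" "C : CS" "Z : CS" "Q Y a" "s : ob S C" "Q' Z b" for Y C Z a s b
  unfolding lin(1)[OF v(1,2,4,5)] lin(2)[OF v(2,3,5,6)]
  by (rule rp_balanced[OF M v(1-3) mhD(1)[OF ph(1) v(1) mgenD[OF Q(1) v(1,4)]] v(5) mhD(1)[OF ph(2) v(3) mgenD[OF Q(2) v(3,6)]]])
 note d = odot_map_facts[OF A M ph Q bal]
 show "odot_map n S M N ph ps : mhm (rbx S A B) (rbx S M N)" by (rule d(1))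
 show "Y : CS ==> Z : CS ==> a : ob A Y ==> b : ob B Z ==>
   odot_map n S M N ph ps (Y ** Z) (rp S A B Y Z a b) = rp S M N Y Z (ph Y a) (ps Z b)" by (rule d(2))
qed

lemma bimod_homD:
 assumes f: "f : bimod_hom n R S M N" and M: "lactor R M" "ractor S M" and N: "lactor R N" "ractor S N"
 shows "f : mhm M N"
  "Y : CS ==> Z : CS ==> r : ob R Y ==> m : ob M Z ==> f (Y ** Z) (lm R M Y Z r m) = lm R N Y Z r (f Z m)"
  "Y : CS ==> Z : CS ==> m : ob M Y ==> s : ob S Z ==> f (Y ** Z) (rm M S Y Z m s) = rm N S Y Z (f Y m) s"
proof -
 note D = lactorD[OF M(1)] ractorD[OF M(2)] lactorD[OF N(1)] ractorD[OF N(2)]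
 show h: "f : mhm M N" using f by (simp add: bimod_hom_def)
 have 1: "mack_eq n (bx R M) (f oM lact M) (lact N oM bmap R N mid f)"
  and 2: "mack_eq n (bx M S) (f oM ract M) (ract N oM bmap N S f mid)" using f unfolding bimod_hom_def by blast+
 note m1 = box_map_facts[OF mid_hom h D(1,2) D(1) D(8)] and m2 = box_map_facts[OF h mid_hom D(2,4,8,4)]
 { assume v: "Y : CS" "Z : CS" "r : ob R Y" "m : ob M Z"
  have "bp R M Y Z r m : ob (bx R M) (Y ** Z)" using v D by simp
  from mack_eqD[OF 1 _ this] show "f (Y ** Z) (lm R M Y Z r m) = lm R N Y Z r (f Z m)"
   using v by (simp add: mcomp_def m1(2) lm_def) }
 { assume v: "Y : CS" "Z : CS" "m : ob M Y" "s : ob S Z"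
  have "bp M S Y Z m s : ob (bx M S) (Y ** Z)" using v D by simp
  from mack_eqD[OF 2 _ this] show "f (Y ** Z) (rm M S Y Z m s) = rm N S Y Z (f Y m) s"
   using v by (simp add: mcomp_def m2(2) rm_def) }
qed

section \<open>Hochschild homology in degree zero\<close>

context
 fixes R :: "('r, 'y) green_scheme" and M :: "('r, 'm, 'r, 'z) bimod_scheme"
 assumes lM: "lactor R M" and rM: "ractor R M"
begin

lemma HH0_coeq:
 "mackey (bx R M)" "mackey M" "lact M : mhm (bx R M) M"
  "ract M oM box_sym n R M : mhm (bx R M) M"
 using lactorD[OF lM] ractorD[OF rM] mh_comp[OF box_sym_facts(1), of R M "ract M" M] by simp_all

lemma HH0_mackey [simp]: "mackey (HH0 n R M)"
 unfolding HH0_def by (rule coeq_mackey[OF HH0_coeq])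

lemma HH0_proj_hom: "HH0_proj n R M : mhm M (HH0 n R M)"
 unfolding HH0_def HH0_proj_def by (rule coeq_proj_hom[OF HH0_coeq])

lemma HH0_pair: assumes "Y : CS" "Z : CS" "r : ob R Y" "m : ob M Z"
 shows "(ract M oM box_sym n R M) (Y ** Z) (bp R M Y Z r m) = tr M (Z ** Y) (Y ** Z) fsw (rm M R Z Y m r)"
 using assms lactorD[OF lM] ractorD[OF rM] by (simp add: mcomp_def box_sym_facts(2) mh_tr[of "ract M"] rm_def)

text \<open>The relation that makes the quotient a shadow: r.m and m.r have the same class.\<close>

lemma HH0_cyclic: assumes "Y : CS" "Z : CS" "r : ob R Y" "m : ob M Z"
 shows "HH0_proj n R M (Y ** Z) (lm R M Y Z r m) = tr (HH0 n R M) (Z ** Y) (Y ** Z) fsw (HH0_proj n R M (Z ** Y) (rm M R Z Y m r))"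
proof -
 have "HH0_proj n R M (Y ** Z) (lact M (Y ** Z) (bp R M Y Z r m)) =
  HH0_proj n R M (Y ** Z) ((ract M oM box_sym n R M) (Y ** Z) (bp R M Y Z r m))"
  unfolding HH0_proj_def by (rule coeq_eq[OF HH0_coeq]) (use assms lactorD[OF lM] in simp_all)
 then show ?thesis unfolding HH0_pair[OF assms] lm_def[symmetric] using assms rM by (simp add: mh_tr[OF HH0_proj_hom])
qed

text \<open>A map that satisfies the cyclic relation on generators descends.\<close>

lemma HH0_desc:
 assumes L: "mackey L" and h: "h : mhm M L" and Q: "mgen M Q"
  and cyc: "!!Y Z r m. Y : CS ==> Z : CS ==> r : ob R Y ==> Q Z m ==>
   h (Y ** Z) (lm R M Y Z r m) = tr L (Z ** Y) (Y ** Z) fsw (h (Z ** Y) (rm M R Z Y m r))"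
 shows "desc h : mhm (HH0 n R M) L"
  "X : CS ==> x : ob M X ==> desc h X (HH0_proj n R M X x) = h X x"
proof -
 have eq: "h X (lact M X k) = h X ((ract M oM box_sym n R M) X k)" if X: "X : CS" "k : ob (bx R M) X" for X k
  using mack_hom_eqI[OF mgen_box[OF lactorD(1,2)[OF lM] mgen_all Q] mh_comp[OF HH0_coeq(3) h] mh_comp[OF HH0_coeq(4) h] HH0_coeq(1) L _ X]
  unfolding mcomp_def[of h]
 proof this
  fix X x assume "EX Y Z m k. Y : CS & Z : CS & m : ob R Y & Q Z k & X = Y ** Z & x = bp R M Y Z m k"
  then obtain Y Z r m where v: "Y : CS" "Z : CS" "r : ob R Y" "Q Z m" "X = Y ** Z" "x = bp R M Y Z r m"
   by (elim exE conjE)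
  have m: "m : ob M Z" by (rule mgenD[OF Q v(2,4)])
  show "h X (lact M X x) = h X ((ract M oM box_sym n R M) X x)"
   unfolding v(5,6) HH0_pair[OF v(1-3) m] using cyc[OF v(1-4)] v(1-3) m rM by (simp add: lm_def mh_tr[OF h])
 qed
 show "desc h : mhm (HH0 n R M) L" unfolding HH0_def by (rule coeq_desc_hom[OF HH0_coeq L h eq])
 show "X : CS ==> x : ob M X ==> desc h X (HH0_proj n R M X x) = h X x"
  unfolding HH0_proj_def by (rule coeq_desc_value[OF HH0_coeq L h eq])
qed

end

declare HH0_mackey [simp]

lemma HH0_map_facts:
 assumes M: "lactor R M" "ractor R M" and N: "lactor R N" "ractor R N" and ph: "ph : mhm M N" and Q: "mgen M Q"
  and lin: "!!Y Z r m. Y : CS ==> Z : CS ==> r : ob R Y ==> Q Z m ==> ph (Y ** Z) (lm R M Y Z r m) = lm R N Y Z r (ph Z m)"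
   "!!Y Z r m. Y : CS ==> Z : CS ==> r : ob R Y ==> Q Z m ==> ph (Z ** Y) (rm M R Z Y m r) = rm N R Z Y (ph Z m) r"
 shows "HH0_map n R N ph : mhm (HH0 n R M) (HH0 n R N)"
  "X : CS ==> x : ob M X ==> HH0_map n R N ph X (HH0_proj n R M X x) = HH0_proj n R N X (ph X x)"
proof -
 have cyc: "(HH0_proj n R N oM ph) (Y ** Z) (lm R M Y Z r m) =
   tr (HH0 n R N) (Z ** Y) (Y ** Z) fsw ((HH0_proj n R N oM ph) (Z ** Y) (rm M R Z Y m r))"
  if v: "Y : CS" "Z : CS" "r : ob R Y" "Q Z m" for Y Z r m
  unfolding mcomp_def lin(1)[OF v] lin(2)[OF v]
  by (rule HH0_cyclic[OF N v(1-3) mhD(1)[OF ph v(2) mgenD[OF Q v(2,4)]]])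
 note d = HH0_desc[OF M HH0_mackey[OF N] mh_comp[OF ph HH0_proj_hom[OF N]] Q cyc, folded HH0_map_def]
 show "HH0_map n R N ph : mhm (HH0 n R M) (HH0 n R N)" by (rule d(1))
 show "X : CS ==> x : ob M X ==> HH0_map n R N ph X (HH0_proj n R M X x) = HH0_proj n R N X (ph X x)"
  using d(2) by (simp add: mcomp_def)
qed

section \<open>The transport maps of a twisted bimodule\<close>

lemma galpha_add: "mackey M ==> g : CG ==> h : CG ==> X : CS ==> x : ob M X ==>
  galpha n M ((g + h) mod int n) X x = galpha n M g X (galpha n M h X x)"
 unfolding galpha_tr by (subst tr_tr) (auto simp: act_comp act_commute intro!: tr_eqI)

lemma Theta_comp_facts:
 assumes R: "green_functor n R" and g: "g : CG" and h: "h : CG"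
 shows "Theta_comp n R g : mhm (rbx R (Theta n R g) (ubimod R)) R"
  "Y : CS ==> Z : CS ==> a : ob R Y ==> b : ob R Z ==>
   Theta_comp n R g (Y ** Z) (rp R (Theta n R g) (ubimod R) Y Z a b) = gm R Y Z a (galpha n R g Z b)"
proof -
 note F = green_facts[OF R] and m = bmodD(2)[OF bmod_Theta[OF R g]] bmodD(1)[OF bmod_ubimod[OF R]]
 note mf = box_map_facts[OF mid_hom galpha_hom[OF F(1) g] F(1,1) F(1,1)]
 define H where "H = gmul R oM bmap R R mid (galpha n R g)"
 have h: "H : mhm (bx (Theta n R g) (ubimod R)) R"
  using mh_comp[OF mf(1) F(2)] by (simp add: H_def)
 have hv: "H (Y ** Z) (bp R R Y Z a b) = gm R Y Z a (galpha n R g Z b)"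
  if "Y : CS" "Z : CS" "a : ob R Y" "b : ob R Z" for Y Z a b
  using that by (simp add: H_def mcomp_def mf(2) gm_def)
 have bal: "H ((Y ** A) ** Z) (bp (Theta n R g) (ubimod R) (Y ** A) Z (rm (Theta n R g) R Y A m s) k) =
   tr R (Y ** A ** Z) ((Y ** A) ** Z) fas' (H (Y ** A ** Z) (bp (Theta n R g) (ubimod R) Y (A ** Z) m (lm R (ubimod R) A Z s k)))"
  if "Y : CS" "A : CS" "Z : CS" "m : ob (Theta n R g) Y" "s : ob R A" "k : ob (ubimod R) Z" for Y A Z m s k
  using that R g F(1) by (simp add: hv rm_Theta F(5) bilin_galpha[OF F(3) g])
 note d = rbox_desc[OF m F(1) h mgen_all mgen_all mgen_all bal]
 have e: "Theta_comp n R g = desc H" by (simp add: Theta_comp_def H_def)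
 show "Theta_comp n R g : mhm (rbx R (Theta n R g) (ubimod R)) R" unfolding e by (rule d(1))
 show "Y : CS ==> Z : CS ==> a : ob R Y ==> b : ob R Z ==>
   Theta_comp n R g (Y ** Z) (rp R (Theta n R g) (ubimod R) Y Z a b) = gm R Y Z a (galpha n R g Z b)"
  using d(3)[of Y Z a b] by (simp add: e hv)
qed

lemma ltw_iso_facts:
 assumes R: "green_functor n R" and M: "lmodule R M" and g: "g : CG"
 shows "ltw_iso n R g M : mhm (rbx R (Theta n R ((- g) mod int n)) M) M"
  "Y : CS ==> Z : CS ==> r : ob R Y ==> m : ob M Z ==>
   ltw_iso n R g M (Y ** Z) (rp R (Theta n R ((- g) mod int n)) M Y Z r m) = lm R M Y Z (galpha n R g Y r) m"
proof -
 note D = lmoduleD[OF M] and F = green_facts[OF R]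
 have g': "(- g) mod int n : CG" using g by simp
 have bal: "lm R (ltw n R g M) (Y ** B) Z (rm (Theta n R ((- g) mod int n)) R Y B a r) m =
   tr M (Y ** B ** Z) ((Y ** B) ** Z) fas' (lm R (ltw n R g M) Y (B ** Z) a (lm R M B Z r m))"
  if v: "Y : CS" "B : CS" "Z : CS" "a : ob R Y" "r : ob R B" "m : ob M Z" for Y B Z a r m
  using v D(1-3) R F(1) g g' by (simp add: rm_Theta lm_ltw bilin_galpha[OF F(3) g, symmetric] D(4))
 note d = desc_lact[OF same_Theta bmodD(2)[OF bmod_Theta[OF R g']] D(1) lactor_ltw[OF D(1) g] same_ltw bal, folded ltw_iso_def]
 show "ltw_iso n R g M : mhm (rbx R (Theta n R ((- g) mod int n)) M) M" by (rule d(1))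
 show "Y : CS ==> Z : CS ==> r : ob R Y ==> m : ob M Z ==>
   ltw_iso n R g M (Y ** Z) (rp R (Theta n R ((- g) mod int n)) M Y Z r m) = lm R M Y Z (galpha n R g Y r) m"
  using d(2) D(1) g by (simp add: lm_ltw)
qed

text \<open>The twist isomorphism read on elements: p \<mapsto> 1 \<otimes> p \<mapsto> t(p) \<otimes> 1 \<mapsto> t(p).\<close>

definition tmap where
 "tmap R P ta g = (%X p. orunit P X (ta g X (iota R (Theta n R g) P X p)))"

context
 fixes R :: "('r, 'u) green_scheme" and S :: "('s, 'v) green_scheme" and P :: "('r, 'p, 's, 'z) bimod_scheme" and ta
 assumes R: "green_functor n R" and S: "green_functor n S" and tw: "twist_cell n R S P ta"
begin

abbreviation (input) "tg == tmap R P ta"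
abbreviation (input) "OT g == odo R R S (Theta n R g) P"
abbreviation (input) "PT g == odo R S S P (Theta n S g)"

lemma P_bimodule: "bimodule n R S P" using tw by (simp add: twist_cell_def)

lemmas P_modules = bimodule_modules[OF P_bimodule R S]
lemmas P_bmod = bimodule_facts(1)[OF P_bimodule R S]
lemmas P_kap = orunit_facts[OF S P_modules(2)]

lemma kap_lm: assumes g: "g : CG" and v: "Y : CS" "Z : CS" "r : ob R Y" "q : ob P Z"
 shows "lm R (PT g) Y Z r (kap S P Z q) = kap S P (Y ** Z) (lm R P Y Z r q)"
proof -
 note F = odot_facts[OF P_bmod bmod_Theta[OF S g]] and D = bmodD[OF P_bmod] and U = bmodD[OF bmod_ubimod[OF S]]
 note m = D(2) U(1)
 have pu: "rp S P (ubimod S) Y Z m s : ob (rbx S P (ubimod S)) (Y ** Z)" if "Y : CS" "Z : CS" "m : ob P Y" "s : ob S Z" for Y Z m s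
  using rp_closed[OF m that(1-3)] that(4) by simp
 show ?thesis
  using v m green_facts(1,4)[OF S] D lm_tr(2)[OF F(1)] F(3)[of Y Z pt r q "gone n S"]
  by (simp add: kap_def pu) (rule tr_eqI_ball, simp)
qed

lemma kap_rm: assumes g: "g : CG" and v: "Y : CS" "Z : CS" "q : ob P Y" "s : ob S Z"
 shows "rm (PT g) S Y Z (kap S P Y q) s = kap S P (Y ** Z) (rm P S Y Z q (galpha n S g Z s))"
proof -
 note F = odot_facts[OF P_bmod bmod_Theta[OF S g]] and D = bmodD[OF P_bmod] and U = bmodD[OF bmod_ubimod[OF S]]
 note m = D(2) U(1) and gS = green_facts[OF S]
 have pu: "rp S P (ubimod S) Y Z m s : ob (rbx S P (ubimod S)) (Y ** Z)" if "Y : CS" "Z : CS" "m : ob P Y" "s : ob S Z" for Y Z m s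
  using rp_closed[OF m that(1-3)] that(4) by simp
 have "rm (PT g) S (Y ** pt) Z (rp S P (ubimod S) Y pt q (gone n S)) s =
  tr (rbx S P (ubimod S)) (Y ** pt ** Z) ((Y ** pt) ** Z) fas'
   (rp S P (ubimod S) Y (pt ** Z) q (gm S pt Z (gone n S) (galpha n S g Z s)))"
  using F(4)[of Z Y pt s q "gone n S"] v gS(1,4) S g by (simp add: rm_Theta)
 moreover have "galpha n S g Z s : ob S Z" using gS(1) g v by simp
 ultimately show ?thesis
  unfolding P_kap(6)[OF v(1-3) `galpha n S g Z s : ob S Z`, symmetric]
  using v m gS(1,4) D rm_tr(1)[OF F(2)] g
  by (simp add: kap_def pu gS(6) rp_tr(2)[OF m, simplified] tr_id_ball)
qed

lemma Theta_one [simp]: "gone n R : ob R pt" "gone n S : ob S pt"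
 using green_facts(4)[OF R] green_facts(4)[OF S] by simp_all

context
 fixes g assumes g: "g : CG"
begin

lemma tau_hom:
 shows "ta g : mhm (rbx R (Theta n R g) P) (rbx S P (ubimod S))"
  "Y : CS ==> Z : CS ==> r : ob R Y ==> m : ob (rbx R (Theta n R g) P) Z ==> ta g (Y ** Z) (lm R (OT g) Y Z r m) = lm R (PT g) Y Z r (ta g Z m)"
  "Y : CS ==> Z : CS ==> m : ob (rbx R (Theta n R g) P) Y ==> s : ob S Z ==> ta g (Y ** Z) (rm (OT g) S Y Z m s) = rm (PT g) S Y Z (ta g Y m) s"
  "X : CS ==> bij_betw (ta g X) (ob (rbx R (Theta n R g) P) X) (ob (rbx S P (ubimod S)) X)"
proof -
 have i: "ta g : bimod_iso n R S (OT g) (PT g)" using tw g unfolding twist_cell_def by blast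
 then have h: "ta g : bimod_hom n R S (OT g) (PT g)" by (simp add: bimod_iso_def)
 note O = odot_facts(1,2)[OF bmod_Theta[OF R g] P_bmod] and Q = odot_facts(1,2)[OF P_bmod bmod_Theta[OF S g]]
 note d = bimod_homD[OF h O Q]
 show "ta g : mhm (rbx R (Theta n R g) P) (rbx S P (ubimod S))" using d(1) by simp
 show "Y : CS ==> Z : CS ==> r : ob R Y ==> m : ob (rbx R (Theta n R g) P) Z ==> ta g (Y ** Z) (lm R (OT g) Y Z r m) = lm R (PT g) Y Z r (ta g Z m)"
  using d(2)[of Y Z r m] by simp
 show "Y : CS ==> Z : CS ==> m : ob (rbx R (Theta n R g) P) Y ==> s : ob S Z ==> ta g (Y ** Z) (rm (OT g) S Y Z m s) = rm (PT g) S Y Z (ta g Y m) s"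
  using d(3)[of Y Z m s] by simp
 show "X : CS ==> bij_betw (ta g X) (ob (rbx R (Theta n R g) P) X) (ob (rbx S P (ubimod S)) X)"
  using i by (simp add: bimod_iso_def)
qed

lemmas ThP = bmodD(2)[OF bmod_Theta[OF R g]] bmodD(1)[OF P_bmod]

lemma iota_Theta:
 shows "iota R (Theta n R g) P : mhm P (rbx R (Theta n R g) P)"
  "Y : CS ==> Z : CS ==> r : ob R Y ==> p : ob P Z ==> rp R (Theta n R g) P Y Z r p : ob (rbx R (Theta n R g) P) (Y ** Z)"
  "Y : CS ==> Z : CS ==> r : ob R Y ==> p : ob P Z ==>
   lm R (OT g) Y Z r (iota R (Theta n R g) P Z p) = rp R (Theta n R g) P Y Z r p"
  "Y : CS ==> Z : CS ==> p : ob P Y ==> s : ob S Z ==>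
   rm (OT g) S Y Z (iota R (Theta n R g) P Y p) s = iota R (Theta n R g) P (Y ** Z) (rm P S Y Z p s)"
  "Y : CS ==> Z : CS ==> r : ob R Y ==> p : ob P Z ==>
   iota R (Theta n R g) P (Y ** Z) (lm R P Y Z r p) = rp R (Theta n R g) P Y Z (galpha n R g Y r) p"
proof -
 note m = ThP and F = odot_facts[OF bmod_Theta[OF R g] P_bmod] and gR = green_facts[OF R] and D = bmodD[OF P_bmod]
 show "iota R (Theta n R g) P : mhm P (rbx R (Theta n R g) P)" by (rule iota_hom[OF m]) simp
 show pu: "rp R (Theta n R g) P Y Z r p : ob (rbx R (Theta n R g) P) (Y ** Z)"
  if "Y : CS" "Z : CS" "r : ob R Y" "p : ob P Z" for Y Z r p
  using rp_closed[OF m that(1,2) _ that(4)] that(3) by simp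
 { assume v: "Y : CS" "Z : CS" "r : ob R Y" "p : ob P Z"
  show "lm R (OT g) Y Z r (iota R (Theta n R g) P Z p) = rp R (Theta n R g) P Y Z r p"
   using v m gR(1,4) D lm_tr(2)[OF F(1)] F(3)[of Y pt Z r "gone n R" p]
   by (simp add: iota_def pu gR(7) rp_tr(1)[OF m, simplified] tr_id_ball)
  have "rp R (Theta n R g) P (pt ** Y) Z (gm R pt Y (gone n R) (galpha n R g Y r)) p =
   tr (rbx R (Theta n R g) P) (pt ** Y ** Z) ((pt ** Y) ** Z) fas' (rp R (Theta n R g) P pt (Y ** Z) (gone n R) (lm R P Y Z r p))"
   using rp_balanced[OF m cpoint_csets v(1,2) _ v(3,4)] R g v by (simp add: rm_Theta)
  then have "rp R (Theta n R g) P pt (Y ** Z) (gone n R) (lm R P Y Z r p) =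
   tr (rbx R (Theta n R g) P) ((pt ** Y) ** Z) (pt ** Y ** Z) fas (rp R (Theta n R g) P (pt ** Y) Z (gm R pt Y (gone n R) (galpha n R g Y r)) p)"
   using v D m pu[of pt "Y ** Z" "gone n R" "lm R P Y Z r p"] by (simp add: tr_id_ball)
  then show "iota R (Theta n R g) P (Y ** Z) (lm R P Y Z r p) = rp R (Theta n R g) P Y Z (galpha n R g Y r) p"
   using v m gR(1,4) D g by (simp add: iota_def pu gR(6) rp_tr(1)[OF m, simplified] tr_id_ball) }
 assume v: "Y : CS" "Z : CS" "p : ob P Y" "s : ob S Z"
 show "rm (OT g) S Y Z (iota R (Theta n R g) P Y p) s = iota R (Theta n R g) P (Y ** Z) (rm P S Y Z p s)"
  using v m gR(1,4) D rm_tr(1)[OF F(2)] F(4)[of Z pt Y s "gone n R" p]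
  by (simp add: iota_def pu) (rule tr_eqI_ball, simp)
qed

lemma tmap_apply: "tg g X p = orunit P X (ta g X (iota R (Theta n R g) P X p))"
 by (simp add: tmap_def)

lemma tmap_hom: "tg g : mhm P P"
 using mh_comp[OF mh_comp[OF iota_Theta(1) tau_hom(1)] P_kap(1)] by (simp add: tmap_def[abs_def] mcomp_def)

lemma tmap_closed [simp]: "X : CS ==> p : ob P X ==> tg g X p : ob P X"
 by (rule mhD(1)[OF tmap_hom])

lemma tau_iota: "X : CS ==> p : ob P X ==> ta g X (iota R (Theta n R g) P X p) = kap S P X (tg g X p)"
 by (simp add: tmap_def P_kap(5) mhD(1)[OF tau_hom(1)] mhD(1)[OF iota_Theta(1)])

text \<open>By linearity of \<tau> over R, its value on r \<otimes> p = r.(1 \<otimes> p) is r.t(p) \<otimes> 1.\<close>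

lemma tau_rp: "Y : CS ==> Z : CS ==> r : ob R Y ==> p : ob P Z ==>
  ta g (Y ** Z) (rp R (Theta n R g) P Y Z r p) = kap S P (Y ** Z) (lm R P Y Z r (tg g Z p))"
 by (simp add: iota_Theta(3)[symmetric] tau_hom(2) mhD(1)[OF iota_Theta(1)] tau_iota kap_lm[OF g])

text \<open>In the twisted unit bimodule, 1 \<otimes> r.p = \<alpha>(r) \<otimes> p, and \<open>tau_rp\<close> applies.\<close>

lemma tmap_lm: "Y : CS ==> Z : CS ==> r : ob R Y ==> p : ob P Z ==>
  tg g (Y ** Z) (lm R P Y Z r p) = lm R P Y Z (galpha n R g Y r) (tg g Z p)"
 using g bmodD[OF P_bmod] green_facts(1)[OF R]
 by (simp add: tmap_apply[of "Y ** Z"] iota_Theta(5) tau_rp P_kap(4))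

text \<open>The right action on P twisted by g sends p \<otimes> 1 to p.\<alpha>(s) \<otimes> 1.\<close>

lemma tmap_rm: "Y : CS ==> Z : CS ==> p : ob P Y ==> s : ob S Z ==>
  tg g (Y ** Z) (rm P S Y Z p s) = rm P S Y Z (tg g Y p) (galpha n S g Z s)"
 using g bmodD[OF P_bmod] green_facts(1)[OF S]
 by (simp add: tmap_apply[of "Y ** Z"] iota_Theta(4)[symmetric] tau_hom(3) mhD(1)[OF iota_Theta(1)] tau_iota kap_rm[OF g] P_kap(4))

end

lemma zero_G [simp]: "0 : CG" using n_pos by (simp add: carrier_G)

text \<open>The condition on \<tau> at the neutral element, evaluated at 1 \<otimes> p.\<close>

lemma tmap_zero: assumes X: "X : CS" and p: "p : ob P X" shows "tg 0 X p = p"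
proof -
 note D = lmoduleD[OF P_modules(1)] and gR = green_facts[OF R]
 note m = ThP[OF zero_G]
 have t: "mack_eq n (rbx R (Theta n R 0) P) (ta 0) (orunit' n R S P oM olunit P)" using tw by (simp add: twist_cell_def)
 have bal: "lm R P (Y ** B) Z (rm (Theta n R 0) R Y B a r) k = tr P (Y ** B ** Z) ((Y ** B) ** Z) fas' (lm R P Y (B ** Z) a (lm R P B Z r k))"
  if "Y : CS" "B : CS" "Z : CS" "a : ob R Y" "r : ob R B" "k : ob P Z" for Y B Z a r k
  using that R gR(1) by (simp add: rm_Theta D(4))
 note d = desc_lact[OF same_Theta m D(1) same_refl bal, folded olunit_def]
 have i: "iota R (Theta n R 0) P X p : ob (rbx R (Theta n R 0) P) X" by (rule mhD(1)[OF iota_Theta(1)[OF zero_G] X p])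
 have c: "rp R (Theta n R 0) P pt X (gone n R) p : ob (rbx R (Theta n R 0) P) (pt ** X)"
  by (rule iota_Theta(2)[OF zero_G]) (use X p in simp_all)
 have l: "olunit P X (iota R (Theta n R 0) P X p) = p"
  using X p m c D by (simp add: iota_def mh_tr[OF d(1)] d(2) tr_id_ball)
 have "ta 0 X (iota R (Theta n R 0) P X p) = orunit' n R S P X p"
  using mack_eqD[OF t X i] by (simp add: mcomp_def l)
 then show ?thesis using X p by (simp add: tmap_def P_kap(4,7))
qed

end

lemma odot_map_left:
 assumes A: "ractor S A" "lactor S B" and M: "ractor S M" and ph: "ph : mhm A M" and Q: "mgen A Q"
  and lin: "!!Y C a s. Y : CS ==> C : CS ==> Q Y a ==> s : ob S C ==> ph (Y ** C) (rm A S Y C a s) = rm M S Y C (ph Y a) s"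
 shows "odot_map n S M B ph mid : mhm (rbx S A B) (rbx S M B)"
  "Y : CS ==> Z : CS ==> a : ob A Y ==> b : ob B Z ==>
   odot_map n S M B ph mid (Y ** Z) (rp S A B Y Z a b) = rp S M B Y Z (ph Y a) b"
 using odot_map_linear[OF A M A(2) ph mid_hom Q mgen_all lin] by simp_all

lemma odot_map_right:
 assumes A: "ractor S A" "lactor S B" and N: "lactor S N" and ps: "ps : mhm B N" and Q: "mgen B Q"
  and lin: "!!C Z s b. C : CS ==> Z : CS ==> s : ob S C ==> Q Z b ==> ps (C ** Z) (lm S B C Z s b) = lm S N C Z s (ps Z b)"
 shows "odot_map n S A N mid ps : mhm (rbx S A B) (rbx S A N)"
  "Y : CS ==> Z : CS ==> a : ob A Y ==> b : ob B Z ==>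
   odot_map n S A N mid ps (Y ** Z) (rp S A B Y Z a b) = rp S A N Y Z a (ps Z b)"
 using odot_map_linear[OF A A(1) N mid_hom ps mgen_all Q _ lin] by simp_all

context
 fixes R :: "('r, 'u) green_scheme" and S :: "('s, 'v) green_scheme" and P :: "('r, 'p, 's, 'z) bimod_scheme" and ta
 assumes R: "green_functor n R" and S: "green_functor n S" and tw: "twist_cell n R S P ta"
begin

lemmas Pm = P_modules[OF R S tw] and Pb = P_bmod[OF R S tw] and Pk = P_kap[OF R S tw]
lemmas t_hom = tmap_hom[OF R S tw] and tau_hom' = tau_hom[OF R S tw] and tau_rp' = tau_rp[OF R S tw]
 and t_lm = tmap_lm[OF R S tw] and t_rm = tmap_rm[OF R S tw] and t_closed [simp] = tmap_closed[OF R S tw]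
 and one_closed [simp] = Theta_one[OF R S tw]

lemma rp_Theta: assumes "g : CG" "Y : CS" "Z : CS"
 shows "r : ob R Y ==> p : ob P Z ==> rp R (Theta n R g) P Y Z r p : ob (rbx R (Theta n R g) P) (Y ** Z)"
  "q : ob P Y ==> s : ob S Z ==> rp S P (ubimod S) Y Z q s : ob (rbx S P (ubimod S)) (Y ** Z)"
 using rp_closed[OF bmodD(2)[OF bmod_Theta[OF R assms(1)]] bmodD(1)[OF Pb] assms(2,3), of r p]
  rp_closed[OF bmodD(2)[OF Pb] bmodD(1)[OF bmod_ubimod[OF S]] assms(2,3), of q s] by simp_all

text \<open>The composition axiom of a twist, evaluated at 1 \<otimes> 1 \<otimes> p.\<close>

lemma tmap_comp:
 assumes g: "g : CG" and h: "h : CG" and X: "X : CS" and p: "p : ob P X"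
 shows "tmap R P ta ((g + h) mod int n) X p = tmap R P ta g X (tmap R P ta h X p)"
proof -
 define gh where "gh = (g + h) mod int n"
 have gh: "gh : CG" using g h by (simp add: gh_def)
 note gR = green_facts[OF R] and gS = green_facts[OF S]
 note T = bmod_Theta[OF R] and TS = bmod_Theta[OF S]
 note D = bmodD[OF Pb] lmoduleD(4,5)[OF Pm(1)] rmoduleD(4,5)[OF Pm(2)]
 let ?c = "pt ** pt"
 let ?RR = "odo R R R (Theta n R g) (Theta n R h)" and ?SS = "odo S S S (Theta n S g) (Theta n S h)"
 note bRR = odot_bmod[OF T[OF g] T[OF h]] and bSS = odot_bmod[OF TS[OF g] TS[OF h]]
 note fRR = odot_facts[OF T[OF g] T[OF h], simplified] and fSS = odot_facts[OF TS[OF g] TS[OF h], simplified]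
 note bOTh = odot_bmod[OF T[OF h] Pb] and bPTh = odot_bmod[OF Pb TS[OF h]]
 note bOTg = odot_bmod[OF T[OF g] Pb] and bPTg = odot_bmod[OF Pb TS[OF g]]
 have pRR: "rp R (Theta n R g) (ubimod R) Y Z a b : ob (rbx R (Theta n R g) (ubimod R)) (Y ** Z)"
  if "Y : CS" "Z : CS" "a : ob R Y" "b : ob R Z" for Y Z a b
  using rp_closed[OF bmodD(2)[OF T[OF g]] bmodD(1)[OF bmod_ubimod[OF R]] that(1,2)] that(3,4) by simp
 have pSS: "rp S (Theta n S g) (ubimod S) Y Z a b : ob (rbx S (Theta n S g) (ubimod S)) (Y ** Z)"
  if "Y : CS" "Z : CS" "a : ob S Y" "b : ob S Z" for Y Z a b
  using rp_closed[OF bmodD(2)[OF TS[OF g]] bmodD(1)[OF bmod_ubimod[OF S]] that(1,2)] that(3,4) by simp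
 note tcR = Theta_comp_facts[OF R g h] and tcS = Theta_comp_facts[OF S g h]
 have mk: "mackey (rbx R (Theta n R g) (ubimod R))" "mackey (rbx S (Theta n S g) (ubimod S))"
  using bmodD(5)[OF bRR] bmodD(5)[OF bSS] by simp_all
 have gR': "mgen ?RR (%X t. EX Y Z l m. Y : CS & Z : CS & l : ob R Y & m : ob R Z & X = Y ** Z & t = rp R (Theta n R g) (ubimod R) Y Z l m)"
  using mgen_rbox[OF bmodD(2)[OF T[OF g]] bmodD(1)[OF T[OF h]] mgen_all mgen_all] by simp
 have gS': "mgen ?SS (%X t. EX Y Z l m. Y : CS & Z : CS & l : ob S Y & m : ob S Z & X = Y ** Z & t = rp S (Theta n S g) (ubimod S) Y Z l m)"
  using mgen_rbox[OF bmodD(2)[OF TS[OF g]] bmodD(1)[OF TS[OF h]] mgen_all mgen_all] by simp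
 have lR: "Theta_comp n R g (X ** C) (rm ?RR R X C c s) = rm (Theta n R gh) R X C (Theta_comp n R g X c) s"
  if a: "X : CS" "C : CS" "s : ob R C" and c: "EX Y Z l m. Y : CS & Z : CS & l : ob R Y & m : ob R Z & X = Y ** Z & c = rp R (Theta n R g) (ubimod R) Y Z l m" for X C c s
 proof -
  obtain Y Z l m where v: "Y : CS" "Z : CS" "l : ob R Y" "m : ob R Z" "X = Y ** Z" "c = rp R (Theta n R g) (ubimod R) Y Z l m"
   using c by (elim exE conjE)
  show ?thesis using a(2,3) v(1-4) R g h gh gR(1) unfolding v(5,6)
   by (simp add: fRR(4) rm_Theta mh_tr[OF tcR(1)] tcR(2) pRR gR(5) bilin_galpha[OF gR(3) g, symmetric])
    (simp add: gh_def galpha_add)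
 qed
 have lS: "Theta_comp n S g (C ** X) (lm S ?SS C X s c) = lm S (Theta n S gh) C X s (Theta_comp n S g X c)"
  if a: "C : CS" "X : CS" "s : ob S C" and c: "EX Y Z l m. Y : CS & Z : CS & l : ob S Y & m : ob S Z & X = Y ** Z & c = rp S (Theta n S g) (ubimod S) Y Z l m" for X C c s
 proof -
  obtain Y Z l m where v: "Y : CS" "Z : CS" "l : ob S Y" "m : ob S Z" "X = Y ** Z" "c = rp S (Theta n S g) (ubimod S) Y Z l m"
   using c by (elim exE conjE)
  show ?thesis using a(1,3) v(1-4) S g h gh gS(1) unfolding v(5,6)
   by (simp add: fSS(3) mh_tr[OF tcS(1)] tcS(2) pSS gS(5) tr_id_ball)
 qed
 have hR: "Theta_comp n R g : mhm ?RR (Theta n R gh)" and hS: "Theta_comp n S g : mhm ?SS (Theta n S gh)"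
  using tcR(1) tcS(1) by simp_all
 have th: "ta h : mhm (odo R R S (Theta n R h) P) (odo R S S P (Theta n S h))" and tgh: "ta g : mhm (odo R R S (Theta n R g) P) (odo R S S P (Theta n S g))" using tau_hom'(1) g h by simp_all
 note m1 = odot_map_left[OF bmodD(2)[OF bRR] D(1) bmodD(2)[OF T[OF gh]] hR gR' lR, simplified]
 have lth: "ta h (C ** Z) (lm R (odo R R S (Theta n R h) P) C Z s b) = lm R (odo R S S P (Theta n S h)) C Z s (ta h Z b)"
  if "C : CS" "Z : CS" "s : ob R C" "b : ob (odo R R S (Theta n R h) P) Z" for C Z s b
  using tau_hom'(2)[OF h] that by simp
 have ltg: "ta g (C ** Z) (rm (odo R R S (Theta n R g) P) S C Z b s) = rm (odo R S S P (Theta n S g)) S C Z (ta g C b) s"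
  if "C : CS" "Z : CS" "b : ob (odo R R S (Theta n R g) P) C" "s : ob S Z" for C Z s b
  using tau_hom'(3)[OF g] that by simp
 note m2 = odot_map_right[OF bmodD(2)[OF T[OF g]] bmodD(1)[OF bOTh] bmodD(1)[OF bPTh] th mgen_all lth, simplified]
 note m3 = odot_map_left[OF bmodD(2)[OF bOTg] bmodD(1)[OF TS[OF h]] bmodD(2)[OF bPTg] tgh mgen_all ltg, simplified]
 note m4 = odot_map_right[OF D(2) bmodD(1)[OF bSS] bmodD(1)[OF TS[OF gh]] hS gS' lS, simplified]
 note o1 = oassoc_facts[OF T[OF g] T[OF h] Pb, simplified] and o3 = oassoc'_facts[OF T[OF g] Pb TS[OF h], simplified] and o5 = oassoc_facts[OF Pb TS[OF g] TS[OF h], simplified]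
 let ?u = "ubimod S" and ?Tg = "Theta n R g" and ?Th = "Theta n R h" and ?Tgh = "Theta n R gh"
 let ?OTh = "odo R R S ?Th P" and ?OTg = "odo R R S ?Tg P" and ?PTh = "odo R S S P (Theta n S h)" and ?PTg = "odo R S S P (Theta n S g)"
 define q where "q = tmap R P ta h X p"
 define q' where "q' = tmap R P ta g X q"
 have q: "q : ob P X" "q' : ob P X" using g h X p by (simp_all add: q_def q'_def)
 note k2 = bmodD(2)[OF T[OF g]] bmodD(1)[OF bPTh] and k3 = bmodD(2)[OF bPTg] bmodD(1)[OF bmod_ubimod[OF S]]
  and k5 = bmodD(2)[OF Pb] bmodD(1)[OF bSS] and k0 = bmodD(2)[OF T[OF g]] bmodD(1)[OF bOTh] and k4 = bmodD(2)[OF bOTg] bmodD(1)[OF bmod_ubimod[OF S]]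
  and k1 = bmodD(2)[OF bRR] D(1) and k6 = bmodD(2)[OF Pb] bmodD(1)[OF bmod_ubimod[OF S]]
 note cl = rp_closed[OF k0, simplified] rp_closed[OF k1, simplified] rp_closed[OF k2, simplified] rp_closed[OF k3, simplified] rp_closed[OF k4, simplified]
  rp_closed[OF k5, simplified] rp_closed[OF k6, simplified] rp_Theta(1)[OF g] rp_Theta(1)[OF h] rp_Theta(1)[OF gh] pRR pSS
 note mks = rbox_mackey[OF k0] rbox_mackey[OF k1] rbox_mackey[OF k2] rbox_mackey[OF k3, simplified] rbox_mackey[OF k4, simplified] rbox_mackey[OF k5] rbox_mackey[OF k6]
 note tr2 = rp_tr(2)[OF k2, simplified] and tr3 = rp_tr(1)[OF k3, simplified]
 have kk: "kap S P (pt ** X) (lm R P pt X (gone n R) w) =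
   tr (rbx S P ?u) (X ** pt) (pt ** X) (%x. flu' (fru x)) (rp S P ?u X pt w (gone n S))" if "w : ob P X" for w
 proof -
  have "kap S P (pt ** X) (tr P X (pt ** X) flu' w) = tr (rbx S P ?u) X (pt ** X) flu' (kap S P X w)"
   by (rule mh_tr[OF Pk(2) X]) (use X that in simp_all)
  then show ?thesis using X that D mks by (simp add: lmoduleD(5)[OF Pm(1)] kap_def[of S P] cl)
 qed
 define z where "z = rp R ?RR P ?c X (rp R ?Tg (ubimod R) pt pt (gone n R) (gone n R)) p"
 define A2 where "A2 = rp R ?Tg ?PTh pt (X ** pt) (gone n R) (rp S P ?u X pt q (gone n S))"
 define A3 where "A3 = rp S ?OTg ?u (pt ** X) pt (rp R ?Tg P pt X (gone n R) q) (gone n S)"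
 define A4 where "A4 = rp S ?PTg ?u (X ** pt) pt (rp S P ?u X pt q' (gone n S)) (gone n S)"
 define A5 where "A5 = rp S P ?SS X ?c q' (rp S (Theta n S g) ?u pt pt (gone n S) (gone n S))"
 have zc: "z : ob (rbx R ?RR P) (?c ** X)" using X p by (simp add: z_def cl)
 have A2c: "A2 : ob (rbx R ?Tg ?PTh) (pt ** X ** pt)" using X q by (simp add: A2_def cl)
 have A3c: "A3 : ob (rbx S ?OTg ?u) ((pt ** X) ** pt)" using X q by (simp add: A3_def cl)
 have A4c: "A4 : ob (rbx S ?PTg ?u) ((X ** pt) ** pt)" using X q by (simp add: A4_def cl)
 have A5c: "A5 : ob (rbx S P ?SS) (X ** ?c)" using X q by (simp add: A5_def cl)
 have s2: "odot_map n R ?Tg ?PTh mid (ta h) ((pt ** pt) ** X) (oassoc n R R S ?Tg ?Th P ((pt ** pt) ** X) z) =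
   tr (rbx R ?Tg ?PTh) (pt ** X ** pt) ((pt ** pt) ** X) (%x. fas' (fpm (%x. x) (%x. flu' (fru x)) x)) A2"
  using X p q mks by (simp add: z_def A2_def o1(2) mh_tr[OF m2(1)] m2(2) cl tau_rp'[OF h] q_def[symmetric] kk tr2)
 have s3: "oassoc' n R R S S ?Tg P (Theta n S h) (pt ** X ** pt) A2 =
   tr (rbx S ?OTg ?u) ((pt ** X) ** pt) (pt ** X ** pt) fas A3"
  using X q by (simp add: A2_def A3_def o3(2))
 have s4: "odot_map n S ?PTg (Theta n S h) (ta g) mid ((pt ** X) ** pt) A3 =
   tr (rbx S ?PTg ?u) ((X ** pt) ** pt) ((pt ** X) ** pt) (fpm (%x. flu' (fru x)) (%x. x)) A4"
  using X q mks by (simp add: A3_def A4_def m3(2) cl tau_rp'[OF g] q'_def[symmetric] kk tr3)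
 have s5: "oassoc n S S S P (Theta n S g) (Theta n S h) ((X ** pt) ** pt) A4 =
   tr (rbx S P ?SS) (X ** ?c) ((X ** pt) ** pt) fas' A5"
  using X q by (simp add: A4_def A5_def o5(2))
 have s6: "orunit P (X ** ?c) (odot_map n S P (Theta n S gh) mid (Theta_comp n S g) (X ** ?c) A5) = tr P X (X ** ?c) (%x. fpm (%x. x) flu' (fru' x)) q'"
  using X q D gS(1) S by (simp add: A5_def m4(2) cl tcS(2) Pk(3) gS(6))
 have o6: "odot_map n S P (Theta n S gh) mid (Theta_comp n S g) (X ** ?c) A5 : ob (rbx S P ?u) (X ** ?c)"
  by (rule mhD(1)[OF m4(1) _ A5c]) (use X in simp)
 have e0: "mack_eq n (rbx R ?RR P) (ta gh oM odot_map n R ?Tgh P (Theta_comp n R g) mid)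
   (odot_map n S P (Theta n S gh) mid (Theta_comp n S g) oM oassoc n S S S P (Theta n S g) (Theta n S h) oM
    odot_map n S ?PTg (Theta n S h) (ta g) mid oM oassoc' n R R S S ?Tg P (Theta n S h) oM
    odot_map n R ?Tg ?PTh mid (ta h) oM oassoc n R R S ?Tg ?Th P)"
  using tw g h unfolding twist_cell_def gh_def by simp
 have L: "orunit P (?c ** X) (ta gh (?c ** X) (odot_map n R ?Tgh P (Theta_comp n R g) mid (?c ** X) z)) =
   tr P X (?c ** X) (%x. fpm flu' (%x. x) (flu' x)) (tmap R P ta gh X p)"
  using X p gh D gR(1) R by (simp add: z_def m1(2) cl tcR(2) tau_rp'[OF gh] Pk(4) gR(6))
 have "tr P X (?c ** X) (%x. fpm flu' (%x. x) (flu' x)) (tmap R P ta gh X p) =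
  tr P X (?c ** X) (%x. prod_encode (prod_encode (0, 0), x)) q'"
  unfolding L[symmetric] mack_eqD[OF e0 _ zc, unfolded mcomp_def, OF cprod_csets[OF cprod_csets[OF cpoint_csets cpoint_csets] X]] s2
  using X q mks A2c A3c A4c A5c D(5) o6
  by (simp add: mh_tr[OF o3(1)] s3 mh_tr[OF m3(1)] s4 mh_tr[OF o5(1)] s5 mh_tr[OF m4(1)] mh_tr[OF Pk(1)] s6)
 then have "tr P (?c ** X) X flu (tr P X (?c ** X) (%x. fpm flu' (%x. x) (flu' x)) (tmap R P ta gh X p)) =
  tr P (?c ** X) X flu (tr P X (?c ** X) (%x. prod_encode (prod_encode (0, 0), x)) q')" by simp
 then show ?thesis using X p gh D q by (simp add: gh_def[symmetric] q'_def q_def)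
qed

lemma tmap_inv: assumes g: "g : CG" and X: "X : CS" and p: "p : ob P X"
 shows "tmap R P ta g X (tmap R P ta ((- g) mod int n) X p) = p"
 using tmap_comp[OF g _ X p, of "(- g) mod int n"] G_inv(1)[OF g] tmap_zero[OF R S tw X p] g by simp

text \<open>The transport map is an inverse of \<tau> at -g, and t at -g is inverse to t.\<close>

lemma transport_eq: assumes g: "g : CG" and X: "X : CS" and p: "p : ob P X"
 shows "transport n R S P ta g X p = tmap R P ta g X p"
proof -
 define g' where "g' = (- g) mod int n"
 have g': "g' : CG" and gi: "inv\<^bsub>G\<^esub> g = g'" using g by (simp_all add: g'_def)
 note m = bmodD(2)[OF bmod_Theta[OF R g']] bmodD(1)[OF Pb] and l = ltw_iso_facts[OF R Pm(1) g, folded g'_def] and D = bmodD[OF Pb]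
 have k: "minv (odo R S S P (Theta n S g')) (rtw_iso P) X p = kap S P X p"
  using minv_eq[OF Pk(1,2,5,4) X p] by (simp add: rtw_iso_def orunit_def)
 have kc: "kap S P X p : ob (rbx S P (ubimod S)) X" by (rule mhD(1)[OF Pk(2) X p])
 have bij: "bij_betw (ta g' X) (ob (rbx R (Theta n R g') P) X) (ob (rbx S P (ubimod S)) X)" by (rule tau_hom'(4)[OF g' X])
 define x where "x = minv (odo R R S (Theta n R g') P) (ta g') X (kap S P X p)"
 have x: "x : ob (rbx R (Theta n R g') P) X" "ta g' X x = kap S P X p"
  using bij kc by (simp_all add: x_def minv_def bij_betw_def inv_into_into f_inv_into_f)
 have eq: "ltw_iso n R g P Y y = tmap R P ta g Y (orunit P Y (ta g' Y y))" if Y: "Y : CS" "y : ob (rbx R (Theta n R g') P) Y" for Y y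
  using mack_hom_eqI[OF mgen_rbox[OF m mgen_all mgen_all] l(1) mh_comp[OF mh_comp[OF tau_hom'(1)[OF g'] Pk(1)] t_hom[OF g]] rbox_mackey[OF m] D(5) _ Y]
  unfolding mcomp_def
 proof this
  fix X x assume "EX Y Z p k. Y : CS & Z : CS & p : ob (Theta n R g') Y & k : ob P Z & X = Y ** Z & x = rp R (Theta n R g') P Y Z p k"
  then show "ltw_iso n R g P X x = tmap R P ta g X (orunit P X (ta g' X x))"
   by (elim exE conjE) (use g g' D in \<open>simp add: l(2) tau_rp' Pk(4) t_lm tmap_inv[OF g, folded g'_def]\<close>)
 qed
 show ?thesis using eq[OF X x(1)] X p by (simp add: transport_def gi Let_def mcomp_def k[simplified] x_def[simplified, symmetric] x(2) Pk(4))
qed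

lemma gamma_eq: assumes g: "g : CG" and X: "X : CS" and p: "p : ob P X"
 shows "gamma n R S P ta g X p = tmap R P ta g X p"
proof -
 define g' where "g' = (- g) mod int n"
 have g': "g' : CG" and gi: "inv\<^bsub>G\<^esub> g = g'" using g by (simp_all add: g'_def)
 note T = bmod_Theta[OF R] and gR = green_facts[OF R] and D = bmodD[OF Pb] lmoduleD(4,5)[OF Pm(1)]
 let ?u = "ubimod R" and ?RR = "odo R R R (Theta n R g') (Theta n R g)"
 let ?OT = "odo R R S (Theta n R g) P" and ?PT = "odo R S S P (Theta n S g)"
 note bRR = odot_bmod[OF T[OF g'] T[OF g]] and bOT = odot_bmod[OF T[OF g] Pb] and bPT = odot_bmod[OF Pb bmod_Theta[OF S g]]
 note fRR = odot_facts[OF T[OF g'] T[OF g], simplified] and tc = Theta_comp_facts[OF R g' g]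
 note uu = bmod_ubimod[OF R]
 note k1 = bmodD(2)[OF bRR] D(1) and k2 = bmodD(2)[OF T[OF g']] bmodD(1)[OF bOT] and k3 = bmodD(2)[OF T[OF g']] bmodD(1)[OF bPT]
  and k4 = bmodD(2)[OF T[OF g']] D(1) and k5 = bmodD(2)[OF uu] D(1) and k6 = bmodD(2)[OF T[OF g']] bmodD(1)[OF uu]
 note cl = rp_closed[OF k1, simplified] rp_closed[OF k2, simplified] rp_closed[OF k3, simplified] rp_closed[OF k4, simplified] rp_closed[OF k5, simplified] rp_closed[OF k6, simplified]
  rp_Theta(1)[OF g]
 note mks = rbox_mackey[OF k1] rbox_mackey[OF k2] rbox_mackey[OF k3] rbox_mackey[OF k4] rbox_mackey[OF k5] rbox_mackey[OF k6]
 have gen: "mgen ?RR (%X t. EX Y Z l m. Y : CS & Z : CS & l : ob R Y & m : ob R Z & X = Y ** Z & t = rp R (Theta n R g') ?u Y Z l m)"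
  using mgen_rbox[OF bmodD(2)[OF T[OF g']] bmodD(1)[OF T[OF g]] mgen_all mgen_all] by simp
 have lin: "Theta_comp n R g' (X ** C) (rm ?RR R X C c s) = rm ?u R X C (Theta_comp n R g' X c) s"
  if a: "X : CS" "C : CS" "s : ob R C" and c: "EX Y Z l m. Y : CS & Z : CS & l : ob R Y & m : ob R Z & X = Y ** Z & c = rp R (Theta n R g') ?u Y Z l m" for X C c s
 proof -
  obtain Y Z l m where v: "Y : CS" "Z : CS" "l : ob R Y" "m : ob R Z" "X = Y ** Z" "c = rp R (Theta n R g') ?u Y Z l m"
   using c by (elim exE conjE)
  have "galpha n R g' C (galpha n R g C s) = s"
   using galpha_add[OF gR(1) g' g a(2,3)] gR(1) a G_inv(2)[OF g] by (simp add: g'_def)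
  then show ?thesis using a(2,3) v(1-4) R g g' gR(1) unfolding v(5,6)
   by (simp add: fRR(4) rm_Theta mh_tr[OF tc(1)] tc(2) cl gR(5) bilin_galpha[OF gR(3) g', symmetric])
 qed
 have tch: "Theta_comp n R g' : mhm ?RR ?u" using tc(1) by simp
 define F where "F = odot_map n R ?u P (Theta_comp n R g') mid"
 note m1 = odot_map_left[OF bmodD(2)[OF bRR] D(1) bmodD(2)[OF uu] tch gen lin, simplified, folded F_def]
 have th: "ta g : mhm ?OT ?PT" using tau_hom'(1) g by simp
 have lt: "ta g (C ** Z) (lm R ?OT C Z s b) = lm R ?PT C Z s (ta g Z b)"
  if "C : CS" "Z : CS" "s : ob R C" "b : ob ?OT Z" for C Z s b
  using tau_hom'(2)[OF g] that by simp
 note m2 = odot_map_right[OF k2 bmodD(1)[OF bPT] th mgen_all lt, simplified]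
 have rh: "rtw_iso P : mhm ?PT (rtw n S g P)" using Pk(1) by (simp add: rtw_iso_def orunit_def)
 have lr: "rtw_iso P (C ** Z) (lm R ?PT C Z s b) = lm R (rtw n S g P) C Z s (rtw_iso P Z b)"
  if v: "C : CS" "Z : CS" "s : ob R C" "b : ob ?PT Z" for C Z s b
 proof -
  have b: "b : ob (rbx S P (ubimod S)) Z" using v(4) by simp
  have o: "orunit P Z b : ob P Z" by (rule mhD(1)[OF Pk(1) v(2) b])
  show ?thesis using kap_lm[OF R S tw g v(1-3) o] v(1-3) D o
   by (simp add: rtw_iso_def orunit_def[symmetric] Pk(5)[OF v(2) b] Pk(4))
 qed
 note m3 = odot_map_right[OF k3 lactor_rtw[OF D(1)] rh mgen_all lr, simplified]
 have lmr: "lmodule R (rtw n S g P)" using Pm(1) by (simp add: lmodule_def lactor_rtw)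
 note l = ltw_iso_facts[OF R lmr g, folded g'_def, simplified]
 note o1 = oassoc_facts[OF T[OF g'] T[OF g] Pb, simplified]
 note ol = olunit_facts[OF R Pm(1)]
 define K where "K = ltw_iso n R g (rtw n S g P) oM odot_map n R (Theta n R g') (rtw n S g P) mid (rtw_iso P) oM
  odot_map n R (Theta n R g') ?PT mid (ta g) oM oassoc n R R S (Theta n R g') (Theta n R g) P"
 have Kh: "K : mhm (rbx R ?RR P) P"
  unfolding K_def by (rule mh_comp[OF mh_comp[OF mh_comp[OF o1(1) m2(1)] m3(1)] l(1)])
 have eq: "K Y y = tmap R P ta g Y (olunit P Y (F Y y))" if Y: "Y : CS" "y : ob (rbx R ?RR P) Y" for Y y
  using mack_hom_eqI[OF mgen_rbox[OF k1 gen mgen_all] Kh mh_comp[OF mh_comp[OF m1(1) ol(1)] t_hom[OF g]] mks(1) D(5) _ Y]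
  unfolding mcomp_def
 proof this
  fix X x assume "EX Y Z m k. Y : CS & Z : CS & (EX Ya Z l ma. Ya : CS & Z : CS & l : ob R Ya & ma : ob R Z & Y = Ya ** Z & m = rp R (Theta n R g') ?u Ya Z l ma) &
   k : ob P Z & X = Y ** Z & x = rp R ?RR P Y Z m k"
  then obtain A B Z r s k where v: "A : CS" "B : CS" "Z : CS" "r : ob R A" "s : ob R B" "k : ob P Z"
   "X = (A ** B) ** Z" "x = rp R ?RR P (A ** B) Z (rp R (Theta n R g') ?u A B r s) k"
   by (elim exE conjE) simp
  have "rtw_iso P W (kap S P W w) = w" if "W : CS" "w : ob P W" for W w
   using Pk(4)[OF that] by (simp add: rtw_iso_def orunit_def)
  then show "K X x = tmap R P ta g X (olunit P X (F X x))"
   unfolding v(7,8) using v(1-6) g g' gR(1) R D(1-5) mks mhD(1)[OF Pk(2)]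
   by (simp add: K_def mcomp_def o1(2) mh_tr[OF m2(1)] m2(2) mh_tr[OF m3(1)] m3(2) mh_tr[OF l(1)] l(2) cl tau_rp'
    m1(2) tc(2) ol(3) t_lm bilin_galpha[OF gR(3) g, symmetric]) (simp add: g'_def D(6))
 qed
 define z where "z = tr (rbx R ?RR P) ((pt ** pt) ** X) X flu
  (rp R ?RR P (pt ** pt) X (rp R (Theta n R g') ?u pt pt (gone n R) (gone n R)) p)"
 have z: "z : ob (rbx R ?RR P) X" using X p mks by (simp add: z_def cl)
 have Fz: "F X z = iota R ?u P X p"
  using X p mks gR(1) R k5
  by (simp add: z_def mh_tr[OF m1(1)] m1(2) cl tc(2) gR(6) rp_tr(1)[OF k5, simplified] iota_def) (rule tr_eqI_ball, simp)
 define w where "w = minv (odo R R S ?RR P) F X (iota R ?u P X p)"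
 have "iota R ?u P X p : F X ` ob (rbx R ?RR P) X" using z Fz[symmetric] by (rule rev_image_eqI)
 then have w: "w : ob (rbx R ?RR P) X" "F X w = iota R ?u P X p"
  by (simp_all add: w_def minv_def inv_into_into f_inv_into_f)
 have "gamma n R S P ta g X p = K X w"
  using ol(6)[OF X p, of S] by (simp add: gamma_def Let_def gi K_def mcomp_def w_def F_def)
 then show ?thesis using eq[OF X w(1)] X p by (simp add: w(2) ol(4))
qed

end

section \<open>The twisted trace on generators\<close>

context
 fixes R :: "('r, 'u) green_scheme" and S :: "('s, 'v) green_scheme" and P :: "('r, 'p, 's, 'z) bimod_scheme" and ta
  and D :: "('s, 'd, 'r, 'w) bimod_scheme" and si et ep and f :: "cset => 'p => 'p"
 assumes R: "green_functor n R" and S: "green_functor n S" and tw: "twist_cell n R S P ta"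
  and du: "left_dual n R S P ta D si et ep" and f: "twist_2cell n R S P ta P ta f"
begin

lemmas pb = P_bmod[OF R S tw]

lemma db: "bmod S R D"
 using du bimodule_facts(1)[OF _ S R, of D] unfolding left_dual_def twist_cell_def by blast

lemma eta_facts:
 shows "et : mhm S (rbx R D P)"
  "Y : CS ==> Z : CS ==> s : ob S Y ==> s' : ob S Z ==> et (Y ** Z) (gm S Y Z s s') = lm S (odo S R S D P) Y Z s (et Z s')"
  "Y : CS ==> Z : CS ==> s : ob S Y ==> s' : ob S Z ==> et (Y ** Z) (gm S Y Z s s') = rm (odo S R S D P) S Y Z (et Y s) s'"
proof -
 have h: "et : bimod_hom n S S (ubimod S) (odo S R S D P)" using du unfolding left_dual_def twist_2cell_def by blast
 note d = bimod_homD[OF h bmodD(1,2)[OF bmod_ubimod[OF S]] odot_facts(1,2)[OF db pb], simplified]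
 show "et : mhm S (rbx R D P)" by (rule d(1))
 show "Y : CS ==> Z : CS ==> s : ob S Y ==> s' : ob S Z ==> et (Y ** Z) (gm S Y Z s s') = lm S (odo S R S D P) Y Z s (et Z s')"
  by (rule d(2))
 show "Y : CS ==> Z : CS ==> s : ob S Y ==> s' : ob S Z ==> et (Y ** Z) (gm S Y Z s s') = rm (odo S R S D P) S Y Z (et Y s) s'"
  by (rule d(3))
qed

lemma eps_facts:
 shows "ep : mhm (rbx S P D) R"
  "Y : CS ==> Z : CS ==> r : ob R Y ==> x : ob (rbx S P D) Z ==> ep (Y ** Z) (lm R (odo R S R P D) Y Z r x) = gm R Y Z r (ep Z x)"
  "Y : CS ==> Z : CS ==> x : ob (rbx S P D) Y ==> r : ob R Z ==> ep (Y ** Z) (rm (odo R S R P D) R Y Z x r) = gm R Y Z (ep Y x) r"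
proof -
 have h: "ep : bimod_hom n R R (odo R S R P D) (ubimod R)" using du unfolding left_dual_def twist_2cell_def by blast
 note d = bimod_homD[OF h odot_facts(1,2)[OF pb db] bmodD(1,2)[OF bmod_ubimod[OF R]], simplified]
 show "ep : mhm (rbx S P D) R" by (rule d(1))
 show "Y : CS ==> Z : CS ==> r : ob R Y ==> x : ob (rbx S P D) Z ==> ep (Y ** Z) (lm R (odo R S R P D) Y Z r x) = gm R Y Z r (ep Z x)"
  by (rule d(2))
 show "Y : CS ==> Z : CS ==> x : ob (rbx S P D) Y ==> r : ob R Z ==> ep (Y ** Z) (rm (odo R S R P D) R Y Z x r) = gm R Y Z (ep Y x) r"
  by (rule d(3))
qed

lemma f_facts:
 shows "f : mhm P P"
  "Y : CS ==> Z : CS ==> r : ob R Y ==> m : ob P Z ==> f (Y ** Z) (lm R P Y Z r m) = lm R P Y Z r (f Z m)"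
  "Y : CS ==> Z : CS ==> m : ob P Y ==> s : ob S Z ==> f (Y ** Z) (rm P S Y Z m s) = rm P S Y Z (f Y m) s"
 using bimod_homD[OF _ bmodD(1,2)[OF pb] bmodD(1,2)[OF pb], of f] f unfolding twist_2cell_def by blast+

lemma rp_eps_closed: "Y : CS ==> Z : CS ==> p : ob P Y ==> d : ob D Z ==> rp S P D Y Z p d : ob (rbx S P D) (Y ** Z)"
 and rp_eta_closed: "Y : CS ==> Z : CS ==> d : ob D Y ==> p : ob P Z ==> rp R D P Y Z d p : ob (rbx R D P) (Y ** Z)"
 using rp_closed[OF bmodD(2)[OF pb] bmodD(1)[OF db]] rp_closed[OF bmodD(2)[OF db] bmodD(1)[OF pb]] by blast+

text \<open>All five maps in the definition of the trace are induced by maps of bimodules or by cyclicity, so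
they can be followed on classes d \<otimes> p: the twist passes from d to p, where the transport map turns
it into t.\<close>

lemma twisted_trace_value:
 assumes g: "g : CG"
 obtains La where "La : mhm (rbx R D P) (tHH0 n R g (ubimod R))"
  "!!A B d p. A : CS ==> B : CS ==> d : ob D A ==> p : ob P B ==> La (A ** B) (rp R D P A B d p) =
   tr (tHH0 n R g (ubimod R)) (B ** A) (A ** B) fsw (tHH0_proj n R g (ubimod R) (B ** A) (ep (B ** A) (rp S P D B A (tmap R P ta g B (f B p)) d)))"
  "!!X s. X : CS ==> s : ob S X ==> twisted_trace n R S P ta D et ep g f X (tHH0_proj n S g (ubimod S) X s) = La X (et X s)"
proof -
 define g' where "g' = (- g) mod int n"
 have g': "g' : CG" and gi: "inv\<^bsub>G\<^esub> g = g'" using g by (simp_all add: g'_def)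
 note PD = bmodD[OF pb] and DD = bmodD[OF db] and gR = green_facts[OF R] and gS = green_facts[OF S]
 note uR = bmod_ubimod[OF R] and uS = bmod_ubimod[OF S]
 let ?DP = "odo S R S D P" and ?PD = "odo R S R P D" and ?lD = "ltw n S g D" and ?lP = "ltw n R g P" and ?rP = "rtw n S g' P"
 let ?PDl = "odo R S R P ?lD" and ?PrD = "odo R S R ?rP D" and ?PlD = "odo R S R ?lP D"
 let ?t = "tmap R P ta g" and ?H = "tHH0 n R g (ubimod R)" and ?lR = "ltw n R g (ubimod R)"
 note lD = bmod_ltw[OF db g] and lP = bmod_ltw[OF pb g] and rP = bmod_rtw[OF pb g'] and lR = bmod_ltw[OF uR g] and lS = bmod_ltw[OF uS g]
 note bDP = odot_bmod[OF db pb] and bPD = odot_bmod[OF pb db] and bPDl = odot_bmod[OF pb lD] and bPrD = odot_bmod[OF rP db] and bPlD = odot_bmod[OF lP db]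
 note lDP = bmod_ltw[OF bDP g]
 note oDP = odot_facts(3,4)[OF db pb] and oPD = odot_facts(3,4)[OF pb db] and oPDl = odot_facts(3,4)[OF pb lD]
  and oPrD = odot_facts(3,4)[OF rP db] and oPlD = odot_facts(3,4)[OF lP db, simplified]
 note cDP = rp_closed[OF DD(2) PD(1)] and cPD = rp_closed[OF PD(2) DD(1)] and cPDl = rp_closed[OF PD(2) bmodD(1)[OF lD]] and cPrD = rp_closed[OF bmodD(2)[OF rP] DD(1)]
 note mks = rbox_mackey[OF DD(2) PD(1)] rbox_mackey[OF PD(2) DD(1)] rbox_mackey[OF PD(2) bmodD(1)[OF lD]] rbox_mackey[OF bmodD(2)[OF rP] DD(1)]
 note HPDl = HH0_mackey[OF bmodD(1,2)[OF bPDl]] HH0_proj_hom[OF bmodD(1,2)[OF bPDl]] HH0_cyclic[OF bmodD(1,2)[OF bPDl]]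
  and HPrD = HH0_mackey[OF bmodD(1,2)[OF bPrD]] HH0_proj_hom[OF bmodD(1,2)[OF bPrD]] HH0_cyclic[OF bmodD(1,2)[OF bPrD]]
  and HPlD = HH0_mackey[OF bmodD(1,2)[OF bPlD]] HH0_proj_hom[OF bmodD(1,2)[OF bPlD]] HH0_cyclic[OF bmodD(1,2)[OF bPlD]]
 note E = eta_facts and Ep = eps_facts and F = f_facts and th = tmap_hom[OF R S tw g]
 have genDP: "mgen (ltw n S g ?DP) (%X x. EX A B d p. A : CS & B : CS & d : ob D A & p : ob P B & X = A ** B & x = rp R D P A B d p)"
  using mgen_rbox[OF DD(2) PD(1) mgen_all mgen_all] by simp
 have genPD: "mgen ?PlD (%X x. EX A B p d. A : CS & B : CS & p : ob P A & d : ob D B & X = A ** B & x = rp S P D A B p d)"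
  using mgen_rbox[OF PD(2) DD(1) mgen_all mgen_all] by simp
 have genPDl: "mgen ?PDl (%X x. EX A B p d. A : CS & B : CS & p : ob P A & d : ob D B & X = A ** B & x = rp S P ?lD A B p d)"
  using mgen_rbox[OF PD(2) bmodD(1)[OF lD] mgen_all mgen_all] by simp
 have genPrD: "mgen ?PrD (%X x. EX A B p d. A : CS & B : CS & p : ob P A & d : ob D B & X = A ** B & x = rp S ?rP D A B p d)"
  using mgen_rbox[OF bmodD(2)[OF rP] DD(1) mgen_all mgen_all] by simp
 have c1: "HH0_map n S (ltw n S g ?DP) et X (HH0_proj n S (ltw n S g (ubimod S)) X s) = HH0_proj n S (ltw n S g ?DP) X (et X s)"
  if "X : CS" "s : ob S X" for X s
 proof (rule HH0_map_facts(2)[OF bmodD(1,2)[OF lS] bmodD(1,2)[OF lDP] _ mgen_all])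
  show "et : mhm (ltw n S g (ubimod S)) (ltw n S g ?DP)" using E(1) by simp
  fix Y Z r m assume v: "Y : CS" "Z : CS" "r : ob S Y" "m : ob (ltw n S g (ubimod S)) Z"
  show "et (Y ** Z) (lm S (ltw n S g (ubimod S)) Y Z r m) = lm S (ltw n S g ?DP) Y Z r (et Z m)"
   using v g gS(1) mhD(1)[OF E(1)] by (simp add: lm_ltw[OF bmodD(1)[OF uS]] lm_ltw[OF bmodD(1)[OF bDP]] E(2))
  show "et (Z ** Y) (rm (ltw n S g (ubimod S)) S Z Y m r) = rm (ltw n S g ?DP) S Z Y (et Z m) r"
   using v by (simp add: E(3))
 qed (use that in simp_all)
 define fm where "fm = odot_map n R D P mid f"
 note fm = odot_map_right[OF DD(2) PD(1) PD(1) F(1) mgen_all, folded fm_def, OF F(2), simplified]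
 have c2: "HH0_map n S (ltw n S g ?DP) fm X (HH0_proj n S (ltw n S g ?DP) X x) = HH0_proj n S (ltw n S g ?DP) X (fm X x)"
  if X: "X : CS" "x : ob (rbx R D P) X" for X x
 proof (rule HH0_map_facts(2)[OF bmodD(1,2)[OF lDP] bmodD(1,2)[OF lDP] _ genDP])
  show "fm : mhm (ltw n S g ?DP) (ltw n S g ?DP)" using fm(1) by simp
  fix Y Z r m assume v: "Y : CS" "Z : CS" "r : ob S Y"
   "EX A B d p. A : CS & B : CS & d : ob D A & p : ob P B & Z = A ** B & m = rp R D P A B d p"
  then obtain A B d p where w: "A : CS" "B : CS" "d : ob D A" "p : ob P B" "Z = A ** B" "m = rp R D P A B d p" by (elim exE conjE)
  show "fm (Y ** Z) (lm S (ltw n S g ?DP) Y Z r m) = lm S (ltw n S g ?DP) Y Z r (fm Z m)"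
   "fm (Z ** Y) (rm (ltw n S g ?DP) S Z Y m r) = rm (ltw n S g ?DP) S Z Y (fm Z m) r"
   unfolding w(5,6) using v(1,3) w(1-4) g gS(1) DD PD mks mhD(1)[OF F(1)]
   by (simp_all add: lm_ltw[OF bmodD(1)[OF bDP]] oDP fm(2) mh_tr[OF fm(1)] F(3) cDP)
 qed (use that in simp_all)
 define k0 where "k0 = HH0_proj n R ?PDl oM rproj n S P ?lD oM box_sym n ?lD P"
 have pPDl: "HH0_proj n R ?PDl : mhm (rbx S P ?lD) (HH0 n R ?PDl)" using HPDl(2) by simp
 have rpl: "rproj n S P ?lD : mhm (bx P D) (rbx S P ?lD)" using rproj_hom[OF PD(2) bmodD(1)[OF lD]] by simp
 note sy = box_sym_facts[OF DD(5) PD(5)]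
 have k0h: "k0 : mhm (bx D P) (HH0 n R ?PDl)"
  unfolding k0_def using mh_comp[OF mh_comp[OF sy(1) rpl] pPDl] by simp
 have k0v: "k0 (A ** B) (bp D P A B d p) = tr (HH0 n R ?PDl) (B ** A) (A ** B) fsw (HH0_proj n R ?PDl (B ** A) (rp S P ?lD B A p d))"
  if v: "A : CS" "B : CS" "d : ob D A" "p : ob P B" for A B d p
  using v DD PD cPDl[of B A p d] by (simp add: k0_def mcomp_def sy(2) mh_tr[OF rpl] mh_tr[OF pPDl] rp_def mhD(1)[OF rpl])
 have pc: "HH0_proj n R ?PDl (B ** A) (rp S P ?lD B A p d) : ob (HH0 n R ?PDl) (B ** A)" if "A : CS" "B : CS" "d : ob D A" "p : ob P B" for A B d p
  using mhD(1)[OF pPDl] cPDl[of B A p d] that by simp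
 have b0: "k0 ((Y ** A) ** Z) (bp D P (Y ** A) Z (rm D R Y A m s) k) =
   tr (HH0 n R ?PDl) (Y ** A ** Z) ((Y ** A) ** Z) fas' (k0 (Y ** A ** Z) (bp D P Y (A ** Z) m (lm R P A Z s k)))"
  if v: "Y : CS" "A : CS" "Z : CS" "m : ob D Y" "s : ob R A" "k : ob P Z" for Y A Z m s k
 proof -
  have kc: "rp S P ?lD Z Y k m : ob ?PDl (Z ** Y)" using cPDl[of Z Y k m] v by simp
  have "HH0_proj n R ?PDl (A ** Z ** Y) (lm R ?PDl A (Z ** Y) s (rp S P ?lD Z Y k m)) =
   tr (HH0 n R ?PDl) ((Z ** Y) ** A) (A ** Z ** Y) fsw (HH0_proj n R ?PDl ((Z ** Y) ** A) (rm ?PDl R (Z ** Y) A (rp S P ?lD Z Y k m) s))"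
   by (rule HPDl(3)[OF v(2) _ v(5) kc]) (use v in simp)
  then have e: "tr (HH0 n R ?PDl) ((A ** Z) ** Y) (A ** Z ** Y) fas (HH0_proj n R ?PDl ((A ** Z) ** Y) (rp S P ?lD (A ** Z) Y (lm R P A Z s k) m)) =
   tr (HH0 n R ?PDl) (Z ** Y ** A) (A ** Z ** Y) (%x. fsw (fas' x)) (HH0_proj n R ?PDl (Z ** Y ** A) (rp S P ?lD Z (Y ** A) k (rm D R Y A m s)))"
   using v DD PD HPDl(1) cPDl pc by (simp add: oPDl mh_tr[OF pPDl])
  let ?T = "tr (HH0 n R ?PDl) (A ** Z ** Y) ((Y ** A) ** Z) (%w. fas' (fsw (fas' w)))"
  note c = pc[of "Y ** A" Z "rm D R Y A m s" k] pc[of Y "A ** Z" m "lm R P A Z s k"]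
  have "tr (HH0 n R ?PDl) ((A ** Z) ** Y) ((Y ** A) ** Z) (%x. fas' (fsw x)) (HH0_proj n R ?PDl ((A ** Z) ** Y) (rp S P ?lD (A ** Z) Y (lm R P A Z s k) m)) =
   ?T (tr (HH0 n R ?PDl) ((A ** Z) ** Y) (A ** Z ** Y) fas (HH0_proj n R ?PDl ((A ** Z) ** Y) (rp S P ?lD (A ** Z) Y (lm R P A Z s k) m)))"
   using v DD PD HPDl(1) c by simp (rule tr_eqI_ball, simp)
  also have "... = ?T (tr (HH0 n R ?PDl) (Z ** Y ** A) (A ** Z ** Y) (%x. fsw (fas' x)) (HH0_proj n R ?PDl (Z ** Y ** A) (rp S P ?lD Z (Y ** A) k (rm D R Y A m s))))"
   unfolding e ..
  also have "... = tr (HH0 n R ?PDl) (Z ** Y ** A) ((Y ** A) ** Z) fsw (HH0_proj n R ?PDl (Z ** Y ** A) (rp S P ?lD Z (Y ** A) k (rm D R Y A m s)))"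
   using v DD PD HPDl(1) c by simp (rule tr_eqI_ball, simp)
  finally show ?thesis
   using v DD PD HPDl(1) c by (simp add: k0v)
 qed
 define K where "K = desc k0"
 note K = rbox_desc[OF DD(2) PD(1) HPDl(1) k0h mgen_all mgen_all mgen_all b0, folded K_def]
 have Kv: "K (A ** B) (rp R D P A B d p) = tr (HH0 n R ?PDl) (B ** A) (A ** B) fsw (HH0_proj n R ?PDl (B ** A) (rp S P ?lD B A p d))"
  if "A : CS" "B : CS" "d : ob D A" "p : ob P B" for A B d p
  using K(3)[of A B d p] that k0v[OF that] by simp
 have Kh: "K : mhm (rbx R D P) (HH0 n R ?PDl)" by (rule K(1))
 have c3: "cyclicity n S R ?lD P X (HH0_proj n S (ltw n S g ?DP) X x) = K X x" if X: "X : CS" "x : ob (rbx R D P) X" for X x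
  unfolding cyclicity_def k0_def[symmetric] K_def[symmetric]
 proof (rule HH0_desc(2)[OF bmodD(1,2)[OF lDP] HPDl(1) _ genDP])
  show "K : mhm (ltw n S g ?DP) (HH0 n R ?PDl)" using Kh by simp
  fix Y Z s m assume v: "Y : CS" "Z : CS" "s : ob S Y"
   "EX A B d p. A : CS & B : CS & d : ob D A & p : ob P B & Z = A ** B & m = rp R D P A B d p"
  then obtain A B d p where w: "A : CS" "B : CS" "d : ob D A" "p : ob P B" "Z = A ** B" "m = rp R D P A B d p" by (elim exE conjE)
  have "rp S P ?lD (B ** Y) A (rm P S B Y p s) d = tr (rbx S P ?lD) (B ** Y ** A) ((B ** Y) ** A) fas' (rp S P ?lD B (Y ** A) p (lm S D Y A (galpha n S g Y s) d))"
   using rp_balanced[OF PD(2) bmodD(1)[OF lD] w(2) v(1) w(1) w(4) v(3)] w DD v g by (simp add: lm_ltw)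
  then show "K (Y ** Z) (lm S (ltw n S g ?DP) Y Z s m) = tr (HH0 n R ?PDl) (Z ** Y) (Y ** Z) fsw (K (Z ** Y) (rm (ltw n S g ?DP) S Z Y m s))"
   unfolding w(5,6) using v(1,3) w(1-4) g gS(1) DD PD mks HPDl(1) cPDl pc[of "Y ** A" B "lm S D Y A (galpha n S g Y s) d" p]
   by (simp add: lm_ltw[OF bmodD(1)[OF bDP]] oDP mh_tr[OF Kh] Kv cDP mh_tr[OF pPDl]) (rule tr_eqI_ball, simp)
 qed (use that in simp_all)
 define k1 where "k1 = HH0_proj n R ?PrD oM rproj n S ?rP D"
 have pPrD: "HH0_proj n R ?PrD : mhm (rbx S ?rP D) (HH0 n R ?PrD)" using HPrD(2) by simp
 have k1h: "k1 : mhm (bx P D) (HH0 n R ?PrD)"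
  unfolding k1_def using mh_comp[OF rproj_hom[OF bmodD(2)[OF rP] DD(1)] pPrD] by simp
 have k1v: "k1 (A ** B) (bp P D A B p d) = HH0_proj n R ?PrD (A ** B) (rp S ?rP D A B p d)" for A B p d
  by (simp add: k1_def mcomp_def rp_def)
 have b1: "k1 ((Y ** A) ** Z) (bp P ?lD (Y ** A) Z (rm P S Y A m s) k) =
   tr (HH0 n R ?PrD) (Y ** A ** Z) ((Y ** A) ** Z) fas' (k1 (Y ** A ** Z) (bp P ?lD Y (A ** Z) m (lm S ?lD A Z s k)))"
  if v: "Y : CS" "A : CS" "Z : CS" "m : ob P Y" "s : ob S A" "k : ob ?lD Z" for Y A Z m s k
 proof -
  have "galpha n S g' A (galpha n S g A s) = s"
   using galpha_add[OF gS(1) g' g v(2,5)] gS(1) v(2,5) G_inv(2)[OF g] by (simp add: g'_def)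
  then have "rp S ?rP D (Y ** A) Z (rm P S Y A m s) k = tr (rbx S ?rP D) (Y ** A ** Z) ((Y ** A) ** Z) fas' (rp S ?rP D Y (A ** Z) m (lm S D A Z (galpha n S g A s) k))"
   using rp_balanced[OF bmodD(2)[OF rP] DD(1) v(1-3), of m "galpha n S g A s" k] v g g' gS(1) PD by (simp add: rm_rtw)
  then show ?thesis using v DD g gS(1) cPrD by (simp add: k1v lm_ltw mh_tr[OF pPrD])
 qed
 have k1h': "k1 : mhm (bx P ?lD) (HH0 n R ?PrD)" using k1h by simp
 define K1 where "K1 = desc k1"
 note K1 = rbox_desc[OF PD(2) bmodD(1)[OF lD] HPrD(1) k1h' mgen_all mgen_all mgen_all b1, folded K1_def]
 have K1v: "K1 (A ** B) (rp S P ?lD A B p d) = HH0_proj n R ?PrD (A ** B) (rp S ?rP D A B p d)"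
  if "A : CS" "B : CS" "p : ob P A" "d : ob D B" for A B p d
  using K1(3)[of A B p d] that k1v by simp
 have K1h: "K1 : mhm (rbx S P ?lD) (HH0 n R ?PrD)" by (rule K1(1))
 have c4: "desc K1 : mhm (HH0 n R ?PDl) (HH0 n R ?PrD)"
  "X : CS ==> x : ob (rbx S P ?lD) X ==> desc K1 X (HH0_proj n R ?PDl X x) = K1 X x" for X x
 proof -
  have h: "K1 : mhm ?PDl (HH0 n R ?PrD)" using K1h by simp
  have cyc: "K1 (Y ** Z) (lm R ?PDl Y Z r m) = tr (HH0 n R ?PrD) (Z ** Y) (Y ** Z) fsw (K1 (Z ** Y) (rm ?PDl R Z Y m r))"
   if v: "Y : CS" "Z : CS" "r : ob R Y" "EX A B p d. A : CS & B : CS & p : ob P A & d : ob D B & Z = A ** B & m = rp S P ?lD A B p d" for Y Z r m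
  proof -
   obtain A B p d where w: "A : CS" "B : CS" "p : ob P A" "d : ob D B" "Z = A ** B" "m = rp S P ?lD A B p d" using v(4) by (elim exE conjE)
   have kc: "rp S ?rP D A B p d : ob ?PrD (A ** B)" using cPrD[of A B p d] w by simp
   show ?thesis unfolding w(5,6) using HPrD(3)[OF v(1) _ v(3) kc] v(1,3) w(1-4) DD PD mks cPDl cPrD
    by (simp add: oPDl oPrD mh_tr[OF K1h] K1v mh_tr[OF pPrD])
  qed
  note d = HH0_desc[OF bmodD(1,2)[OF bPDl] HPrD(1) h genPDl cyc]
  show "desc K1 : mhm (HH0 n R ?PDl) (HH0 n R ?PrD)" by (rule d(1))
  show "X : CS ==> x : ob (rbx S P ?lD) X ==> desc K1 X (HH0_proj n R ?PDl X x) = K1 X x" using d(2)[of X x] by simp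
 qed
 define T where "T = transport n R S P ta g"
 have Tv: "T X p = ?t X p" if "X : CS" "p : ob P X" for X p
  unfolding T_def by (rule transport_eq[OF R S tw g that])
 have Th: "T : mhm ?rP ?lP"
  using mack_hom_cong[OF th PD(5), of T] Tv by simp
 have Tl: "T (Y ** C) (rm ?rP S Y C a s) = rm ?lP S Y C (T Y a) s" if v: "Y : CS" "C : CS" "a : ob ?rP Y" "s : ob S C" for Y C a s
  using v PD g g' gS(1) tmap_rm[OF R S tw g] by (simp add: rm_rtw Tv) (simp add: g'_def)
 define tm where "tm = odot_map n S ?lP D T mid"
 note tm = odot_map_left[OF bmodD(2)[OF rP] DD(1) bmodD(2)[OF lP] Th mgen_all Tl, folded tm_def, simplified]
 have c5: "HH0_map n R ?PlD tm : mhm (HH0 n R ?PrD) (HH0 n R ?PlD)"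
  "X : CS ==> x : ob (rbx S ?rP D) X ==> HH0_map n R ?PlD tm X (HH0_proj n R ?PrD X x) = HH0_proj n R ?PlD X (tm X x)" for X x
 proof -
  have h: "tm : mhm ?PrD ?PlD" using tm(1) by simp
  have lin: "tm (Y ** Z) (lm R ?PrD Y Z r m) = lm R ?PlD Y Z r (tm Z m)" "tm (Z ** Y) (rm ?PrD R Z Y m r) = rm ?PlD R Z Y (tm Z m) r"
   if v: "Y : CS" "Z : CS" "r : ob R Y" "EX A B p d. A : CS & B : CS & p : ob P A & d : ob D B & Z = A ** B & m = rp S ?rP D A B p d" for Y Z r m
  proof -
   obtain A B p d where w: "A : CS" "B : CS" "p : ob P A" "d : ob D B" "Z = A ** B" "m = rp S ?rP D A B p d" using v(4) by (elim exE conjE)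
   show "tm (Y ** Z) (lm R ?PrD Y Z r m) = lm R ?PlD Y Z r (tm Z m)" "tm (Z ** Y) (rm ?PrD R Z Y m r) = rm ?PlD R Z Y (tm Z m) r"
    unfolding w(5,6) using v(1,3) w(1-4) DD PD mks cPrD g gR(1) tmap_lm[OF R S tw g] tmap_closed[OF R S tw g]
    by (simp_all add: oPrD oPlD mh_tr[OF tm(1)] tm(2) Tv lm_ltw)
  qed
  note d = HH0_map_facts[OF bmodD(1,2)[OF bPrD] bmodD(1,2)[OF bPlD] h genPrD lin]
  show "HH0_map n R ?PlD tm : mhm (HH0 n R ?PrD) (HH0 n R ?PlD)" by (rule d(1))
  show "X : CS ==> x : ob (rbx S ?rP D) X ==> HH0_map n R ?PlD tm X (HH0_proj n R ?PrD X x) = HH0_proj n R ?PlD X (tm X x)" using d(2)[of X x] by simp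
 qed
 have c6: "HH0_map n R ?lR ep : mhm (HH0 n R ?PlD) (HH0 n R ?lR)"
  "X : CS ==> x : ob (rbx S P D) X ==> HH0_map n R ?lR ep X (HH0_proj n R ?PlD X x) = HH0_proj n R ?lR X (ep X x)" for X x
 proof -
  have h: "ep : mhm ?PlD ?lR" using Ep(1) by simp
  have lin: "ep (Y ** Z) (lm R ?PlD Y Z r m) = lm R ?lR Y Z r (ep Z m)" "ep (Z ** Y) (rm ?PlD R Z Y m r) = rm ?lR R Z Y (ep Z m) r"
   if v: "Y : CS" "Z : CS" "r : ob R Y" "EX A B p d. A : CS & B : CS & p : ob P A & d : ob D B & Z = A ** B & m = rp S P D A B p d" for Y Z r m
  proof -
   obtain A B p d where w: "A : CS" "B : CS" "p : ob P A" "d : ob D B" "Z = A ** B" "m = rp S P D A B p d" using v(4) by (elim exE conjE)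
   have 1: "lm R ?PlD Y Z r m = lm R ?PD Y Z (galpha n R g Y r) m" "rm ?PlD R Z Y m r = rm ?PD R Z Y m r"
    unfolding w(5,6) using v(1,3) w(1-4) DD PD g gR(1) by (simp_all add: oPlD oPD lm_ltw)
   have m: "m : ob (rbx S P D) Z" unfolding w(5,6) using cPD w by simp
   show "ep (Y ** Z) (lm R ?PlD Y Z r m) = lm R ?lR Y Z r (ep Z m)" "ep (Z ** Y) (rm ?PlD R Z Y m r) = rm ?lR R Z Y (ep Z m) r"
    unfolding 1 using v(1-3) m g gR(1) mhD(1)[OF Ep(1) v(2) m] by (simp_all add: Ep(2,3) lm_ltw[OF bmodD(1)[OF uR]])
  qed
  note d = HH0_map_facts[OF bmodD(1,2)[OF bPlD] bmodD(1,2)[OF lR] h genPD lin]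
  show "HH0_map n R ?lR ep : mhm (HH0 n R ?PlD) (HH0 n R ?lR)" by (rule d(1))
  show "X : CS ==> x : ob (rbx S P D) X ==> HH0_map n R ?lR ep X (HH0_proj n R ?PlD X x) = HH0_proj n R ?lR X (ep X x)" using d(2)[of X x] by simp
 qed
 define L where "L = HH0_map n R ?lR ep oM HH0_map n R ?PlD tm oM desc K1 oM K oM fm"
 have Lh: "L : mhm (rbx R D P) ?H"
  using mh_comp[OF mh_comp[OF mh_comp[OF mh_comp[OF fm(1) Kh] c4(1)] c5(1)] c6(1)] by (simp add: L_def tHH0_def)
 have Lv: "L (A ** B) (rp R D P A B d p) =
   tr ?H (B ** A) (A ** B) fsw (tHH0_proj n R g (ubimod R) (B ** A) (ep (B ** A) (rp S P D B A (?t B (f B p)) d)))"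
  if v: "A : CS" "B : CS" "d : ob D A" "p : ob P B" for A B d p
 proof -
  have fp: "f B p : ob P B" by (rule mhD(1)[OF F(1) v(2,4)])
  have tf: "?t B (f B p) : ob P B" by (rule tmap_closed[OF R S tw g v(2) fp])
  have x1: "HH0_proj n R ?PDl (B ** A) (rp S P ?lD B A (f B p) d) : ob (HH0 n R ?PDl) (B ** A)" by (rule pc[OF v(1-3) fp])
  have x2: "HH0_proj n R ?PrD (B ** A) (rp S ?rP D B A (f B p) d) : ob (HH0 n R ?PrD) (B ** A)"
   using mhD(1)[OF pPrD] cPrD[of B A "f B p" d] v fp by simp
  have x3: "HH0_proj n R ?PlD (B ** A) (rp S P D B A (?t B (f B p)) d) : ob (HH0 n R ?PlD) (B ** A)"
   using mhD(1)[OF HPlD(2)] cPD[of B A "?t B (f B p)" d] v tf by simp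
  show ?thesis using v fp tf x1 x2 x3 cPDl[of B A "f B p" d] cPrD[of B A "f B p" d] cPD[of B A "?t B (f B p)" d]
   by (simp add: L_def mcomp_def fm(2) Kv mh_tr[OF c4(1)] c4(2) K1v mh_tr[OF c5(1)] c5(2) tm(2) Tv mh_tr[OF c6(1)] c6(2) tHH0_def tHH0_proj_def)
 qed
 have "twisted_trace n R S P ta D et ep g f X (tHH0_proj n S g (ubimod S) X s) = L X (et X s)" if X: "X : CS" "s : ob S X" for X s
 proof -
  have e: "et X s : ob (rbx R D P) X" by (rule mhD(1)[OF E(1) X])
  have fe: "fm X (et X s) : ob (rbx R D P) X" by (rule mhD(1)[OF fm(1) X(1) e])
  show ?thesis
   by (simp add: twisted_trace_def tHH0_map_def tHH0_proj_def mcomp_def c1[OF X] fm_def[symmetric] c2[OF X(1) e] twisted_cyclicity_def Let_def gi c3[OF X(1) fe]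
    L_def T_def[symmetric] tm_def[symmetric] K1_def k1_def)
 qed
 with Lh Lv show ?thesis using that by blast
qed

end

section \<open>Internal Hom objects\<close>

lemma mrestrict_apply: "X : CS ==> x : ob M X ==> mrestrict n M ph X x = ph X x"
 by (simp add: mrestrict_def)

lemma mrestrict_cong: assumes "!!X x. X : CS ==> x : ob M X ==> ph X x = ps X x"
 shows "mrestrict n M ph = mrestrict n M ps"
proof
 fix X show "mrestrict n M ph X = mrestrict n M ps X"
  using assms by (cases "X : CS") (simp_all add: mrestrict_def restrict_def fun_eq_iff)
qed

lemma mrestrict_idem: "mrestrict n M (mrestrict n M ph) = mrestrict n M ph"
 by (rule mrestrict_cong) (rule mrestrict_apply)

lemma mrestrict_hom: "ph : mhm M N ==> mackey M ==> mrestrict n M ph : mhm M N"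
 by (rule mack_hom_cong) (simp_all add: mrestrict_apply)

lemma hom_inv_eq: "h : hom A B ==> group A ==> group B ==> x : carrier A ==> h (inv\<^bsub>A\<^esub> x) = inv\<^bsub>B\<^esub> (h x)"
 and hom_one_eq: "h : hom A B ==> group A ==> group B ==> h \<one>\<^bsub>A\<^esub> = \<one>\<^bsub>B\<^esub>"
 using group_hom.hom_inv[of A B h x] group_hom.hom_one[of A B h] by (simp_all add: group_hom_def group_hom_axioms_def)

lemma ob_one [simp]: "mackey M ==> X : CS ==> \<one>\<^bsub>obj M X\<^esub> : ob M X"
 and ob_inv [simp]: "mackey M ==> X : CS ==> x : ob M X ==> inv\<^bsub>obj M X\<^esub> x : ob M X"
 using ob_group[of M X] by (simp_all add: group.is_monoid monoid.one_closed)

lemma mack_hom_one: "mackey L ==> (%X x. \<one>\<^bsub>obj L X\<^esub>) : mhm M L"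
 by (rule mack_homI) (simp_all add: hom_one_eq[OF mackeyD(2)] ob_group monoid.l_one group.is_monoid)

lemma mack_hom_inv: assumes "ph : mhm M L" "mackey L"
 shows "(%X x. inv\<^bsub>obj L X\<^esub> ph X x) : mhm M L"
 by (rule mack_homI) (use assms in \<open>simp_all add: mhD[OF assms(1)] comm_group.inv_mult[OF mackeyD(1)] hom_inv_eq[OF mackeyD(2)] ob_group\<close>)

text \<open>Any element a of the representable functor is the image of the identity under a, so pairs (t, id) generate.\<close>

lemma pair_repr: assumes T: "mackey T" and v: "X : CS" "W : CS" "V : CS" "t : ob T W" "a : bhm X V"
 shows "bp T (rpr X) W V t a = mor (bx T (rpr X)) (W ** X) (W ** V) (bpr W W X V (bd W) a) (bp T (rpr X) W X t (bd X))"
 using bilinD(4)[OF bilin_pair[OF T repr_mackey[OF v(1)]] v(2,1,2,3) bid_closed[OF v(2)] v(5) v(4), of "bd X"] v T by (simp add: mackeyD(3))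

lemma hom_on_repr_eqI:
 assumes T: "mackey T" "mgen T Q" and L: "mackey L" and X: "X : CS"
  and h: "h : mhm (bx T (rpr X)) L" "k : mhm (bx T (rpr X)) L"
  and eq: "!!W t. W : CS ==> Q W t ==> h (W ** X) (bp T (rpr X) W X t (bd X)) = k (W ** X) (bp T (rpr X) W X t (bd X))"
  and Y: "Y : CS" "y : ob (bx T (rpr X)) Y"
 shows "h Y y = k Y y"
proof (rule mack_hom_eqI[OF mgen_box[OF T(1) repr_mackey[OF X] T(2) mgen_all] h box_mackey[OF T(1) repr_mackey[OF X]] L _ Y], goal_cases)
 case (1 Y y)
 then obtain W V t a where v: "W : CS" "V : CS" "Q W t" "a : bhm X V" "Y = W ** V" "y = bp T (rpr X) W V t a"
  by (elim exE conjE) simp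
 have t: "t : ob T W" by (rule mgenD[OF T(2) v(1,3)])
 have p: "bp T (rpr X) W X t (bd X) : ob (bx T (rpr X)) (W ** X)" using T(1) X v t by simp
 show ?case
  unfolding v(5,6) pair_repr[OF T(1) X v(1,2) t v(4)]
  using v X p eq[OF v(1,3)] mhD(3)[OF h(1) _ _ _ p] mhD(3)[OF h(2) _ _ _ p] by simp
qed

context
 fixes M :: "('m, 'y) mackey_scheme" and N :: "('k, 'z) mackey_scheme"
 assumes M: "mackey M" and N: "mackey N"
begin

text \<open>An element of the internal Hom at X is a map out of M boxed with the functor represented by X,
extended by a default value outside the finite sets so that equality is extensional.\<close>

lemma mhom_ob: "h : ob (mhom n M N) X \<longleftrightarrow> h : mhm (bx M (rpr X)) N & mrestrict n (bx M (rpr X)) h = h"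
 by (simp add: mhom_def)

text \<open>By the Yoneda lemma, such a map is determined by its values on pairs (m, id).\<close>

lemma mhom_eqI:
 assumes X: "X : CS" and h: "h : ob (mhom n M N) X" "k : ob (mhom n M N) X"
  and eq: "!!W m. W : CS ==> m : ob M W ==> hev M X h W m = hev M X k W m"
 shows "h = k"
proof -
 have "mrestrict n (bx M (rpr X)) h = mrestrict n (bx M (rpr X)) k"
  by (rule mrestrict_cong, rule hom_on_repr_eqI[OF M mgen_all N X]) (use h eq in \<open>simp_all add: mhom_ob hom_ev_def\<close>)
 then show ?thesis using h by (simp add: mhom_ob)
qed

lemma hom_ev_hom: "X : CS ==> h : ob (mhom n M N) X ==> hev M X h : mhm M (shift n N X)"
 unfolding hom_ev_def[abs_def]
 by (rule bilin_fix_right[OF mack_hom_bilin]) (simp_all add: mhom_ob M)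

lemma bilin_ext: assumes X: "X : CS" and k: "ka : mhm M (shift n N X)"
 shows "bilin M (rpr X) N (%W V m a. mor N (W ** X) (W ** V) (bpr W W X V (bd W) a) (ka W m))"
proof -
 have c: "ka W m : ob N (W ** X)" if "W : CS" "m : ob M W" for W m using mhD(1)[OF k that] by simp
 show ?thesis
 proof (rule bilinI)
  fix W V m m' a assume "W : CS" "V : CS" "m : ob M W" "m' : ob M W" "a : ob (rpr X) V"
  then show "mor N (W ** X) (W ** V) (bpr W W X V (bd W) a) (ka W (m +[M,W] m')) =
   mor N (W ** X) (W ** V) (bpr W W X V (bd W) a) (ka W m) +[N,(W ** V)] mor N (W ** X) (W ** V) (bpr W W X V (bd W) a) (ka W m')"
   using X N c mhD(2)[OF k] by (simp add: mor_mult)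
 next
  fix W V m a a' assume "W : CS" "V : CS" "m : ob M W" "a : ob (rpr X) V" "a' : ob (rpr X) V"
  then show "mor N (W ** X) (W ** V) (bpr W W X V (bd W) (a +[(rpr X),V] a')) (ka W m) =
   mor N (W ** X) (W ** V) (bpr W W X V (bd W) a) (ka W m) +[N,(W ** V)] mor N (W ** X) (W ** V) (bpr W W X V (bd W) a') (ka W m)"
   using X N c by (simp add: bprod_badd_right mackeyD(5))
 next
  fix W V W' V' xi ze m a
  assume v: "W : CS" "V : CS" "W' : CS" "V' : CS" "xi : bhm W W'" "ze : bhm V V'" "m : ob M W" "a : ob (rpr X) V"
  have a: "a : bhm X V" using v by simp
  have za: "bco X V' ze a : bhm X V'" by (rule bcomp_closed[OF a v(6,2)])
  have "mor N (W' ** X) (W' ** V') (bpr W' W' X V' (bd W') (bco X V' ze a)) (ka W' (mor M W W' xi m)) =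
   mor N (W' ** X) (W' ** V') (bpr W' W' X V' (bd W') (bco X V' ze a)) (mor N (W ** X) (W' ** X) (bpr W W' X X xi (bd X)) (ka W m))"
   using mhD(3)[OF k v(1) v(3,5,7)] by simp
  also have "... = mor N (W ** X) (W' ** V') (bco (W ** X) (W' ** V') (bpr W' W' X V' (bd W') (bco X V' ze a)) (bpr W W' X X xi (bd X))) (ka W m)"
   by (rule mackeyD(4)[OF N]) (use v X za c in simp_all)
  also have "bco (W ** X) (W' ** V') (bpr W' W' X V' (bd W') (bco X V' ze a)) (bpr W W' X X xi (bd X)) = bpr W W' X V' xi (bco X V' ze a)"
   using bprod_bcomp[OF v(5) bid_closed[OF v(3)] bid_closed[OF X] za] v X za by simp
  also have "... = bco (W ** X) (W' ** V') (bpr W W' V V' xi ze) (bpr W W X V (bd W) a)"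
   using bprod_bcomp[OF bid_closed[OF v(1)] v(5) a v(6)] v X by simp
  also have "mor N (W ** X) (W' ** V') ... (ka W m) = mor N (W ** V) (W' ** V') (bpr W W' V V' xi ze) (mor N (W ** X) (W ** V) (bpr W W X V (bd W) a) (ka W m))"
   by (rule mackeyD(4)[OF N, symmetric]) (use v X a c in simp_all)
  finally show "mor N (W' ** X) (W' ** V') (bpr W' W' X V' (bd W') (mor (rpr X) V V' ze a)) (ka W' (mor M W W' xi m)) =
   mor N (W ** V) (W' ** V') (bpr W W' V V' xi ze) (mor N (W ** X) (W ** V) (bpr W W X V (bd W) a) (ka W m))" by simp
 qed (use X N c in simp_all)
qed

text \<open>The Yoneda lemma in the other direction: a map into a shifted functor extends uniquely.\<close>

lemma hom_ext_facts: assumes X: "X : CS" and k: "ka : mhm M (shift n N X)"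
 shows "hom_ext n M N X ka : ob (mhom n M N) X"
  "W : CS ==> m : ob M W ==> hev M X (hom_ext n M N X ka) W m = ka W m"
proof -
 note l = box_lift_facts[OF M repr_mackey[OF X] N bilin_ext[OF X k]]
 show "hom_ext n M N X ka : ob (mhom n M N) X"
  unfolding mhom_ob hom_ext_def using mrestrict_hom[OF l(1)] M X by (simp add: mrestrict_idem)
 assume v: "W : CS" "m : ob M W"
 have c: "ka W m : ob N (W ** X)" using mhD(1)[OF k v] by simp
 show "hev M X (hom_ext n M N X ka) W m = ka W m"
  using v X M N c by (simp add: hom_ev_def hom_ext_def mrestrict_apply l(2) mackeyD(3))
qed

lemma hom_ext_cong: assumes X: "X : CS" and k: "ka : mhm M (shift n N X)" and eq: "!!W m. W : CS ==> m : ob M W ==> ka W m = ka' W m"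
 shows "hom_ext n M N X ka = hom_ext n M N X ka'"
proof -
 have k': "ka' : mhm M (shift n N X)" by (rule mack_hom_cong[OF k M eq])
 show ?thesis by (rule mhom_eqI[OF X hom_ext_facts(1)[OF X k] hom_ext_facts(1)[OF X k']]) (simp add: hom_ext_facts(2)[OF X k] hom_ext_facts(2)[OF X k'] eq)
qed

lemma hom_ev_closed [simp]: "X : CS ==> h : ob (mhom n M N) X ==> W : CS ==> m : ob M W ==> hev M X h W m : ob N (W ** X)"
 using mhD(1)[OF hom_ev_hom] by simp

lemma precomp_hom: assumes "X : CS" "X' : CS" "be : bhm X X'"
 shows "(%Y a. bco X Y a be) : mhm (rpr X') (rpr X)"
proof (rule mack_homI)
 fix Y a assume "Y : CS" "a : ob (rpr X') Y"
 then show "bco X Y a be : ob (rpr X) Y" using assms bcomp_closed[of be X X' a Y] by simp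
next
 fix Y a b assume "Y : CS" "a : ob (rpr X') Y" "b : ob (rpr X') Y"
 then show "bco X Y (a +[(rpr X'),Y] b) be = bco X Y a be +[(rpr X),Y] bco X Y b be"
  using assms by (simp add: bcomp_badd_left[of be X X'])
next
 fix Y Z ze a assume "Y : CS" "Z : CS" "ze : bhm Y Z" "a : ob (rpr X') Y"
 then show "bco X Z (mor (rpr X') Y Z ze a) be = mor (rpr X) Y Z ze (bco X Y a be)"
  using bcomp_assoc[of be X X' a Y ze Z] assms by simp
qed

lemma mhom_ops: assumes X: "X : CS"
 shows "\<one>\<^bsub>obj (mhom n M N) X\<^esub> : ob (mhom n M N) X"
  "W : CS ==> m : ob M W ==> hev M X \<one>\<^bsub>obj (mhom n M N) X\<^esub> W m = \<one>\<^bsub>obj N (W ** X)\<^esub>"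
  "h : ob (mhom n M N) X ==> k : ob (mhom n M N) X ==> h +[(mhom n M N),X] k : ob (mhom n M N) X"
  "h : ob (mhom n M N) X ==> k : ob (mhom n M N) X ==> W : CS ==> m : ob M W ==>
   hev M X (h +[(mhom n M N),X] k) W m = hev M X h W m +[N,(W ** X)] hev M X k W m"
  "h : ob (mhom n M N) X ==> X' : CS ==> be : bhm X X' ==> mor (mhom n M N) X X' be h : ob (mhom n M N) X'"
  "h : ob (mhom n M N) X ==> X' : CS ==> be : bhm X X' ==> W : CS ==> m : ob M W ==>
   hev M X' (mor (mhom n M N) X X' be h) W m = mor N (W ** X) (W ** X') (bpr W W X X' (bd W) be) (hev M X h W m)"
proof -
 note mk = box_mackey[OF M repr_mackey[OF X]]
 note 1 = mrestrict_hom[OF mack_hom_one[OF N, of "bx M (rpr X)"] mk]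
 show "\<one>\<^bsub>obj (mhom n M N) X\<^esub> : ob (mhom n M N) X" unfolding mhom_ob using 1 by (simp add: mhom_def mrestrict_idem)
 show "W : CS ==> m : ob M W ==> hev M X \<one>\<^bsub>obj (mhom n M N) X\<^esub> W m = \<one>\<^bsub>obj N (W ** X)\<^esub>"
  using X M by (simp add: hom_ev_def mhom_def mrestrict_apply)
 { assume h: "h : ob (mhom n M N) X" "k : ob (mhom n M N) X"
  note h' = h[unfolded mhom_ob]
  note 2 = mrestrict_hom[OF mack_hom_mult[OF h'(1)[THEN conjunct1] h'(2)[THEN conjunct1] N] mk]
  show "h +[(mhom n M N),X] k : ob (mhom n M N) X" unfolding mhom_ob using 2 by (simp add: mhom_def mrestrict_idem)
  show "W : CS ==> m : ob M W ==> hev M X (h +[(mhom n M N),X] k) W m = hev M X h W m +[N,(W ** X)] hev M X k W m"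
   using X M by (simp add: hom_ev_def mhom_def mrestrict_apply) }
 assume h: "h : ob (mhom n M N) X" and X': "X' : CS" and b: "be : bhm X X'"
 note h' = h[unfolded mhom_ob, THEN conjunct1]
 note f = box_map_facts[OF mid_hom precomp_hom[OF X X' b] M repr_mackey[OF X'] M repr_mackey[OF X]]
 note 3 = mrestrict_hom[OF mh_comp[OF f(1) h'] box_mackey[OF M repr_mackey[OF X']]]
 show "mor (mhom n M N) X X' be h : ob (mhom n M N) X'" unfolding mhom_ob using 3 by (simp add: mhom_def mrestrict_idem)
 assume v: "W : CS" "m : ob M W"
 have "hev M X' (mor (mhom n M N) X X' be h) W m = h (W ** X') (bp M (rpr X) W X' m be)"
  using v X X' M b by (simp add: hom_ev_def mhom_def mrestrict_apply mcomp_def f(2))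
 also have "... = mor N (W ** X) (W ** X') (bpr W W X X' (bd W) be) (hev M X h W m)"
  unfolding pair_repr[OF M X v(1) X' v(2) b] hom_ev_def by (rule mhD(3)[OF h']) (use v X X' M b in simp_all)
 finally show "hev M X' (mor (mhom n M N) X X' be h) W m = mor N (W ** X) (W ** X') (bpr W W X X' (bd W) be) (hev M X h W m)" .
qed

lemma mhom_inv: assumes X: "X : CS" and h: "h : ob (mhom n M N) X"
 obtains k where "k : ob (mhom n M N) X" "k +[(mhom n M N),X] h = \<one>\<^bsub>obj (mhom n M N) X\<^esub>"
  "!!W m. W : CS ==> m : ob M W ==> hev M X k W m = inv\<^bsub>obj N (W ** X)\<^esub> hev M X h W m"
proof -
 have k: "(%W m. inv\<^bsub>obj N (W ** X)\<^esub> hev M X h W m) : mhm M (shift n N X)"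
  using mack_hom_inv[OF hom_ev_hom[OF X h]] N X by simp
 note e = hom_ext_facts[OF X k]
 show ?thesis
 proof (rule that[OF e(1) _ e(2)])
  show "hom_ext n M N X (%W m. inv\<^bsub>obj N (W ** X)\<^esub> hev M X h W m) +[(mhom n M N),X] h = \<one>\<^bsub>obj (mhom n M N) X\<^esub>"
   by (rule mhom_eqI[OF X mhom_ops(3)[OF X e(1) h] mhom_ops(1)[OF X]])
    (use X h N in \<open>simp add: mhom_ops[OF X] e group.l_inv ob_group\<close>)
 qed
qed

lemma mhom_mackey: "mackey (mhom n M N)"
 unfolding mackey_functor_def
proof (intro conjI ballI)
 fix X assume X: "X : CS"
 note o = mhom_ops[OF X]
 show cg: "comm_group (obj (mhom n M N) X)"
 proof (rule comm_groupI)
  fix h k l assume h: "h : ob (mhom n M N) X" "k : ob (mhom n M N) X" "l : ob (mhom n M N) X"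
  show "h +[(mhom n M N),X] k +[(mhom n M N),X] l = h +[(mhom n M N),X] (k +[(mhom n M N),X] l)"
   by (rule mhom_eqI[OF X]) (use h o X in \<open>simp_all add: monoid.m_assoc[OF group.is_monoid[OF ob_group[OF N]]]\<close>)
 next
  fix h k assume h: "h : ob (mhom n M N) X" "k : ob (mhom n M N) X"
  show "h +[(mhom n M N),X] k = k +[(mhom n M N),X] h"
   by (rule mhom_eqI[OF X]) (use h o X in \<open>simp_all add: comm_monoid.m_comm[OF comm_group.axioms(1)[OF mackeyD(1)[OF N]]]\<close>)
 next
  fix h assume h: "h : ob (mhom n M N) X"
  show "\<one>\<^bsub>obj (mhom n M N) X\<^esub> +[(mhom n M N),X] h = h"
   by (rule mhom_eqI[OF X]) (use h o X in \<open>simp_all add: monoid.l_one[OF group.is_monoid[OF ob_group[OF N]]]\<close>)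
  show "EX k : ob (mhom n M N) X. k +[(mhom n M N),X] h = \<one>\<^bsub>obj (mhom n M N) X\<^esub>"
   using mhom_inv[OF X h] by blast
 qed (use o in simp_all)
 fix x assume x: "x : ob (mhom n M N) X"
 show "mor (mhom n M N) X X (bd X) x = x"
  by (rule mhom_eqI[OF X]) (use X x o N in \<open>simp_all add: mackeyD(3)\<close>)
next
 fix X Y be assume v: "X : CS" "Y : CS" "be : bhm X Y"
 note o = mhom_ops[OF v(1)]
 show "mor (mhom n M N) X Y be : hom (obj (mhom n M N) X) (obj (mhom n M N) Y)"
 proof (rule homI)
  fix h k assume h: "h : ob (mhom n M N) X" "k : ob (mhom n M N) X"
  show "mor (mhom n M N) X Y be (h +[(mhom n M N),X] k) = mor (mhom n M N) X Y be h +[(mhom n M N),Y] mor (mhom n M N) X Y be k"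
   by (rule mhom_eqI[OF v(2)]) (use h v o mhom_ops[OF v(2)] N in \<open>simp_all add: mor_mult\<close>)
 qed (use o v in simp)
 fix be' h assume b: "be' : bhm X Y" and h: "h : ob (mhom n M N) X"
 show "mor (mhom n M N) X Y (badd n X Y be be') h = mor (mhom n M N) X Y be h +[(mhom n M N),Y] mor (mhom n M N) X Y be' h"
  by (rule mhom_eqI[OF v(2)]) (use h v b o mhom_ops[OF v(2)] N in \<open>simp_all add: bprod_badd_right mackeyD(5)\<close>)
next
 fix X Y Z al be h assume v: "X : CS" "Y : CS" "Z : CS" "al : bhm X Y" "be : bhm Y Z" "h : ob (mhom n M N) X"
 note o = mhom_ops[OF v(1)]
 have c: "bco X Z be al : bhm X Z" using bcomp_closed[OF v(4,5,2)] .
 show "mor (mhom n M N) X Z (bco X Z be al) h = mor (mhom n M N) Y Z be (mor (mhom n M N) X Y al h)"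
 proof (rule mhom_eqI[OF v(3)])
  fix W m assume w: "W : CS" "m : ob M W"
  show "hev M Z (mor (mhom n M N) X Z (bco X Z be al) h) W m = hev M Z (mor (mhom n M N) Y Z be (mor (mhom n M N) X Y al h)) W m"
   using v w c o mhom_ops[OF v(2)] N by (simp add: bprod_bcomp_bid mackeyD(4)[OF N])
 qed (use v c o mhom_ops[OF v(2)] in simp_all)
qed

end

lemma hom_ext_same: assumes "same N N'" shows "hom_ext n M N = hom_ext n M N'"
 unfolding hom_ext_def[abs_def] same_rules(2,20)[OF assms] ..

context
 fixes R :: "('r, 'x) green_scheme" and M :: "('r, 'm, 'y) lmod_scheme" and N :: "('r, 'k, 'z) lmod_scheme"
 assumes lM: "lactor R M" and lN: "lactor R N"
begin

lemmas rM' = lactorD(1,2)[OF lM] and rN' = lactorD(2)[OF lN]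
lemmas mo = mhom_ops[OF rM'(2) rN'] and mc [simp] = hom_ev_closed[OF rM'(2) rN']

lemma rhom_sub: "h : ob (rh R M N) X ==> h : ob (mhom n M N) X"
 by (simp add: rhom_def)

text \<open>The equalizer that defines the relative Hom picks out the maps that are linear in the first variable.\<close>

lemma rhom_ob: assumes X: "X : CS"
 shows "h : ob (rh R M N) X \<longleftrightarrow> h : ob (mhom n M N) X & (ALL A : CS. ALL W : CS. ALL r : ob R A. ALL m : ob M W.
  hev M X h (A ** W) (lm R M A W r m) = tr N (A ** W ** X) ((A ** W) ** X) fas' (lm R N A (W ** X) r (hev M X h W m)))"
proof (cases "h : ob (mhom n M N) X")
 case False then show ?thesis by (simp add: rhom_def)
next
 case True
 then have h: "h : mhm (bx M (rpr X)) N" by (simp add: mhom_def)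
 note R = rM'(1) and M = rM'(2) and N = rN'
 note rp = repr_mackey[OF X]
 note f1 = box_map_facts[OF lactorD(3)[OF lM] mid_hom box_mackey[OF R M] rp M rp]
 note f2 = box_assoc_facts[OF R M rp] and f3 = box_map_facts[OF mid_hom h R box_mackey[OF M rp] R N]
 define H where "H = h oM bmap M (rpr X) (lact M) mid"
 define K where "K = lact N oM bmap R N mid h oM box_assoc n R M (rpr X)"
 have HK: "H : mhm (bx (bx R M) (rpr X)) N" "K : mhm (bx (bx R M) (rpr X)) N"
  unfolding H_def K_def using mh_comp[OF f1(1) h] mh_comp[OF mh_comp[OF f2(1) f3(1)] lactorD(3)[OF lN]] by simp_all
 have v: "H ((A ** W) ** X) (bp (bx R M) (rpr X) (A ** W) X (bp R M A W r m) (bd X)) = hev M X h (A ** W) (lm R M A W r m)"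
  "K ((A ** W) ** X) (bp (bx R M) (rpr X) (A ** W) X (bp R M A W r m) (bd X)) =
   tr N (A ** W ** X) ((A ** W) ** X) fas' (lm R N A (W ** X) r (hev M X h W m))"
  if "A : CS" "W : CS" "r : ob R A" "m : ob M W" for A W r m
  using that X R M N mhD(1)[OF h]
  by (simp_all add: H_def K_def mcomp_def f1(2) f2(2) mh_tr[OF f3(1)] f3(2) mh_tr[OF lactorD(3)[OF lN]] hom_ev_def lm_def)
 have "h : ob (rh R M N) X \<longleftrightarrow> mack_eq n (bx (bx R M) (rpr X)) H K"
  using True by (simp add: rhom_def H_def K_def)
 also have "... \<longleftrightarrow> (ALL A : CS. ALL W : CS. ALL r : ob R A. ALL m : ob M W.
  hev M X h (A ** W) (lm R M A W r m) = tr N (A ** W ** X) ((A ** W) ** X) fas' (lm R N A (W ** X) r (hev M X h W m)))" (is "_ \<longleftrightarrow> ?C")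
 proof
  assume e: "mack_eq n (bx (bx R M) (rpr X)) H K"
  show ?C
  proof (intro ballI)
   fix A W r m assume a: "A : CS" "W : CS" "r : ob R A" "m : ob M W"
   show "hev M X h (A ** W) (lm R M A W r m) = tr N (A ** W ** X) ((A ** W) ** X) fas' (lm R N A (W ** X) r (hev M X h W m))"
    unfolding v[OF a, symmetric] by (rule mack_eqD[OF e]) (use a X R M in simp_all)
  qed
 next
  assume c: ?C
  show "mack_eq n (bx (bx R M) (rpr X)) H K"
   unfolding mack_eq_def
  proof (intro ballI)
   fix Y y assume Y: "Y : CS" "y : ob (bx (bx R M) (rpr X)) Y"
   show "H Y y = K Y y"
   proof (rule hom_on_repr_eqI[OF box_mackey[OF R M] mgen_box[OF R M mgen_all mgen_all] N X HK _ Y], goal_cases)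
    case (1 W t)
    then obtain A B r m where w: "A : CS" "B : CS" "r : ob R A" "m : ob M B" "W = A ** B" "t = bp R M A B r m" by (elim exE conjE)
    show ?case
     unfolding w(5,6) v[OF w(1-4)] using c w(1-4) by blast
   qed
  qed
 qed
 finally show ?thesis using True by simp
qed

lemma rhom_lin: "X : CS ==> h : ob (rh R M N) X ==> A : CS ==> W : CS ==> r : ob R A ==> m : ob M W ==>
  hev M X h (A ** W) (lm R M A W r m) = tr N (A ** W ** X) ((A ** W) ** X) fas' (lm R N A (W ** X) r (hev M X h W m))"
 using rhom_ob by blast

lemma rhom_structure: "monoid.mult (obj (rh R M N) X) = monoid.mult (obj (mhom n M N) X)" "one (obj (rh R M N) X) = one (obj (mhom n M N) X)"
 "mor (rh R M N) = mor (mhom n M N)"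
 by (simp_all add: rhom_def)

lemma rhom_closed: assumes X: "X : CS"
 shows "\<one>\<^bsub>obj (mhom n M N) X\<^esub> : ob (rh R M N) X"
  "h : ob (rh R M N) X ==> k : ob (rh R M N) X ==> h +[(mhom n M N),X] k : ob (rh R M N) X"
  "h : ob (rh R M N) X ==> X' : CS ==> be : bhm X X' ==> mor (mhom n M N) X X' be h : ob (rh R M N) X'"
  "h : ob (rh R M N) X ==> EX k : ob (rh R M N) X. k +[(mhom n M N),X] h = \<one>\<^bsub>obj (mhom n M N) X\<^esub>"
proof -
 note R = rM'(1) and M = rM'(2) and N = rN'
 have L: "(%x. tr N (A ** W ** X) ((A ** W) ** X) fas' (lm R N A (W ** X) r x)) : hom (obj N (W ** X)) (obj N ((A ** W) ** X))"
  if "A : CS" "W : CS" "r : ob R A" for A W r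
  by (rule homI) (use that X N lN in \<open>simp_all add: bilinD(3)[OF bilin_lm[OF lN]] tr_mult\<close>)
 show "\<one>\<^bsub>obj (mhom n M N) X\<^esub> : ob (rh R M N) X"
  unfolding rhom_ob[OF X] using mo(1)[OF X] X N hom_one_eq[OF L] lM by (simp add: mo(2)[OF X] ob_group)
 { fix h k assume h: "h : ob (rh R M N) X" "k : ob (rh R M N) X"
  note h' = rhom_sub[OF h(1)] rhom_sub[OF h(2)]
  show "h +[(mhom n M N),X] k : ob (rh R M N) X"
   unfolding rhom_ob[OF X] using mo(3)[OF X h'] X N hom_mult[OF L] lM h' rhom_lin[OF X h(1)] rhom_lin[OF X h(2)] by (simp add: mo(4)[OF X h']) }
 { assume h: "h : ob (rh R M N) X" and X': "X' : CS" and b: "be : bhm X X'"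
  note h' = rhom_sub[OF h]
  show "mor (mhom n M N) X X' be h : ob (rh R M N) X'"
   unfolding rhom_ob[OF X']
  proof (intro conjI ballI)
   show "mor (mhom n M N) X X' be h : ob (mhom n M N) X'" by (rule mo(5)[OF X h' X' b])
   fix A W r m assume v: "A : CS" "W : CS" "r : ob R A" "m : ob M W"
   let ?e = "hev M X h W m"
   have e: "?e : ob N (W ** X)" using X h' v by simp
   have g: "bgraph n (A ** W ** X) ((A ** W) ** X) fas' : bhm (A ** W ** X) ((A ** W) ** X)"
    "bgraph n (A ** W ** X') ((A ** W) ** X') fas' : bhm (A ** W ** X') ((A ** W) ** X')"
    by (rule bgraph_closed; use v X X' in simp)+
   have "lm R N A (W ** X') r (mor N (W ** X) (W ** X') (bpr W W X X' (bd W) be) ?e) =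
    mor N (A ** W ** X) (A ** W ** X') (bpr A A (W ** X) (W ** X') (bd A) (bpr W W X X' (bd W) be)) (lm R N A (W ** X) r ?e)"
    using bilinD(4)[OF bilin_lm[OF lN] v(1) _ v(1) _ bid_closed[OF v(1)] _ v(3) e, of "W ** X'" "bpr W W X X' (bd W) be"] v X X' b R by (simp add: mackeyD(3))
   then show "hev M X' (mor (mhom n M N) X X' be h) (A ** W) (lm R M A W r m) =
    tr N (A ** W ** X') ((A ** W) ** X') fas' (lm R N A (W ** X') r (hev M X' (mor (mhom n M N) X X' be h) W m))"
    using v X X' b e lM lN N h' g fas'_natural[OF bid_closed[OF v(1)] bid_closed[OF v(2)] b v(1,2) X v(1,2) X']
    by (simp add: mo(6)[OF X h' X' b] rhom_lin[OF X h] tr_def mackeyD(4)[OF N] del: emaps_iff)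
  qed }
 assume h: "h : ob (rh R M N) X"
 note h' = rhom_sub[OF h]
 obtain k where k: "k : ob (mhom n M N) X" "k +[(mhom n M N),X] h = \<one>\<^bsub>obj (mhom n M N) X\<^esub>"
  "!!W m. W : CS ==> m : ob M W ==> hev M X k W m = inv\<^bsub>obj N (W ** X)\<^esub> hev M X h W m"
  by (rule mhom_inv[OF M N X h']) blast
 have "k : ob (rh R M N) X"
  unfolding rhom_ob[OF X] using k(1,3) X N lM h' rhom_lin[OF X h] hom_inv_eq[OF L] by (simp add: ob_group)
 then show "EX k : ob (rh R M N) X. k +[(mhom n M N),X] h = \<one>\<^bsub>obj (mhom n M N) X\<^esub>" using k(2) by blast
qed

lemma rhom_mackey: "mackey (rh R M N)"
proof -
 note m = mhom_mackey[OF rM'(2) rN']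
 note s = rhom_structure and c = rhom_closed and sub = rhom_sub
 show ?thesis unfolding mackey_functor_def
 proof (intro conjI ballI)
  fix X assume X: "X : CS"
  note cg = mackeyD(1)[OF m X]
  show "comm_group (obj (rh R M N) X)"
  proof (rule comm_groupI)
   show "EX k : ob (rh R M N) X. k +[(rh R M N),X] h = \<one>\<^bsub>obj (rh R M N) X\<^esub>" if "h : ob (rh R M N) X" for h
    using c(4)[OF X that] by (simp add: s)
  next
   fix h k assume "h : ob (rh R M N) X" "k : ob (rh R M N) X"
   then show "h +[(rh R M N),X] k = k +[(rh R M N),X] h"
    using comm_monoid.m_comm[OF comm_group.axioms(1)[OF cg]] sub by (simp add: s)
  next
   fix h k l assume "h : ob (rh R M N) X" "k : ob (rh R M N) X" "l : ob (rh R M N) X"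
   then show "h +[(rh R M N),X] k +[(rh R M N),X] l = h +[(rh R M N),X] (k +[(rh R M N),X] l)"
    using monoid.m_assoc[OF group.is_monoid[OF ob_group[OF m X]]] sub by (simp add: s)
  next
   fix h assume "h : ob (rh R M N) X"
   then show "\<one>\<^bsub>obj (rh R M N) X\<^esub> +[(rh R M N),X] h = h"
    using monoid.l_one[OF group.is_monoid[OF ob_group[OF m X]]] sub by (simp add: s)
  qed (use c[OF X] in \<open>simp_all add: s\<close>)
  show "mor (rh R M N) X X (bd X) x = x" if "x : ob (rh R M N) X" for x
   using mackeyD(3)[OF m X] sub[OF that] by (simp add: s)
 next
  fix X Y be assume v: "X : CS" "Y : CS" "be : bhm X Y"
  show "mor (rh R M N) X Y be : hom (obj (rh R M N) X) (obj (rh R M N) Y)"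
   by (rule homI) (use c(3)[OF v(1) _ v(2,3)] mor_mult[OF m v] sub in \<open>simp_all add: s\<close>)
  fix be' h assume "be' : bhm X Y" "h : ob (rh R M N) X"
  then show "mor (rh R M N) X Y (badd n X Y be be') h = mor (rh R M N) X Y be h +[(rh R M N),Y] mor (rh R M N) X Y be' h"
   using mackeyD(5)[OF m v] sub by (simp add: s)
 next
  fix X Y Z al be h assume v: "X : CS" "Y : CS" "Z : CS" "al : bhm X Y" "be : bhm Y Z" "h : ob (rh R M N) X"
  show "mor (rh R M N) X Z (bco X Z be al) h = mor (rh R M N) Y Z be (mor (rh R M N) X Y al h)"
   using mackeyD(4)[OF m v(1-5) sub[OF v(6)]] by (simp add: s)
 qed
qed

lemma rhom_eqI:
 assumes X: "X : CS" and h: "h : ob (rh R M N) X" "k : ob (rh R M N) X"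
  and eq: "!!W m. W : CS ==> m : ob M W ==> hev M X h W m = hev M X k W m"
 shows "h = k"
 by (rule mhom_eqI[OF rM'(2) rN' X rhom_sub[OF h(1)] rhom_sub[OF h(2)] eq])

lemma bilin_ev: "bilin M (rh R M N) N (%W X m h. hev M X h W m)"
proof (rule bilinI)
 fix Y Z m h assume v: "Y : CS" "Z : CS" "m : ob M Y" "h : ob (rh R M N) Z"
 show "hev M Z h Y m : ob N (Y ** Z)" using v(1-3) rhom_sub[OF v(4)] by simp
next
 fix Y Z m m' h assume v: "Y : CS" "Z : CS" "m : ob M Y" "m' : ob M Y" "h : ob (rh R M N) Z"
 show "hev M Z h Y (m +[M,Y] m') = hev M Z h Y m +[N,(Y ** Z)] hev M Z h Y m'"
  using mhD(2)[OF hom_ev_hom[OF rM'(2) rN' v(2) rhom_sub[OF v(5)]] v(1,3,4)] by simp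
next
 fix Y Z m h k assume v: "Y : CS" "Z : CS" "m : ob M Y" "h : ob (rh R M N) Z" "k : ob (rh R M N) Z"
 show "hev M Z (h +[(rh R M N),Z] k) Y m = hev M Z h Y m +[N,(Y ** Z)] hev M Z k Y m"
  using mo(4)[OF v(2) rhom_sub[OF v(4)] rhom_sub[OF v(5)] v(1,3)] by (simp add: rhom_structure)
next
 fix Y Z Y' Z' xi ze m h
 assume v: "Y : CS" "Z : CS" "Y' : CS" "Z' : CS" "xi : bhm Y Y'" "ze : bhm Z Z'" "m : ob M Y" "h : ob (rh R M N) Z"
 note h = rhom_sub[OF v(8)]
 have e: "hev M Z h Y m : ob N (Y ** Z)" using v h by simp
 have "mor M Y Y' xi m : ob M Y'" using v rM'(2) by simp
 then show "hev M Z' (mor (rh R M N) Z Z' ze h) Y' (mor M Y Y' xi m) = mor N (Y ** Z) (Y' ** Z') (bpr Y Y' Z Z' xi ze) (hev M Z h Y m)"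
  using mo(6)[OF v(2) h v(4,6,3), of "mor M Y Y' xi m"] mhD(3)[OF hom_ev_hom[OF rM'(2) rN' v(2) h] v(1,3,5,7)] v e
   bprod_bcomp[OF v(5) bid_closed[OF v(3)] bid_closed[OF v(2)] v(6)]
  by (simp add: rhom_structure mackeyD(4)[OF rN'])
qed

text \<open>A pairing that is linear in the first variable is a map into the relative Hom.\<close>

lemma rhom_adjunct:
 assumes A: "mackey A" and b: "bilin M A N be"
  and lin: "!!B W X r m a. B : CS ==> W : CS ==> X : CS ==> r : ob R B ==> m : ob M W ==> a : ob A X ==>
   be (B ** W) X (lm R M B W r m) a = tr N (B ** W ** X) ((B ** W) ** X) fas' (lm R N B (W ** X) r (be W X m a))"
 shows "(%X a. hom_ext n M N X (%W m. be W X m a)) : mhm A (rh R M N)"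
  "X : CS ==> a : ob A X ==> W : CS ==> m : ob M W ==> hev M X (hom_ext n M N X (%W m. be W X m a)) W m = be W X m a"
proof -
 have k: "(%W m. be W X m a) : mhm M (shift n N X)" if "X : CS" "a : ob A X" for X a
  by (rule bilin_fix_right[OF b A that])
 note e = hom_ext_facts[OF rM'(2) rN' _ k]
 show ev: "hev M X (hom_ext n M N X (%W m. be W X m a)) W m = be W X m a" if "X : CS" "a : ob A X" "W : CS" "m : ob M W" for X a W m
  using e(2) that by blast
 have c: "hom_ext n M N X (%W m. be W X m a) : ob (rh R M N) X" if "X : CS" "a : ob A X" for X a
  unfolding rhom_ob[OF that(1)] using that lM lin e(1)[OF that(1) that] by (simp add: ev)
 note bev = bilinD[OF bilin_ev]
 show "(%X a. hom_ext n M N X (%W m. be W X m a)) : mhm A (rh R M N)"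
 proof (rule mack_homI)
  fix X a a' assume v: "X : CS" "a : ob A X" "a' : ob A X"
  show "hom_ext n M N X (%W m. be W X m (a +[A,X] a')) = hom_ext n M N X (%W m. be W X m a) +[(rh R M N),X] hom_ext n M N X (%W m. be W X m a')"
   by (rule rhom_eqI[OF v(1)]) (use v c A rhom_mackey in \<open>simp_all add: bev ev bilinD[OF b]\<close>)
 next
  fix X Y ze a assume v: "X : CS" "Y : CS" "ze : bhm X Y" "a : ob A X"
  show "hom_ext n M N Y (%W m. be W Y m (mor A X Y ze a)) = mor (rh R M N) X Y ze (hom_ext n M N X (%W m. be W X m a))"
  proof (rule rhom_eqI[OF v(2)])
   fix W m assume w: "W : CS" "m : ob M W"
   have "mor M W W (bd W) m = m" by (rule mackeyD(3)[OF rM'(2) w])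
   then show "hev M Y (hom_ext n M N Y (%W m. be W Y m (mor A X Y ze a))) W m = hev M Y (mor (rh R M N) X Y ze (hom_ext n M N X (%W m. be W X m a))) W m"
    using bev(4)[OF w(1) v(1) w(1) v(2) bid_closed[OF w(1)] v(3) w(2) c[OF v(1,4)]] bilinD(4)[OF b w(1) v(1) w(1) v(2) bid_closed[OF w(1)] v(3) w(2) v(4)] v w A
    by (simp add: ev)
  qed (use v c A rhom_mackey in simp_all)
 qed (rule c)
qed

end

section \<open>The dual module and the tensor-Hom map\<close>

lemma bilin_cong: assumes b: "bilin M N L pp" and M: "mackey M" and N: "mackey N"
  and eq: "!!Y Z m k. Y : CS ==> Z : CS ==> m : ob M Y ==> k : ob N Z ==> pp Y Z m k = pp' Y Z m k"
 shows "bilin M N L pp'"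
 by (rule bilinI) (use M N in \<open>simp_all add: eq[symmetric] bilinD[OF b]\<close>)

lemma lmodule_ubimod: assumes R: "green_functor n R" shows "lmodule R (ubimod R)"
 unfolding lmodule_def
proof (intro conjI ballI)
 show "lactor R (ubimod R)" by (rule bmodD(1)[OF bmod_ubimod[OF R]])
qed (use green_facts(5,6)[OF R] in simp_all)

text \<open>Linearity in the first variable may be tested on generators of the second.\<close>

lemma adjunct_linear:
 assumes lM: "lactor R M" and lN: "lactor R N" and A: "mackey A" "mgen A Q" and H: "H : mhm (bx M A) N"
  and gen: "!!B W X r m a. B : CS ==> W : CS ==> X : CS ==> r : ob R B ==> m : ob M W ==> Q X a ==>
   H ((B ** W) ** X) (bp M A (B ** W) X (lm R M B W r m) a) =
   tr N (B ** W ** X) ((B ** W) ** X) fas' (lm R N B (W ** X) r (H (W ** X) (bp M A W X m a)))"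
  and v: "B : CS" "W : CS" "X : CS" "r : ob R B" "m : ob M W" "a : ob A X"
 shows "H ((B ** W) ** X) (bp M A (B ** W) X (lm R M B W r m) a) =
   tr N (B ** W ** X) ((B ** W) ** X) fas' (lm R N B (W ** X) r (H (W ** X) (bp M A W X m a)))"
proof -
 note D = lactorD[OF lM] lactorD[OF lN]
 note f1 = box_map_facts[OF D(3) mid_hom box_mackey[OF D(1,2)] A(1) D(2) A(1)]
 note f2 = box_assoc_facts[OF D(1,2) A(1)] and f3 = box_map_facts[OF mid_hom H D(1) box_mackey[OF D(2) A(1)] D(1) D(5)]
 define F where "F = H oM bmap M A (lact M) mid"
 define K where "K = lact N oM bmap R N mid H oM box_assoc n R M A"
 have FK: "F : mhm (bx (bx R M) A) N" "K : mhm (bx (bx R M) A) N"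
  unfolding F_def K_def using mh_comp[OF f1(1) H] mh_comp[OF mh_comp[OF f2(1) f3(1)] D(6)] by simp_all
 have val: "F ((B ** W) ** X) (bp (bx R M) A (B ** W) X (bp R M B W r m) a) = H ((B ** W) ** X) (bp M A (B ** W) X (lm R M B W r m) a)"
  "K ((B ** W) ** X) (bp (bx R M) A (B ** W) X (bp R M B W r m) a) =
   tr N (B ** W ** X) ((B ** W) ** X) fas' (lm R N B (W ** X) r (H (W ** X) (bp M A W X m a)))"
  if "B : CS" "W : CS" "X : CS" "r : ob R B" "m : ob M W" "a : ob A X" for B W X r m a
  using that D A mhD(1)[OF H]
  by (simp_all add: F_def K_def mcomp_def f1(2) f2(2) mh_tr[OF f3(1)] f3(2) mh_tr[OF D(6)] lm_def)
 show ?thesis unfolding val[OF v, symmetric]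
 proof (rule mack_hom_eqI[OF mgen_box[OF box_mackey[OF D(1,2)] A(1) mgen_box[OF D(1,2) mgen_all mgen_all] A(2)] FK])
  fix X z assume "EX Y Z m k. Y : CS & Z : CS & (EX A B l b. A : CS & B : CS &
   l : ob R A & b : ob M B & Y = A ** B & m = bp R M A B l b) & Q Z k & X = Y ** Z & z = bp (bx R M) A Y Z m k"
  then obtain B W Y r m a where w: "B : CS" "W : CS" "Y : CS" "r : ob R B" "m : ob M W" "Q Y a"
   "X = (B ** W) ** Y" "z = bp (bx R M) A (B ** W) Y (bp R M B W r m) a"
   by (elim exE conjE) simp
  show "F X z = K X z" unfolding w(7,8) val[OF w(1-5) mgenD[OF A(2) w(3,6)]] by (rule gen[OF w(1-6)])
 qed (use v D A in simp_all)
qed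

text \<open>The pairing (d, x) \<mapsto> (q \<mapsto> d(q).x) behind the tensor-Hom map.\<close>

definition tpair where
 "tpair R P N X Y d x = hom_ext n P N (X ** Y) (%W q. tr N ((W ** X) ** Y) (W ** X ** Y) fas (lm R N (W ** X) Y (hev P X d W q) x))"

context
 fixes R :: "('r, 'u) green_scheme" and P :: "('r, 'p, 's, 'z) bimod_scheme"
 assumes R: "green_functor n R" and lP: "lactor R P"
begin

lemmas lu = bmodD(1)[OF bmod_ubimod[OF R]]
lemmas Pmk = lactorD(1,2)[OF lP]
lemmas rhR_mackey = rhom_mackey[OF lP lu]
lemmas evR = bilin_ev[OF lP lu]

lemma dual_eval_facts:
 shows "dual_eval n R P : mhm (bx P (rh R P (ubimod R))) R"
  "W : CS ==> X : CS ==> p : ob P W ==> d : ob (rh R P (ubimod R)) X ==>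
   dual_eval n R P (W ** X) (bp P (rh R P (ubimod R)) W X p d) = hev P X d W p"
  "W : CS ==> X : CS ==> p : ob P W ==> d : ob (rh R P (ubimod R)) X ==> hev P X d W p : ob R (W ** X)"
proof -
 have b: "bilin P (rh R P (ubimod R)) R (%W X m h. hev P X h W m)" using evR by simp
 note l = box_lift_facts[OF Pmk(2) rhR_mackey Pmk(1) b, folded dual_eval_def]
 show "dual_eval n R P : mhm (bx P (rh R P (ubimod R))) R" by (rule l(1))
 show "W : CS ==> X : CS ==> p : ob P W ==> d : ob (rh R P (ubimod R)) X ==>
   dual_eval n R P (W ** X) (bp P (rh R P (ubimod R)) W X p d) = hev P X d W p" by (rule l(2))
 show "W : CS ==> X : CS ==> p : ob P W ==> d : ob (rh R P (ubimod R)) X ==> hev P X d W p : ob R (W ** X)"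
  by (rule bilinD(1)[OF b])
qed

lemma ev_linR: "X : CS ==> d : ob (rh R P (ubimod R)) X ==> A : CS ==> W : CS ==> r : ob R A ==> m : ob P W ==>
  hev P X d (A ** W) (lm R P A W r m) = tr R (A ** W ** X) ((A ** W) ** X) fas' (gm R A (W ** X) r (hev P X d W m))"
 using rhom_lin[OF lP lu] by simp

lemma ev_tr:
 assumes N: "lactor R N" and v: "W : CS" "X : CS" "p : ob P W" "h : ob (rh R P N) X"
 shows "X' : CS ==> f : emaps X X' ==> hev P X' (tr (rh R P N) X X' f h) W p = tr N (W ** X) (W ** X') (fpm (%x. x) f) (hev P X h W p)"
  "W' : CS ==> f : emaps W W' ==> hev P X h W' (tr P W W' f p) = tr N (W ** X) (W' ** X) (fpm f (%x. x)) (hev P X h W p)"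
 using bilin_tr_right[OF bilin_ev[OF lP N] Pmk(2) _ v(1,2) _ v(3,4)] bilin_tr_left[OF bilin_ev[OF lP N] rhom_mackey[OF lP N] _ v(1,2) _ v(3,4)] by blast+

lemma tpair_facts:
 assumes N: "lmodule R N"
 shows "bilin (rh R P (ubimod R)) N (rh R P N) (tpair R P N)"
  "X : CS ==> Y : CS ==> d : ob (rh R P (ubimod R)) X ==> x : ob N Y ==> W : CS ==> q : ob P W ==>
   hev P (X ** Y) (tpair R P N X Y d x) W q = tr N ((W ** X) ** Y) (W ** X ** Y) fas (lm R N (W ** X) Y (hev P X d W q) x)"
proof -
 note D = lmoduleD[OF N] lactorD(3)[OF lmoduleD(1)[OF N]] and E = dual_eval_facts
 let ?D = "rh R P (ubimod R)"
 note mk = box_mackey[OF rhR_mackey D(3)]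
 note f1 = box_assoc'_facts[OF Pmk(2) rhR_mackey D(3)] and f2 = box_map_facts[OF E(1) mid_hom box_mackey[OF Pmk(2) rhR_mackey] D(3) Pmk(1) D(3)]
 define H where "H = lact N oM bmap R N (dual_eval n R P) mid oM box_assoc' n P ?D N"
 have H: "H : mhm (bx P (bx ?D N)) N" unfolding H_def by (rule mh_comp[OF mh_comp[OF f1(1) f2(1)] D(6)])
 have Hv: "H (W ** X ** Y) (bp P (bx ?D N) W (X ** Y) q (bp ?D N X Y d x)) =
   tr N ((W ** X) ** Y) (W ** X ** Y) fas (lm R N (W ** X) Y (hev P X d W q) x)"
  if "X : CS" "Y : CS" "d : ob ?D X" "x : ob N Y" "W : CS" "q : ob P W" for X Y d x W q
  using that D Pmk rhR_mackey E(3) by (simp add: H_def mcomp_def f1(2) mh_tr[OF f2(1)] f2(2) E(2) mh_tr[OF D(6)] lm_def)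
 have gen: "H ((B ** W) ** X) (bp P (bx ?D N) (B ** W) X (lm R P B W r m) a) =
   tr N (B ** W ** X) ((B ** W) ** X) fas' (lm R N B (W ** X) r (H (W ** X) (bp P (bx ?D N) W X m a)))"
  if v: "B : CS" "W : CS" "X : CS" "r : ob R B" "m : ob P W" and a: "EX Y Z d x. Y : CS & Z : CS & d : ob ?D Y & x : ob N Z & X = Y ** Z & a = bp ?D N Y Z d x"
  for B W X r m a
 proof -
  obtain Y Z d x where w: "Y : CS" "Z : CS" "d : ob ?D Y" "x : ob N Z" "X = Y ** Z" "a = bp ?D N Y Z d x" using a by (elim exE conjE)
  show ?thesis unfolding w(5,6) using v(1,2,4,5) w(1-4) lP D(1-3) Pmk R E(3) by (simp add: Hv ev_linR D(4)) (rule tr_eqI_ball, simp)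
 qed
 note lin = adjunct_linear[OF lP D(1) mk mgen_box[OF rhR_mackey D(3) mgen_all mgen_all] H gen]
 note ad = rhom_adjunct[OF lP D(1) mk mack_hom_bilin[OF H Pmk(2) mk] lin]
 have k: "(%W m. H (W ** Z) (bp P (bx ?D N) W Z m a)) : mhm P (shift n N Z)" if "Z : CS" "a : ob (bx ?D N) Z" for Z a
  by (rule bilin_fix_right[OF mack_hom_bilin[OF H Pmk(2) mk] mk that])
 have eq: "hom_ext n P N (X ** Y) (%W m. H (W ** X ** Y) (bp P (bx ?D N) W (X ** Y) m (bp ?D N X Y d x))) = tpair R P N X Y d x"
  if v: "X : CS" "Y : CS" "d : ob ?D X" "x : ob N Y" for X Y d x
  unfolding tpair_def by (rule hom_ext_cong[OF Pmk(2) D(3) _ k]) (use v rhR_mackey D(3) in \<open>simp_all add: Hv\<close>)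
 have h: "(%X a. hom_ext n P N X (%W m. H (W ** X) (bp P (bx ?D N) W X m a))) : mhm (bx ?D N) (rh R P N)"
  by (rule ad(1))
 show "bilin ?D N (rh R P N) (tpair R P N)"
  by (rule bilin_cong[OF mack_hom_bilin[OF h rhR_mackey D(3)] rhR_mackey D(3) eq])
 assume v: "X : CS" "Y : CS" "d : ob ?D X" "x : ob N Y" "W : CS" "q : ob P W"
 have c: "bp ?D N X Y d x : ob (bx ?D N) (X ** Y)" using v rhR_mackey D(3) by simp
 show "hev P (X ** Y) (tpair R P N X Y d x) W q = tr N ((W ** X) ** Y) (W ** X ** Y) fas (lm R N (W ** X) Y (hev P X d W q) x)"
  unfolding eq[OF v(1-4), symmetric] Hv[OF v, symmetric] by (rule hom_ext_facts(2)[OF Pmk(2) D(3) _ k[OF _ c]]) (use v in simp_all)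
qed

end

context
 fixes R :: "('r, 'u) green_scheme" and S :: "('s, 'v) green_scheme" and P :: "('r, 'p, 's, 'z) bimod_scheme"
 assumes R: "green_functor n R" and lP: "lactor R P"
begin

abbreviation (input) "rhR == rh R P (ubimod R)"
abbreviation (input) "DM == dual_bimod n R S P"

lemmas lu' = bmodD(1)[OF bmod_ubimod[OF R]]
lemmas rhR_mk = rhom_mackey[OF lP lu']
lemmas Pk' = lactorD(1,2)[OF lP]
lemmas tu = tpair_facts[OF R lP lmodule_ubimod[OF R]]

lemma dual_ract: "ract DM = box_lift rhR (tpair R P (ubimod R))"
 by (simp add: dual_bimod_def tpair_def[abs_def] tr_def structure_graphs gm_def hom_ext_same[OF same_ubimod])

text \<open>The right action on the dual is the tensor-Hom pairing into R: (d.r)(q) = d(q) r.\<close>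

lemma dual_ractor:
 shows "ractor R DM"
  "X : CS ==> Y : CS ==> d : ob rhR X ==> r : ob R Y ==> rm DM R X Y d r = tpair R P (ubimod R) X Y d r"
  "X : CS ==> Y : CS ==> d : ob rhR X ==> r : ob R Y ==> rm DM R X Y d r : ob rhR (X ** Y)"
  "X : CS ==> Y : CS ==> d : ob rhR X ==> r : ob R Y ==> W : CS ==> q : ob P W ==>
   hev P (X ** Y) (rm DM R X Y d r) W q = tr R ((W ** X) ** Y) (W ** X ** Y) fas (gm R (W ** X) Y (hev P X d W q) r)"
proof -
 have b: "bilin rhR R rhR (tpair R P (ubimod R))" using tu(1) by simp
 note l = box_lift_facts[OF rhR_mk Pk'(1) rhR_mk b, folded dual_ract]
 show "ractor R DM" using l(1) Pk'(1) rhR_mk by (simp add: ractor_def)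
 show rm: "rm DM R X Y d r = tpair R P (ubimod R) X Y d r" if "X : CS" "Y : CS" "d : ob rhR X" "r : ob R Y" for X Y d r
  using l(2)[OF that] by (simp add: rm_def)
 show "X : CS ==> Y : CS ==> d : ob rhR X ==> r : ob R Y ==> rm DM R X Y d r : ob rhR (X ** Y)"
  using rm bilinD(1)[OF b] by simp
 show "hev P (X ** Y) (rm DM R X Y d r) W q = tr R ((W ** X) ** Y) (W ** X ** Y) fas (gm R (W ** X) Y (hev P X d W q) r)"
  if "X : CS" "Y : CS" "d : ob rhR X" "r : ob R Y" "W : CS" "q : ob P W"
  unfolding rm[OF that(1-4)] using tu(2)[of X Y d r W q] that by simp
qed

text \<open>The pairing is balanced since (d.r)(q).x = d(q) r.x = d(q).(r.x).\<close>

lemma tensor_hom_facts: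
 assumes N: "lmodule R N"
 shows "tensor_hom n R P N : mhm (rbx R DM N) (rh R P N)"
  "X : CS ==> Y : CS ==> d : ob rhR X ==> x : ob N Y ==> tensor_hom n R P N (X ** Y) (rp R DM N X Y d x) = tpair R P N X Y d x"
proof -
 note D = lmoduleD[OF N] and t = tpair_facts[OF R lP N] and E = dual_eval_facts[OF R lP]
 note rN = rhom_mackey[OF lP D(1)]
 note l = box_lift_facts[OF rhR_mk D(3) rN t(1)]
 have h: "box_lift (rh R P N) (tpair R P N) : mhm (bx DM N) (rh R P N)" using l(1) by simp
 have e: "tensor_hom n R P N = desc (box_lift (rh R P N) (tpair R P N))"
  by (simp add: tensor_hom_def tpair_def[abs_def] tr_def structure_graphs lm_def)
 have bal: "box_lift (rh R P N) (tpair R P N) ((Y ** A) ** Z) (bp DM N (Y ** A) Z (rm DM R Y A m s) k) =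
   tr (rh R P N) (Y ** A ** Z) ((Y ** A) ** Z) fas' (box_lift (rh R P N) (tpair R P N) (Y ** A ** Z) (bp DM N Y (A ** Z) m (lm R N A Z s k)))"
  if v: "Y : CS" "A : CS" "Z : CS" "m : ob DM Y" "s : ob R A" "k : ob N Z" for Y A Z m s k
 proof -
  have m: "m : ob rhR Y" using v by simp
  have rc: "rm DM R Y A m s : ob rhR (Y ** A)" by (rule dual_ractor(3)[OF v(1,2) m v(5)])
  have c: "tpair R P N (Y ** A) Z (rm DM R Y A m s) k : ob (rh R P N) ((Y ** A) ** Z)" "tpair R P N Y (A ** Z) m (lm R N A Z s k) : ob (rh R P N) (Y ** A ** Z)"
   using bilinD(1)[OF t(1)] v rc m D(1) by simp_all
  have "tpair R P N (Y ** A) Z (rm DM R Y A m s) k = tr (rh R P N) (Y ** A ** Z) ((Y ** A) ** Z) fas' (tpair R P N Y (A ** Z) m (lm R N A Z s k))"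
  proof (rule rhom_eqI[OF lP D(1) _ c(1)])
   fix W q assume w: "W : CS" "q : ob P W"
   show "hev P ((Y ** A) ** Z) (tpair R P N (Y ** A) Z (rm DM R Y A m s) k) W q =
    hev P ((Y ** A) ** Z) (tr (rh R P N) (Y ** A ** Z) ((Y ** A) ** Z) fas' (tpair R P N Y (A ** Z) m (lm R N A Z s k))) W q"
    using v(1-3,5,6) w m rc c D(1-3) R E(3) by (simp add: ev_tr[OF R lP D(1)] t(2) dual_ractor(4) D(4)) (rule tr_eqI_ball, simp)
  qed (use v rN c in simp_all)
  then show ?thesis using v m rc D(1) l(2) by simp
 qed
 note d = rbox_desc[OF dual_ractor(1) D(1) rN h mgen_all mgen_all mgen_all bal, folded e]
 show "tensor_hom n R P N : mhm (rbx R DM N) (rh R P N)" by (rule d(1))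
 show "X : CS ==> Y : CS ==> d : ob rhR X ==> x : ob N Y ==> tensor_hom n R P N (X ** Y) (rp R DM N X Y d x) = tpair R P N X Y d x"
  using d(3)[of X Y d x] l(2)[of X Y d x] by simp
qed

end

section \<open>The Hattori--Stallings trace through the duality data\<close>

text \<open>The contraction (q, d \<otimes> p) \<mapsto> \<epsilon>(q \<otimes> d).p.\<close>

definition Gcap where
 "Gcap R S P D ep W Y q y = (olunit P oM odot_map n R (ubimod R) P ep mid oM oassoc' n R S R S P D P) (W ** Y)
  (rp S P (odo S R S D P) W Y q y)"

text \<open>The comparison d \<mapsto> \<epsilon>(- \<otimes> d) from the given dual to the module of linear maps.\<close>

definition ehat where
 "ehat R S P D ep = (%X d. hom_ext n P (ubimod R) X (%W q. ep (W ** X) (rp S P D W X q d)))"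

context
 fixes R :: "('r, 'u) green_scheme" and S :: "('s, 'v) green_scheme" and P :: "('r, 'p, 's, 'z) bimod_scheme" and ta
  and D :: "('s, 'd, 'r, 'w) bimod_scheme" and si et ep and f :: "cset => 'p => 'p"
 assumes R: "green_functor n R" and S: "green_functor n S" and tw: "twist_cell n R S P ta"
  and du: "left_dual n R S P ta D si et ep" and f: "twist_2cell n R S P ta P ta f"
begin

lemmas PB = P_bmod[OF R S tw] and DB = db[OF R S tw du f]
lemmas PM = P_modules[OF R S tw] and PK = P_kap[OF R S tw]
lemmas EE = eps_facts[OF R S tw du f] and HH = eta_facts[OF R S tw du f]
lemmas lP = bmodD(1)[OF P_bmod[OF R S tw]]
lemmas lU = bmodD(1)[OF bmod_ubimod[OF R]]
lemmas PDc = rp_eps_closed[OF R S tw du f]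
lemmas rhD = rhom_mackey[OF lP lU]

lemma mk_DP: "mackey (rbx R D P)" "mackey (rbx S P D)"
 using rbox_mackey[OF bmodD(2)[OF DB] lP] rbox_mackey[OF bmodD(2)[OF PB] bmodD(1)[OF DB]] .

lemma gen_DP: "mgen (rbx R D P) (%X x. EX A B d p. A : CS & B : CS & d : ob D A & p : ob P B & X = A ** B & x = rp R D P A B d p)"
 by (rule mgen_rbox[OF bmodD(2)[OF DB] lP mgen_all mgen_all])

text \<open>The last claim is a triangle identity: contracting q with \<eta>(1) gives q back.\<close>

lemma Gcap_facts:
 shows "bilin P (rbx R D P) P (Gcap R S P D ep)"
  "W : CS ==> A : CS ==> B : CS ==> q : ob P W ==> d : ob D A ==> p : ob P B ==>
   Gcap R S P D ep W (A ** B) q (rp R D P A B d p) = tr P ((W ** A) ** B) (W ** A ** B) fas (lm R P (W ** A) B (ep (W ** A) (rp S P D W A q d)) p)"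
  "W : CS ==> q : ob P W ==> Gcap R S P D ep W pt q (et pt (gone n S)) = tr P W (W ** pt) fru' q"
proof -
 let ?DP = "odo S R S D P" and ?PD = "odo R S R P D"
 note bDP = odot_bmod[OF DB PB] and bPD = odot_bmod[OF PB DB] and uR = bmod_ubimod[OF R] and uS = bmod_ubimod[OF S]
 note pd = bmodD[OF PB] and dd = bmodD[OF DB] and gS = green_facts[OF S]
 note oa = oassoc'_facts[OF PB DB PB]
 have e: "ep : mhm ?PD (ubimod R)" using EE(1) by simp
 have el: "ep (Y ** C) (rm ?PD R Y C a s) = rm (ubimod R) R Y C (ep Y a) s" if "Y : CS" "C : CS" "a : ob ?PD Y" "s : ob R C" for Y C a s
  using EE(3)[OF that(1,2) _ that(4), of a] that by simp
 note m1 = odot_map_left[OF bmodD(2)[OF bPD] lP bmodD(2)[OF uR] e mgen_all el, simplified]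
 note ol = olunit_facts[OF R PM(1)]
 define F where "F = olunit P oM odot_map n R (ubimod R) P ep mid oM oassoc' n R S R S P D P"
 have F: "F : mhm (rbx S P ?DP) P" unfolding F_def by (rule mh_comp[OF mh_comp[OF oa(1) m1(1)] ol(1)])
 note k1 = pd(2) bmodD(1)[OF bDP] and k2 = bmodD(2)[OF bPD] lP and k3 = bmodD(2)[OF uR] lP
 have b: "bilin P (rbx R D P) (rbx S P ?DP) (rp S P ?DP)" using bilin_rp[OF k1] by simp
 show bG: "bilin P (rbx R D P) P (Gcap R S P D ep)" unfolding Gcap_def[abs_def] F_def[symmetric] by (rule bilin_comp[OF F b])
 show "Gcap R S P D ep W (A ** B) q (rp R D P A B d p) = tr P ((W ** A) ** B) (W ** A ** B) fas (lm R P (W ** A) B (ep (W ** A) (rp S P D W A q d)) p)"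
  if v: "W : CS" "A : CS" "B : CS" "q : ob P W" "d : ob D A" "p : ob P B"
 proof -
  have c: "rp S P D W A q d : ob (rbx S P D) (W ** A)" using PDc v by blast
  have e1: "ep (W ** A) (rp S P D W A q d) : ob R (W ** A)" by (rule mhD(1)[OF EE(1) _ c]) (use v in simp)
  have c2: "rp R ?PD P (W ** A) B (rp S P D W A q d) p : ob (rbx R ?PD P) ((W ** A) ** B)"
   using rp_closed[OF k2, of "W ** A" B "rp S P D W A q d" p] v c by simp
  have c3: "rp R (ubimod R) P (W ** A) B (ep (W ** A) (rp S P D W A q d)) p : ob (rbx R (ubimod R) P) ((W ** A) ** B)"
   using rp_closed[OF k3, of "W ** A" B "ep (W ** A) (rp S P D W A q d)" p] v e1 by simp
  show ?thesis unfolding Gcap_def using v c c2 c3 e1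
   by (simp add: mcomp_def oa(2) mh_tr[OF m1(1)] m1(2) mh_tr[OF ol(1)] ol(3))
 qed
 assume W: "W : CS" and q: "q : ob P W"
 have h: "et : mhm (ubimod S) ?DP" using HH(1) by simp
 have hl: "et (C ** Z) (lm S (ubimod S) C Z s b) = lm S ?DP C Z s (et Z b)" if "C : CS" "Z : CS" "s : ob S C" "b : ob (ubimod S) Z" for C Z s b
  using HH(2)[OF that(1-3), of b] that by simp
 note m2 = odot_map_right[OF pd(2) bmodD(1)[OF uS] bmodD(1)[OF bDP] h mgen_all hl, simplified]
 have t: "mack_eq n P (olunit P oM odot_map n R (ubimod R) P ep mid oM oassoc' n R S R S P D P oM odot_map n S P ?DP mid et oM orunit' n R S P) mid"
  using du unfolding left_dual_def by blast
 have c1: "rp S P (ubimod S) W pt q (gone n S) : ob (rbx S P (ubimod S)) (W ** pt)"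
  using rp_closed[OF pd(2) bmodD(1)[OF uS] W cpoint_csets q] gS(4) by simp
 have y: "et pt (gone n S) : ob (rbx R D P) pt" by (rule mhD(1)[OF HH(1) cpoint_csets gS(4)])
 have c2: "rp S P ?DP W pt q (et pt (gone n S)) : ob (rbx S P ?DP) (W ** pt)" by (rule bilinD(1)[OF b W cpoint_csets q y])
 have c3: "F (W ** pt) (rp S P ?DP W pt q (et pt (gone n S))) : ob P (W ** pt)" by (rule mhD(1)[OF F _ c2]) (use W in simp)
 have "F W (odot_map n S P ?DP mid et W (orunit' n R S P W q)) = q"
  using mack_eqD[OF t W q] by (simp add: mcomp_def F_def)
 then have "tr P (W ** pt) W fru (F (W ** pt) (rp S P ?DP W pt q (et pt (gone n S)))) = q"
  using W q gS(4) c1 c2 by (simp add: PK(7) kap_def mh_tr[OF m2(1)] m2(2) mh_tr[OF F])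
 then have "tr P W (W ** pt) fru' (tr P (W ** pt) W fru (F (W ** pt) (rp S P ?DP W pt q (et pt (gone n S))))) = tr P W (W ** pt) fru' q"
  by simp
 then show "Gcap R S P D ep W pt q (et pt (gone n S)) = tr P W (W ** pt) fru' q"
  unfolding Gcap_def F_def[symmetric] using W c3 pd by (simp add: tr_id_ball)
qed

lemma ehat_facts:
 shows "ehat R S P D ep : mhm D (rh R P (ubimod R))"
  "X : CS ==> d : ob D X ==> W : CS ==> q : ob P W ==> hev P X (ehat R S P D ep X d) W q = ep (W ** X) (rp S P D W X q d)"
  "X : CS ==> Y : CS ==> d : ob D X ==> r : ob R Y ==>
   ehat R S P D ep (X ** Y) (rm D R X Y d r) = rm (dual_bimod n R S P) R X Y (ehat R S P D ep X d) r"
proof -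
 note pd = bmodD[OF PB] and dd = bmodD[OF DB] and o = odot_facts(3,4)[OF PB DB]
 have ec: "ep (W ** X) (rp S P D W X q d) : ob R (W ** X)" if "W : CS" "X : CS" "q : ob P W" "d : ob D X" for W X q d
  by (rule mhD(1)[OF EE(1) _ PDc]) (use that in simp_all)
 have b: "bilin P D (ubimod R) (%W X q d. ep (W ** X) (rp S P D W X q d))"
  using bilin_comp[OF EE(1) bilin_rp[OF pd(2) dd(1)]] by simp
 have lin: "ep ((B ** W) ** X) (rp S P D (B ** W) X (lm R P B W r q) d) =
   tr (ubimod R) (B ** W ** X) ((B ** W) ** X) fas' (lm R (ubimod R) B (W ** X) r (ep (W ** X) (rp S P D W X q d)))"
  if v: "B : CS" "W : CS" "X : CS" "r : ob R B" "q : ob P W" "d : ob D X" for B W X r q d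
 proof -
  have "gm R B (W ** X) r (ep (W ** X) (rp S P D W X q d)) = ep (B ** W ** X) (lm R (odo R S R P D) B (W ** X) r (rp S P D W X q d))"
   using EE(2)[of B "W ** X" r "rp S P D W X q d"] v PDc by simp
  also have "... = tr R ((B ** W) ** X) (B ** W ** X) fas (ep ((B ** W) ** X) (rp S P D (B ** W) X (lm R P B W r q) d))"
   using v pd dd PDc by (simp add: o mh_tr[OF EE(1)])
  finally show ?thesis using v pd ec[of "B ** W" X "lm R P B W r q" d] by (simp add: tr_id_ball)
 qed
 note ad = rhom_adjunct[OF lP lU dd(5) b lin]
 show h: "ehat R S P D ep : mhm D (rh R P (ubimod R))" unfolding ehat_def by (rule ad(1))
 show ev: "hev P X (ehat R S P D ep X d) W q = ep (W ** X) (rp S P D W X q d)" if "X : CS" "d : ob D X" "W : CS" "q : ob P W" for X d W q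
  unfolding ehat_def by (rule ad(2)[OF _ _ _ _ _ _ that])
 assume v: "X : CS" "Y : CS" "d : ob D X" "r : ob R Y"
 note ec' = mhD(1)[OF h v(1,3)]
 have m: "rm D R X Y d r : ob D (X ** Y)" using v dd by simp
 note DR = dual_ractor[OF R lP, where S = S]
 show "ehat R S P D ep (X ** Y) (rm D R X Y d r) = rm (dual_bimod n R S P) R X Y (ehat R S P D ep X d) r"
 proof (rule rhom_eqI[OF lP lU])
  fix W q assume w: "W : CS" "q : ob P W"
  have "gm R (W ** X) Y (ep (W ** X) (rp S P D W X q d)) r = ep ((W ** X) ** Y) (rm (odo R S R P D) R (W ** X) Y (rp S P D W X q d) r)"
   using EE(3)[of "W ** X" Y "rp S P D W X q d" r] v w PDc by simp
  also have "... = tr R (W ** X ** Y) ((W ** X) ** Y) fas' (ep (W ** X ** Y) (rp S P D W (X ** Y) q (rm D R X Y d r)))"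
   using v w pd dd PDc by (simp add: o mh_tr[OF EE(1)])
  finally show "hev P (X ** Y) (ehat R S P D ep (X ** Y) (rm D R X Y d r)) W q = hev P (X ** Y) (rm (dual_bimod n R S P) R X Y (ehat R S P D ep X d) r) W q"
   using v w m ec' pd ec[of W "X ** Y" q "rm D R X Y d r"] by (simp add: ev DR(4) tr_id_ball)
 qed (use v m ec' mhD(1)[OF h] DR(3) in simp_all)
qed

text \<open>The formula is balanced over R: (d.r) \<otimes> p goes to \<epsilon>(- \<otimes> d) r \<otimes> h(p), and d \<otimes> r.p to
\<epsilon>(- \<otimes> d) \<otimes> h(r.p), and h is linear.\<close>

lemma dual_tensor_pairing:
 assumes g: "g : CG"
 defines "N == ltw n R g P" and "L == rbx R (dual_bimod n R S P) (ltw n R g P)"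
 obtains Z where "bilin (rbx R D P) (rh R P N) L Z"
  "!!A B X d p h. A : CS ==> B : CS ==> X : CS ==> d : ob D A ==> p : ob P B ==> h : ob (rh R P N) X ==>
   Z (A ** B) X (rp R D P A B d p) h = tr L (A ** B ** X) ((A ** B) ** X) fas'
    (rp R (dual_bimod n R S P) N A (B ** X) (ehat R S P D ep A d) (hev P X h B p))"
proof -
 let ?E = "dual_bimod n R S P" and ?H = "rh R P N"
 note pd = bmodD[OF PB] and dd = bmodD[OF DB]
 have lN: "lactor R N" unfolding N_def by (rule lactor_ltw[OF lP g])
 note DR = dual_ractor[OF R lP, where S = S] and eh = ehat_facts
 have rh: "mackey ?H" by (rule rhom_mackey[OF lP lN])
 have sN: "same N P" unfolding N_def by (rule same_ltw)
 note sN' = same_rules[OF sN]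
 have bev: "bilin P ?H P (%W X m h. hev P X h W m)" using bilin_ev[OF lP lN] unfolding sN' .
 have evc: "hev P X h W p : ob P (W ** X)" if "W : CS" "X : CS" "p : ob P W" "h : ob ?H X" for W X p h by (rule bilinD(1)[OF bev that])
 note lv = box_lift_facts[OF pd(5) rh pd(5) bev]
 have mL: "mackey L" unfolding L_def by (rule rbox_mackey[OF DR(1) lN[unfolded N_def]])
 have pr: "rproj n R ?E N : mhm (bx (rh R P (ubimod R)) P) L" using rproj_hom[OF DR(1) lN] unfolding L_def N_def by simp
 note f1 = box_assoc_facts[OF dd(5) pd(5) rh] and f2 = box_map_facts[OF eh(1) lv(1) dd(5) box_mackey[OF pd(5) rh] rhD pd(5)]
 define K where "K = rproj n R ?E N oM bmap (rh R P (ubimod R)) P (ehat R S P D ep) (box_lift P (%W X m h. hev P X h W m)) oM box_assoc n D P ?H"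
 have K: "K : mhm (bx (bx D P) ?H) L" unfolding K_def by (rule mh_comp[OF mh_comp[OF f1(1) f2(1)] pr])
 have Kv: "K ((A ** B) ** X) (bp (bx D P) ?H (A ** B) X (bp D P A B d p) h) =
   tr L (A ** B ** X) ((A ** B) ** X) fas' (rp R ?E N A (B ** X) (ehat R S P D ep A d) (hev P X h B p))"
  if "A : CS" "B : CS" "X : CS" "d : ob D A" "p : ob P B" "h : ob ?H X" for A B X d p h
  using that dd pd rh rhD evc mhD(1)[OF eh(1)]
  by (simp add: K_def mcomp_def f1(2) mh_tr[OF f2(1)] f2(2) lv(2) mh_tr[OF pr]) (simp add: rp_def N_def)
 have tc: "rp R ?E N A B e x : ob L (A ** B)" if "A : CS" "B : CS" "e : ob (rh R P (ubimod R)) A" "x : ob P B" for A B e x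
  using rp_closed[OF DR(1) lN that(1,2), of e x] that sN' unfolding L_def N_def by simp
 have bal: "K (((Y ** A) ** Z) ** B) (bp (bx D P) ?H ((Y ** A) ** Z) B (bp D P (Y ** A) Z (rm D R Y A m s) k) r) =
   tr L ((Y ** A ** Z) ** B) (((Y ** A) ** Z) ** B) (fpm fas' (%x. x))
    (K ((Y ** A ** Z) ** B) (bp (bx D P) ?H (Y ** A ** Z) B (bp D P Y (A ** Z) m (lm R P A Z s k)) r))"
  if v: "B : CS" "Y : CS" "A : CS" "Z : CS" "r : ob ?H B" "m : ob D Y" "s : ob R A" "k : ob P Z" for B Y A Z r m s k
 proof -
  note e = mhD(1)[OF eh(1) v(2,6)]
  have x: "hev P B r Z k : ob P (Z ** B)" by (rule evc[OF v(4,1,8,5)])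
  have lx: "lm R N A (Z ** B) s (hev P B r Z k) : ob P (A ** Z ** B)" using lm_closed[OF lN v(3) _ v(7), of "Z ** B" "hev P B r Z k"] v x unfolding sN' by simp
  have ll: "hev P B r (A ** Z) (lm R P A Z s k) = tr P (A ** Z ** B) ((A ** Z) ** B) fas' (lm R N A (Z ** B) s (hev P B r Z k))"
   using rhom_lin[OF lP lN v(1,5) v(3,4,7,8)] unfolding sN' .
  have bb: "rp R ?E N (Y ** A) (Z ** B) (rm ?E R Y A (ehat R S P D ep Y m) s) (hev P B r Z k) =
   tr L (Y ** A ** Z ** B) ((Y ** A) ** Z ** B) fas' (rp R ?E N Y (A ** Z ** B) (ehat R S P D ep Y m) (lm R N A (Z ** B) s (hev P B r Z k)))"
   using rp_balanced[OF DR(1) lN v(2,3) _ _ v(7), of "Z ** B" "ehat R S P D ep Y m" "hev P B r Z k"] v e x unfolding L_def[folded N_def, symmetric] sN' by simp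
  have tt: "rp R ?E N Y ((A ** Z) ** B) (ehat R S P D ep Y m) (tr P (A ** Z ** B) ((A ** Z) ** B) fas' w) =
   tr L (Y ** A ** Z ** B) (Y ** (A ** Z) ** B) (fpm (%x. x) fas') (rp R ?E N Y (A ** Z ** B) (ehat R S P D ep Y m) w)" if w: "w : ob P (A ** Z ** B)" for w
   using rp_tr(2)[OF DR(1) lN v(2), of "A ** Z ** B" "(A ** Z) ** B" fas' "ehat R S P D ep Y m" w] v e w unfolding L_def[folded N_def, symmetric] sN' by simp
  show ?thesis using v e x lx dd pd mL tc[of "Y" "A ** Z ** B"]
   by (simp add: Kv eh(3) bb ll tt) (rule tr_eqI_ball, simp)
 qed
 note rl = rbox_left[OF dd(2) lP rh mL K bal]
 define Z where "Z = (%X A c r. the_elem ((%t. K (X ** A) (bp (bx D P) ?H X A t r)) ` c))"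
 show ?thesis
 proof (rule that[of Z])
  show "bilin (rbx R D P) ?H L Z" unfolding Z_def by (rule rl(1))
  show "Z (A ** B) X (rp R D P A B d p) h = tr L (A ** B ** X) ((A ** B) ** X) fas'
    (rp R ?E N A (B ** X) (ehat R S P D ep A d) (hev P X h B p))"
   if v: "A : CS" "B : CS" "X : CS" "d : ob D A" "p : ob P B" "h : ob ?H X" for A B X d p h
   unfolding Kv[OF v, symmetric] Z_def by (rule rl(2)) (use v in simp_all)
 qed
qed

end

text \<open>The map e \<otimes> x \<mapsto> q(e(x)), which is the Hattori--Stallings trace before inverting tensor-Hom.\<close>

definition dual_trace where
 "dual_trace R S P g = desc (tHH0_proj n R g (ubimod R) oM dual_eval n R P oM box_sym n (dual_bimod n R S P) P)"

context
 fixes R :: "('r, 'u) green_scheme" and S :: "('s, 'v) green_scheme" and P :: "('r, 'p, 's, 'z) bimod_scheme" and ta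
  and D :: "('s, 'd, 'r, 'w) bimod_scheme" and si et ep and f :: "cset => 'p => 'p" and g :: int
 assumes R: "green_functor n R" and S: "green_functor n S" and tw: "twist_cell n R S P ta"
  and du: "left_dual n R S P ta D si et ep" and f: "twist_2cell n R S P ta P ta f" and g: "g : CG"
begin

lemmas pB = P_bmod[OF R S tw] and dB = db[OF R S tw du f]
lemmas pM = P_modules[OF R S tw]
lemmas eF = eps_facts[OF R S tw du f] and hF = eta_facts[OF R S tw du f] and fF = f_facts[OF R S tw du f]
lemmas lP1 = bmodD(1)[OF P_bmod[OF R S tw]] and lU1 = bmodD(1)[OF bmod_ubimod[OF R]]
lemmas pdc = rp_eps_closed[OF R S tw du f] and dpc = rp_eta_closed[OF R S tw du f]
lemmas rhd = rhom_mackey[OF lP1 lU1]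
lemmas mkdp = mk_DP[OF R S tw du f] and gendp = gen_DP[OF R S tw du f]
lemmas gcap = Gcap_facts[OF R S tw du f] and ehf = ehat_facts[OF R S tw du f]
lemmas lN = lmodule_ltw[OF P_modules(1)[OF R S tw] R g]
lemmas dr = dual_ractor[OF R lP1, where S = S] and th = tensor_hom_facts[OF R lP1 lN, where S = S]
lemmas sN = same_rules[OF same_ltw]
lemmas rhN = rhom_mackey[OF lP1 lmoduleD(1)[OF lN]]
lemmas de = dual_eval_facts[OF R lP1] and tp = tpair_facts[OF R lP1 lN]

abbreviation (input) "trd == dual_trace R S P g"
abbreviation (input) "QR == tHH0_proj n R g (ubimod R)"
abbreviation (input) "tH == tHH0 n R g (ubimod R)"
abbreviation (input) "EP == dual_bimod n R S P"
abbreviation (input) "gP == ltw n R g P"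
abbreviation (input) "LL == rbx R (dual_bimod n R S P) (ltw n R g P)"
abbreviation (input) "hP == rh R P (ltw n R g P)"
abbreviation (input) "hR == rh R P (ubimod R)"

lemma tH_facts:
 shows "mackey tH" "QR : mhm R tH"
  "Y : CS ==> Z : CS ==> a : ob R Y ==> b : ob R Z ==>
   QR (Y ** Z) (gm R Y Z (galpha n R g Y a) b) = tr tH (Z ** Y) (Y ** Z) fsw (QR (Z ** Y) (gm R Z Y b a))"
proof -
 note b = bmod_ltw[OF bmod_ubimod[OF R] g]
 show "mackey tH" unfolding tHH0_def by (rule HH0_mackey[OF bmodD(1,2)[OF b]])
 show "QR : mhm R tH" using HH0_proj_hom[OF bmodD(1,2)[OF b]] by (simp add: tHH0_def tHH0_proj_def)
 show "Y : CS ==> Z : CS ==> a : ob R Y ==> b : ob R Z ==>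
   QR (Y ** Z) (gm R Y Z (galpha n R g Y a) b) = tr tH (Z ** Y) (Y ** Z) fsw (QR (Z ** Y) (gm R Z Y b a))"
  using HH0_cyclic[OF bmodD(1,2)[OF b], of Y Z a b] g by (simp add: tHH0_def tHH0_proj_def lm_ltw[OF lU1])
qed

lemma LL_rp: "A : CS ==> B : CS ==> e : ob hR A ==> x : ob P B ==> rp R EP gP A B e x : ob LL (A ** B)"
 using rp_closed[OF dr(1) lmoduleD(1)[OF lN], of A B e x] by simp

lemma LL_mackey: "mackey LL"
 by (rule rbox_mackey[OF dr(1) lmoduleD(1)[OF lN]])

text \<open>Twisting x by g makes the evaluation compatible with balancing only up to the relation of twisted HH_0.\<close>

lemma trd_facts:
 shows "trd : mhm LL tH"
  "A : CS ==> B : CS ==> d : ob hR A ==> x : ob P B ==>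
   trd (A ** B) (rp R EP gP A B d x) = tr tH (B ** A) (A ** B) fsw (QR (B ** A) (hev P A d B x))"
proof -
 note pd = bmodD[OF pB] and T = tH_facts and gR = green_facts[OF R]
 note s = box_sym_facts[OF rhd pd(5)]
 define h where "h = QR oM dual_eval n R P oM box_sym n EP P"
 have hh: "h : mhm (bx EP gP) tH"
  using mh_comp[OF mh_comp[OF s(1) de(1)] T(2)] by (simp add: h_def)
 have Qc: "QR X r : ob tH X" if "X : CS" "r : ob R X" for X r by (rule mhD(1)[OF T(2) that])
 have hv: "h (A ** B) (bp EP gP A B d x) = tr tH (B ** A) (A ** B) fsw (QR (B ** A) (hev P A d B x))"
  if "A : CS" "B : CS" "d : ob hR A" "x : ob P B" for A B d x
  using that rhd pd de(3) by (simp add: h_def mcomp_def s(2) mh_tr[OF de(1)] de(2) mh_tr[OF T(2)])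
 have bal: "h ((Y ** A) ** Z) (bp EP gP (Y ** A) Z (rm EP R Y A d r) x) =
   tr tH (Y ** A ** Z) ((Y ** A) ** Z) fas' (h (Y ** A ** Z) (bp EP gP Y (A ** Z) d (lm R gP A Z r x)))"
  if v: "Y : CS" "A : CS" "Z : CS" "d : ob EP Y" "r : ob R A" "x : ob gP Z" for Y A Z d r x
 proof -
  have d: "d : ob hR Y" and x: "x : ob P Z" using v by simp_all
  note e = de(3)[OF v(3,1) x d] and dr3 = dr(3)[OF v(1,2) d v(5)]
  have a: "galpha n R g A r : ob R A" using v g gR(1) by simp
  show ?thesis
   using v(1-3,5) d x e dr3 a pd R T(1) Qc g gR(1)
   by (simp add: hv[simplified] lm_ltw[OF lP1] dr(4) ev_linR[OF R lP1] mh_tr[OF T(2)] T(3)) (rule tr_eqI_ball, simp)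
 qed
 note d = rbox_desc[OF dr(1) lmoduleD(1)[OF lN] T(1) hh mgen_all mgen_all mgen_all bal]
 have e: "trd = desc h" by (simp add: dual_trace_def h_def)
 show "trd : mhm LL tH" unfolding e by (rule d(1))
 show "A : CS ==> B : CS ==> d : ob hR A ==> x : ob P B ==>
   trd (A ** B) (rp R EP gP A B d x) = tr tH (B ** A) (A ** B) fsw (QR (B ** A) (hev P A d B x))"
  unfolding e using d(3)[of A B d x] hv[of A B d x] by simp
qed

lemma evN: "bilin P hP P (%W X m h. hev P X h W m)"
 using bilin_ev[OF lP1 lmoduleD(1)[OF lN]] by simp

lemma evN_closed: "W : CS ==> X : CS ==> p : ob P W ==> h : ob hP X ==> hev P X h W p : ob P (W ** X)"
 by (rule bilinD(1)[OF evN])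

lemma eps_closed: "W : CS ==> X : CS ==> q : ob P W ==> d : ob D X ==> ep (W ** X) (rp S P D W X q d) : ob R (W ** X)"
 by (rule mhD(1)[OF eF(1) _ pdc]) simp_all

lemma tp_value: "X : CS ==> Y : CS ==> d : ob hR X ==> x : ob P Y ==> W : CS ==> q : ob P W ==>
  hev P (X ** Y) (tpair R P gP X Y d x) W q = tr P ((W ** X) ** Y) (W ** X ** Y) fas (lm R P (W ** X) Y (galpha n R g (W ** X) (hev P X d W q)) x)"
 using tp(2)[of X Y d x W q] de(3) g by (simp add: lm_ltw[OF lP1])

lemma evN_lin: "X : CS ==> h : ob hP X ==> A : CS ==> W : CS ==> r : ob R A ==> m : ob P W ==>
  hev P X h (A ** W) (lm R P A W r m) = tr P (A ** W ** X) ((A ** W) ** X) fas' (lm R P A (W ** X) (galpha n R g A r) (hev P X h W m))"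
 using rhom_lin[OF lP1 lmoduleD(1)[OF lN]] g evN_closed by (simp add: lm_ltw[OF lP1])

lemma evN_tr:
 assumes v: "W : CS" "X : CS" "p : ob P W" "h : ob hP X"
 shows "X' : CS ==> k : emaps X X' ==> hev P X' (tr hP X X' k h) W p = tr P (W ** X) (W ** X') (fpm (%x. x) k) (hev P X h W p)"
  "W' : CS ==> k : emaps W W' ==> hev P X h W' (tr P W W' k p) = tr P (W ** X) (W' ** X) (fpm k (%x. x)) (hev P X h W p)"
 using ev_tr[OF R lP1 lmoduleD(1)[OF lN] v] by simp_all

context
 fixes Z
 assumes Zb: "bilin (rbx R D P) hP LL Z"
  and Zv: "!!A B X d p h. A : CS ==> B : CS ==> X : CS ==> d : ob D A ==> p : ob P B ==> h : ob hP X ==>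
   Z (A ** B) X (rp R D P A B d p) h = tr LL (A ** B ** X) ((A ** B) ** X) fas'
    (rp R EP gP A (B ** X) (ehat R S P D ep A d) (hev P X h B p))"
begin

lemma Z_lift:
 shows "box_lift LL Z : mhm (bx (rbx R D P) hP) LL"
  "Y : CS ==> X : CS ==> y : ob (rbx R D P) Y ==> h : ob hP X ==> box_lift LL Z (Y ** X) (bp (rbx R D P) hP Y X y h) = Z Y X y h"
 using box_lift_facts[OF mkdp(1) rhN LL_mackey Zb] by blast+

lemma G_lift:
 shows "box_lift P (Gcap R S P D ep) : mhm (bx P (rbx R D P)) P"
  "W : CS ==> Y : CS ==> q : ob P W ==> y : ob (rbx R D P) Y ==>
   box_lift P (Gcap R S P D ep) (W ** Y) (bp P (rbx R D P) W Y q y) = Gcap R S P D ep W Y q y"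
 using box_lift_facts[OF lactorD(2)[OF lP1] mkdp(1) lactorD(2)[OF lP1] gcap(1)] by blast+

text \<open>On y = d \<otimes> p: the value at q is \<epsilon>(q \<otimes> d).h(p) = h(\<epsilon>(q \<otimes> d).p).\<close>

lemma tensor_Z:
 assumes v: "W : CS" "Y : CS" "X : CS" "q : ob P W" "y : ob (rbx R D P) Y" "h : ob hP X"
 shows "hev P (Y ** X) (tensor_hom n R P gP (Y ** X) (Z Y X y h)) W q =
  tr P ((W ** Y) ** X) (W ** Y ** X) fas (hev P X h (W ** Y) (Gcap R S P D ep W Y q y))"
proof -
 note pd = bmodD[OF pB] and zl = Z_lift and gl = G_lift
 note el = box_lift_facts[OF pd(5) rhN pd(5) evN]
 define E where "E = box_lift P (%W X m h. hev P X h W m)"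
 define ZT where "ZT = tensor_hom n R P gP oM box_lift LL Z"
 have ZT: "ZT : mhm (bx (rbx R D P) hP) hP" unfolding ZT_def by (rule mh_comp[OF zl(1) th(1)])
 have Zc: "Z Y X y h : ob LL (Y ** X)" if "Y : CS" "X : CS" "y : ob (rbx R D P) Y" "h : ob hP X" for Y X y h
  by (rule bilinD(1)[OF Zb that])
 note f1 = box_map_facts[OF mid_hom ZT pd(5) box_mackey[OF mkdp(1) rhN] pd(5) rhN]
 note f2 = box_assoc'_facts[OF pd(5) mkdp(1) rhN] and f3 = box_map_facts[OF gl(1) mid_hom box_mackey[OF pd(5) mkdp(1)] rhN pd(5) rhN]
 define H1 where "H1 = E oM bmap P hP mid ZT"
 define H2 where "H2 = E oM bmap P hP (box_lift P (Gcap R S P D ep)) mid oM box_assoc' n P (rbx R D P) hP"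
 note e1 = el(1)[folded E_def] and e2 = el(2)[folded E_def]
 have H: "H1 : mhm (bx P (bx (rbx R D P) hP)) P" "H2 : mhm (bx P (bx (rbx R D P) hP)) P"
  unfolding H1_def H2_def by (rule mh_comp[OF f1(1) e1], rule mh_comp[OF mh_comp[OF f2(1) f3(1)] e1])
 have Gc: "Gcap R S P D ep W Y q y : ob P (W ** Y)" if "W : CS" "Y : CS" "q : ob P W" "y : ob (rbx R D P) Y" for W Y q y
  by (rule bilinD(1)[OF gcap(1) that])
 have Tc: "tensor_hom n R P gP (Y ** X) (Z Y X y h) : ob hP (Y ** X)" if "Y : CS" "X : CS" "y : ob (rbx R D P) Y" "h : ob hP X" for Y X y h
  by (rule mhD(1)[OF th(1) _ Zc[OF that]]) (use that in simp)
 have val: "H1 (W ** Y ** X) (bp P (bx (rbx R D P) hP) W (Y ** X) q (bp (rbx R D P) hP Y X y h)) =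
   hev P (Y ** X) (tensor_hom n R P gP (Y ** X) (Z Y X y h)) W q"
  "H2 (W ** Y ** X) (bp P (bx (rbx R D P) hP) W (Y ** X) q (bp (rbx R D P) hP Y X y h)) =
   tr P ((W ** Y) ** X) (W ** Y ** X) fas (hev P X h (W ** Y) (Gcap R S P D ep W Y q y))"
  if v: "W : CS" "Y : CS" "X : CS" "q : ob P W" "y : ob (rbx R D P) Y" "h : ob hP X" for W Y X q y h
  using v pd mkdp rhN Tc Gc
  by (simp_all add: H1_def H2_def mcomp_def f1(2) f2(2) mh_tr[OF f3(1)] f3(2) mh_tr[OF e1] e2 gl(2)) (simp add: ZT_def mcomp_def zl(2) e2)
 show ?thesis unfolding val[OF v, symmetric]
 proof (rule mack_hom_eqI[OF mgen_box[OF pd(5) box_mackey[OF mkdp(1) rhN] mgen_all mgen_box[OF mkdp(1) rhN gendp mgen_all]] H])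
  fix X' z assume "EX W Z m k. W : CS & Z : CS & m : ob P W & (EX Y Z' l b. Y : CS & Z' : CS &
    (EX A B d p. A : CS & B : CS & d : ob D A & p : ob P B & Y = A ** B & l = rp R D P A B d p) & b : ob hP Z' &
    Z = Y ** Z' & k = bp (rbx R D P) hP Y Z' l b) & X' = W ** Z & z = bp P (bx (rbx R D P) hP) W Z m k"
  then obtain W A B X q d p h where w: "W : CS" "A : CS" "B : CS" "X : CS" "q : ob P W" "d : ob D A" "p : ob P B" "h : ob hP X"
   "X' = W ** (A ** B) ** X" "z = bp P (bx (rbx R D P) hP) W ((A ** B) ** X) q (bp (rbx R D P) hP (A ** B) X (rp R D P A B d p) h)"
   by (elim exE conjE) simp
  note y = dpc[OF w(2,3,6,7)]
  note ed = mhD(1)[OF ehf(1) w(2,6)] and ex = evN_closed[OF w(3,4,7,8)] and ec = eps_closed[OF w(1,2,5,6)]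
  have tc: "tpair R P gP A (B ** X) (ehat R S P D ep A d) (hev P X h B p) : ob hP (A ** B ** X)"
   using bilinD(1)[OF tp(1) w(2) _ ed, of "B ** X" "hev P X h B p"] w ex by simp
  have lc: "lm R P (W ** A) B (ep (W ** A) (rp S P D W A q d)) p : ob P ((W ** A) ** B)" using lm_closed[OF lP1] w ec by simp
  have ac: "galpha n R g (W ** A) (ep (W ** A) (rp S P D W A q d)) : ob R (W ** A)" using g w ec pd by simp
  have "hev P ((A ** B) ** X) (tensor_hom n R P gP ((A ** B) ** X) (Z (A ** B) X (rp R D P A B d p) h)) W q =
   tr P ((W ** A ** B) ** X) (W ** (A ** B) ** X) fas (hev P X h (W ** A ** B) (Gcap R S P D ep W (A ** B) q (rp R D P A B d p)))"
   using w(1-8) y ed ex ec tc lc ac pd LL_rp LL_mackey rhN lP1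
   by (simp add: Zv mh_tr[OF th(1)] th(2) evN_tr tp_value ehf(2) gcap(2) evN_lin) (rule tr_eqI_ball, simp)
  then show "H1 X' z = H2 X' z" unfolding w(9,10) using val[of W "A ** B" X q "rp R D P A B d p" h] w y by simp
 qed (use v pd mkdp rhN in simp_all)
qed

text \<open>On y = d \<otimes> p: the trace of \<epsilon>(- \<otimes> d) \<otimes> e(p).x is q(\<alpha>_g(e(p)) \<epsilon>(x \<otimes> d)), and by the relation
of twisted HH_0 this equals q(\<epsilon>(x \<otimes> d) e(p)) = q(e(\<epsilon>(x \<otimes> d).p)).\<close>

lemma trace_Z:
 assumes v: "V : CS" "Y : CS" "U : CS" "x : ob P V" "y : ob (rbx R D P) Y" "e : ob hR U"
 shows "tr tH (Y ** U ** V) (V ** Y ** U) (%w. fsw (fas' w)) (trd (Y ** U ** V) (Z Y (U ** V) y (tpair R P gP U V e x))) =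
  tr tH ((V ** Y) ** U) (V ** Y ** U) fas (QR ((V ** Y) ** U) (hev P U e (V ** Y) (Gcap R S P D ep V Y x y)))"
proof -
 note pd = bmodD[OF pB] and zl = Z_lift and gl = G_lift and T = tH_facts and tf = trd_facts
 have tb: "bilin hR P hP (tpair R P gP)" using tp(1) by simp
 note tl = box_lift_facts[OF rhd pd(5) rhN tb]
 let ?DP = "rbx R D P"
 note g1 = box_sym_facts[OF pd(5) box_mackey[OF mkdp(1) rhd]] and g2 = box_assoc_facts[OF mkdp(1) rhd pd(5)]
  and g3 = box_map_facts[OF mid_hom tl(1) mkdp(1) box_mackey[OF rhd pd(5)] mkdp(1) rhN]
 note f2 = box_assoc'_facts[OF pd(5) mkdp(1) rhd] and f3 = box_map_facts[OF gl(1) mid_hom box_mackey[OF pd(5) mkdp(1)] rhd pd(5) rhd]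
 define H1 where "H1 = trd oM box_lift LL Z oM bmap ?DP hP mid (box_lift hP (tpair R P gP)) oM box_assoc n ?DP hR P oM box_sym n P (bx ?DP hR)"
 define H2 where "H2 = QR oM dual_eval n R P oM bmap P hR (box_lift P (Gcap R S P D ep)) mid oM box_assoc' n P ?DP hR"
 have H: "H1 : mhm (bx P (bx ?DP hR)) tH" "H2 : mhm (bx P (bx ?DP hR)) tH"
  unfolding H1_def H2_def by (rule mh_comp[OF mh_comp[OF mh_comp[OF mh_comp[OF g1(1) g2(1)] g3(1)] zl(1)] tf(1)],
   rule mh_comp[OF mh_comp[OF mh_comp[OF f2(1) f3(1)] de(1)] T(2)])
 have Gc: "Gcap R S P D ep W Y q y : ob P (W ** Y)" if "W : CS" "Y : CS" "q : ob P W" "y : ob ?DP Y" for W Y q y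
  by (rule bilinD(1)[OF gcap(1) that])
 have Qc: "QR X r : ob tH X" if "X : CS" "r : ob R X" for X r by (rule mhD(1)[OF T(2) that])
 have tc: "tpair R P gP U V e x : ob hP (U ** V)" if "U : CS" "V : CS" "e : ob hR U" "x : ob P V" for U V e x by (rule bilinD(1)[OF tb that])
 have Zc: "Z Y X y h : ob LL (Y ** X)" if "Y : CS" "X : CS" "y : ob ?DP Y" "h : ob hP X" for Y X y h
  by (rule bilinD(1)[OF Zb that])
 have trc: "trd X z : ob tH X" if "X : CS" "z : ob LL X" for X z by (rule mhD(1)[OF tf(1) that])
 have val: "H1 (V ** Y ** U) (bp P (bx ?DP hR) V (Y ** U) x (bp ?DP hR Y U y e)) =
   tr tH (Y ** U ** V) (V ** Y ** U) (%w. fsw (fas' w)) (trd (Y ** U ** V) (Z Y (U ** V) y (tpair R P gP U V e x)))"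
  "H2 (V ** Y ** U) (bp P (bx ?DP hR) V (Y ** U) x (bp ?DP hR Y U y e)) =
   tr tH ((V ** Y) ** U) (V ** Y ** U) fas (QR ((V ** Y) ** U) (hev P U e (V ** Y) (Gcap R S P D ep V Y x y)))"
  if v: "V : CS" "Y : CS" "U : CS" "x : ob P V" "y : ob ?DP Y" "e : ob hR U" for V Y U x y e
  using v pd mkdp rhd rhN Gc Qc tc Zc trc T(1) LL_mackey de(3)
  by (simp_all add: H1_def H2_def mcomp_def g1(2) g2(2) mh_tr[OF g2(1)] mh_tr[OF g3(1)] g3(2) tl(2) mh_tr[OF zl(1)] zl(2) mh_tr[OF tf(1)]
   f2(2) mh_tr[OF f3(1)] f3(2) mh_tr[OF de(1)] de(2) mh_tr[OF T(2)] gl(2))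
 show ?thesis unfolding val[OF v, symmetric]
 proof (rule mack_hom_eqI[OF mgen_box[OF pd(5) box_mackey[OF mkdp(1) rhd] mgen_all mgen_box[OF mkdp(1) rhd gendp mgen_all]] H])
  fix X' z assume "EX W Z m k. W : CS & Z : CS & m : ob P W & (EX Y Z' l b. Y : CS & Z' : CS &
    (EX A B d p. A : CS & B : CS & d : ob D A & p : ob P B & Y = A ** B & l = rp R D P A B d p) & b : ob hR Z' &
    Z = Y ** Z' & k = bp ?DP hR Y Z' l b) & X' = W ** Z & z = bp P (bx ?DP hR) W Z m k"
  then obtain V A B U x d p e where w: "V : CS" "A : CS" "B : CS" "U : CS" "x : ob P V" "d : ob D A" "p : ob P B" "e : ob hR U"
   "X' = V ** (A ** B) ** U" "z = bp P (bx ?DP hR) V ((A ** B) ** U) x (bp ?DP hR (A ** B) U (rp R D P A B d p) e)"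
   by (elim exE conjE) simp
  note y = dpc[OF w(2,3,6,7)] and ed = mhD(1)[OF ehf(1) w(2,6)] and t = tc[OF w(4,1,8,5)]
  define b where "b = hev P U e B p"
  define c where "c = ep (V ** A) (rp S P D V A x d)"
  have b: "b : ob R (B ** U)" unfolding b_def by (rule de(3)[OF w(3,4,7,8)])
  have c: "c : ob R (V ** A)" unfolding c_def by (rule eps_closed[OF w(1,2,5,6)])
  have ab: "galpha n R g (B ** U) b : ob R (B ** U)" using g w b pd by simp
  have ex: "hev P (U ** V) (tpair R P gP U V e x) B p = tr P ((B ** U) ** V) (B ** U ** V) fas (lm R P (B ** U) V (galpha n R g (B ** U) b) x)"
   using tp_value[OF w(4,1,8,5,3,7)] unfolding b_def .
  have lx: "lm R P (B ** U) V (galpha n R g (B ** U) b) x : ob P ((B ** U) ** V)" using lm_closed[OF lP1] w ab by simp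
  have el: "ep (((B ** U) ** V) ** A) (rp S P D ((B ** U) ** V) A (lm R P (B ** U) V (galpha n R g (B ** U) b) x) d) =
   tr R ((B ** U) ** V ** A) (((B ** U) ** V) ** A) fas' (gm R (B ** U) (V ** A) (galpha n R g (B ** U) b) c)"
  proof -
   have "gm R (B ** U) (V ** A) (galpha n R g (B ** U) b) c = ep ((B ** U) ** V ** A) (lm R (odo R S R P D) (B ** U) (V ** A) (galpha n R g (B ** U) b) (rp S P D V A x d))"
    unfolding c_def using eF(2)[of "B ** U" "V ** A" "galpha n R g (B ** U) b" "rp S P D V A x d"] w ab pdc by simp
   also have "... = tr R (((B ** U) ** V) ** A) ((B ** U) ** V ** A) fas (ep (((B ** U) ** V) ** A) (rp S P D ((B ** U) ** V) A (lm R P (B ** U) V (galpha n R g (B ** U) b) x) d))"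
    using w(1-8) ab lx pdc pd by (simp add: odot_facts(3)[OF pB dB] mh_tr[OF eF(1)])
   finally show ?thesis using w(1-8) pd lx eps_closed[of "(B ** U) ** V" A "lm R P (B ** U) V (galpha n R g (B ** U) b) x" d] by (simp add: tr_id_ball)
  qed
  have tx: "ep ((B ** U ** V) ** A) (rp S P D (B ** U ** V) A (tr P ((B ** U) ** V) (B ** U ** V) fas w') d) =
   tr R (((B ** U) ** V) ** A) ((B ** U ** V) ** A) (fpm fas (%x. x)) (ep (((B ** U) ** V) ** A) (rp S P D ((B ** U) ** V) A w' d))"
   if "w' : ob P ((B ** U) ** V)" for w'
   using that w(1-8) pdc bmodD(1)[OF dB] pd by (simp add: rp_tr(1) mh_tr[OF eF(1)])
  have gc: "lm R P (V ** A) B c p : ob P ((V ** A) ** B)" using lm_closed[OF lP1] w c by simp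
  have gmc: "gm R (V ** A) (B ** U) c b : ob R ((V ** A) ** B ** U)" "gm R (B ** U) (V ** A) (galpha n R g (B ** U) b) c : ob R ((B ** U) ** V ** A)"
   using R w b c ab by simp_all
  have L: "trd ((A ** B) ** U ** V) (Z (A ** B) (U ** V) (rp R D P A B d p) (tpair R P gP U V e x)) =
   tr tH ((V ** A) ** B ** U) ((A ** B) ** U ** V) (%w. fas' (fsw (fpm fas (%x. x) (fas' (fsw w))))) (QR ((V ** A) ** B ** U) (gm R (V ** A) (B ** U) c b))"
   using w(1-8) y ed t lx pd T(1) LL_rp LL_mackey gmc Qc[OF _ gmc(1)] Qc[OF _ gmc(2)] R b c ab
   by (simp add: Zv ex mh_tr[OF tf(1)] tf(2) ehf(2) tx el mh_tr[OF T(2)] T(3)) 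
  have Rr: "QR ((V ** A ** B) ** U) (hev P U e (V ** A ** B) (Gcap R S P D ep V (A ** B) x (rp R D P A B d p))) =
   tr tH ((V ** A) ** B ** U) ((V ** A ** B) ** U) (%w. fpm fas (%x. x) (fas' w)) (QR ((V ** A) ** B ** U) (gm R (V ** A) (B ** U) c b))"
   using w(1-8) y gc gmc pd T(1) c R
   by (simp add: gcap(2) c_def[symmetric] ev_tr[OF R lP1 lU1, simplified] ev_linR[OF R lP1] b_def[symmetric] mh_tr[OF T(2)])
  show "H1 X' z = H2 X' z"
   unfolding w(9,10) val[OF w(1) cprod_csets[OF w(2,3)] w(4,5) y w(8)] L Rr
   using w(1-4) T(1) Qc[OF _ gmc(1)] by simp (rule tr_eqI_ball, simp)
 qed (use v pd mkdp rhd T(1) in simp_all)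
qed

end
end

section \<open>The adjunct of the right action and the comparison of traces\<close>

lemma same_free_lmod: "same (free_lmod n R M) (bx R M)"
 by (simp add: same_def free_lmod_def)

lemmas free_lmod_simps [simp] = same_rules[OF same_free_lmod]

lemma yoneda_hom: assumes S: "mackey S" and X: "X : CS" and s: "s : ob S X"
 shows "(%Y a. mor S X Y a s) : mhm (rpr X) S"
 by (rule mack_homI) (use assms in \<open>simp_all add: mackeyD(4,5)[OF S]\<close>)

text \<open>The action of one element s of S(X), through the map a \<mapsto> a(s) on representables.\<close>

definition varrho_map where
 "varrho_map S P X s = ract P oM bmap P S mid (%Y a. mor S X Y a s)"

lemma varrho_map_facts:
 assumes P: "ractor S P" and X: "X : CS" and s: "s : ob S X"
 shows "varrho_map S P X s : mhm (bx P (rpr X)) P"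
  "W : CS ==> V : CS ==> p : ob P W ==> a : bhm X V ==>
   varrho_map S P X s (W ** V) (bp P (rpr X) W V p a) = rm P S W V p (mor S X V a s)"
proof -
 note D = ractorD[OF P]
 note m = box_map_facts[OF mid_hom yoneda_hom[OF D(1) X s] D(2) repr_mackey[OF X] D(2,1)]
 show "varrho_map S P X s : mhm (bx P (rpr X)) P" unfolding varrho_map_def by (rule mh_comp[OF m(1) D(3)])
 show "W : CS ==> V : CS ==> p : ob P W ==> a : bhm X V ==>
   varrho_map S P X s (W ** V) (bp P (rpr X) W V p a) = rm P S W V p (mor S X V a s)"
  by (simp add: varrho_map_def mcomp_def m(2) rm_def)
qed

text \<open>On p \<otimes> a both maps are p.a(s): the isomorphism with a relative box product inserts a unit of S,
which the map induced by s sends to a(s).\<close>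

lemma varrho_rep_eq:
 assumes S: "green_functor n S" and P: "rmodule S P" and X: "X : CS" and s: "s : ob S X"
  and Y: "Y : CS" "y : ob (bx P (rpr X)) Y"
 shows "varrho_rep n S P X s Y y = varrho_map S P X s Y y"
proof -
 note D = rmoduleD[OF P] and gS = green_facts[OF S] and r = repr_mackey[OF X] and uS = bmod_ubimod[OF S]
 let ?F = "free_lmod n S (rpr X)" and ?B = "bx S (rpr X)"
 have B: "mackey ?B" using gS(1) r by simp
 note y = yoneda_hom[OF gS(1) X s]
 note f1 = box_map_facts[OF gS(2) mid_hom box_mackey[OF gS(1) gS(1)] r gS(1) r] and f2 = box_assoc'_facts[OF gS(1) gS(1) r]
 have lF0: "lact ?F = bmap S (rpr X) (gmul S) mid oM box_assoc' n S S (rpr X)" by (simp add: free_lmod_def)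
 have lF: "lactor S ?F"
  using mh_comp[OF f2(1) f1(1)] gS(1) B by (simp add: lactor_def lF0)
 have lv: "lm S ?F A (C ** V) t (bp S (rpr X) C V b a) = tr ?B ((A ** C) ** V) (A ** C ** V) fas (bp S (rpr X) (A ** C) V (gm S A C t b) a)"
  if v: "A : CS" "C : CS" "V : CS" "t : ob S A" "b : ob S C" "a : bhm X V" for A C V t b a
  using v gS(1) r by (simp add: lm_def lF0 mcomp_def f2(2) mh_tr[OF f1(1)] f1(2) gm_def)
 note h1 = box_map_facts[OF mid_hom y gS(1) r gS(1) gS(1)]
 have hh: "hat n S X s : mhm ?B S" unfolding hat_def by (rule mh_comp[OF h1(1) gS(2)])
 have hv: "hat n S X s (A ** V) (bp S (rpr X) A V t a) = gm S A V t (mor S X V a s)"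
  if "A : CS" "V : CS" "t : ob S A" "a : bhm X V" for A V t a
  using that by (simp add: hat_def mcomp_def h1(2) gm_def)
 have gen: "mgen ?F (%X' x. EX C V b a. C : CS & V : CS & b : ob S C & a : ob (rpr X) V & X' = C ** V & x = bp S (rpr X) C V b a)"
  using mgen_box_pair[OF gS(1) r] by simp
 have lin: "hat n S X s (A ** Z) (lm S ?F A Z t x) = lm S (ubimod S) A Z t (hat n S X s Z x)"
  if v: "A : CS" "Z : CS" "t : ob S A" and x: "EX C V b a. C : CS & V : CS & b : ob S C & a : ob (rpr X) V & Z = C ** V & x = bp S (rpr X) C V b a" for A Z t x
 proof -
  obtain C V b a where w: "C : CS" "V : CS" "b : ob S C" "a : bhm X V" "Z = C ** V" "x = bp S (rpr X) C V b a"
   using x by (elim exE conjE) simp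
  have m: "mor S X V a s : ob S V" using gS(1) X w s by simp
  show ?thesis unfolding w(5,6) using v(1,3) w(1-4) gS(1) S r m X by (simp add: lv mh_tr[OF hh] hv gS(5) tr_id_ball)
 qed
 have hh': "hat n S X s : mhm ?F (ubimod S)" using hh by simp
 note om = odot_map_right[OF D(1) lF bmodD(1)[OF uS] hh' gen lin, simplified]
 define io where "io = (%V a. tr ?B (pt ** V) V flu (bp S (rpr X) pt V (gone n S) a))"
 have i: "io : mhm (rpr X) ?F"
  using unit_pair_hom[OF bilin_pair[OF gS(1) r] gS(1) B gS(4)] by (simp add: io_def)
 note bi = bilin_pre[OF mid_hom i bilin_rp[OF D(1) lF], simplified mid_apply]
 note bl = box_lift_facts[OF D(3) r rbox_mackey[OF D(1) lF] bi]
 have e: "varrho_rep n S P X s = orunit P oM odot_map n S P (ubimod S) mid (hat n S X s) oM box_lift (rbx S P ?F) (%W V p a. rp S P ?F W V p (io V a))"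
  by (simp add: varrho_rep_def Let_def rp_def io_def tr_def structure_graphs)
 note O = orunit_facts[OF S P]
 have hI: "hat n S X s V (io V a) = mor S X V a s" if "V : CS" "a : bhm X V" for V a
 proof -
  have m: "mor S X V a s : ob S V" using gS(1) X that s by simp
  have p: "bp S (rpr X) pt V (gone n S) a : ob ?B (pt ** V)" using gS(1,4) r that by simp
  show ?thesis using that gS(1,4) m p by (simp add: io_def mh_tr[OF hh] hv gS(6) tr_id_ball)
 qed
 have vh: "varrho_rep n S P X s : mhm (bx P (rpr X)) P"
  unfolding e by (rule mh_comp[OF mh_comp[OF bl(1) om(1)] O(1)])
 note v0 = varrho_map_facts[OF D(1) X s]
 show ?thesis
 proof (rule mack_hom_eqI[OF mgen_box[OF D(3) r mgen_all mgen_all] vh v0(1) box_mackey[OF D(3) r] D(3) _ Y])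
  fix X' z assume "EX W V p a. W : CS & V : CS & p : ob P W & a : ob (rpr X) V & X' = W ** V & z = bp P (rpr X) W V p a"
  then obtain W V p a where w: "W : CS" "V : CS" "p : ob P W" "a : bhm X V" "X' = W ** V" "z = bp P (rpr X) W V p a"
   by (elim exE conjE) simp
  have "io V a : ob ?B V" using mhD(1)[OF i w(2), of a] w(4) by simp
  then show "varrho_rep n S P X s X' z = varrho_map S P X s X' z"
   unfolding w(5,6) e using w(1-4) X s gS(1) by (simp add: mcomp_def bl(2) om(2) O(3) hI v0(2))
 qed
qed

context
 fixes R :: "('r, 'u) green_scheme" and S :: "('s, 'v) green_scheme" and P :: "('r, 'p, 's, 'z) bimod_scheme" and ta
  and D :: "('s, 'd, 'r, 'w) bimod_scheme" and si et ep and f :: "cset => 'p => 'p" and g :: int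
 assumes R: "green_functor n R" and S: "green_functor n S" and tw: "twist_cell n R S P ta"
  and du: "left_dual n R S P ta D si et ep" and f: "twist_2cell n R S P ta P ta f" and g: "g : CG"
begin

lemma traces_agree:
 assumes X: "X : CS" and s: "s : ob S X"
 shows "twisted_trace n R S P ta D et ep g f X (tHH0_proj n S g (ubimod S) X s) =
  HS_trace_gamma n R S P ta g X (post_comp n P f X (varrho n S P X s))"
proof -
 let ?E = "dual_bimod n R S P" and ?N = "ltw n R g P" and ?L = "rbx R (dual_bimod n R S P) (ltw n R g P)"
  and ?h = "rh R P (ltw n R g P)" and ?D = "rh R P (ubimod R)" and ?T = "tensor_hom n R P (ltw n R g P)"
  and ?H = "tHH0 n R g (ubimod R)" and ?Q = "tHH0_proj n R g (ubimod R)" and ?t = "tmap R P ta g"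
 note pB = P_bmod[OF R S tw] and dB = db[OF R S tw du f] and pM = P_modules[OF R S tw]
 note lP = bmodD(1)[OF pB] and lU = bmodD(1)[OF bmod_ubimod[OF R]]
 note lN = lmodule_ltw[OF pM(1) R g]
 note lN1 = lmoduleD(1)[OF lN]
 note dr = dual_ractor[OF R lP, where S = S] and th = tensor_hom_facts[OF R lP lN, where S = S]
 note pd = bmodD[OF pB] and hF = eta_facts[OF R S tw du f] and fF = f_facts[OF R S tw du f] and gS = green_facts[OF S]
 note eh = ehat_facts[OF R S tw du f] and gc = Gcap_facts[OF R S tw du f]
 note mkdp = mk_DP[OF R S tw du f] and gendp = gen_DP[OF R S tw du f]
 note rhN = rhom_mackey[OF lP lN1] and Lm = rbox_mackey[OF dr(1) lN1]
 note dt = trd_facts[OF R S tw du f g] and tH = tH_facts[OF R S tw du f g]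
 obtain La where L: "La : mhm (rbx R D P) ?H"
  and Lv: "!!A B d p. A : CS ==> B : CS ==> d : ob D A ==> p : ob P B ==> La (A ** B) (rp R D P A B d p) =
   tr ?H (B ** A) (A ** B) fsw (?Q (B ** A) (ep (B ** A) (rp S P D B A (?t B (f B p)) d)))"
  and Lt: "!!X s. X : CS ==> s : ob S X ==> twisted_trace n R S P ta D et ep g f X (tHH0_proj n S g (ubimod S) X s) = La X (et X s)"
  by (rule twisted_trace_value[OF R S tw du f g]) (rule that)
 obtain Z where Zb: "bilin (rbx R D P) ?h ?L Z"
  and Zv: "!!A B X d p h. A : CS ==> B : CS ==> X : CS ==> d : ob D A ==> p : ob P B ==> h : ob ?h X ==>
   Z (A ** B) X (rp R D P A B d p) h = tr ?L (A ** B ** X) ((A ** B) ** X) fas'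
    (rp R ?E ?N A (B ** X) (ehat R S P D ep A d) (hev P X h B p))"
  by (rule dual_tensor_pairing[OF R S tw du f g]) (rule that)
 have tz: "hev P (Y ** X) (?T (Y ** X) (Z Y X y h)) W q =
   tr P ((W ** Y) ** X) (W ** Y ** X) fas (hev P X h (W ** Y) (Gcap R S P D ep W Y q y))"
  if "W : CS" "Y : CS" "X : CS" "q : ob P W" "y : ob (rbx R D P) Y" "h : ob ?h X" for W Y X q y h
  by (rule tensor_Z[OF R S tw du f g Zb], rule Zv) (use that in simp_all)
 have trz: "tr ?H (Y ** U ** V) (V ** Y ** U) (%w. fsw (fas' w)) (dual_trace R S P g (Y ** U ** V) (Z Y (U ** V) y (tpair R P ?N U V e x))) =
   tr ?H ((V ** Y) ** U) (V ** Y ** U) fas (?Q ((V ** Y) ** U) (hev P U e (V ** Y) (Gcap R S P D ep V Y x y)))"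
  if "V : CS" "Y : CS" "U : CS" "x : ob P V" "y : ob (rbx R D P) Y" "e : ob ?D U" for V Y U x y e
  by (rule trace_Z[OF R S tw du f g Zb], rule Zv) (use that in simp_all)
 note evt = evN_tr[OF R S tw du f g] and evc = evN_closed[OF R S tw du f g]
 define u where "u = et pt (gone n S)"
 have u: "u : ob (rbx R D P) pt" unfolding u_def by (rule mhD(1)[OF hF(1) cpoint_csets gS(4)])
 define Z1 where "Z1 = (%X h. tr ?L (pt ** X) X flu (Z pt X u h))"
 have Z1: "Z1 : mhm ?h ?L" unfolding Z1_def by (rule unit_pair_hom[OF Zb mkdp(1) Lm u])
 have Zc: "Z Y X y h : ob ?L (Y ** X)" if "Y : CS" "X : CS" "y : ob (rbx R D P) Y" "h : ob ?h X" for Y X y h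
  by (rule bilinD(1)[OF Zb that])
 \<comment> \<open>Z1 is a section of the tensor-Hom map, because contracting with \<eta>(1) is the identity\<close>
 have B: "?T X (Z1 X h) = h" if X: "X : CS" "h : ob ?h X" for X h
 proof (rule rhom_eqI[OF lP lN1 X(1)])
  have Tc: "?T (pt ** X) (Z pt X u h) : ob ?h (pt ** X)" by (rule mhD(1)[OF th(1) _ Zc]) (use X u in simp_all)
  fix W q assume w: "W : CS" "q : ob P W"
  show "hev P X (?T X (Z1 X h)) W q = hev P X h W q"
   using w X u Zc[OF cpoint_csets X(1) u X(2)] Tc pd evc[OF w(1) X(1) w(2) X(2)]
   by (simp add: Z1_def mh_tr[OF th(1)] evt tz gc(3)[OF w, folded u_def] tr_id_ball)
 qed (use X mhD(1)[OF th(1) X(1)] mhD(1)[OF Z1 X] in simp_all)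
 \<comment> \<open>the trace depends only on the image under the tensor-Hom map\<close>
 have A: "dual_trace R S P g X (Z1 X (?T X z)) = dual_trace R S P g X z" if X: "X : CS" "z : ob ?L X" for X z
  using mack_hom_eqI[OF mgen_rbox[OF dr(1) lN1 mgen_all mgen_all] mh_comp[OF mh_comp[OF th(1) Z1] dt(1)] dt(1) Lm tH(1) _ X] unfolding mcomp_def
 proof this
  fix X z assume "EX Y Z m k. Y : CS & Z : CS & m : ob ?E Y & k : ob ?N Z & X = Y ** Z & z = rp R ?E ?N Y Z m k"
  then obtain U V e x where v: "U : CS" "V : CS" "e : ob ?D U" "x : ob P V" "X = U ** V" "z = rp R ?E ?N U V e x"
   by (elim exE conjE) simp
  have tc: "tpair R P ?N U V e x : ob ?h (U ** V)" using bilinD(1)[OF tpair_facts(1)[OF R lP lN] v(1-3), of x] v(4) by simp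
  let ?w = "dual_trace R S P g (pt ** U ** V) (Z pt (U ** V) u (tpair R P ?N U V e x))"
  have wc: "?w : ob ?H (pt ** U ** V)" by (rule mhD(1)[OF dt(1) _ Zc]) (use v u tc in simp_all)
  have ec: "hev P U e V x : ob R (V ** U)" by (rule dual_eval_facts(3)[OF R lP v(2,1,4,3)])
  have qc: "?Q (V ** U) (hev P U e V x) : ob ?H (V ** U)" by (rule mhD(1)[OF tH(2) _ ec]) (use v in simp)
  have "tr ?H (V ** pt ** U) (U ** V) (%w. flu (fas (fsw w))) (tr ?H (pt ** U ** V) (V ** pt ** U) (%w. fsw (fas' w)) ?w) =
   tr ?H (pt ** U ** V) (U ** V) flu ?w"
   using v(1,2) wc tH(1) by simp (rule tr_eqI_ball, simp)
  moreover have "tr ?H (V ** pt ** U) (U ** V) (%w. flu (fas (fsw w))) (tr ?H (pt ** U ** V) (V ** pt ** U) (%w. fsw (fas' w)) ?w) =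
   tr ?H (V ** U) (U ** V) fsw (?Q (V ** U) (hev P U e V x))"
   unfolding trz[OF v(2) cpoint_csets v(1,4) u v(3)] using v(1-4) tH(1) ec qc pd
   by (simp add: gc(3)[OF v(2,4), folded u_def] ev_tr(2)[OF R lP lU, simplified] mh_tr[OF tH(2)]) (rule tr_eqI_ball, simp)
  ultimately have "tr ?H (pt ** U ** V) (U ** V) flu ?w = tr ?H (V ** U) (U ** V) fsw (?Q (V ** U) (hev P U e V x))" by simp
  then show "dual_trace R S P g X (Z1 X (?T X z)) = dual_trace R S P g X z"
   unfolding v(5,6) using v(1-4) u tc by (simp add: th(2) Z1_def mh_tr[OF dt(1)] Zc dt(2))
 qed
 \<comment> \<open>so the preimage chosen in the definition of the trace may be replaced by the value of Z1\<close>
 have HS: "HS_trace n R S P g X h = dual_trace R S P g X (Z1 X h)" if X: "X : CS" "h : ob ?h X" for X h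
 proof -
  define w where "w = minv ?L ?T X h"
  have "h : ?T X ` ob ?L X" using mhD(1)[OF Z1 X] B[OF X, symmetric] by (rule rev_image_eqI)
  then have w: "w : ob ?L X" "?T X w = h" by (simp_all add: w_def minv_def inv_into_into f_inv_into_f)
  have "HS_trace n R S P g X h = dual_trace R S P g X w" by (simp add: HS_trace_def Let_def dual_trace_def mcomp_def w_def)
  then show ?thesis using A[OF X(1) w(1)] by (simp add: w(2))
 qed
 define be where "be = (%W X p s. ?t (W ** X) (f (W ** X) (rm P S W X p s)))"
 note th' = tmap_hom[OF R S tw g]
 have b: "bilin P S ?N be" unfolding be_def using bilin_comp[OF th' bilin_comp[OF fF(1) bilin_rm[OF pd(2)]]] by simp
 have lin: "be (C ** W) X (lm R P C W r p) s = tr ?N (C ** W ** X) ((C ** W) ** X) fas' (lm R ?N C (W ** X) r (be W X p s))"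
  if v: "C : CS" "W : CS" "X : CS" "r : ob R C" "p : ob P W" "s : ob S X" for C W X r p s
 proof -
  have "rm P S (C ** W) X (lm R P C W r p) s = tr P (C ** W ** X) ((C ** W) ** X) fas' (lm R P C (W ** X) r (rm P S W X p s))"
   using v pd pB by (simp add: tr_id_ball)
  then show ?thesis using v pd g mhD(1)[OF fF(1)] tmap_closed[OF R S tw g]
   by (simp add: be_def mh_tr[OF fF(1)] mh_tr[OF th'] fF(2) tmap_lm[OF R S tw g] lm_ltw[OF lP] del: bmod_assoc)
 qed
 define mu where "mu = (%X s. hom_ext n P ?N X (%W p. be W X p s))"
 note ad = rhom_adjunct[OF lP lN1 gS(1) b lin]
 have m: "mu : mhm S ?h" unfolding mu_def by (rule ad(1))
 have mv: "hev P X (mu X s) W p = be W X p s" if "X : CS" "s : ob S X" "W : CS" "p : ob P W" for X s W p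
  unfolding mu_def by (rule ad(2)[OF _ _ _ _ _ _ that])
 have bc: "be W X p s : ob P (W ** X)" if "W : CS" "X : CS" "p : ob P W" "s : ob S X" for W X p s
  using bilinD(1)[OF b that] by simp
 let ?DP = "odo S R S D P"
 note oDP = odot_facts[OF dB pB]
 have br: "bilin (rbx R D P) S (rbx R D P) (rm ?DP S)" using bilin_rm[OF oDP(2)] by simp
 \<comment> \<open>for y = d \<otimes> p both sides are the class of \<epsilon>(t f (p.s) \<otimes> d)\<close>
 have C: "dual_trace R S P g (Y ** X) (Z Y X y (mu X s)) = La (Y ** X) (rm ?DP S Y X y s)"
  if v: "Y : CS" "X : CS" "y : ob (rbx R D P) Y" "s : ob S X" for Y X y s
 proof (rule bilin_eqI[OF bilin_comp[OF dt(1) bilin_pre[OF mid_hom m Zb], simplified mid_apply] bilin_comp[OF L br] mkdp(1) gS(1) tH(1) gendp mgen_all _ v])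
  fix Y X y s assume a: "Y : CS" "X : CS" "EX A B d p. A : CS & B : CS & d : ob D A & p : ob P B & Y = A ** B & y = rp R D P A B d p" "s : ob S X"
  then obtain A B d p where w: "A : CS" "B : CS" "d : ob D A" "p : ob P B" "Y = A ** B" "y = rp R D P A B d p" by (elim exE conjE)
  note ms = mhD(1)[OF m a(2,4)] and ed = mhD(1)[OF eh(1) w(1,3)] and bb = bc[OF w(2) a(2) w(4) a(4)]
  have rmc: "rm P S B X p s : ob P (B ** X)" using pd w a by simp
  show "dual_trace R S P g (Y ** X) (Z Y X y (mu X s)) = La (Y ** X) (rm ?DP S Y X y s)"
   unfolding w(5,6) using a(2,4) w(1-4) ms ed bb rmc LL_rp[OF R S tw du f g, of A "B ** X"] rp_eta_closed[OF R S tw du f, of A "B ** X"]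
   by (simp add: Zv mv mh_tr[OF dt(1)] Lm dt(2) eh(2) oDP(4) mh_tr[OF L] Lv) (simp add: be_def)
 qed
 have HSm: "HS_trace n R S P g X (mu X s) = La X (et X s)"
 proof -
  note ms = mhD(1)[OF m X s]
  have es: "et X s : ob (rbx R D P) X" by (rule mhD(1)[OF hF(1) X s])
  have Ls: "La X (et X s) : ob ?H X" by (rule mhD(1)[OF L X es])
  have "rm ?DP S pt X u s = et (pt ** X) (tr S X (pt ** X) flu' s)"
   unfolding u_def using hF(3)[OF cpoint_csets X gS(4) s] by (simp add: gS(6)[OF X s])
  also have "... = tr (rbx R D P) X (pt ** X) flu' (et X s)" by (rule mh_tr[OF hF(1)]) (use X s in simp_all)
  finally have "La (pt ** X) (rm ?DP S pt X u s) = tr ?H X (pt ** X) flu' (La X (et X s))"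
   using X es by (simp add: mh_tr[OF L])
  then show ?thesis
   using X s Ls Zc[OF cpoint_csets X u ms] C[OF cpoint_csets X u s] tH(1) by (simp add: HS[OF X ms] Z1_def mh_tr[OF dt(1)] tr_id_ball)
 qed
 have K: "post_comp n P (gamma n R S P ta g) X (post_comp n P f X (varrho n S P X s)) = mu X s"
 proof -
  note v0 = varrho_map_facts[OF pd(2) X s] and r = repr_mackey[OF X]
  note mk = box_mackey[OF pd(5) r]
  have vc: "f Y (varrho_map S P X s Y y) : ob P Y" if "Y : CS" "y : ob (bx P (rpr X)) Y" for Y y
   by (rule mhD(1)[OF fF(1) that(1) mhD(1)[OF v0(1) that]])
  have e: "post_comp n P (gamma n R S P ta g) X (post_comp n P f X (varrho n S P X s)) = mrestrict n (bx P (rpr X)) (?t oM f oM varrho_map S P X s)"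
   unfolding post_comp_def varrho_def varrho_map_def[symmetric]
   by (rule mrestrict_cong) (simp add: mcomp_def mrestrict_apply gamma_eq[OF R S tw g] vc)
  note hh = mh_comp[OF mh_comp[OF v0(1) fF(1)] th']
  have k: "mrestrict n (bx P (rpr X)) (?t oM f oM varrho_map S P X s) : ob (mhom n P ?N) X"
   using mrestrict_hom[OF hh mk] by (simp add: mhom_def mrestrict_idem)
  show ?thesis unfolding e
  proof (rule mhom_eqI[OF pd(5) lmoduleD(3)[OF lN] X k rhom_sub[OF lP lN1 mhD(1)[OF m X s]]])
   fix W q assume w: "W : CS" "q : ob P W"
   show "hev P X (mrestrict n (bx P (rpr X)) (?t oM f oM varrho_map S P X s)) W q = hev P X (mu X s) W q"
    unfolding mv[OF X s w] using w X s pd(5) r gS(1) by (simp add: hom_ev_def mrestrict_apply mcomp_def v0(2) mackeyD(3) be_def)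
  qed
 qed
 show ?thesis unfolding Lt[OF X s] HS_trace_gamma_def mcomp_def K HSm ..
qed

lemma trace_hom: "twisted_trace n R S P ta D et ep g f oM tHH0_proj n S g (ubimod S) : mhm S (tHH0 n R g (ubimod R))"
proof -
 obtain La where L: "La : mhm (rbx R D P) (tHH0 n R g (ubimod R))"
  and Lt: "!!X s. X : CS ==> s : ob S X ==> twisted_trace n R S P ta D et ep g f X (tHH0_proj n S g (ubimod S) X s) = La X (et X s)"
  by (rule twisted_trace_value[OF R S tw du f g]) (rule that)
 show ?thesis
  by (rule mack_hom_cong[OF mh_comp[OF eta_facts(1)[OF R S tw du f] L] green_facts(1)[OF S]]) (simp add: mcomp_def Lt)
qed

text \<open>Linearity of f over S gives f(p.a(s)) = f(p).a(s) on generators.\<close>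

lemma varrho_rep_composites:
 assumes X: "X : CS" and s: "s : ob S X"
 shows "mrestrict n (bx P (rpr X)) (f oM varrho_rep n S P X s) = post_comp n P f X (varrho n S P X s)"
  "mrestrict n (bx P (rpr X)) (varrho_rep n S P X s oM bmap P (rpr X) f mid) = post_comp n P f X (varrho n S P X s)"
proof -
 note pB = P_bmod[OF R S tw] and pM = P_modules[OF R S tw]
 note pd = bmodD[OF pB] and fF = f_facts[OF R S tw du f] and gS = green_facts[OF S] and r = repr_mackey[OF X]
 note v0 = varrho_map_facts[OF pd(2) X s] and ve = varrho_rep_eq[OF S pM(2) X s]
 note bf = box_map_facts[OF fF(1) mid_hom pd(5) r pd(5) r] and mk = box_mackey[OF pd(5) r]
 have p: "post_comp n P f X (varrho n S P X s) = mrestrict n (bx P (rpr X)) (f oM varrho_map S P X s)"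
  unfolding post_comp_def varrho_def varrho_map_def[symmetric] by (rule mrestrict_cong) (simp add: mcomp_def mrestrict_apply)
 show "mrestrict n (bx P (rpr X)) (f oM varrho_rep n S P X s) = post_comp n P f X (varrho n S P X s)"
  unfolding p by (rule mrestrict_cong) (simp add: mcomp_def ve)
 show "mrestrict n (bx P (rpr X)) (varrho_rep n S P X s oM bmap P (rpr X) f mid) = post_comp n P f X (varrho n S P X s)"
  unfolding p
 proof (rule mrestrict_cong)
  fix Y y assume Y: "Y : CS" "y : ob (bx P (rpr X)) Y"
  have "(varrho_map S P X s oM bmap P (rpr X) f mid) Y y = (f oM varrho_map S P X s) Y y"
  proof (rule mack_hom_eqI[OF mgen_box[OF pd(5) r mgen_all mgen_all] mh_comp[OF bf(1) v0(1)] mh_comp[OF v0(1) fF(1)] mk pd(5) _ Y], goal_cases)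
   case (1 X' z)
   then obtain W V p a where w: "W : CS" "V : CS" "p : ob P W" "a : bhm X V" "X' = W ** V" "z = bp P (rpr X) W V p a"
    by (elim exE conjE) simp
   show ?case
    unfolding w(5,6) using w(1-4) X s gS(1) mhD(1)[OF fF(1)] by (simp add: mcomp_def bf(2) v0(2) fF(3))
  qed
  then show "(varrho_rep n S P X s oM bmap P (rpr X) f mid) Y y = (f oM varrho_map S P X s) Y y"
   using ve[OF Y(1) mhD(1)[OF bf(1) Y]] by (simp add: mcomp_def)
 qed
qed

end

end

theorem theorem5p23:
  fixes n :: nat and g :: int
    and R :: "'r green" and S :: "'s green"
    and P :: "('r, 'p, 's) bimod"
    and \<tau> :: "int \<Rightarrow> cset \<Rightarrow> ('r, 'p) boxel set \<Rightarrow> ('p, 's) boxel set"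
    and D :: "('s, 'd, 'r) bimod"
    and \<sigma> :: "int \<Rightarrow> cset \<Rightarrow> ('s, 'd) boxel set \<Rightarrow> ('d, 'r) boxel set"
    and \<eta> :: "cset \<Rightarrow> 's \<Rightarrow> ('d, 'p) boxel set"
    and \<epsilon> :: "cset \<Rightarrow> ('p, 'd) boxel set \<Rightarrow> 'r"
    and f :: "cset \<Rightarrow> 'p \<Rightarrow> 'p"
  assumes "n \<ge> 1"
    and "g \<in> carrier (integer_mod_group n)"
    and "green_functor n R"
    and "green_functor n S"
    and "twist_cell n R S P \<tau>"
    and "left_dual n R S P \<tau> D \<sigma> \<eta> \<epsilon>"
    and "twist_2cell n R S P \<tau> P \<tau> f"
  shows "twisted_trace n R S P \<tau> D \<eta> \<epsilon> g f \<circ>\<^sub>M tHH0_proj n S g (ubimod S)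
      \<in> mack_hom n S (tHH0 n R g (ubimod R)) \<and>
    mack_eq n S
      (twisted_trace n R S P \<tau> D \<eta> \<epsilon> g f \<circ>\<^sub>M tHH0_proj n S g (ubimod S))
      (HS_trace_gamma n R S P \<tau> g \<circ>\<^sub>M post_comp n P f \<circ>\<^sub>M varrho n S P) \<and>
    (\<forall>X \<in> csets n. \<forall>s \<in> carrier (obj S X).
      twisted_trace n R S P \<tau> D \<eta> \<epsilon> g f X (tHH0_proj n S g (ubimod S) X s) =
        HS_trace_gamma n R S P \<tau> g X
          (mrestrict n (box n P (repr n X)) (f \<circ>\<^sub>M varrho_rep n S P X s)) \<and>
      HS_trace_gamma n R S P \<tau> g X
          (mrestrict n (box n P (repr n X)) (f \<circ>\<^sub>M varrho_rep n S P X s)) =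
        HS_trace_gamma n R S P \<tau> g X
          (mrestrict n (box n P (repr n X))
            (varrho_rep n S P X s \<circ>\<^sub>M box_map n P (repr n X) f mid)))"
proof -
  interpret burnside n by unfold_locales (rule assms(1))
  note a = assms(3-7,2)
  note agree = traces_agree[OF a] and rep = varrho_rep_composites[OF a]
  show ?thesis
  proof (intro conjI ballI trace_hom[OF a])
    show "mack_eq n S (twisted_trace n R S P \<tau> D \<eta> \<epsilon> g f \<circ>\<^sub>M tHH0_proj n S g (ubimod S))
      (HS_trace_gamma n R S P \<tau> g \<circ>\<^sub>M post_comp n P f \<circ>\<^sub>M varrho n S P)"
      unfolding mack_eq_def mcomp_def using agree by blast
  qed (simp_all only: agree rep)
qed

end
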